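(* Let $p\in(1,+\infty)$ and let $C_p>0$ be a constant such that for every $f\in B_b(0,T;C_0^\infty(\mathbb{R}^N))$ the (unique) solution $u$ of the unperturbed problem $\partial_t u=L^{\mathrm{ou}}u+f$ on $(0,T)\times\mathbb{R}^N$, $u(0,\cdot)=0$, satisfies $$\|D_x^2u\|_{L^p((0,T)\times\mathbb{R}^N)}=\|B_I\,D^2u\,B_I\|_{L^p((0,T)\times\mathbb{R}^N)}\le C_p\,\|f\|_{L^p((0,T)\times\mathbb{R}^N)} .$$ Let $t\mapsto S(t)$, $t\in[0,T]$, be a continuous map with values in the symmetric non-negative definite $N\times N$ real matrices, and let $f\in B_b(0,T;C_0^\infty(\mathbb{R}^N))$. Then there exists a unique solution $u_S$ of the Cauchy problem $$\partial_tu_S(t,z)=L_t^{\mathrm{ou},S}u_S(t,z)+f(t,z)\ \text{ on }(0,T)\times\mathbb{R}^N,\qquad u_S(0,z)=0\ \text{ on }\mathbb{R}^N,$$ and it satisfies, with the same constant $C_p$, $$\|D_x^2u_S\|_{L^p((0,T)\times\mathbb{R}^N)}=\|B_I\,D^2u_S\,B_I\|_{L^p((0,T)\times\mathbb{R}^N)}\le C_p\,\|\partial_tu_S-L_t^{\mathrm{ou},S}u_S\|_{L^p((0,T)\times\mathbb{R}^N)}=C_p\,\|f\|_{L^p((0,T)\times\mathbb{R}^N)} .$$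
   Context: Fix $T>0$ and $\mathbb{R}^N=\mathbb{R}^{d_0}\times\mathbb{R}^{d_1}$ with integers $d_0\ge1$, $d_1\ge0$, $d_0+d_1=N$; write $z=(x,y)$, $x\in\mathbb{R}^{d_0}$, $y\in\mathbb{R}^{d_1}$. $D^2=D_z^2$ is the full $N\times N$ spatial Hessian and $D_x^2$ the $d_0\times d_0$ Hessian in $x$. Let $B=\begin{pmatrix}B_0&0\\0&0\end{pmatrix}\in\mathbb{R}^{N\times N}$, where $B_0$ is a symmetric $d_0\times d_0$ matrix with $\nu|\xi|^2\le\langle B_0\xi,\xi\rangle\le\nu^{-1}|\xi|^2$ for all $\xi\in\mathbb{R}^{d_0}$, for some $\nu>0$. Let $B_I=\begin{pmatrix}I_{d_0}&0\\0&0\end{pmatrix}\in\mathbb{R}^{N\times N}$. Let $A\in\mathbb{R}^{N\times N}$ satisfy the Kalman condition: there is a non-negative integer $k$ with $\mathrm{Rank}[B,AB,\dots,A^kB]=N$, where $[B,AB,\dots,A^kB]$ is the $N\times N(k+1)$ matrix with these blocks. Operators: $$L^{\mathrm{ou}}f(z)=\mathrm{Tr}(BD^2f(z))+\langle Az,Df(z)\rangle,\qquad L_t^{\mathrm{ou},S}f(z)=L^{\mathrm{ou}}f(z)+\mathrm{Tr}(S(t)D^2f(z)).$$ $B_b(0,T;C_0^\infty(\mathbb{R}^N))$ is the space of bounded Borel functions $\phi:[0,T]\times\mathbb{R}^N\to\mathbb{R}$ such that: $\phi(t,\cdot)$ is smooth with compact support for every $t\in[0,T]$; for each $n\in\mathbb{N}$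 the $C^n(\mathbb{R}^N)$-norms of $\phi(t,\cdot)$ are bounded uniformly in $t$; the supports of all $\phi(t,\cdot)$ lie in one common ball; and for every $z$ the map $t\mapsto\phi(t,z)$ is piecewise continuous, i.e. continuous except at finitely many points of $[0,T]$. Notion of solution: a solution of $\partial_tv=\mathcal{L}_tv+f$, $v(0,\cdot)=0$, where $\mathcal{L}_t$ is either $L^{\mathrm{ou}}$ (for every $t$) or $L_t^{\mathrm{ou},S}$, is a bounded continuous function $v:[0,T]\times\mathbb{R}^N\to\mathbb{R}$ with $v(t,\cdot)\in C^2(\mathbb{R}^N)$ for every $t\in[0,T]$ and $v(t,z)=\int_0^t\big(f(s,z)+\mathcal{L}_sv(s,z)\big)ds$ for all $(t,z)\in[0,T]\times\mathbb{R}^N$. Such solutions are $C^1$ in $t$ piecewise, for each $z$, and $\partial_tv$ is understood for almost every $t$. $L^p$-norms of matrix-valued functions are taken using one fixed norm on matrices. A finite constant $C_p=C_p(\nu,A,d_0,d_1,T)$ with the property assumed in the claim for the unperturbed problem is known to exist. *)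

theory Defs
  imports "HOL-Analysis.Analysis"
begin

section \<open>Differential calculus on the space indexed by 'n\<close>

definition partial :: "'n \<Rightarrow> (real^'n \<Rightarrow> real) \<Rightarrow> real^'n \<Rightarrow> real" where
  "partial i f z = frechet_derivative f (at z) (axis i 1)"

definition grad :: "(real^'n \<Rightarrow> real) \<Rightarrow> real^'n \<Rightarrow> real^'n" where
  "grad f z = (\<chi> i. partial i f z)"

definition hess :: "(real^'n \<Rightarrow> real) \<Rightarrow> real^'n \<Rightarrow> real^'n^'n" where
  "hess f z = (\<chi> i j. partial i (partial j f) z)"

primrec C_k :: "nat \<Rightarrow> (real^'n \<Rightarrow> real) \<Rightarrow> bool" where
  "C_k 0 f \<longleftrightarrow> continuous_on UNIV f"
| "C_k (Suc k) f \<longleftrightarrow> (\<forall>z. f differentiable (at z)) \<and> (\<forall>i. C_k k (partial i f))"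

primrec partials :: "'n list \<Rightarrow> (real^'n \<Rightarrow> real) \<Rightarrow> real^'n \<Rightarrow> real" where
  "partials [] f = f"
| "partials (i # js) f = partial i (partials js f)"

definition Cn_norm :: "nat \<Rightarrow> (real^'n \<Rightarrow> real) \<Rightarrow> ennreal" where
  "Cn_norm n f = (SUP js\<in>{js. length js \<le> n}. SUP z. ennreal \<bar>partials js f z\<bar>)"

definition supp :: "(real^'n \<Rightarrow> real) \<Rightarrow> (real^'n) set" where
  "supp f = closure {z. f z \<noteq> 0}"


section \<open>The splitting of the coordinates into x and y\<close>

text \<open>
  The whole space is indexed by 'n, and the x-coordinates by 'd through an injection
  e from 'd into 'n. Hence d0 = CARD('d), N = CARD('n), and d1 is the number of indices
  outside the range of e, which may be 0.
\<close>

text \<open>The N x N matrix with the d0 x d0 matrix M as its xx-block and zeros elsewhere.\<close>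

definition pad :: "('d \<Rightarrow> 'n) \<Rightarrow> real^'d^'d \<Rightarrow> real^'n^'n" where
  "pad e M = (\<chi> i j. if i \<in> range e \<and> j \<in> range e then M $ (inv e i) $ (inv e j) else 0)"

definition hess_x :: "('d \<Rightarrow> 'n) \<Rightarrow> (real^'n \<Rightarrow> real) \<Rightarrow> real^'n \<Rightarrow> real^'d^'d" where
  "hess_x e f z = (\<chi> a b. partial (e a) (partial (e b) f) z)"


section \<open>Kalman condition, operators\<close>

text \<open>
  Since k varies, the block matrix [B, AB, ..., A^k B] has no fixed column index type; its rank
  is the dimension of the span of its columns, and these are the columns of all the blocks.
\<close>

definition kalman :: "real^'n^'n \<Rightarrow> real^'n^'n \<Rightarrow> bool" where
  "kalman A B \<longleftrightarrow>
     (\<exists>k::nat. dim (\<Union>i\<in>{0..k}. columns ((((**) A) ^^ i) B)) = CARD('n))"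

definition L_ou :: "real^'n^'n \<Rightarrow> real^'n^'n \<Rightarrow> (real^'n \<Rightarrow> real) \<Rightarrow> real^'n \<Rightarrow> real" where
  "L_ou B A f z = trace (B ** hess f z) + (A *v z) \<bullet> grad f z"

definition L_ouS :: "real^'n^'n \<Rightarrow> real^'n^'n \<Rightarrow> (real \<Rightarrow> real^'n^'n) \<Rightarrow>
    real \<Rightarrow> (real^'n \<Rightarrow> real) \<Rightarrow> real^'n \<Rightarrow> real" where
  "L_ouS B A S t f z = L_ou B A f z + trace (S t ** hess f z)"


section \<open>Function spaces and norms\<close>

text \<open>
  Functions on the strip [0,T] x R^N are curried and total; their values at times outside
  [0,T] are irrelevant.
\<close>

definition piecewise_cont :: "real \<Rightarrow> (real \<Rightarrow> real) \<Rightarrow> bool" where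
  "piecewise_cont T g \<longleftrightarrow>
     (\<exists>F. finite F \<and> (\<forall>t\<in>{0..T} - F. continuous (at t within {0..T}) g))"

definition Bb_C0inf :: "real \<Rightarrow> (real \<Rightarrow> real^'n \<Rightarrow> real) set" where
  "Bb_C0inf T = {\<phi>.
      (\<lambda>(t, z). \<phi> t z) \<in> borel_measurable (restrict_space borel ({0..T} \<times> UNIV)) \<and>
      bounded ((\<lambda>(t, z). \<phi> t z) ` ({0..T} \<times> UNIV)) \<and>
      (\<forall>t\<in>{0..T}. (\<forall>n. C_k n (\<phi> t)) \<and> compact (supp (\<phi> t))) \<and>
      (\<forall>n. (SUP t\<in>{0..T}. Cn_norm n (\<phi> t)) < \<infinity>) \<and>
      (\<exists>R. \<forall>t\<in>{0..T}. supp (\<phi> t) \<subseteq> ball 0 R) \<and>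
      (\<forall>z. piecewise_cont T (\<lambda>t. \<phi> t z))}"

definition is_solution :: "real \<Rightarrow> (real \<Rightarrow> (real^'n \<Rightarrow> real) \<Rightarrow> real^'n \<Rightarrow> real) \<Rightarrow>
    (real \<Rightarrow> real^'n \<Rightarrow> real) \<Rightarrow> (real \<Rightarrow> real^'n \<Rightarrow> real) \<Rightarrow> bool" where
  "is_solution T L f v \<longleftrightarrow>
      bounded ((\<lambda>(t, z). v t z) ` ({0..T} \<times> UNIV)) \<and>
      continuous_on ({0..T} \<times> UNIV) (\<lambda>(t, z). v t z) \<and>
      (\<forall>t\<in>{0..T}. C_k 2 (v t)) \<and>
      (\<forall>t\<in>{0..T}. \<forall>z.
         set_integrable lborel {0..t} (\<lambda>s. f s z + L s (v s) z) \<and>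
         v t z = (LINT s:{0..t}|lborel. f s z + L s (v s) z))"

text \<open>
  At a point where the t-derivative does not exist, the value of \<^const>\<open>deriv\<close> is arbitrary; for
  a solution and fixed z this concerns only a null set of times.
\<close>

definition dt :: "(real \<Rightarrow> real^'n \<Rightarrow> real) \<Rightarrow> real \<Rightarrow> real^'n \<Rightarrow> real" where
  "dt v t z = deriv (\<lambda>s. v s z) t"

text \<open>The L^p norm over (0,T) x R^N, with values in [0,\<infinity>].\<close>

definition Lp_norm :: "real \<Rightarrow> real \<Rightarrow> (real \<Rightarrow> real^'n \<Rightarrow> real) \<Rightarrow> ennreal" where
  "Lp_norm p T g =
     (let I = (\<integral>\<^sup>+w\<in>{0<..<T} \<times> UNIV. ennreal (\<bar>g (fst w) (snd w)\<bar> powr p) \<partial>lborel)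
      in if I = \<infinity> then \<infinity> else ennreal (enn2real I powr (1 / p)))"

definition matrix_norm :: "(real^'n^'n \<Rightarrow> real) \<Rightarrow> bool" where
  "matrix_norm nrm \<longleftrightarrow>
      (\<forall>M. nrm M = 0 \<longleftrightarrow> M = 0) \<and>
      (\<forall>c M. nrm (c *\<^sub>R M) = \<bar>c\<bar> * nrm M) \<and>
      (\<forall>M M'. nrm (M + M') \<le> nrm M + nrm M')"

definition Lp_mnorm :: "(real^'n^'n \<Rightarrow> real) \<Rightarrow> real \<Rightarrow> real \<Rightarrow>
    (real \<Rightarrow> real^'n \<Rightarrow> real^'n^'n) \<Rightarrow> ennreal" where
  "Lp_mnorm nrm p T H = Lp_norm p T (\<lambda>t z. nrm (H t z))"

text \<open>
  A matrix norm is fixed on N x N matrices only; a d0 x d0 matrix is measured by the norm of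
  its zero-padded version.
\<close>

definition Lp_mnorm_x :: "(real^'n^'n \<Rightarrow> real) \<Rightarrow> ('d \<Rightarrow> 'n) \<Rightarrow> real \<Rightarrow> real \<Rightarrow>
    (real \<Rightarrow> real^'n \<Rightarrow> real^'d^'d) \<Rightarrow> ennreal" where
  "Lp_mnorm_x nrm e p T H = Lp_norm p T (\<lambda>t z. nrm (pad e (H t z)))"

end

theory Submission
  imports Defs
begin

text \<open>
  In the coordinates \<open>x = exp (t A) z\<close> both equations become heat equations with a time-dependent
  positive semidefinite matrix, and their solutions are Duhamel integrals of Gaussian convolutions.
  These convolutions are limits of averages over random walks, so that finite averages of translations
  suffice and singular covariances need no special treatment.

  The perturbation S contributes an independent Gaussian increment. If this is replaced by finitely many
  symmetric jumps, the perturbed solution is an average of translated solutions of the unperturbed problem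
  with translated sources. By convexity and translation invariance of the \<open>L\<^sup>p\<close> norm the constant Cp survives
  every jump. Refining the jumps and Fatou's lemma give the bound for S.

  Uniqueness has to cope with the absence of any regularity in time of the second derivatives. A solution
  with zero source is compared with strict paraboloid supersolutions. On the closed set of times near which
  the comparison fails, Baire's theorem gives a portion with uniformly controlled second differences, and
  the maximum principle works there.
\<close>

section \<open>Smooth functions with bounded derivatives\<close>

text \<open>All derivative bounds of a source are kept in one sequence \<open>M\<close>, so the
  error estimates for walks are uniform over every source that occurs. Symmetric jumps cancel the
  odd Taylor terms: two walks with the same covariance differ by the square of its trace times
  \<open>M 4\<close>, and n steps of covariance of order 1/n leave an error of order 1/n.
  Conditioning on the sign of one jump gives a half-sum of two problems of the same kind, and a
  convex functional inherits its bound with the factor 1/2 + 1/2 = 1; this is why no constant is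
  lost however many jumps are used. The shifted source is discontinuous at the jump time, and the
  exceptional times of f may vary with the point; therefore f is first frozen on a time grid, which
  makes these times finite in number and common to all points. In the comparison argument second
  derivatives are controlled only on a closed set of times. There the strictness of a barrier pays
  for all errors; in the gaps comparison itself bounds the growth, and what remains is charged to an
  open set of times of small measure.\<close>

lemma vec_expansion: "h = (\<Sum>i\<in>UNIV. h $ i *\<^sub>R axis i (1::real))"
  by (simp add: vec_eq_iff axis_def sum.delta if_distrib cong: if_cong)

lemma partial_unique:
  "(f has_derivative f') (at z) \<Longrightarrow> partial i f z = f' (axis i 1)"
  unfolding partial_def using frechet_derivative_at by metis

lemma has_derivative_partials:
  assumes "f differentiable (at z)"
  shows "(f has_derivative (\<lambda>h. \<Sum>i\<in>UNIV. h $ i * partial i f z)) (at z)"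
proof -
  let ?D = "frechet_derivative f (at z)"
  have D: "(f has_derivative ?D) (at z)" using assms frechet_derivative_works by blast
  then have lin: "linear ?D" by (rule has_derivative_linear)
  have "?D h = (\<Sum>i\<in>UNIV. h $ i * partial i f z)" for h
  proof -
    have "?D h = ?D (\<Sum>i\<in>UNIV. h $ i *\<^sub>R axis i 1)" using vec_expansion by metis
    also have "\<dots> = (\<Sum>i\<in>UNIV. h $ i * ?D (axis i 1))"
      using lin by (simp add: linear_sum linear_scale)
    finally show ?thesis by (simp add: partial_def)
  qed
  then have "?D = (\<lambda>h. \<Sum>i\<in>UNIV. h $ i * partial i f z)" by auto
  with D show ?thesis by simp
qed

lemma grad_inner: "grad f z \<bullet> h = (\<Sum>i\<in>UNIV. h $ i * partial i f z)"
  by (simp add: inner_vec_def grad_def mult.commute)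

lemma sum_axis: "(\<Sum>k\<in>UNIV. axis i (1::real) $ k * p k) = p i"
  "(\<Sum>k\<in>UNIV. p k * axis i (1::real) $ k) = p i"
proof -
  have "axis i (1::real) $ k * p k = (if k = i then p k else 0)" for k
    by (simp add: axis_def)
  then show "(\<Sum>k\<in>UNIV. axis i (1::real) $ k * p k) = p i" by simp
  then show "(\<Sum>k\<in>UNIV. p k * axis i (1::real) $ k) = p i" by (simp add: mult.commute)
qed

lemma partial_of_sum:
  "(f has_derivative (\<lambda>h. \<Sum>i\<in>UNIV. h $ i * p i)) (at z) \<Longrightarrow> partial i f z = p i"
  by (subst partial_unique, assumption) (simp add: sum_axis)

text \<open>One bound for all lists of a given length, so that averages, translations and heat
  operators keep the sequence \<open>M\<close> unchanged. The lists are ordered: derivatives taken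
  in different orders are separate entries.\<close>

definition Cb_le :: "(nat \<Rightarrow> real) \<Rightarrow> (real^'n \<Rightarrow> real) \<Rightarrow> bool" where
  "Cb_le M g \<longleftrightarrow> (\<forall>js z. partials js g differentiable (at z) \<and> \<bar>partials js g z\<bar> \<le> M (length js))"

lemma Cb_leD:
  assumes "Cb_le M g"
  shows "(partials js g has_derivative (\<lambda>h. \<Sum>i\<in>UNIV. h $ i * partials (i # js) g z)) (at z)"
    and "\<bar>partials js g z\<bar> \<le> M (length js)"
  using assms has_derivative_partials[of "partials js g" z] by (auto simp: Cb_le_def)

text \<open>A guess \<open>P\<close> for all iterated derivatives at once: by induction on the list
  each \<open>P js\<close> is \<open>partials js g\<close>. Interchanging derivatives with limits or
  integrals is thereby reduced to one first-order statement about \<open>P\<close>.\<close>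

lemma Cb_le_I:
  assumes "P [] = g"
    and der: "\<And>js z. (P js has_derivative (\<lambda>h. \<Sum>i\<in>UNIV. h $ i * P (i # js) z)) (at z)"
    and bd: "\<And>js z. \<bar>P js z\<bar> \<le> M (length js)"
  shows "Cb_le M g" "partials js g = P js"
proof -
  have *: "partials js g = P js" for js
  proof (induction js)
    case (Cons i js)
    have "partial i (P js) z = P (i # js) z" for z
      by (rule partial_of_sum[OF der])
    then show ?case using Cons by auto
  qed (use assms in auto)
  show "partials js g = P js" by (rule *)
  show "Cb_le M g"
    unfolding Cb_le_def * using der bd by (auto simp: differentiable_def)
qed

lemma partials_snoc: "partials (js @ [i]) g = partials js (partial i g)"
  by (induction js) auto

lemma partials_append: "partials (js @ ks) g = partials js (partials ks g)"
  by (induction js) auto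

lemma Cb_le_mono: "Cb_le M g \<Longrightarrow> (\<And>k. M k \<le> M' k) \<Longrightarrow> Cb_le M' g"
  unfolding Cb_le_def using order_trans by blast

lemma Cb_le_partials: "Cb_le M g \<Longrightarrow> Cb_le (\<lambda>k. M (k + length ks)) (partials ks g)"
  unfolding Cb_le_def partials_append[symmetric] length_append[symmetric] by blast

lemma Cb_le_partial: "Cb_le M g \<Longrightarrow> Cb_le (\<lambda>k. M (Suc k)) (partial i g)"
  using Cb_le_partials[of M g "[i]"] by simp

lemma Cb_le_nonneg: assumes "Cb_le M (g::real^'n\<Rightarrow>real)" shows "0 \<le> M k"
proof -
  obtain i :: 'n where True by auto
  have "0 \<le> \<bar>partials (replicate k i) g 0\<bar>" by simp
  also have "\<dots> \<le> M k" using Cb_leD(2)[OF assms, of "replicate k i" 0] by simp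
  finally show ?thesis .
qed

lemma Cb_le_bound: "Cb_le M g \<Longrightarrow> \<bar>g z\<bar> \<le> M 0"
  using Cb_leD(2)[of M g "[]"] by simp

lemma Cb_le_der:
  "Cb_le M g \<Longrightarrow> (g has_derivative (\<lambda>h. \<Sum>i\<in>UNIV. h $ i * partial i g z)) (at z)"
  using Cb_leD(1)[of M g "[]"] by simp

lemma Cb_le_cont: "Cb_le M g \<Longrightarrow> continuous_on A g"
  using Cb_le_der by (meson continuous_at_imp_continuous_on has_derivative_continuous)

lemma Cb_le_C_k: "Cb_le M g \<Longrightarrow> C_k n g"
proof (induction n arbitrary: M g)
  case 0
  then show ?case using Cb_le_cont by auto
next
  case (Suc n)
  have "\<forall>z. g differentiable (at z)" using Cb_le_der[OF Suc.prems] by (auto simp: differentiable_def)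
  then show ?case using Suc.IH[OF Cb_le_partial[OF Suc.prems]] by simp
qed

lemma Cb_le_sum:
  assumes "finite I" "\<And>i. i \<in> I \<Longrightarrow> Cb_le (M i) (f i)"
  shows "Cb_le (\<lambda>k. \<Sum>i\<in>I. \<bar>c i\<bar> * M i k) (\<lambda>z. \<Sum>i\<in>I. c i * f i z)"
    and "partials js (\<lambda>z. \<Sum>i\<in>I. c i * f i z) = (\<lambda>z. \<Sum>i\<in>I. c i * partials js (f i) z)"
proof -
  let ?P = "\<lambda>js z. \<Sum>i\<in>I. c i * partials js (f i) z"
  have 1: "?P [] = (\<lambda>z. \<Sum>i\<in>I. c i * f i z)" by simp
  have 2: "(?P js has_derivative (\<lambda>h. \<Sum>k\<in>UNIV. h $ k * ?P (k # js) z)) (at z)" for js z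
  proof -
    have "(?P js has_derivative (\<lambda>h. \<Sum>i\<in>I. c i * (\<Sum>k\<in>UNIV. h $ k * partials (k # js) (f i) z))) (at z)"
      by (intro has_derivative_sum has_derivative_mult_right Cb_leD(1)[OF assms(2)])
    also have "(\<lambda>h. \<Sum>i\<in>I. c i * (\<Sum>k\<in>UNIV. h $ k * partials (k # js) (f i) z))
       = (\<lambda>h. \<Sum>k\<in>UNIV. h $ k * ?P (k # js) z)"
      unfolding sum_distrib_left by (subst sum.swap) (simp add: algebra_simps)
    finally show ?thesis .
  qed
  have 3: "\<bar>?P js z\<bar> \<le> (\<Sum>i\<in>I. \<bar>c i\<bar> * M i (length js))" for js z
    by (rule order_trans[OF sum_abs])
      (auto intro!: sum_mono mult_left_mono Cb_leD(2) assms simp: abs_mult)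
  show "Cb_le (\<lambda>k. \<Sum>i\<in>I. \<bar>c i\<bar> * M i k) (\<lambda>z. \<Sum>i\<in>I. c i * f i z)"
    by (rule Cb_le_I(1)[where P="?P", OF 1 2 3])
  show "partials js (\<lambda>z. \<Sum>i\<in>I. c i * f i z) = (\<lambda>z. \<Sum>i\<in>I. c i * partials js (f i) z)"
    by (rule Cb_le_I(2)[where P="?P", OF 1 2 3])
qed

lemma Cb_le_translate:
  assumes "Cb_le M g"
  shows "Cb_le M (\<lambda>z. g (z + c))" "partials js (\<lambda>z. g (z + c)) = (\<lambda>z. partials js g (z + c))"
proof -
  let ?P = "\<lambda>js z. partials js g (z + c)"
  have 2: "(?P js has_derivative (\<lambda>h. \<Sum>k\<in>UNIV. h $ k * ?P (k # js) z)) (at z)" for js z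
    by (rule has_derivative_compose[where f="\<lambda>z. z + c" and f'="\<lambda>h. h", OF _ Cb_leD(1)[OF assms]])
      (auto intro!: derivative_eq_intros)
  show "Cb_le M (\<lambda>z. g (z + c))" "partials js (\<lambda>z. g (z + c)) = ?P js"
    using Cb_le_I[where P="?P", OF _ 2 Cb_leD(2)[OF assms]] by auto
qed

lemma partial_linear:
  fixes P :: "real^'n^'m"
  assumes "Cb_le M g"
  shows "partial i (\<lambda>z. g (P *v z)) = (\<lambda>z. \<Sum>k\<in>UNIV. P $ k $ i * partial k g (P *v z))"
    and "(\<lambda>z. g (P *v z)) differentiable (at z)"
proof -
  have D: "((\<lambda>z. g (P *v z)) has_derivative (\<lambda>h. \<Sum>k\<in>UNIV. (P *v h) $ k * partial k g (P *v z))) (at z)" for z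
    by (rule has_derivative_compose[OF bounded_linear_imp_has_derivative Cb_le_der[OF assms]])
      (simp add: matrix_vector_mul_bounded_linear)
  show "partial i (\<lambda>z. g (P *v z)) = (\<lambda>z. \<Sum>k\<in>UNIV. P $ k $ i * partial k g (P *v z))"
    by (rule ext, subst partial_unique[OF D]) (simp add: matrix_vector_mult_def sum_axis)
  show "(\<lambda>z. g (P *v z)) differentiable (at z)" using D by (auto simp: differentiable_def)
qed

text \<open>One derivative of g (P z) is again h (P z), with h a combination of first derivatives of
  g whose coefficients add up to at most \<open>CARD('m) * p\<close>. This consumes the innermost
  derivative, so the induction removes list elements from the right.\<close>

lemma Cb_le_linear:
  fixes P :: "real^'n^'m"
  assumes p: "\<And>i j. \<bar>P $ i $ j\<bar> \<le> p" and g: "Cb_le M g"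
  shows "Cb_le (\<lambda>k. (real CARD('m) * p)^k * M k) (\<lambda>z. g (P *v z))"
proof -
  have p0: "0 \<le> p" using p abs_ge_zero order_trans by blast
  have "partials js (\<lambda>z. g (P *v z)) differentiable (at z) \<and>
     \<bar>partials js (\<lambda>z. g (P *v z)) z\<bar> \<le> (real CARD('m) * p)^(length js) * M (length js)" for js z
    using g
  proof (induction js arbitrary: g M rule: rev_induct)
    case Nil
    then show ?case using partial_linear(2)[OF Nil] Cb_le_bound[OF Nil] by simp
  next
    case (snoc i js)
    define h where "h = (\<lambda>z. \<Sum>k\<in>UNIV. P $ k $ i * partial k g z)"
    have "Cb_le (\<lambda>l. \<Sum>k\<in>UNIV. \<bar>P $ k $ i\<bar> * M (Suc l)) h"
      unfolding h_def by (rule Cb_le_sum(1)) (auto intro: Cb_le_partial snoc.prems)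
    then have h: "Cb_le (\<lambda>l. (real CARD('m) * p) * M (Suc l)) h"
    proof (rule Cb_le_mono)
      fix l
      have "(\<Sum>k\<in>UNIV. \<bar>P $ k $ i\<bar> * M (Suc l)) \<le> (\<Sum>k\<in>(UNIV::'m set). p * M (Suc l))"
        by (intro sum_mono mult_right_mono p Cb_le_nonneg[OF snoc.prems])
      then show "(\<Sum>k\<in>UNIV. \<bar>P $ k $ i\<bar> * M (Suc l)) \<le> real CARD('m) * p * M (Suc l)" by simp
    qed
    have "partials (js @ [i]) (\<lambda>z. g (P *v z)) = partials js (\<lambda>z. h (P *v z))"
      unfolding partials_snoc partial_linear(1)[OF snoc.prems] h_def ..
    then show ?case using snoc.IH[OF h] by (simp add: algebra_simps)
  qed
  then show ?thesis unfolding Cb_le_def by blast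
qed

section \<open>Directional derivatives and Taylor bounds\<close>

definition dd :: "real^'n \<Rightarrow> (real^'n \<Rightarrow> real) \<Rightarrow> real^'n \<Rightarrow> real" where
  "dd a g z = (\<Sum>i\<in>UNIV. a $ i * partial i g z)"

lemma Cb_le_dd:
  assumes "Cb_le M g"
  shows "Cb_le (\<lambda>k. real CARD('n) * norm a * M (Suc k)) (dd (a::real^'n) g)"
proof -
  have "Cb_le (\<lambda>l. \<Sum>i\<in>UNIV. \<bar>a $ i\<bar> * M (Suc l)) (dd a g)"
    unfolding dd_def[abs_def] by (rule Cb_le_sum(1)) (auto intro: Cb_le_partial assms)
  then show ?thesis
  proof (rule Cb_le_mono)
    fix l
    have "(\<Sum>i\<in>UNIV. \<bar>a $ i\<bar> * M (Suc l)) \<le> (\<Sum>i\<in>(UNIV::'n set). norm a * M (Suc l))"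
      by (intro sum_mono mult_right_mono component_le_norm_cart Cb_le_nonneg[OF assms])
    then show "(\<Sum>i\<in>UNIV. \<bar>a $ i\<bar> * M (Suc l)) \<le> real CARD('n) * norm a * M (Suc l)" by simp
  qed
qed

lemma Cb_le_dd_pow:
  assumes "Cb_le M (g::real^'n\<Rightarrow>real)"
  shows "Cb_le (\<lambda>k. (real CARD('n) * norm a)^m * M (k + m)) ((dd a ^^ m) g)"
proof (induction m)
  case (Suc m)
  show ?case using Cb_le_dd[OF Suc] by (simp add: algebra_simps)
qed (use assms in simp)

lemma line_deriv:
  assumes "Cb_le M g"
  shows "((\<lambda>s. g (x + s *\<^sub>R a)) has_real_derivative dd a g (x + s *\<^sub>R a)) (at s)"
proof -
  have "((\<lambda>s. g (x + s *\<^sub>R a)) has_derivative (\<lambda>t. \<Sum>i\<in>UNIV. (t *\<^sub>R a) $ i * partial i g (x + s *\<^sub>R a))) (at s)"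
    by (rule has_derivative_compose[OF _ Cb_le_der[OF assms]]) (auto intro!: derivative_eq_intros)
  then show ?thesis
    unfolding has_field_derivative_def dd_def
    by (rule has_derivative_eq_rhs) (simp add: sum_distrib_right sum_distrib_left mult_ac fun_eq_iff)
qed

text \<open>Maclaurin's formula for the restriction of g to the line through x in direction a; its
  n-th derivative is the n-fold directional derivative, and each \<open>dd a\<close> costs a factor
  \<open>CARD('n) * norm a\<close>.\<close>

lemma taylor_bound:
  fixes g :: "real^'n \<Rightarrow> real"
  assumes g: "Cb_le M g"
  shows "\<bar>g (x + a) - (\<Sum>m<n. (dd a ^^ m) g x / fact m)\<bar> \<le> (real CARD('n) * norm a)^n * M n / fact n"
proof -
  define diff where "diff m s = (dd a ^^ m) g (x + s *\<^sub>R a)" for m and s :: real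
  have 1: "\<forall>m s. (diff m has_real_derivative diff (Suc m) s) (at s)"
    unfolding diff_def[abs_def] using line_deriv[OF Cb_le_dd_pow[OF g]] by auto
  obtain t where t: "diff 0 1 = (\<Sum>m<n. diff m 0 / fact m * 1 ^ m) + diff n t / fact n * 1 ^ n"
    using Maclaurin_all_le[of diff "diff 0" 1 n, OF refl 1] by auto
  have "\<bar>diff n t\<bar> \<le> (real CARD('n) * norm a)^n * M n"
    using Cb_le_bound[OF Cb_le_dd_pow[OF g, of a n]] by (simp add: diff_def)
  moreover have "g (x + a) - (\<Sum>m<n. (dd a ^^ m) g x / fact m) = diff n t / fact n"
    using t by (simp add: diff_def)
  ultimately show ?thesis by (simp add: divide_right_mono)
qed

lemma dd_minus: "Cb_le M g \<Longrightarrow> dd (-a) g = (\<lambda>z. - dd a g z)"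
  by (auto simp: dd_def sum_negf)

lemma taylor1:
  "Cb_le M (g::real^'n\<Rightarrow>real) \<Longrightarrow> \<bar>g (x + a) - g x\<bar> \<le> real CARD('n) * norm a * M 1"
  using taylor_bound[of M g x a 1] by simp

lemma taylor1':
  "Cb_le M (g::real^'n\<Rightarrow>real) \<Longrightarrow> \<bar>g y - g x\<bar> \<le> real CARD('n) * norm (y - x) * M 1"
  using taylor1[of M g x "y - x"] by simp

lemma taylor2:
  assumes "Cb_le M (g::real^'n\<Rightarrow>real)"
  shows "\<bar>g (x + a) - g x - dd a g x\<bar> \<le> (real CARD('n) * norm a)^2 * M 2"
  using taylor_bound[OF assms, of x a 2] Cb_le_nonneg[OF assms, of 2]
  by (simp add: numeral_2_eq_2 abs_if algebra_simps split: if_splits)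

lemma taylor_sym2:
  assumes "Cb_le M (g::real^'n\<Rightarrow>real)"
  shows "\<bar>(g (x + a) + g (x - a)) / 2 - g x\<bar> \<le> (real CARD('n) * norm a)^2 * M 2"
  using taylor2[OF assms, of x a] taylor2[OF assms, of x "-a"]
  by (simp add: dd_minus[OF assms] abs_le_iff field_simps)

text \<open>The terms of orders one and three cancel in the mean over x + a and x - a, so the error
  after the second-order term is of order four rather than three. The rate 1/n for walks with n
  steps rests on this.\<close>

lemma taylor_sym4:
  assumes "Cb_le M (g::real^'n\<Rightarrow>real)"
  shows "\<bar>(g (x + a) + g (x - a)) / 2 - g x - dd a (dd a g) x / 2\<bar> \<le> (real CARD('n) * norm a)^4 * M 4"
proof -
  let ?K = "(real CARD('n) * norm a)^4 * M 4"
  have K0: "0 \<le> ?K" using Cb_le_nonneg[OF assms, of 4] by simp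
  have sums: "(\<Sum>m<4. F m) = F 0 + F 1 + F 2 + F 3" for F :: "nat \<Rightarrow> real"
    by (simp add: eval_nat_numeral)
  have p2: "(dd b ^^ 2) g = dd b (dd b g)" "(dd b ^^ 3) g = dd b (dd b (dd b g))" for b
    by (simp_all add: eval_nat_numeral)
  have neg: "dd (-a) g = (\<lambda>z. - dd a g z)" "dd (-a) (\<lambda>z. - h z) = (\<lambda>z. - dd (-a) h z)"
    if "Cb_le M' h" for h M'
  proof -
    show "dd (-a) g = (\<lambda>z. - dd a g z)" by (rule dd_minus[OF assms])
    have "partial i (\<lambda>z. - h z) z = - partial i h z" for i z
    proof -
      have "((\<lambda>z. - h z) has_derivative (\<lambda>k. - (\<Sum>i\<in>UNIV. k $ i * partial i h z))) (at z)"
        by (intro has_derivative_minus Cb_le_der[OF that])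
      from partial_unique[OF this, of i] show ?thesis
        by (simp add: sum_axis)
    qed
    then show "dd (-a) (\<lambda>z. - h z) = (\<lambda>z. - dd (-a) h z)"
      by (auto simp: dd_def sum_negf)
  qed
  note d1 = Cb_le_dd[OF assms, of a] note d2 = Cb_le_dd[OF d1, of a]
  have e2: "dd (-a) (dd (-a) g) = dd a (dd a g)"
    using neg(1)[OF assms] neg(2)[OF d1] dd_minus[OF d1, of a] by auto
  have A: "\<bar>g (x + a) - (g x + dd a g x + dd a (dd a g) x / 2 + dd a (dd a (dd a g)) x / 6)\<bar> \<le> ?K / 24"
    using taylor_bound[OF assms, of x a 4] unfolding sums p2 by (simp add: fact_numeral)
  have B: "\<bar>g (x - a) - (g x - dd a g x + dd a (dd a g) x / 2 - dd a (dd a (dd a g)) x / 6)\<bar> \<le> ?K / 24"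
    using taylor_bound[OF assms, of x "-a" 4] unfolding sums p2 e2
    by (simp add: fact_numeral dd_minus[OF assms] dd_minus[OF d2])
  have fin: "\<bar>(u + v) / 2 - g0 - d2 / 2\<bar> \<le> K"
    if "\<bar>u - (g0 + d1 + d2 / 2 + d3 / 6)\<bar> \<le> K / 24"
      "\<bar>v - (g0 - d1 + d2 / 2 - d3 / 6)\<bar> \<le> K / 24" "0 \<le> K" for u v g0 d1 d2 d3 K :: real
    using abs_le_D1[OF that(1)] abs_le_D2[OF that(1)] abs_le_D1[OF that(2)] abs_le_D2[OF that(2)] that(3)
    by (intro abs_leI; argo)
  show ?thesis by (rule fin[OF A B K0])
qed

text \<open>A remainder bounded by a fixed multiple of the squared increment survives pointwise
  limits and integration, which plain differentiability does not; this form carries derivatives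
  through both.\<close>

lemma has_derivative_quad:
  fixes F :: "real^'n \<Rightarrow> real"
  assumes q: "\<And>h. \<bar>F (x + h) - F x - (\<Sum>i\<in>UNIV. h $ i * p i)\<bar> \<le> K * (norm h)\<^sup>2"
  shows "(F has_derivative (\<lambda>h. \<Sum>i\<in>UNIV. h $ i * p i)) (at x)"
  unfolding has_derivative_at
proof
  have "linear (\<lambda>h::real^'n. \<Sum>i\<in>UNIV. h $ i * p i)"
    by (rule linearI) (simp_all add: sum.distrib algebra_simps sum_distrib_left)
  then show "bounded_linear (\<lambda>h. \<Sum>i\<in>UNIV. h $ i * p i)" by (simp add: linear_linear)
  have "norm (F (x + h) - F x - (\<Sum>i\<in>UNIV. h $ i * p i)) / norm h \<le> K * norm h" for h
    using q[of h] by (cases "h = 0") (simp_all add: divide_le_eq power2_eq_square mult.assoc)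
  then have 1: "\<forall>\<^sub>F h in at 0. norm (F (x + h) - F x - (\<Sum>i\<in>UNIV. h $ i * p i)) / norm h \<le> K * norm h"
    by auto
  have 2: "((\<lambda>h::real^'n. K * norm h) \<longlongrightarrow> 0) (at 0)"
    by (intro tendsto_mult_right_zero tendsto_norm_zero tendsto_ident_at)
  show "(\<lambda>h. norm (F (x + h) - F x - (\<Sum>i\<in>UNIV. h $ i * p i)) / norm h) \<midarrow>0\<rightarrow> 0"
    by (rule tendsto_sandwich[OF _ 1 tendsto_const 2]) simp
qed

section \<open>Heat operators as limits of random walks\<close>

text \<open>The expectation of g at x plus the sum of the list entries with independent fair signs,
  that is, iterated convolution with symmetric two-point measures.\<close>

primrec avg :: "(real^'n) list \<Rightarrow> (real^'n \<Rightarrow> real) \<Rightarrow> real^'n \<Rightarrow> real" where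
  "avg [] g x = g x"
| "avg (a # as) g x = (avg as g (x + a) + avg as g (x - a)) / 2"

lemma avg_append: "avg (as @ bs) g = avg as (avg bs g)"
proof
  show "avg (as @ bs) g x = avg as (avg bs g) x" for x
    by (induction as arbitrary: x) auto
qed

lemma avg_translate: "avg as (\<lambda>y. g (y + c)) x = avg as g (x + c)"
  by (induction as arbitrary: x) (auto simp: algebra_simps)

lemma avg_sum: "avg as (\<lambda>y. \<Sum>i\<in>I. c i * f i y) x = (\<Sum>i\<in>I. c i * avg as (f i) x)"
  by (induction as arbitrary: x)
     (auto simp: sum.distrib[symmetric] sum_divide_distrib algebra_simps intro!: sum.cong)

lemma avg_half: "avg as (\<lambda>y. (g y + h y) / 2) x = (avg as g x + avg as h x) / 2"
proof (induction as arbitrary: x)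
  case (Cons a as)
  show ?case by (simp only: avg.simps Cons) (simp add: field_simps)
qed simp

lemma avg_commute: "avg as (avg bs g) = avg bs (avg as g)"
proof
  show "avg as (avg bs g) x = avg bs (avg as g) x" for x
  proof (induction as arbitrary: x)
    case (Cons a as)
    have "avg bs (avg (a # as) g) x = avg bs (\<lambda>y. (avg as g (y + a) + avg as g (y + - a)) / 2) x"
      by (rule arg_cong[where f="\<lambda>h. avg bs h x"]) auto
    also have "\<dots> = (avg bs (avg as g) (x + a) + avg bs (avg as g) (x + - a)) / 2"
      by (subst avg_half) (simp only: avg_translate)
    finally have "avg bs (avg (a # as) g) x = (avg as (avg bs g) (x + a) + avg as (avg bs g) (x + - a)) / 2"
      by (simp only: Cons)
    moreover have "avg (a # as) (avg bs g) x = (avg as (avg bs g) (x + a) + avg as (avg bs g) (x + - a)) / 2"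
      by simp
    ultimately show ?case by (simp only:)
  qed (auto intro!: arg_cong[where f="\<lambda>h. avg bs h _"])
qed

text \<open>The convolutions commute, so only the multiset of jumps counts. This allows the steps of
  two walks to be interleaved.\<close>

lemma avg_mset: "mset as = mset bs \<Longrightarrow> avg as g = avg bs g"
proof (induction as arbitrary: bs)
  case (Cons a as)
  then have "a \<in> set bs" by (metis list.set_intros(1) set_mset_mset)
  then obtain b1 b2 where bs: "bs = b1 @ a # b2" by (meson split_list)
  then have "mset as = mset (b1 @ b2)" using Cons.prems by simp
  then have as: "avg as g = avg (b1 @ b2) g" by (rule Cons.IH)
  have "avg (a # as) g = avg [a] (avg as g)" by auto
  also have "\<dots> = avg b1 (avg [a] (avg b2 g))" unfolding as avg_append by (rule avg_commute)
  also have "\<dots> = avg bs g" unfolding bs by (simp add: avg_append[symmetric])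
  finally show ?case .
qed auto

lemma avg_bound: "(\<And>y. \<bar>g y\<bar> \<le> M) \<Longrightarrow> \<bar>avg as g x\<bar> \<le> M"
proof (induction as arbitrary: x)
  case (Cons a as)
  from Cons(1)[OF Cons(2), of "x + a"] Cons(1)[OF Cons(2), of "x - a"] show ?case by simp
qed auto

lemma half_diff_bound:
  fixes u v u' v' :: real
  assumes "\<bar>u - u'\<bar> \<le> M" "\<bar>v - v'\<bar> \<le> M"
  shows "\<bar>(u + v) / 2 - (u' + v') / 2\<bar> \<le> M"
proof -
  have e: "(u + v) / 2 - (u' + v') / 2 = ((u - u') + (v - v')) / 2" by (simp add: field_simps)
  have "\<bar>(u - u') + (v - v')\<bar> \<le> 2 * M" using assms abs_triangle_ineq[of "u - u'" "v - v'"] by linarith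
  then show ?thesis unfolding e by simp
qed

lemma avg_diff_bound: "(\<And>y. \<bar>g y - h y\<bar> \<le> M) \<Longrightarrow> \<bar>avg as g x - avg as h x\<bar> \<le> M"
proof (induction as arbitrary: x)
  case (Cons a as)
  show ?case unfolding avg.simps by (rule half_diff_bound; rule Cons(1)[OF Cons(2)])
qed auto

section \<open>Derivatives of averages and their expansion to second order\<close>

lemma avg_has_derivative:
  assumes "\<And>z. (F has_derivative (\<lambda>h. \<Sum>i\<in>UNIV. h $ i * F' i z)) (at z)"
  shows "(avg as F has_derivative (\<lambda>h. \<Sum>i\<in>UNIV. h $ i * avg as (F' i) z)) (at z)"
proof (induction as arbitrary: z)
  case Nil
  have "avg [] G = G" for G :: "real^'a \<Rightarrow> real" by auto
  then show ?case using assms by simp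
next
  case (Cons a as)
  have 1: "((\<lambda>z. avg as F (z + c)) has_derivative (\<lambda>h. \<Sum>i\<in>UNIV. h $ i * avg as (F' i) (z + c))) (at z)" for c
    by (rule has_derivative_compose[where f="\<lambda>z. z + c" and f'="\<lambda>h. h", OF _ Cons])
      (auto intro!: derivative_eq_intros)
  have 2: "((\<lambda>z. 1 / 2 * (avg as F (z + a) + avg as F (z + - a))) has_derivative
     (\<lambda>h. 1 / 2 * ((\<Sum>i\<in>UNIV. h $ i * avg as (F' i) (z + a)) + (\<Sum>i\<in>UNIV. h $ i * avg as (F' i) (z + - a))))) (at z)"
    by (intro has_derivative_mult_right has_derivative_add 1)
  have 3: "avg (a # as) F = (\<lambda>z. 1 / 2 * (avg as F (z + a) + avg as F (z + - a)))" by auto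
  have 4: "(\<lambda>h. \<Sum>i\<in>UNIV. h $ i * avg (a # as) (F' i) z) =
     (\<lambda>h. 1 / 2 * ((\<Sum>i\<in>UNIV. h $ i * avg as (F' i) (z + a)) + (\<Sum>i\<in>UNIV. h $ i * avg as (F' i) (z + - a))))"
    unfolding sum.distrib[symmetric] sum_distrib_left by (intro ext sum.cong refl) (simp add: algebra_simps)
  show ?case unfolding 3 4 by (rule 2)
qed

lemma Cb_le_avg:
  assumes "Cb_le M g"
  shows "Cb_le M (avg as g)" "partials js (avg as g) = avg as (partials js g)"
proof -
  let ?P = "\<lambda>js. avg as (partials js g)"
  have 1: "?P [] = avg as g" by simp
  have 2: "(?P js has_derivative (\<lambda>h. \<Sum>i\<in>UNIV. h $ i * ?P (i # js) z)) (at z)" for js z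
    by (rule avg_has_derivative) (rule Cb_leD(1)[OF assms])
  have 3: "\<bar>?P js z\<bar> \<le> M (length js)" for js z
    by (rule avg_bound) (rule Cb_leD(2)[OF assms])
  show "Cb_le M (avg as g)" "partials js (avg as g) = ?P js"
    using Cb_le_I[where P="?P", OF 1 2 3] by auto
qed

lemma avg_partial: "Cb_le M g \<Longrightarrow> partial i (avg as g) = avg as (partial i g)"
  using Cb_le_avg(2)[where g=g and M=M and js="[i]"] by simp

lemma avg_dd: assumes "Cb_le M g" shows "dd a (avg as g) = avg as (dd a g)"
  unfolding dd_def[abs_def] avg_partial[OF assms] by (rule ext) (simp add: avg_sum)

text \<open>The covariance matrix of the random sum behind \<open>avg as\<close>, without the factor
  1/2 of the generator.\<close>

definition gram :: "(real^'n) list \<Rightarrow> real^'n^'n" where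
  "gram as = (\<chi> i j. \<Sum>a\<leftarrow>as. a $ i * a $ j)"

lemma gram_simps [simp]: "gram [] = 0"
  "gram (a # as) = (\<chi> i j. a $ i * a $ j) + gram as"
  by (simp_all add: gram_def vec_eq_iff)

lemma gram_append [simp]: "gram (as @ bs) = gram as + gram bs"
  by (simp add: gram_def vec_eq_iff)

lemma gram_replicate: "gram (concat (replicate n as)) = real n *\<^sub>R gram as"
  by (induction n) (auto simp: algebra_simps)

lemma trace_add': "trace ((A::real^'n^'n) + B) = trace A + trace B"
  by (simp add: trace_def sum.distrib)

lemma trace_scale: "trace (c *\<^sub>R (A::real^'n^'n)) = c * trace A"
  by (simp add: trace_def sum_distrib_left)

lemma trace_mult: "trace ((A::real^'n^'n) ** B) = (\<Sum>i\<in>UNIV. \<Sum>j\<in>UNIV. A $ i $ j * B $ j $ i)"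
  by (simp add: trace_def matrix_matrix_mult_def)

lemma norm_sq_sum: "(norm (a::real^'n))\<^sup>2 = (\<Sum>i\<in>UNIV. a $ i * a $ i)"
  by (simp add: power2_norm_eq_inner inner_vec_def)

lemma trace_gram_Cons: "trace (gram (a # as)) = (norm a)\<^sup>2 + trace (gram as)"
  unfolding gram_simps trace_add' by (simp add: trace_def norm_sq_sum)

lemma trace_gram_nonneg: "0 \<le> trace (gram as)"
proof (induction as)
  case Nil
  then show ?case by (simp add: trace_def)
next
  case (Cons a as)
  then show ?case unfolding trace_gram_Cons by simp
qed

lemma dd_dd:
  fixes g :: "real^'n \<Rightarrow> real"
  assumes "Cb_le M g"
  shows "dd a (dd a g) x = trace ((\<chi> i j. a $ i * a $ j) ** hess g x)"
proof -
  have "partial i (dd a g) x = (\<Sum>j\<in>UNIV. a $ j * partial i (partial j g) x)" for i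
    using Cb_le_sum(2)[where I="UNIV::'n set" and M="\<lambda>_ k. M (Suc k)" and f="\<lambda>j. partial j g" and c="\<lambda>j. a $ j" and js="[i]"]
      Cb_le_partial[OF assms]
    by (simp add: dd_def[abs_def])
  then have "dd a (dd a g) x = (\<Sum>i\<in>UNIV. \<Sum>j\<in>UNIV. a $ i * a $ j * partial i (partial j g) x)"
    unfolding dd_def[of a "dd a g"] by (simp add: sum_distrib_left mult.assoc)
  also have "\<dots> = (\<Sum>j\<in>UNIV. \<Sum>i\<in>UNIV. a $ i * a $ j * partial i (partial j g) x)"
    by (rule sum.swap)
  finally show ?thesis by (simp add: trace_mult hess_def mult_ac)
qed

text \<open>Each jump changes the average by at most a multiple of its squared length times
  \<open>M 2\<close>, and the squared lengths add up to the trace of the Gram matrix.\<close>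

lemma avg_first:
  fixes g :: "real^'n \<Rightarrow> real"
  assumes "Cb_le M g"
  shows "\<bar>avg as g x - g x\<bar> \<le> (real CARD('n))\<^sup>2 * trace (gram as) * M 2"
proof (induction as)
  case Nil
  then show ?case by (simp add: trace_def)
next
  case (Cons a as)
  have "\<bar>avg (a # as) g x - avg as g x\<bar> \<le> (real CARD('n) * norm a)^2 * M 2"
    using taylor_sym2[OF Cb_le_avg(1)[OF assms, of as], of x a] by simp
  then show ?case using Cons unfolding trace_gram_Cons
    by (simp add: algebra_simps)
qed

text \<open>Let n be the squared length of the new jump and S the trace collected so far. Taylor's
  error n^2, the error n S / 2 from undoing the average in the second derivative, and the inherited
  S^2 fit into (n + S)^2; so the squared trace is the quantity on which the induction
  closes.\<close>

lemma avg_second: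
  fixes g :: "real^'n \<Rightarrow> real"
  assumes "Cb_le M g"
  shows "\<bar>avg as g x - g x - trace (gram as ** hess g x) / 2\<bar> \<le> (real CARD('n))^4 * (trace (gram as))\<^sup>2 * M 4"
proof (induction as)
  case Nil
  then show ?case by (simp add: trace_def matrix_matrix_mult_def)
next
  case (Cons a as)
  let ?c = "real CARD('n)"
  define n where "n = (norm a)\<^sup>2"
  define S where "S = trace (gram as)"
  have S0: "0 \<le> S" by (simp add: S_def trace_gram_nonneg)
  have n0: "0 \<le> n" by (simp add: n_def)
  let ?K = "?c^4 * M 4"
  have K0: "0 \<le> ?K" using Cb_le_nonneg[OF assms] by simp
  let ?h = "avg as g"
  note h = Cb_le_avg(1)[OF assms, of as]
  have h2: "dd a (dd a ?h) = avg as (dd a (dd a g))"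
    unfolding avg_dd[OF assms] by (rule avg_dd[OF Cb_le_dd[OF assms]])
  have A: "\<bar>(?h (x + a) + ?h (x - a)) / 2 - ?h x - dd a (dd a ?h) x / 2\<bar> \<le> n\<^sup>2 * ?K"
    using taylor_sym4[OF h, of x a] by (simp add: n_def power_mult_distrib mult_ac)
  have B: "\<bar>?h x - g x - trace (gram as ** hess g x) / 2\<bar> \<le> S\<^sup>2 * ?K"
    using Cons by (simp add: S_def mult_ac)
  have C: "\<bar>dd a (dd a ?h) x - dd a (dd a g) x\<bar> \<le> n * S * ?K"
    unfolding h2 using avg_first[OF Cb_le_dd[OF Cb_le_dd[OF assms]], of as a a x]
    by (simp add: n_def S_def eval_nat_numeral mult_ac)
  have E: "trace (gram (a # as) ** hess g x) = dd a (dd a g) x + trace (gram as ** hess g x)"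
    unfolding gram_simps dd_dd[OF assms] trace_mult by (simp add: algebra_simps sum.distrib)
  have "\<bar>avg (a # as) g x - g x - trace (gram (a # as) ** hess g x) / 2\<bar>
     \<le> n\<^sup>2 * ?K + S\<^sup>2 * ?K + n * S * ?K / 2"
    using A B C unfolding E avg.simps add_divide_distrib by linarith
  also have "\<dots> \<le> (n + S)\<^sup>2 * ?K"
    using mult_nonneg_nonneg[OF mult_nonneg_nonneg[OF n0 S0] K0] by (simp add: power2_eq_square algebra_simps)
  finally show ?case unfolding trace_gram_Cons n_def[symmetric] S_def[symmetric] by (simp add: mult_ac)
qed

section \<open>Positive semidefinite matrices as Gram matrices\<close>

definition psd :: "real^'n^'n \<Rightarrow> bool" where
  "psd C \<longleftrightarrow> transpose C = C \<and> (\<forall>\<xi>. 0 \<le> (C *v \<xi>) \<bullet> \<xi>)"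

lemma quadratic_form_sum: "((C::real^'n^'n) *v \<xi>) \<bullet> \<xi> = (\<Sum>i\<in>UNIV. \<Sum>j\<in>UNIV. C $ i $ j * \<xi> $ j * \<xi> $ i)"
  by (simp add: inner_vec_def matrix_vector_mult_def sum_distrib_right)

lemma psd_sym: "psd C \<Longrightarrow> C $ i $ j = C $ j $ i"
  unfolding psd_def transpose_def by (metis vec_lambda_beta)

lemma psd_add: "psd C \<Longrightarrow> psd D \<Longrightarrow> psd (C + D)"
  by (simp add: psd_def matrix_vector_mult_add_rdistrib inner_left_distrib)
     (simp add: transpose_def vec_eq_iff)

lemma psd_scale: "psd C \<Longrightarrow> 0 \<le> c \<Longrightarrow> psd (c *\<^sub>R C)"
  by (simp add: psd_def scaleR_matrix_vector_assoc[symmetric])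
     (simp add: transpose_def vec_eq_iff)

lemma psd_0: "psd 0"
  by (simp add: psd_def transpose_def vec_eq_iff)

lemma mv_axis: "((C::real^'n^'n) *v axis i 1) = column i C"
  by (rule matrix_vector_mult_basis)

text \<open>This is the form of C at \<xi> minus s times the i-th unit vector. A suitable s yields
  the consequences of the Cauchy-Schwarz inequality for a possibly degenerate form.\<close>

lemma psd_shift_axis:
  fixes C :: "real^'n^'n"
  assumes "psd C"
  shows "0 \<le> (C *v \<xi>) \<bullet> \<xi> - 2 * s * (C *v \<xi>) $ i + s\<^sup>2 * C $ i $ i"
proof -
  have sym: "(C *v x) \<bullet> y = (C *v y) \<bullet> x" for x y
    using assms by (metis psd_def dot_lmul_matrix inner_commute transpose_matrix_vector)
  have "0 \<le> (C *v (\<xi> - s *\<^sub>R axis i 1)) \<bullet> (\<xi> - s *\<^sub>R axis i 1)"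
    using assms by (simp add: psd_def)
  also have "\<dots> = (C *v \<xi>) \<bullet> \<xi> - 2 * s * ((C *v \<xi>) \<bullet> axis i 1) + s\<^sup>2 * ((C *v axis i 1) \<bullet> axis i 1)"
    by (simp add: matrix_vector_mult_diff_distrib matrix_vector_mult_scaleR inner_diff_left inner_diff_right
        sym[of "axis i 1" \<xi>] power2_eq_square algebra_simps)
  also have "\<dots> = (C *v \<xi>) \<bullet> \<xi> - 2 * s * (C *v \<xi>) $ i + s\<^sup>2 * C $ i $ i"
    by (simp add: mv_axis inner_axis column_def)
  finally show ?thesis .
qed

lemma psd_diag: "psd C \<Longrightarrow> 0 \<le> C $ i $ i"
  using psd_shift_axis[of C 0 1 i] by simp

text \<open>Cholesky decomposition with vanishing pivots allowed. Subtracting the rank-one matrix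
  built from the column of a nonzero pivot leaves the Schur complement. It is positive semidefinite,
  vanishes at the pivot and has no new nonzero diagonal entry, so the number of nonzero diagonal
  entries falls.\<close>

lemma psd_decomp: "psd C \<Longrightarrow> \<exists>as. gram as = C"
proof (induction "card {i. C $ i $ i \<noteq> 0}" arbitrary: C rule: less_induct)
  case less
  show ?case
  proof (cases "{i. C $ i $ i \<noteq> 0} = {}")
    case True
    have "C $ j $ i = 0" for i j
    proof -
      have d: "C $ i $ i = 0" "C $ j $ j = 0" using True by auto
      have e: "(C *v axis i 1) $ j = C $ j $ i" "(C *v axis i 1) \<bullet> axis i 1 = C $ i $ i"
        by (simp_all add: mv_axis column_def inner_axis)
      \<comment> \<open>With both diagonal entries zero, s = 1 and s = -1 leave
        \<open>C $ j $ i\<close> both nonpositive and nonnegative.\<close>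
      from psd_shift_axis[OF less.prems, of "axis i 1" 1 j] psd_shift_axis[OF less.prems, of "axis i 1" "-1" j]
      show ?thesis unfolding e d by simp
    qed
    then have "C = 0" by (simp add: vec_eq_iff)
    then show ?thesis by (intro exI[of _ "[]"]) simp
  next
    case False
    then obtain i where "C $ i $ i \<noteq> 0" by auto
    then have pos: "0 < C $ i $ i" using psd_diag[OF less.prems, of i] by simp
    define v :: "real^'a" where "v = (\<chi> j. C $ j $ i / sqrt (C $ i $ i))"
    define C' where "C' = C - gram [v]"
    have vv: "v $ j * v $ k = C $ j $ i * C $ k $ i / C $ i $ i" for j k
      using pos by (simp add: v_def)
    have C': "C' $ j $ k = C $ j $ k - C $ j $ i * C $ k $ i / C $ i $ i" for j k
      by (simp add: C'_def vv)
    have psd': "psd C'"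
      unfolding psd_def
    proof (intro conjI allI)
      show "transpose C' = C'"
        by (simp add: vec_eq_iff transpose_def C' psd_sym[OF less.prems, of _ _] mult.commute)
      fix \<xi>
      let ?b = "(C *v \<xi>) $ i"
      have b: "?b = (\<Sum>j\<in>UNIV. C $ j $ i * \<xi> $ j)"
        by (simp add: matrix_vector_mult_def psd_sym[OF less.prems, of i])
      have "(C' *v \<xi>) \<bullet> \<xi> = (C *v \<xi>) \<bullet> \<xi> - (\<Sum>j\<in>UNIV. \<Sum>k\<in>UNIV. (C $ j $ i * \<xi> $ j) * (C $ k $ i * \<xi> $ k)) / C $ i $ i"
        unfolding quadratic_form_sum C' sum_divide_distrib sum_subtractf[symmetric]
        by (intro sum.cong refl) (simp add: field_simps)
      also have "(\<Sum>j\<in>UNIV. \<Sum>k\<in>UNIV. (C $ j $ i * \<xi> $ j) * (C $ k $ i * \<xi> $ k)) = ?b\<^sup>2"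
        unfolding b power2_eq_square by (simp add: sum_product)
      \<comment> \<open>The form of the Schur complement is the minimum over s of the shifted form
        of C, attained at \<open>?b / C $ i $ i\<close>.\<close>
      finally have "(C' *v \<xi>) \<bullet> \<xi> = (C *v \<xi>) \<bullet> \<xi> - 2 * (?b / C $ i $ i) * ?b + (?b / C $ i $ i)\<^sup>2 * C $ i $ i"
        using pos by (simp add: power2_eq_square field_simps)
      then show "0 \<le> (C' *v \<xi>) \<bullet> \<xi>" using psd_shift_axis[OF less.prems, of \<xi> "?b / C $ i $ i" i] by simp
    qed
    have sub: "C' $ j $ j = 0" if "C $ j $ j = 0" for j
      using psd_diag[OF psd', of j] that pos unfolding C' by (simp add: divide_le_0_iff zero_le_divide_iff mult_le_0_iff) linarith
    have "C' $ i $ i = 0" using pos by (simp add: C')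
    then have "i \<notin> {j. C' $ j $ j \<noteq> 0}" "i \<in> {j. C $ j $ j \<noteq> 0}" using pos by simp_all
    moreover have "{j. C' $ j $ j \<noteq> 0} \<subseteq> {j. C $ j $ j \<noteq> 0}" using sub by blast
    ultimately have "{j. C' $ j $ j \<noteq> 0} \<subset> {j. C $ j $ j \<noteq> 0}" by blast
    then have "card {j. C' $ j $ j \<noteq> 0} < card {j. C $ j $ j \<noteq> 0}" by (intro psubset_card_mono) auto
    from less.hyps[OF this psd'] obtain as where "gram as = C'" by auto
    then have "gram (v # as) = C" by (simp add: C'_def)
    then show ?thesis by blast
  qed
qed

text \<open>
  The factor 2 turns the generator of the walk, half the trace of the Gram matrix against the Hessian,
  into the trace of C against the Hessian. For C that is not positive semidefinite the value is arbitrary.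
\<close>

definition factor :: "real^'n^'n \<Rightarrow> (real^'n) list" where
  "factor C = (SOME as. gram as = 2 *\<^sub>R C)"

lemma gram_factor: "psd C \<Longrightarrow> gram (factor C) = 2 *\<^sub>R C"
  unfolding factor_def by (rule someI_ex) (intro psd_decomp psd_scale, auto)

lemma trace_psd_nonneg: "psd C \<Longrightarrow> 0 \<le> trace C"
  by (simp add: trace_def sum_nonneg psd_diag)

section \<open>Comparison of walks and passage to the heat operators\<close>

lemma gram_eq_avg:
  fixes g :: "real^'n \<Rightarrow> real"
  assumes "gram as = gram bs" "Cb_le M g"
  shows "\<bar>avg as g x - avg bs g x\<bar> \<le> 2 * (real CARD('n))^4 * (trace (gram as))\<^sup>2 * M 4"
  using avg_second[OF assms(2), of as x] avg_second[OF assms(2), of bs x] assms(1) by (simp add: algebra_simps)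

text \<open>Lindeberg's replacement: the blocks are exchanged one at a time. An average does not
  increase the supremum of a difference, so the errors add up, and it preserves the bounds
  \<open>M\<close>, so each block may be tested on an already averaged function.\<close>

lemma avg_telescope:
  assumes e: "\<And>i h x. i < n \<Longrightarrow> Cb_le M h \<Longrightarrow> \<bar>avg (F i) h x - avg (F' i) h x\<bar> \<le> e i" and g: "Cb_le M g"
  shows "\<bar>avg (concat (map F [0..<n])) g x - avg (concat (map F' [0..<n])) g x\<bar> \<le> (\<Sum>i<n. e i)"
  using e g
proof (induction n arbitrary: g)
  case (Suc n)
  let ?P = "concat (map F [0..<n])" and ?P' = "concat (map F' [0..<n])"
  have "\<bar>avg ?P (avg (F n) g) x - avg ?P (avg (F' n) g) x\<bar> \<le> e n"
    by (rule avg_diff_bound) (use Suc.prems in auto)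
  moreover have "\<bar>avg ?P (avg (F' n) g) x - avg ?P' (avg (F' n) g) x\<bar> \<le> (\<Sum>i<n. e i)"
    by (rule Suc.IH) (use Suc.prems Cb_le_avg in auto)
  ultimately show ?case by (simp add: avg_append)
qed auto

lemma concat_replicate_map: "concat (replicate n as) = concat (map (\<lambda>i. as) [0..<n])"
  by (simp add: map_replicate_const)

lemma concat_replicate_mult:
  "concat (replicate (n * m) as) = concat (replicate n (concat (replicate m as)))"
  by (induction n) (auto simp: replicate_add)

definition walk :: "nat \<Rightarrow> real^'n^'n \<Rightarrow> (real^'n) list" where
  "walk n C = concat (replicate n (factor ((1 / real n) *\<^sub>R C)))"

lemma gram_walk: "psd C \<Longrightarrow> 0 < n \<Longrightarrow> gram (walk n C) = 2 *\<^sub>R C"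
  by (simp add: walk_def gram_replicate gram_factor psd_scale)

text \<open>Each of the n blocks has a Gram matrix of trace 2/n times that of C, whose square turns
  the factor 2 of \<open>gram_eq_avg\<close> into 8 / n^2; n blocks give order 1/n. The number of
  jumps inside a block is arbitrary, which permits the comparison with a finer walk.\<close>

lemma walk_compare:
  fixes g :: "real^'n \<Rightarrow> real"
  assumes "gram as = (2 / real n) *\<^sub>R C" "psd C" "0 < n" and g: "Cb_le M g"
  shows "\<bar>avg (walk n C) g x - avg (concat (replicate n as)) g x\<bar> \<le> 8 * (real CARD('n))^4 * (trace C)\<^sup>2 * M 4 / real n"
proof -
  let ?e = "8 * (real CARD('n))^4 * (trace C / n)\<^sup>2 * M 4"
  have gr: "gram (factor ((1 / real n) *\<^sub>R C)) = gram as"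
    using assms by (simp add: gram_factor psd_scale)
  have "\<bar>avg (walk n C) g x - avg (concat (replicate n as)) g x\<bar> \<le> (\<Sum>i<n. ?e)"
    unfolding walk_def concat_replicate_map
  proof (rule avg_telescope[OF _ g])
    fix h :: "real^'n \<Rightarrow> real" and x assume "Cb_le M h"
    from gram_eq_avg[OF gr this, of x]
    show "\<bar>avg (factor ((1 / real n) *\<^sub>R C)) h x - avg as h x\<bar> \<le> ?e"
      unfolding gr assms(1) trace_scale by (simp add: power2_eq_square field_simps)
  qed
  also have "\<dots> = 8 * (real CARD('n))^4 * (trace C)\<^sup>2 * M 4 / real n"
    using assms(3) by (simp add: power2_eq_square)
  finally show ?thesis .
qed

text \<open>
  This is convolution with the centred Gaussian of covariance 2C, singular C included.
\<close>

definition heat :: "real^'n^'n \<Rightarrow> (real^'n \<Rightarrow> real) \<Rightarrow> real^'n \<Rightarrow> real" where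
  "heat C g x = lim (\<lambda>n. avg (walk n C) g x)"

lemma walk_refine:
  fixes g :: "real^'n \<Rightarrow> real"
  assumes "psd C" "0 < n" "0 < m" and g: "Cb_le M g"
  shows "\<bar>avg (walk n C) g x - avg (walk (n * m) C) g x\<bar> \<le> 8 * (real CARD('n))^4 * (trace C)\<^sup>2 * M 4 / real n"
proof -
  have "walk (n * m) C = concat (replicate n (concat (replicate m (factor ((1 / real (n * m)) *\<^sub>R C)))))"
    unfolding walk_def by (rule concat_replicate_mult)
  moreover have "gram (concat (replicate m (factor ((1 / real (n * m)) *\<^sub>R C)))) = (2 / real n) *\<^sub>R C"
    using assms by (simp add: gram_replicate gram_factor psd_scale)
  ultimately show ?thesis using walk_compare[OF _ assms(1,2) g] by metis
qed

text \<open>Walks with n and with m steps are both compared with the walk with n m steps, their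
  common refinement. Hence the sequence is Cauchy.\<close>

lemma heat_lim:
  fixes g :: "real^'n \<Rightarrow> real"
  assumes C: "psd C" and g: "Cb_le M g"
  shows "(\<lambda>n. avg (walk n C) g x) \<longlonglongrightarrow> heat C g x"
proof -
  let ?K = "8 * (real CARD('n))^4 * (trace C)\<^sup>2 * M 4"
  have K0: "0 \<le> ?K" using Cb_le_nonneg[OF g] by simp
  have *: "\<bar>avg (walk n C) g x - avg (walk m C) g x\<bar> \<le> ?K / n + ?K / m" if "0 < n" "0 < m" for n m
    using walk_refine[OF C that g, of x] walk_refine[OF C that(2,1) g, of x] by (simp add: mult.commute)
  have "Cauchy (\<lambda>n. avg (walk n C) g x)"
  proof (rule metric_CauchyI)
    fix e :: real assume e: "0 < e"
    obtain N :: nat where N: "2 * ?K / e < N" "0 < N" using reals_Archimedean2[of "max 0 (2 * ?K / e)"]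
      by auto
    have "dist (avg (walk n C) g x) (avg (walk m C) g x) < e" if "N \<le> n" "N \<le> m" for n m
    proof -
      have "?K / k < e / 2" if "N \<le> k" for k :: nat
      proof -
        have "2 * ?K < e * N" using N e by (simp add: field_simps)
        also have "\<dots> \<le> e * k" using that e by simp
        finally show ?thesis using N(2) that by (simp add: field_simps)
      qed
      from this[OF that(1)] this[OF that(2)] *[of n m] N(2) that show ?thesis
        by (simp add: dist_real_def)
    qed
    then show "\<exists>N. \<forall>m\<ge>N. \<forall>n\<ge>N. dist (avg (walk m C) g x) (avg (walk n C) g x) < e" by blast
  qed
  then show ?thesis unfolding heat_def by (simp add: Cauchy_convergent_iff convergent_LIMSEQ_iff)
qed

lemma heat_rate:
  fixes g :: "real^'n \<Rightarrow> real"
  assumes C: "psd C" and g: "Cb_le M g" and n: "0 < n"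
  shows "\<bar>avg (walk n C) g x - heat C g x\<bar> \<le> 8 * (real CARD('n))^4 * (trace C)\<^sup>2 * M 4 / real n"
proof (rule LIMSEQ_le_const2)
  have "strict_mono (\<lambda>m. n * Suc m)" using n by (auto simp: strict_mono_def)
  from LIMSEQ_subseq_LIMSEQ[OF heat_lim[OF C g, of x] this]
  show "(\<lambda>m. \<bar>avg (walk n C) g x - avg (walk (n * Suc m) C) g x\<bar>) \<longlonglongrightarrow> \<bar>avg (walk n C) g x - heat C g x\<bar>"
    by (intro tendsto_intros) (simp add: o_def)
  show "\<exists>N. \<forall>m\<ge>N. \<bar>avg (walk n C) g x - avg (walk (n * Suc m) C) g x\<bar> \<le> 8 * (real CARD('n))^4 * (trace C)\<^sup>2 * M 4 / real n"
    using walk_refine[OF C n _ g, of "Suc _"] by auto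
qed


lemma has_derivative_quad':
  fixes g :: "real^'n \<Rightarrow> real"
  assumes "\<And>h. \<bar>g (x + h) - g x - dd' h\<bar> \<le> (c * norm h)\<^sup>2 * m"
    and "\<And>h. dd' h = (\<Sum>i\<in>UNIV. h $ i * p i)"
  shows "(g has_derivative (\<lambda>h. \<Sum>i\<in>UNIV. h $ i * p i)) (at x)"
  using assms by (intro has_derivative_quad[where K="c\<^sup>2 * m"]) (simp add: power_mult_distrib mult_ac)

text \<open>The second-order Taylor bound holds for every walk with the same constant and survives
  the limit. It identifies the derivatives of the limit as the limits of the averaged
  derivatives.\<close>

lemma Cb_le_heat:
  fixes g :: "real^'n \<Rightarrow> real"
  assumes C: "psd C" and g: "Cb_le M g"
  shows "Cb_le M (heat C g)" "partials js (heat C g) = heat C (partials js g)"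
proof -
  let ?P = "\<lambda>js. heat C (partials js g)"
  note g' = Cb_le_partials[OF g]
  have 2: "(?P js has_derivative (\<lambda>h. \<Sum>i\<in>UNIV. h $ i * ?P (i # js) x)) (at x)" for js x
  proof (rule has_derivative_quad'[OF _ refl])
    fix h :: "real^'n"
    let ?g = "partials js g"
    show "\<bar>?P js (x + h) - ?P js x - (\<Sum>i\<in>UNIV. h $ i * ?P (i # js) x)\<bar> \<le> (real CARD('n) * norm h)\<^sup>2 * M (2 + length js)"
    proof (rule LIMSEQ_le_const2)
      show "(\<lambda>n. \<bar>avg (walk n C) ?g (x + h) - avg (walk n C) ?g x - (\<Sum>i\<in>UNIV. h $ i * avg (walk n C) (partials (i # js) g) x)\<bar>)
         \<longlonglongrightarrow> \<bar>?P js (x + h) - ?P js x - (\<Sum>i\<in>UNIV. h $ i * ?P (i # js) x)\<bar>"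
        by (intro tendsto_intros heat_lim[OF C g'])
      have "\<bar>avg (walk n C) ?g (x + h) - avg (walk n C) ?g x - (\<Sum>i\<in>UNIV. h $ i * avg (walk n C) (partials (i # js) g) x)\<bar>
         \<le> (real CARD('n) * norm h)\<^sup>2 * M (2 + length js)" for n
        using taylor2[OF Cb_le_avg(1)[OF g'[of js], of "walk n C"], of x h]
        by (simp add: dd_def avg_partial[OF g'])
      then show "\<exists>N. \<forall>n\<ge>N. \<bar>avg (walk n C) ?g (x + h) - avg (walk n C) ?g x - (\<Sum>i\<in>UNIV. h $ i * avg (walk n C) (partials (i # js) g) x)\<bar>
         \<le> (real CARD('n) * norm h)\<^sup>2 * M (2 + length js)" by blast
    qed
  qed
  have 3: "\<bar>?P js x\<bar> \<le> M (length js)" for js x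
  proof (rule LIMSEQ_le_const2)
    show "(\<lambda>n. \<bar>avg (walk n C) (partials js g) x\<bar>) \<longlonglongrightarrow> \<bar>?P js x\<bar>"
      by (intro tendsto_intros heat_lim[OF C g'])
    show "\<exists>N. \<forall>n\<ge>N. \<bar>avg (walk n C) (partials js g) x\<bar> \<le> M (length js)"
      by (intro exI[of _ 0] allI impI avg_bound Cb_leD(2)[OF g])
  qed
  have 1: "?P [] = heat C g" by simp
  show "Cb_le M (heat C g)" "partials js (heat C g) = ?P js"
    using Cb_le_I[where P="?P", OF 1 2 3] by auto
qed

lemma heat_translate: "heat C (\<lambda>y. g (y + c)) x = heat C g (x + c)"
  unfolding heat_def avg_translate ..

lemma heat_first:
  fixes g :: "real^'n \<Rightarrow> real"
  assumes C: "psd C" and g: "Cb_le M g"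
  shows "\<bar>heat C g x - g x\<bar> \<le> 2 * (real CARD('n))\<^sup>2 * trace C * M 2"
proof (rule LIMSEQ_le_const2)
  show "(\<lambda>n. \<bar>avg (walk n C) g x - g x\<bar>) \<longlonglongrightarrow> \<bar>heat C g x - g x\<bar>"
    by (intro tendsto_intros heat_lim[OF C g])
  have "\<bar>avg (walk n C) g x - g x\<bar> \<le> 2 * (real CARD('n))\<^sup>2 * trace C * M 2" if "0 < n" for n
    using avg_first[OF g, of "walk n C" x] unfolding gram_walk[OF C that] trace_scale by (simp add: mult_ac)
  then show "\<exists>N. \<forall>n\<ge>N. \<bar>avg (walk n C) g x - g x\<bar> \<le> 2 * (real CARD('n))\<^sup>2 * trace C * M 2"
    by (metis Suc_le_eq)
qed

lemma heat_second:
  fixes g :: "real^'n \<Rightarrow> real"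
  assumes C: "psd C" and g: "Cb_le M g"
  shows "\<bar>heat C g x - g x - trace (C ** hess g x)\<bar> \<le> 4 * (real CARD('n))^4 * (trace C)\<^sup>2 * M 4"
proof (rule LIMSEQ_le_const2)
  have e: "trace (2 *\<^sub>R C ** hess g x) = 2 * trace (C ** hess g x)"
    by (simp add: trace_mult sum_distrib_left mult.assoc)
  show "(\<lambda>n. \<bar>avg (walk n C) g x - g x - trace (C ** hess g x)\<bar>) \<longlonglongrightarrow> \<bar>heat C g x - g x - trace (C ** hess g x)\<bar>"
    by (intro tendsto_intros heat_lim[OF C g])
  have "\<bar>avg (walk n C) g x - g x - trace (C ** hess g x)\<bar> \<le> 4 * (real CARD('n))^4 * (trace C)\<^sup>2 * M 4" if "0 < n" for n
    using avg_second[OF g, of "walk n C" x] unfolding gram_walk[OF C that] e trace_scale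
    by (simp add: mult_ac power_mult_distrib)
  then show "\<exists>N. \<forall>n\<ge>N. \<bar>avg (walk n C) g x - g x - trace (C ** hess g x)\<bar> \<le> 4 * (real CARD('n))^4 * (trace C)\<^sup>2 * M 4"
    by (metis Suc_le_eq)
qed

lemma heat_avg_diff:
  fixes g :: "real^'n \<Rightarrow> real"
  assumes C: "psd C" and g: "Cb_le M g" and gr: "gram as = 2 *\<^sub>R C"
  shows "\<bar>avg as g x - heat C g x\<bar> \<le> 8 * (real CARD('n))^4 * (trace C)\<^sup>2 * M 4"
proof -
  have e: "trace (2 *\<^sub>R C ** hess g x) = 2 * trace (C ** hess g x)"
    by (simp add: trace_mult sum_distrib_left mult.assoc)
  have "\<bar>avg as g x - g x - trace (C ** hess g x)\<bar> \<le> 4 * (real CARD('n))^4 * (trace C)\<^sup>2 * M 4"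
    using avg_second[OF g, of as x] unfolding gr e trace_scale by (simp add: mult_ac power_mult_distrib)
  with heat_second[OF C g, of x] show ?thesis by (simp add: abs_le_iff algebra_simps)
qed

lemma mset_concat_replicate_append:
  "mset (concat (replicate n as) @ concat (replicate n bs)) = mset (concat (replicate n (as @ bs)))"
  by (induction n) auto

text \<open>The convolution property of Gaussians. A block for C/n followed by one for D/n has the
  Gram matrix of a block for (C + D)/n, and reordering the jumps separates the two walks; every
  replacement costs order 1/n.\<close>

lemma heat_add:
  fixes g :: "real^'n \<Rightarrow> real"
  assumes C: "psd C" and D: "psd D" and g: "Cb_le M g"
  shows "heat (C + D) g = heat C (heat D g)"
proof
  fix x
  let ?c = "real CARD('n)"
  note hD = Cb_le_heat(1)[OF D g]
  note CD = psd_add[OF C D]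
  define e where "e n = 8 * ?c^4 * (trace (C + D))\<^sup>2 * M 4 / real n + 8 * ?c^4 * (trace C)\<^sup>2 * M 4 / real n
     + 8 * ?c^4 * (trace D)\<^sup>2 * M 4 / real n + 8 * ?c^4 * (trace (C + D))\<^sup>2 * M 4 / real n" for n
  have "\<bar>heat (C + D) g x - heat C (heat D g) x\<bar> \<le> e n" if n: "0 < n" for n
  proof -
    let ?F = "factor ((1 / real n) *\<^sub>R C) @ factor ((1 / real n) *\<^sub>R D)"
    have "gram ?F = (2 / real n) *\<^sub>R (C + D)"
      using n C D by (simp add: gram_factor psd_scale algebra_simps)
    from walk_compare[OF this CD n g]
    have 1: "\<bar>avg (walk n (C + D)) g x - avg (concat (replicate n ?F)) g x\<bar> \<le> 8 * ?c^4 * (trace (C + D))\<^sup>2 * M 4 / real n" .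
    have "avg (concat (replicate n ?F)) g = avg (walk n C @ walk n D) g"
      unfolding walk_def by (rule avg_mset) (rule mset_concat_replicate_append[symmetric])
    then have 2: "avg (concat (replicate n ?F)) g x = avg (walk n C) (avg (walk n D) g) x"
      by (simp add: avg_append)
    have 3: "\<bar>avg (walk n C) (avg (walk n D) g) x - avg (walk n C) (heat D g) x\<bar> \<le> 8 * ?c^4 * (trace D)\<^sup>2 * M 4 / real n"
      by (rule avg_diff_bound) (rule heat_rate[OF D g n])
    have 4: "\<bar>avg (walk n C) (heat D g) x - heat C (heat D g) x\<bar> \<le> 8 * ?c^4 * (trace C)\<^sup>2 * M 4 / real n"
      by (rule heat_rate[OF C hD n])
    have 5: "\<bar>avg (walk n (C + D)) g x - heat (C + D) g x\<bar> \<le> 8 * ?c^4 * (trace (C + D))\<^sup>2 * M 4 / real n"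
      by (rule heat_rate[OF CD g n])
    show ?thesis using 1 3 4 5 unfolding 2 e_def by linarith
  qed
  moreover have "e \<longlonglongrightarrow> 0"
    unfolding e_def by (intro tendsto_add_zero lim_const_over_n)
  ultimately have "\<bar>heat (C + D) g x - heat C (heat D g) x\<bar> \<le> 0"
    by (intro LIMSEQ_le_const[of e 0]) (auto intro!: exI[of _ 1])
  then show "heat (C + D) g x = heat C (heat D g) x" by simp
qed

text \<open>The rate of the walks depends only on \<open>M\<close>, so one number of steps serves
  all members of the sequence; for that finite average the convergence is immediate.\<close>

lemma heat_pointwise:
  fixes g :: "real^'n \<Rightarrow> real"
  assumes C: "psd C" and gs: "\<And>n. Cb_le M (gs n)" and g: "Cb_le M g"
    and lim: "\<And>y. (\<lambda>n. gs n y) \<longlonglongrightarrow> g y"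
  shows "(\<lambda>n. heat C (gs n) x) \<longlonglongrightarrow> heat C g x"
proof (rule LIMSEQ_I)
  fix r :: real assume r: "0 < r"
  let ?K = "8 * (real CARD('n))^4 * (trace C)\<^sup>2 * M 4"
  have "(\<lambda>k. ?K / real k) \<longlonglongrightarrow> 0" by (rule lim_const_over_n)
  then have "\<forall>\<^sub>F k in sequentially. ?K / real k < r / 3 \<and> 0 < k"
    using r by (intro eventually_conj order_tendstoD(2)[where a="r/3"] eventually_gt_at_top) auto
  then obtain k where k: "?K / real k < r / 3" "0 < k" by (metis (no_types, lifting) eventually_happens sequentially_bot)
  have "(\<lambda>n. avg as (gs n) x) \<longlonglongrightarrow> avg as g x" for as x
    by (induction as arbitrary: x) (auto intro!: tendsto_intros lim)
  from LIMSEQ_D[OF this, of "r / 3" "walk k C" x] r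
  obtain N where N: "\<And>n. N \<le> n \<Longrightarrow> \<bar>avg (walk k C) (gs n) x - avg (walk k C) g x\<bar> < r / 3" by auto
  have "\<bar>heat C (gs n) x - heat C g x\<bar> < r" if "N \<le> n" for n
    using N[OF that] heat_rate[OF C gs k(2), of n x] heat_rate[OF C g k(2), of x] k(1) by linarith
  then show "\<exists>no. \<forall>n\<ge>no. norm (heat C (gs n) x - heat C g x) < r" by auto
qed

lemma avg_measurable:
  assumes "\<And>x. (\<lambda>s. G s x) \<in> borel_measurable N"
  shows "(\<lambda>s. avg as (G s) x) \<in> borel_measurable N"
  by (induction as arbitrary: x) (auto intro!: borel_measurable_divide borel_measurable_add assms)

lemma heat_measurable:
  assumes "\<And>x. (\<lambda>s. G s x) \<in> borel_measurable N"
  shows "(\<lambda>s. heat C (G s) x) \<in> borel_measurable N"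
  unfolding heat_def by (intro borel_measurable_lim_metric avg_measurable assms)

lemma heat_zero: assumes "Cb_le M g" shows "heat 0 g = g"
  using heat_first[OF psd_0 assms] by (auto simp: trace_def)

text \<open>The operator for D factors through that for C, and the excess D - C acts as a heat
  operator close to the identity.\<close>

lemma heat_mono_diff:
  fixes g :: "real^'n \<Rightarrow> real"
  assumes C: "psd C" and D: "psd (D - C)" and g: "Cb_le M g"
  shows "\<bar>heat D g x - heat C g x\<bar> \<le> 2 * (real CARD('n))\<^sup>2 * trace (D - C) * M 2"
proof -
  have "heat D g = heat (D - C) (heat C g)" using heat_add[OF D C g] by simp
  then show ?thesis using heat_first[OF D Cb_le_heat(1)[OF C g], of x] by simp
qed

section \<open>The matrix exponential\<close>

definition mpow :: "real^'n^'n \<Rightarrow> nat \<Rightarrow> real^'n^'n" where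
  "mpow A k = (((**) A) ^^ k) (mat 1)"

lemma mpow_simps [simp]: "mpow A 0 = mat 1" "mpow A (Suc k) = A ** mpow A k"
  by (simp_all add: mpow_def)

lemma mpow_right: "mpow A k ** A = A ** mpow A k"
  by (induction k) (simp_all add: matrix_mul_assoc[symmetric])

lemma mpow_entry: "\<exists>r. \<forall>k i j. \<bar>mpow (A::real^'n^'n) k $ i $ j\<bar> \<le> r ^ k"
proof -
  define a where "a = (\<Sum>i\<in>UNIV. \<Sum>j\<in>UNIV. \<bar>A $ i $ j\<bar>)"
  have a: "\<bar>A $ i $ j\<bar> \<le> a" for i j
  proof -
    have "\<bar>A $ i $ j\<bar> \<le> (\<Sum>j\<in>UNIV. \<bar>A $ i $ j\<bar>)" by (rule member_le_sum) auto
    also have "\<dots> \<le> a" unfolding a_def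
      by (rule member_le_sum[where f="\<lambda>i. \<Sum>j\<in>UNIV. \<bar>A $ i $ j\<bar>"]) (auto intro: sum_nonneg)
    finally show ?thesis .
  qed
  have "\<bar>mpow A k $ i $ j\<bar> \<le> (real CARD('n) * a) ^ k" for k i j
  proof (induction k arbitrary: i j)
    case 0
    then show ?case by (simp add: mat_def)
  next
    case (Suc k)
    have "\<bar>mpow A (Suc k) $ i $ j\<bar> \<le> (\<Sum>l\<in>UNIV. \<bar>A $ i $ l\<bar> * \<bar>mpow A k $ l $ j\<bar>)"
      by (simp add: matrix_matrix_mult_def) (rule order_trans[OF sum_abs], simp add: abs_mult)
    also have "\<dots> \<le> (\<Sum>l\<in>(UNIV::'n set). a * (real CARD('n) * a) ^ k)"
      by (intro sum_mono mult_mono a Suc) (auto intro: order_trans[OF abs_ge_zero a])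
    finally show ?case by (simp add: mult_ac)
  qed
  then show ?thesis by blast
qed

text \<open>The entrywise power series of exp (t A), so that differentiation is that of power series
  in one variable.\<close>

definition mexp :: "real^'n^'n \<Rightarrow> real \<Rightarrow> real^'n^'n" where
  "mexp A t = (\<chi> i j. \<Sum>k. mpow A k $ i $ j / fact k * t ^ k)"

lemma mexp_summable: "summable (\<lambda>k. mpow A k $ i $ j / fact k * t ^ k)"
proof -
  obtain r where r: "\<And>k i j. \<bar>mpow A k $ i $ j\<bar> \<le> r ^ k" using mpow_entry by blast
  show ?thesis
  proof (rule summable_comparison_test')
    show "summable (\<lambda>k. (r * \<bar>t\<bar>) ^ k / fact k)"
      using summable_exp_generic[of "r * \<bar>t\<bar>"] by (simp add: divide_inverse mult.commute)
    fix k
    show "norm (mpow A k $ i $ j / fact k * t ^ k) \<le> (r * \<bar>t\<bar>) ^ k / fact k" if "0 \<le> k"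
      using r[of k i j] by (simp add: abs_mult power_abs power_mult_distrib divide_right_mono mult_right_mono)
  qed
qed

lemma mexp_deriv:
  "((\<lambda>t. mexp A t $ i $ j) has_real_derivative (A ** mexp A t) $ i $ j) (at t)"
proof -
  have "((\<lambda>t. \<Sum>k. mpow A k $ i $ j / fact k * t ^ k) has_real_derivative
      (\<Sum>k. diffs (\<lambda>k. mpow A k $ i $ j / fact k) k * t ^ k)) (at t)"
    by (rule termdiffs_strong_converges_everywhere) (rule mexp_summable)
  moreover have "(\<Sum>k. diffs (\<lambda>k. mpow A k $ i $ j / fact k) k * t ^ k) = (A ** mexp A t) $ i $ j"
  proof -
    have "diffs (\<lambda>k. mpow A k $ i $ j / fact k) k * t ^ k = (\<Sum>l\<in>UNIV. A $ i $ l * (mpow A k $ l $ j / fact k * t ^ k))" for k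
    proof -
      have "diffs (\<lambda>k. mpow A k $ i $ j / fact k) k = mpow A (Suc k) $ i $ j / fact k"
        unfolding diffs_def fact_Suc by (simp del: of_nat_Suc)
      then show ?thesis
        by (simp add: matrix_matrix_mult_def sum_distrib_right sum_divide_distrib mult.assoc)
    qed
    note e = this
    have "(\<Sum>k. diffs (\<lambda>k. mpow A k $ i $ j / fact k) k * t ^ k)
       = (\<Sum>l\<in>UNIV. \<Sum>k. A $ i $ l * (mpow A k $ l $ j / fact k * t ^ k))"
      unfolding e by (rule suminf_sum[OF summable_mult[OF mexp_summable]])
    also have "\<dots> = (\<Sum>l\<in>UNIV. A $ i $ l * (\<Sum>k. mpow A k $ l $ j / fact k * t ^ k))"
      by (simp only: suminf_mult[OF mexp_summable])
    finally show ?thesis by (simp add: mexp_def matrix_matrix_mult_def)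
  qed
  ultimately show ?thesis by (simp add: mexp_def)
qed

lemma mexp_commute: "A ** mexp A t = mexp A t ** A"
proof -
  have "(A ** mexp A t) $ i $ j = (mexp A t ** A) $ i $ j" for i j
  proof -
    have "(A ** mexp A t) $ i $ j = (\<Sum>l\<in>UNIV. \<Sum>k. A $ i $ l * (mpow A k $ l $ j / fact k * t ^ k))"
      unfolding mexp_def matrix_matrix_mult_def vec_lambda_beta by (simp only: suminf_mult[OF mexp_summable])
    also have "\<dots> = (\<Sum>k. \<Sum>l\<in>UNIV. A $ i $ l * (mpow A k $ l $ j / fact k * t ^ k))"
      by (rule suminf_sum[OF summable_mult[OF mexp_summable], symmetric])
    also have "\<dots> = (\<Sum>k. (A ** mpow A k) $ i $ j / fact k * t ^ k)"
      by (simp add: matrix_matrix_mult_def sum_divide_distrib sum_distrib_right mult.assoc)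
    also have "\<dots> = (\<Sum>k. (mpow A k ** A) $ i $ j / fact k * t ^ k)"
      by (simp only: mpow_right)
    also have "\<dots> = (\<Sum>k. \<Sum>l\<in>UNIV. (mpow A k $ i $ l / fact k * t ^ k) * A $ l $ j)"
      by (simp add: matrix_matrix_mult_def sum_divide_distrib sum_distrib_right) (simp add: mult_ac)
    also have "\<dots> = (\<Sum>l\<in>UNIV. \<Sum>k. (mpow A k $ i $ l / fact k * t ^ k) * A $ l $ j)"
      by (rule suminf_sum[OF summable_mult2[OF mexp_summable]])
    also have "\<dots> = (mexp A t ** A) $ i $ j"
      unfolding mexp_def matrix_matrix_mult_def vec_lambda_beta by (simp only: suminf_mult2[OF mexp_summable])
    finally show ?thesis .
  qed
  then show ?thesis by (simp add: vec_eq_iff)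
qed

lemma mexp_0: "mexp A 0 = mat 1"
proof -
  have "mexp A 0 $ i $ j = mat 1 $ i $ j" for i j
    unfolding mexp_def using powser_zero[of "\<lambda>k. mpow A k $ i $ j / fact k"] by simp
  then show ?thesis by (simp add: vec_eq_iff)
qed

text \<open>Since A commutes with its exponential, the product has derivative zero and keeps its
  value at t = 0.\<close>

lemma mexp_inverse: "mexp A t ** mexp A (- t) = mat 1"
proof -
  have "((\<lambda>t. (mexp A t ** mexp A (- t)) $ i $ j) has_real_derivative 0) (at t)" for i j t
  proof -
    have m: "((\<lambda>t. mexp A (- t) $ l $ j) has_real_derivative (A ** mexp A (- t)) $ l $ j * (- 1)) (at t)" for l
      by (rule DERIV_chain2[OF mexp_deriv]) (auto intro!: derivative_eq_intros)
    have "((\<lambda>t. \<Sum>l\<in>UNIV. mexp A t $ i $ l * mexp A (- t) $ l $ j) has_real_derivative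
       (\<Sum>l\<in>UNIV. (A ** mexp A t) $ i $ l * mexp A (- t) $ l $ j + (A ** mexp A (- t)) $ l $ j * (- 1) * mexp A t $ i $ l)) (at t)"
      by (intro DERIV_sum DERIV_mult mexp_deriv m)
    moreover have "(\<Sum>l\<in>UNIV. (A ** mexp A t) $ i $ l * mexp A (- t) $ l $ j + (A ** mexp A (- t)) $ l $ j * (- 1) * mexp A t $ i $ l)
       = ((A ** mexp A t) ** mexp A (- t)) $ i $ j - (mexp A t ** (A ** mexp A (- t))) $ i $ j"
      unfolding matrix_matrix_mult_def[of "A ** mexp A t"] matrix_matrix_mult_def[of "mexp A t"] vec_lambda_beta
        sum_subtractf[symmetric] by (intro sum.cong refl) (simp add: mult.commute)
    moreover have e: "(A ** mexp A t) ** mexp A (- t) = mexp A t ** (A ** mexp A (- t))"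
      unfolding mexp_commute[of A t] by (simp add: matrix_mul_assoc)
    ultimately have "((\<lambda>t. \<Sum>l\<in>UNIV. mexp A t $ i $ l * mexp A (- t) $ l $ j) has_real_derivative 0) (at t)"
      by (simp only: e diff_self)
    then show ?thesis unfolding matrix_matrix_mult_def vec_lambda_beta .
  qed
  then have "(mexp A t ** mexp A (- t)) $ i $ j = (mexp A 0 ** mexp A (- 0)) $ i $ j" for i j
    using DERIV_isconst_all by blast
  then have "mexp A t ** mexp A (- t) = mexp A 0 ** mexp A (- 0)" by (simp add: vec_eq_iff)
  then show ?thesis by (simp add: mexp_0)
qed

lemma mexp_inverse': "mexp A (- t) ** mexp A t = mat 1"
  using mexp_inverse[of A "- t"] by simp

lemma mexp_vec_inverse:
  "mexp A t *v (mexp A (- t) *v z) = z" "mexp A (- t) *v (mexp A t *v z) = z"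
  by (simp_all add: matrix_vector_mul_assoc mexp_inverse mexp_inverse')

lemma mexp_cont: "continuous_on S (\<lambda>t. mexp A t)"
  unfolding continuous_on_eq_continuous_within
proof
  fix t
  have "continuous (at t) (\<lambda>t. \<chi> i j. mexp A t $ i $ j)"
    unfolding continuous_at by (intro tendsto_vec_lambda)
      (metis DERIV_isCont isCont_def mexp_deriv)
  then show "continuous (at t within S) (\<lambda>t. mexp A t)"
    by (simp add: continuous_at_imp_continuous_at_within)
qed

lemma mexp_vec_deriv:
  "((\<lambda>t. (mexp A t *v z) $ i) has_real_derivative (mexp A t *v (A *v z)) $ i) (at t)"
proof -
  have "((\<lambda>t. \<Sum>j\<in>UNIV. mexp A t $ i $ j * z $ j) has_real_derivative (\<Sum>j\<in>UNIV. (A ** mexp A t) $ i $ j * z $ j)) (at t)"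
    by (intro DERIV_sum DERIV_cmult_right mexp_deriv)
  then show ?thesis
    by (simp add: mexp_commute matrix_vector_mul_assoc matrix_vector_mult_def[of "mexp A _"] matrix_vector_mult_def[of "mexp A _ ** A"])
qed

lemma mexp_entry_bound: "\<exists>p. 0 \<le> p \<and> (\<forall>t\<in>{-T..T}. \<forall>i j. \<bar>mexp A t $ i $ j\<bar> \<le> p)"
proof -
  have "compact ((\<lambda>t. mexp A t) ` {-T..T})" by (intro compact_continuous_image mexp_cont compact_Icc)
  then obtain b where b: "\<And>t. t \<in> {-T..T} \<Longrightarrow> norm (mexp A t) \<le> b"
    by (meson compact_imp_bounded bounded_iff imageI)
  have "\<bar>mexp A t $ i $ j\<bar> \<le> max 0 b" if "t \<in> {-T..T}" for t i j
    using b[OF that] component_le_norm_cart[of "mexp A t $ i" j] Finite_Cartesian_Product.norm_nth_le[of "mexp A t" i] by linarith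
  then show ?thesis by (intro exI[of _ "max 0 b"]) auto
qed

section \<open>Duhamel integrals with jumps\<close>

lemma set_integrable_continuous:
  fixes f :: "real \<Rightarrow> real"
  assumes "continuous_on {a..b} f" shows "set_integrable lborel {a..b} f"
  unfolding set_integrable_def by (rule borel_integrable_compact[OF compact_Icc assms])

lemma sint_bound:
  fixes f :: "real \<Rightarrow> real"
  assumes i: "set_integrable lborel {a..b} f" and b: "\<And>s. s \<in> {a..b} \<Longrightarrow> \<bar>f s\<bar> \<le> K" and ab: "a \<le> b"
  shows "\<bar>LINT s:{a..b}|lborel. f s\<bar> \<le> K * (b - a)"
proof -
  have c: "set_integrable lborel {a..b} (\<lambda>_. K)"
    by (simp add: set_integrable_def integrable_real_indicator emeasure_lborel_Icc_eq)
  have K: "(LINT s:{a..b}|lborel. K) = K * (b - a)"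
    using ab by (simp add: set_lebesgue_integral_def)
  have "(LINT s:{a..b}|lborel. f s) \<le> K * (b - a)"
    unfolding K[symmetric] by (rule set_integral_mono[OF i c]) (use b abs_le_D1 in blast)
  moreover have "(LINT s:{a..b}|lborel. - f s) \<le> K * (b - a)"
    unfolding K[symmetric] by (rule set_integral_mono[OF _ c]) (use b abs_le_D2 i in \<open>auto simp: set_integrable_def\<close>)
  ultimately show ?thesis
    by (simp add: set_integral_uminus[OF i] abs_le_iff)
qed

lemma set_integrable_bounded:
  fixes f :: "real \<Rightarrow> real"
  assumes m: "f \<in> borel_measurable borel" and b: "\<And>s. s \<in> {a..b} \<Longrightarrow> \<bar>f s\<bar> \<le> K"
  shows "set_integrable lborel {a..b} f"
    and "a \<le> b \<Longrightarrow> \<bar>LINT s:{a..b}|lborel. f s\<bar> \<le> K * (b - a)"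
proof -
  have c: "set_integrable lborel {a..b} (\<lambda>_. K)"
    by (simp add: set_integrable_def integrable_real_indicator emeasure_lborel_Icc_eq)
  show i: "set_integrable lborel {a..b} f"
  proof (rule set_integrable_bound[OF c])
    show "set_borel_measurable lborel {a..b} f"
      using m by (simp add: set_borel_measurable_def)
    show "AE s in lborel. s \<in> {a..b} \<longrightarrow> norm (f s) \<le> norm K"
      using order_trans[OF b abs_ge_self] by (intro AE_I2 impI) auto
  qed
  show "a \<le> b \<Longrightarrow> \<bar>LINT s:{a..b}|lborel. f s\<bar> \<le> K * (b - a)"
    by (rule sint_bound[OF i b])
qed

lemma lint_combine:
  fixes f :: "real \<Rightarrow> real"
  assumes i: "set_integrable lborel {a..b} f" and "a \<le> c" "c \<le> b"
  shows "(LINT s:{a..b}|lborel. f s) = (LINT s:{a..c}|lborel. f s) + (LINT s:{c..b}|lborel. f s)"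
proof -
  have "set_integrable lborel {a..c} f" "set_integrable lborel {c..b} f"
    using assms by (auto intro: set_integrable_subset[OF i])
  with i show ?thesis
    using Henstock_Kurzweil_Integration.integral_combine[OF assms(2,3), of f]
    by (simp add: set_borel_integral_eq_integral)
qed

lemma lint_sum:
  fixes f :: "'i \<Rightarrow> real \<Rightarrow> real"
  assumes "finite I" "\<And>i. i \<in> I \<Longrightarrow> set_integrable M A (f i)"
  shows "set_integrable M A (\<lambda>s. \<Sum>i\<in>I. c i * f i s)"
    and "(LINT s:A|M. \<Sum>i\<in>I. c i * f i s) = (\<Sum>i\<in>I. c i * (LINT s:A|M. f i s))"
proof -
  have "set_integrable M A (\<lambda>s. \<Sum>i\<in>I. c i * f i s) \<and>
     (LINT s:A|M. \<Sum>i\<in>I. c i * f i s) = (\<Sum>i\<in>I. c i * (LINT s:A|M. f i s))"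
    using assms
  proof (induction rule: finite_induct)
    case empty
    then show ?case by (simp add: set_integrable_def set_lebesgue_integral_def)
  next
    case (insert x F)
    then show ?case by (auto intro!: set_integral_add)
  qed
  then show "set_integrable M A (\<lambda>s. \<Sum>i\<in>I. c i * f i s)"
    "(LINT s:A|M. \<Sum>i\<in>I. c i * f i s) = (\<Sum>i\<in>I. c i * (LINT s:A|M. f i s))" by auto
qed

text \<open>A Caratheodory class: smooth in space with bounds uniform in time, merely measurable in
  time. All real times occur, so sources on [0,T] enter extended by zero.\<close>

definition admissible :: "(nat \<Rightarrow> real) \<Rightarrow> (real \<Rightarrow> real^'n \<Rightarrow> real) \<Rightarrow> bool" where
  "admissible M G \<longleftrightarrow> (\<forall>s. Cb_le M (G s)) \<and> (\<forall>x. (\<lambda>s. G s x) \<in> borel_measurable borel)"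

lemma admissibleD: "admissible M G \<Longrightarrow> Cb_le M (G s)" "admissible M G \<Longrightarrow> (\<lambda>s. G s x) \<in> borel_measurable borel"
  by (auto simp: admissible_def)

text \<open>Difference quotients with the steps 1/(n+1) present a spatial derivative as the limit of
  a sequence, so that measurability in time passes to it.\<close>

lemma partial_lim:
  assumes "Cb_le M (g::real^'n\<Rightarrow>real)"
  shows "(\<lambda>n. real (Suc n) * (g (x + (1 / real (Suc n)) *\<^sub>R axis i 1) - g x)) \<longlonglongrightarrow> partial i g x"
proof (rule metric_LIMSEQ_I)
  fix r :: real assume r: "0 < r"
  let ?K = "(real CARD('n))\<^sup>2 * M 2"
  have "(\<lambda>n. ?K / real (Suc n)) \<longlonglongrightarrow> 0" using LIMSEQ_Suc[OF lim_const_over_n[of ?K]] .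
  from order_tendstoD(2)[OF this r] obtain N where N: "\<And>n. N \<le> n \<Longrightarrow> ?K / real (Suc n) < r"
    by (auto simp: eventually_sequentially)
  have "dist (real (Suc n) * (g (x + (1 / real (Suc n)) *\<^sub>R axis i 1) - g x)) (partial i g x) < r" if n: "N \<le> n" for n
  proof -
    define h where "h = (1 / real (Suc n)) *\<^sub>R (axis i 1 :: real^'n)"
    define m where "m = real (Suc n)"
    have m: "0 < m" by (simp add: m_def)
    have hn: "norm h = 1 / m" by (simp add: h_def m_def)
    have "dd h g x = (\<Sum>k\<in>UNIV. axis i 1 $ k * (partial k g x / m))"
      by (simp add: dd_def h_def m_def)
    then have hd: "dd h g x = partial i g x / m"
      using sum_axis(1)[of i "\<lambda>k. partial k g x / m"] by (simp only:)
    have "\<bar>g (x + h) - g x - partial i g x / m\<bar> \<le> ?K / m\<^sup>2"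
      using taylor2[OF assms, of x h] unfolding hd hn by (simp add: power_divide power_mult_distrib mult_ac)
    then have "m * \<bar>g (x + h) - g x - partial i g x / m\<bar> \<le> m * (?K / m\<^sup>2)"
      using m by (intro mult_left_mono) auto
    moreover have "m * \<bar>g (x + h) - g x - partial i g x / m\<bar> = \<bar>m * (g (x + h) - g x) - partial i g x\<bar>"
    proof -
      have "m * (g (x + h) - g x) - partial i g x = m * (g (x + h) - g x - partial i g x / m)"
        using m by (simp add: field_simps)
      then show ?thesis using m by (simp add: abs_mult)
    qed
    moreover have "m * (?K / m\<^sup>2) = ?K / m" using m by (simp add: power2_eq_square)
    ultimately show ?thesis using N[OF n] unfolding dist_real_def h_def m_def by linarith
  qed
  then show "\<exists>no. \<forall>n\<ge>no. dist (real (Suc n) * (g (x + (1 / real (Suc n)) *\<^sub>R axis i 1) - g x)) (partial i g x) < r"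
    by blast
qed

lemma admissible_partial:
  assumes "admissible M G" shows "admissible (\<lambda>k. M (Suc k)) (\<lambda>s. partial i (G s))"
  unfolding admissible_def
proof (intro conjI allI)
  show "Cb_le (\<lambda>k. M (Suc k)) (partial i (G s))" for s
    by (rule Cb_le_partial) (rule admissibleD(1)[OF assms])
  show "(\<lambda>s. partial i (G s) x) \<in> borel_measurable borel" for x
    by (rule borel_measurable_LIMSEQ_real[OF partial_lim[OF admissibleD(1)[OF assms]]])
      (intro borel_measurable_times borel_measurable_diff admissibleD(2)[OF assms] borel_measurable_const)
qed

lemma admissible_partials:
  assumes "admissible M G" shows "admissible (\<lambda>k. M (k + length js)) (\<lambda>s. partials js (G s))"
proof (induction js)
  case (Cons i js)
  show ?case using admissible_partial[OF Cons] by simp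
qed (use assms in simp)

lemma admissible_sint:
  assumes "admissible M G"
  shows "set_integrable lborel {a..b} (\<lambda>s. G s x)"
    and "a \<le> b \<Longrightarrow> \<bar>LINT s:{a..b}|lborel. G s x\<bar> \<le> M 0 * (b - a)"
  using set_integrable_bounded[where f="\<lambda>s. G s x" and K="M 0" and a=a and b=b] admissibleD[OF assms] Cb_le_bound by blast+

text \<open>The Taylor bound is uniform in s. Integrating it differentiates under the integral sign
  although the integrand is only measurable in time.\<close>

lemma admissible_integral:
  fixes G :: "real \<Rightarrow> real^'n \<Rightarrow> real"
  assumes G: "admissible M G" and ab: "a \<le> b"
  shows "Cb_le (\<lambda>k. (b - a) * M k) (\<lambda>x. LINT s:{a..b}|lborel. G s x)"
    and "partials js (\<lambda>x. LINT s:{a..b}|lborel. G s x) = (\<lambda>x. LINT s:{a..b}|lborel. partials js (G s) x)"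
proof -
  let ?P = "\<lambda>js x. LINT s:{a..b}|lborel. partials js (G s) x"
  have 1: "?P [] = (\<lambda>x. LINT s:{a..b}|lborel. G s x)" by simp
  note G' = admissible_partials[OF G]
  have 2: "(?P js has_derivative (\<lambda>h. \<Sum>i\<in>UNIV. h $ i * ?P (i # js) x)) (at x)" for js x
  proof (rule has_derivative_quad'[OF _ refl])
    fix h
    note I = admissible_sint(1)[OF G'[of js]] and I2 = admissible_sint(1)[OF G'[of "_ # js"]]
    let ?r = "\<lambda>s. partials js (G s) (x + h) - partials js (G s) x - (\<Sum>i\<in>UNIV. h $ i * partials (i # js) (G s) x)"
    have S: "set_integrable lborel {a..b} (\<lambda>s. \<Sum>i\<in>UNIV. h $ i * partials (i # js) (G s) x)"
      "(LINT s:{a..b}|lborel. (\<Sum>i\<in>UNIV. h $ i * partials (i # js) (G s) x)) = (\<Sum>i\<in>UNIV. h $ i * ?P (i # js) x)"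
      using lint_sum[where I=UNIV and c="\<lambda>i. h $ i" and f="\<lambda>i s. partials (i # js) (G s) x", OF _ I2] by auto
    have "?P js (x + h) - ?P js x - (\<Sum>i\<in>UNIV. h $ i * ?P (i # js) x) = (LINT s:{a..b}|lborel. ?r s)"
      using set_integral_diff[OF set_integral_diff(1)[OF I[of a b "x + h"] I[of a b x]] S(1)]
        set_integral_diff[OF I[of a b "x + h"] I[of a b x]] S(2) by simp
    moreover have "\<bar>LINT s:{a..b}|lborel. ?r s\<bar> \<le> ((real CARD('n) * norm h)\<^sup>2 * M (2 + length js)) * (b - a)"
    proof (rule sint_bound[OF _ _ ab])
      show "set_integrable lborel {a..b} ?r" by (intro set_integral_diff(1) I S(1))
      show "\<bar>?r s\<bar> \<le> (real CARD('n) * norm h)\<^sup>2 * M (2 + length js)" for s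
        using taylor2[OF admissibleD(1)[OF G'[of js]], of s x h] by (simp add: dd_def)
    qed
    ultimately show "\<bar>?P js (x + h) - ?P js x - (\<Sum>i\<in>UNIV. h $ i * ?P (i # js) x)\<bar>
       \<le> (real CARD('n) * norm h)\<^sup>2 * (M (2 + length js) * (b - a))" by (simp add: mult.assoc)
  qed
  have 3: "\<bar>?P js x\<bar> \<le> (b - a) * M (length js)" for js x
    using admissible_sint(2)[OF G'[of js] ab, of x] by (simp add: mult.commute)
  show "Cb_le (\<lambda>k. (b - a) * M k) (\<lambda>x. LINT s:{a..b}|lborel. G s x)"
    "partials js (\<lambda>x. LINT s:{a..b}|lborel. G s x) = ?P js"
    using Cb_le_I[where P="?P", OF 1 2 3] by auto
qed

lemma avg_integral:
  assumes "admissible M G"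
  shows "avg as (\<lambda>y. LINT s:{a..b}|lborel. G s y) x = (LINT s:{a..b}|lborel. avg as (G s) x)"
    and "set_integrable lborel {a..b} (\<lambda>s. avg as (G s) x)"
proof -
  have "avg as (\<lambda>y. LINT s:{a..b}|lborel. G s y) x = (LINT s:{a..b}|lborel. avg as (G s) x)
    \<and> set_integrable lborel {a..b} (\<lambda>s. avg as (G s) x)"
  proof (induction as arbitrary: x)
    case Nil
    then show ?case using admissible_sint(1)[OF assms] by simp
  next
    case (Cons c as)
    then show ?case using set_integral_add[of lborel "{a..b}" "\<lambda>s. avg as (G s) (x + c)" "\<lambda>s. avg as (G s) (x - c)"]
      by simp
  qed
  then show "avg as (\<lambda>y. LINT s:{a..b}|lborel. G s y) x = (LINT s:{a..b}|lborel. avg as (G s) x)"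
    "set_integrable lborel {a..b} (\<lambda>s. avg as (G s) x)" by auto
qed

text \<open>For finite averages the interchange is linearity of the integral; dominated convergence
  with the bound \<open>M 0\<close> carries it to the limit of the walks.\<close>

lemma heat_integral:
  assumes C: "psd C" and G: "admissible M G" and ab: "a \<le> b"
  shows "heat C (\<lambda>y. LINT s:{a..b}|lborel. G s y) x = (LINT s:{a..b}|lborel. heat C (G s) x)"
proof (rule LIMSEQ_unique)
  show "(\<lambda>n. avg (walk n C) (\<lambda>y. LINT s:{a..b}|lborel. G s y) x) \<longlonglongrightarrow> heat C (\<lambda>y. LINT s:{a..b}|lborel. G s y) x"
    by (rule heat_lim[OF C admissible_integral(1)[OF G ab]])
  show "(\<lambda>n. avg (walk n C) (\<lambda>y. LINT s:{a..b}|lborel. G s y) x) \<longlonglongrightarrow> (LINT s:{a..b}|lborel. heat C (G s) x)"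
    unfolding avg_integral(1)[OF G] unfolding set_lebesgue_integral_def
  proof (rule integral_dominated_convergence[where w="\<lambda>s. indicator {a..b} s *\<^sub>R M 0" and f="\<lambda>s. indicator {a..b} s *\<^sub>R heat C (G s) x" and s="\<lambda>n s. indicator {a..b} s *\<^sub>R avg (walk n C) (G s) x"])
    show "(\<lambda>s. indicator {a..b} s *\<^sub>R heat C (G s) x) \<in> borel_measurable lborel"
      using heat_measurable[OF admissibleD(2)[OF G]] by measurable
    show "(\<lambda>s. indicator {a..b} s *\<^sub>R avg (walk n C) (G s) x) \<in> borel_measurable lborel" for n
      using avg_measurable[OF admissibleD(2)[OF G]] by measurable
    show "integrable lborel (\<lambda>s. indicator {a..b} s *\<^sub>R M 0)"
      by (simp add: integrable_real_indicator emeasure_lborel_Icc_eq)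
    show "AE s in lborel. (\<lambda>n. indicator {a..b} s *\<^sub>R avg (walk n C) (G s) x) \<longlonglongrightarrow> indicator {a..b} s *\<^sub>R heat C (G s) x"
      by (intro AE_I2 tendsto_intros heat_lim[OF C admissibleD(1)[OF G]])
    show "AE s in lborel. norm (indicator {a..b} s *\<^sub>R avg (walk n C) (G s) x) \<le> indicator {a..b} s *\<^sub>R M 0" for n
      using avg_bound[OF Cb_le_bound[OF admissibleD(1)[OF G]]] by (intro AE_I2) (auto simp: indicator_def)
  qed
qed

section \<open>Propagation along an increasing covariance\<close>

definition psd_incr :: "real \<Rightarrow> real \<Rightarrow> (real \<Rightarrow> real^'n^'n) \<Rightarrow> bool" where
  "psd_incr T \<Lambda> C \<longleftrightarrow> 0 \<le> \<Lambda> \<and> (\<forall>a b. 0 \<le> a \<longrightarrow> a \<le> b \<longrightarrow> b \<le> T \<longrightarrow> psd (C b - C a) \<and> trace (C b - C a) \<le> \<Lambda> * (b - a))"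

lemma psd_incrD: "psd_incr T \<Lambda> C \<Longrightarrow> 0 \<le> a \<Longrightarrow> a \<le> b \<Longrightarrow> b \<le> T \<Longrightarrow> psd (C b - C a)"
  "psd_incr T \<Lambda> C \<Longrightarrow> 0 \<le> a \<Longrightarrow> a \<le> b \<Longrightarrow> b \<le> T \<Longrightarrow> trace (C b - C a) \<le> \<Lambda> * (b - a)"
  "psd_incr T \<Lambda> C \<Longrightarrow> 0 \<le> \<Lambda>"
  by (auto simp: psd_incr_def)

text \<open>The interval is open at s and closed at t: a jump at \<tau> acts on the solution from
  time \<tau> on, and only on sources strictly before \<tau>. The shift in \<open>late_shift\<close>
  starts at \<tau> for the same reason.\<close>

definition jumps_in :: "(real \<times> (real^'n)) list \<Rightarrow> real \<Rightarrow> real \<Rightarrow> (real^'n) list" where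
  "jumps_in L s t = map snd (filter (\<lambda>(\<tau>, a). s < \<tau> \<and> \<tau> \<le> t) L)"

text \<open>
  In the coordinates moving with the flow: the solution with source G when the covariance grows by C and,
  in addition, at each time \<open>\<tau>\<close> with \<open>(\<tau>, a) \<in> set L\<close> the state jumps by a or -a with probability 1/2.
\<close>

definition duhamel :: "(real \<Rightarrow> real^'n^'n) \<Rightarrow> (real \<times> (real^'n)) list \<Rightarrow> (real \<Rightarrow> real^'n \<Rightarrow> real) \<Rightarrow> real \<Rightarrow> real^'n \<Rightarrow> real" where
  "duhamel C L G t x = (LINT s:{0..t}|lborel. avg (jumps_in L s t) (heat (C t - C s) (G s)) x)"

text \<open>The time s enters through the source and through the covariance at once. With the
  covariance frozen at the grid point below s only countably many operators occur, each giving a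
  measurable function of s; the Lipschitz bound of \<open>C\<close> then lets the grid be refined.
  Outside [a,t], where the increment need not be positive semidefinite, the value is set to
  0.\<close>

lemma admissible_propag:
  fixes G :: "real \<Rightarrow> real^'n \<Rightarrow> real"
  assumes C: "psd_incr T \<Lambda> C" and G: "admissible M G" and t: "t \<in> {0..T}" and a: "0 \<le> a"
  shows "admissible M (\<lambda>s. if s \<in> {a..t} then avg (jumps_in L s t) (heat (C t - C s) (G s)) else (\<lambda>_. 0))"
  unfolding admissible_def
proof (intro conjI allI)
  have psd: "psd (C t - C s)" if "s \<in> {a..t}" for s
    using psd_incrD(1)[OF C, of s t] that t a by auto
  have z: "Cb_le M (\<lambda>_::real^'n. 0)"
    using Cb_le_nonneg[OF admissibleD(1)[OF G]] by (intro Cb_le_I[where P="\<lambda>_ _. 0"]) auto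
  show "Cb_le M (if s \<in> {a..t} then avg (jumps_in L s t) (heat (C t - C s) (G s)) else (\<lambda>_. 0))" for s
    using Cb_le_avg(1)[OF Cb_le_heat(1)[OF psd admissibleD(1)[OF G]]] z by auto
  let ?d = "\<lambda>s n. real_of_int \<lfloor>s * real (Suc n)\<rfloor> / real (Suc n)"
  have m1: "(\<lambda>s. indicator {a..t} s * heat (C t - C s) (G s) x) \<in> borel_measurable borel" for x
  proof (rule borel_measurable_LIMSEQ_real)
    fix n
    have "(\<lambda>s. heat (C t - C (real_of_int \<lfloor>s * real (Suc n)\<rfloor> / real (Suc n))) (G s) x) \<in> borel_measurable borel"
      by (rule measurable_compose_countable[where f="\<lambda>i s. heat (C t - C (real_of_int i / real (Suc n))) (G s) x"])
        (auto intro!: heat_measurable admissibleD(2)[OF G])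
    then show "(\<lambda>s. indicator {a..t} s * heat (C t - C (?d s n)) (G s) x) \<in> borel_measurable borel"
      by (intro borel_measurable_times borel_measurable_indicator) auto
  next
    fix s
    show "(\<lambda>n. indicator {a..t} s * heat (C t - C (?d s n)) (G s) x) \<longlonglongrightarrow> indicator {a..t} s * heat (C t - C s) (G s) x"
    proof (cases "s \<in> {a..t}")
      case s: True
      let ?K = "2 * (real CARD('n))\<^sup>2 * \<Lambda> * M 2"
      have K0: "0 \<le> 2 * (real CARD('n))\<^sup>2 * M 2" using Cb_le_nonneg[OF admissibleD(1)[OF G]] by simp
      have "\<bar>heat (C t - C (?d s n)) (G s) x - heat (C t - C s) (G s) x\<bar> \<le> ?K / real (Suc n)" for n
      proof -
        have f: "real_of_int \<lfloor>s * real (Suc n)\<rfloor> \<le> s * real (Suc n)" "s * real (Suc n) \<le> real_of_int \<lfloor>s * real (Suc n)\<rfloor> + 1"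
          by linarith+
        have d: "?d s n \<le> s" using f(1) by (simp add: divide_le_eq)
        have d0: "0 \<le> ?d s n" using s a by simp
        have "s \<le> (real_of_int \<lfloor>s * real (Suc n)\<rfloor> + 1) / real (Suc n)"
          using f(2) by (simp only: pos_le_divide_eq of_nat_0_less_iff zero_less_Suc)
        then have d1: "s - ?d s n \<le> 1 / real (Suc n)" unfolding add_divide_distrib by linarith
        have e: "(C t - C (?d s n)) - (C t - C s) = C s - C (?d s n)" by simp
        have sT: "s \<le> T" "0 \<le> s" using s t a by auto
        have "\<bar>heat (C t - C (?d s n)) (G s) x - heat (C t - C s) (G s) x\<bar> \<le> 2 * (real CARD('n))\<^sup>2 * trace (C s - C (?d s n)) * M 2"
          using heat_mono_diff[OF psd[OF s], of "C t - C (?d s n)", OF _ admissibleD(1)[OF G], of s x]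
          unfolding e using psd_incrD(1)[OF C d0 d sT(1)] by blast
        also have "\<dots> \<le> 2 * (real CARD('n))\<^sup>2 * (\<Lambda> * (1 / real (Suc n))) * M 2"
        proof -
          have "trace (C s - C (?d s n)) \<le> \<Lambda> * (1 / real (Suc n))"
            using psd_incrD(2)[OF C d0 d sT(1)] mult_left_mono[OF d1 psd_incrD(3)[OF C]] by linarith
          from mult_left_mono[OF this K0] show ?thesis by (simp only: mult_ac)
        qed
        finally show ?thesis by (simp add: mult_ac)
      qed
      then have 1: "\<forall>n. norm (heat (C t - C (?d s n)) (G s) x - heat (C t - C s) (G s) x) \<le> ?K / real (Suc n)"
        unfolding real_norm_def by blast
      have 2: "(\<lambda>n. ?K / real (Suc n)) \<longlonglongrightarrow> 0" by (rule LIMSEQ_Suc[OF lim_const_over_n])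
      have "(\<lambda>n. heat (C t - C (?d s n)) (G s) x) \<longlonglongrightarrow> heat (C t - C s) (G s) x"
        by (rule LIM_zero_cancel, rule Lim_null_comparison[OF always_eventually[OF 1] 2])
      then show ?thesis using s by (intro tendsto_mult_left)
    qed simp
  qed
  have m2: "(\<lambda>s. indicator {a..t} s * avg (jumps_in L s t) (heat (C t - C s) (G s)) x) \<in> borel_measurable borel" for x
  proof (induction L arbitrary: x)
    case Nil
    then show ?case using m1 by (simp add: jumps_in_def)
  next
    case (Cons l L)
    obtain \<tau> c where l: "l = (\<tau>, c)" by (cases l)
    have "(\<lambda>s. indicator {a..t} s * avg (jumps_in (l # L) s t) (heat (C t - C s) (G s)) x) =
      (\<lambda>s. if s < \<tau> \<and> \<tau> \<le> t then (indicator {a..t} s * avg (jumps_in L s t) (heat (C t - C s) (G s)) (x + c)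
          + indicator {a..t} s * avg (jumps_in L s t) (heat (C t - C s) (G s)) (x - c)) / 2
        else indicator {a..t} s * avg (jumps_in L s t) (heat (C t - C s) (G s)) x)"
      by (auto simp: jumps_in_def l algebra_simps)
    also have "\<dots> \<in> borel_measurable borel"
      by (intro measurable_If borel_measurable_divide borel_measurable_add Cons borel_measurable_const) auto
    finally show ?case .
  qed
  show "(\<lambda>s. (if s \<in> {a..t} then avg (jumps_in L s t) (heat (C t - C s) (G s)) else (\<lambda>_. 0)) x) \<in> borel_measurable borel" for x
    using m2[of x] by (rule subst[rotated, where P="\<lambda>f. f \<in> borel_measurable borel"]) auto
qed

lemma duhamel_eq: "duhamel C L G t x = (LINT s:{0..t}|lborel. (if s \<in> {0..t} then avg (jumps_in L s t) (heat (C t - C s) (G s)) else (\<lambda>_. 0)) x)"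
  unfolding duhamel_def by (rule set_lebesgue_integral_cong) auto

lemma Cb_le_duhamel:
  fixes G :: "real \<Rightarrow> real^'n \<Rightarrow> real"
  assumes C: "psd_incr T \<Lambda> C" and G: "admissible M G" and t: "t \<in> {0..T}"
  shows "Cb_le (\<lambda>k. T * M k) (duhamel C L G t)"
    and "partials js (duhamel C L G t) = duhamel C L (\<lambda>s. partials js (G s)) t"
proof -
  note A = admissible_propag[OF C G t order_refl, of L]
  have t0: "0 \<le> t" using t by simp
  have e: "duhamel C L G t = (\<lambda>x. LINT s:{0..t}|lborel. (if s \<in> {0..t} then avg (jumps_in L s t) (heat (C t - C s) (G s)) else (\<lambda>_. 0)) x)"
    by (rule ext) (rule duhamel_eq)
  show "Cb_le (\<lambda>k. T * M k) (duhamel C L G t)"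
    unfolding e by (rule Cb_le_mono[OF admissible_integral(1)[OF A t0]])
      (use t Cb_le_nonneg[OF admissibleD(1)[OF G]] in \<open>auto intro!: mult_right_mono\<close>)
  show "partials js (duhamel C L G t) = duhamel C L (\<lambda>s. partials js (G s)) t"
    unfolding e admissible_integral(2)[OF A t0]
  proof
    fix x
    show "(LINT s:{0..t}|lborel. partials js (if s \<in> {0..t} then avg (jumps_in L s t) (heat (C t - C s) (G s)) else (\<lambda>_. 0)) x)
      = duhamel C L (\<lambda>s. partials js (G s)) t x"
      unfolding duhamel_def
    proof (rule set_lebesgue_integral_cong)
      show "\<forall>s. s \<in> {0..t} \<longrightarrow> partials js (if s \<in> {0..t} then avg (jumps_in L s t) (heat (C t - C s) (G s)) else (\<lambda>_. 0)) x
         = avg (jumps_in L s t) (heat (C t - C s) (partials js (G s))) x"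
      proof (intro allI impI)
        fix s assume s: "s \<in> {0..t}"
        then have p: "psd (C t - C s)" using psd_incrD(1)[OF C, of s t] t by auto
        show "partials js (if s \<in> {0..t} then avg (jumps_in L s t) (heat (C t - C s) (G s)) else (\<lambda>_. 0)) x
         = avg (jumps_in L s t) (heat (C t - C s) (partials js (G s))) x"
          using s Cb_le_avg(2)[OF Cb_le_heat(1)[OF p admissibleD(1)[OF G]]] Cb_le_heat(2)[OF p admissibleD(1)[OF G]] by simp
      qed
    qed simp
  qed
qed

text \<open>The time integral is split at a, and \<open>heat_add\<close> for C b - C s = (C b - C a)
  + (C a - C s) restarts the solution at time a.\<close>

lemma duhamel_evol:
  fixes G :: "real \<Rightarrow> real^'n \<Rightarrow> real"
  assumes C: "psd_incr T \<Lambda> C" and G: "admissible M G" and a: "0 \<le> a" and ab: "a \<le> b" and b: "b \<le> T"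
  shows "duhamel C [] G b x = heat (C b - C a) (duhamel C [] G a) x + (LINT s:{a..b}|lborel. heat (C b - C s) (G s) x)"
    and "set_integrable lborel {a..b} (\<lambda>s. heat (C b - C s) (G s) x)"
proof -
  have jumps_in[simp]: "jumps_in [] s t = []" for s t :: real by (simp add: jumps_in_def)
  have av[simp]: "avg [] g = g" for g :: "real^'n \<Rightarrow> real" by auto
  have aT: "a \<in> {0..T}" and bT: "b \<in> {0..T}" using a ab b by auto
  have int: "set_integrable lborel {c..b} (\<lambda>s. heat (C b - C s) (G s) x)" if "0 \<le> c" for c
  proof -
    have "set_integrable lborel {c..b} (\<lambda>s. (if s \<in> {c..b} then avg (jumps_in [] s b) (heat (C b - C s) (G s)) else (\<lambda>_. 0)) x)"
      by (rule admissible_sint(1)[OF admissible_propag[OF C G bT that]])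
    then show ?thesis by (rule set_integrable_cong[THEN iffD1, rotated -1]) auto
  qed
  show "set_integrable lborel {a..b} (\<lambda>s. heat (C b - C s) (G s) x)" by (rule int[OF a])
  have "duhamel C [] G b x = (LINT s:{0..a}|lborel. heat (C b - C s) (G s) x) + (LINT s:{a..b}|lborel. heat (C b - C s) (G s) x)"
    unfolding duhamel_def by simp (rule lint_combine[OF int[OF order_refl] a ab])
  moreover have "(LINT s:{0..a}|lborel. heat (C b - C s) (G s) x) = heat (C b - C a) (duhamel C [] G a) x"
  proof -
    let ?g = "\<lambda>s. if s \<in> {0..a} then avg (jumps_in [] s a) (heat (C a - C s) (G s)) else (\<lambda>_. 0)"
    have p: "psd (C b - C a)" by (rule psd_incrD(1)[OF C a ab b])
    have "duhamel C [] G a = (\<lambda>y. LINT s:{0..a}|lborel. ?g s y)" by (rule ext) (rule duhamel_eq)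
    then have "heat (C b - C a) (duhamel C [] G a) x = (LINT s:{0..a}|lborel. heat (C b - C a) (?g s) x)"
      using heat_integral[OF p admissible_propag[OF C G aT order_refl, of "[]"] a] by simp
    also have "\<dots> = (LINT s:{0..a}|lborel. heat (C b - C s) (G s) x)"
    proof (rule set_lebesgue_integral_cong)
      show "\<forall>s. s \<in> {0..a} \<longrightarrow> heat (C b - C a) (?g s) x = heat (C b - C s) (G s) x"
      proof (intro allI impI)
        fix s assume s: "s \<in> {0..a}"
        then have "psd (C a - C s)" using psd_incrD(1)[OF C, of s a] aT by auto
        from heat_add[OF p this admissibleD(1)[OF G, of s]] s
        show "heat (C b - C a) (?g s) x = heat (C b - C s) (G s) x" by simp
      qed
    qed simp
    finally show ?thesis ..
  qed
  ultimately show "duhamel C [] G b x = heat (C b - C a) (duhamel C [] G a) x + (LINT s:{a..b}|lborel. heat (C b - C s) (G s) x)"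
    by simp
qed

text \<open>After a restart at a, \<open>heat_second\<close> expands the propagated solution and
  \<open>heat_first\<close> removes the propagation from the source. The trace of the increment is
  at most \<Lambda> (b - a), so both errors are quadratic in b - a.\<close>

lemma duhamel_step:
  fixes G :: "real \<Rightarrow> real^'n \<Rightarrow> real"
  assumes C: "psd_incr T \<Lambda> C" and G: "admissible M G"
  obtains K where "0 \<le> K" "\<And>a b x. 0 \<le> a \<Longrightarrow> a \<le> b \<Longrightarrow> b \<le> T \<Longrightarrow>
     \<bar>duhamel C [] G b x - duhamel C [] G a x - trace ((C b - C a) ** hess (duhamel C [] G a) x) - (LINT s:{a..b}|lborel. G s x)\<bar> \<le> K * (b - a)\<^sup>2"
proof (cases "0 \<le> T")
  case False
  then show ?thesis by (intro that[of 0]) auto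
next
  case T: True
  let ?c = "real CARD('n)"
  define K where "K = 4 * ?c^4 * \<Lambda>\<^sup>2 * (T * M 4) + 2 * ?c\<^sup>2 * \<Lambda> * M 2"
  have M0: "0 \<le> M k" for k by (rule Cb_le_nonneg[OF admissibleD(1)[OF G]])
  have L0: "0 \<le> \<Lambda>" by (rule psd_incrD(3)[OF C])
  show ?thesis
  proof (rule that[of K])
    show "0 \<le> K" using T M0 L0 by (simp add: K_def)
    fix a b x assume a: "0 \<le> a" and ab: "a \<le> b" and b: "b \<le> T"
    then have aT: "a \<in> {0..T}" by auto
    define D where "D = C b - C a"
    have p: "psd D" unfolding D_def by (rule psd_incrD(1)[OF C a ab b])
    have tr: "0 \<le> trace D" "trace D \<le> \<Lambda> * (b - a)"
      using trace_psd_nonneg[OF p] psd_incrD(2)[OF C a ab b] by (auto simp: D_def)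
    have "(trace D)\<^sup>2 \<le> (\<Lambda> * (b - a))\<^sup>2" by (rule power_mono[OF tr(2,1)])
    from mult_left_mono[OF this, of "4 * ?c^4 * (T * M 4)"] T M0
    have "4 * ?c^4 * (trace D)\<^sup>2 * (T * M 4) \<le> 4 * ?c^4 * \<Lambda>\<^sup>2 * (T * M 4) * (b - a)\<^sup>2"
      by (simp add: power_mult_distrib mult_ac)
    with heat_second[OF p Cb_le_duhamel(1)[OF C G aT, of "[]"], of x]
    have 1: "\<bar>heat D (duhamel C [] G a) x - duhamel C [] G a x - trace (D ** hess (duhamel C [] G a) x)\<bar> \<le> 4 * ?c^4 * \<Lambda>\<^sup>2 * (T * M 4) * (b - a)\<^sup>2"
      by linarith
    note e = duhamel_evol[OF C G a ab b, of x]
    note Gi = admissible_sint(1)[OF G, of a b x]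
    have d: "(LINT s:{a..b}|lborel. heat (C b - C s) (G s) x) - (LINT s:{a..b}|lborel. G s x) = (LINT s:{a..b}|lborel. heat (C b - C s) (G s) x - G s x)"
      by (rule set_integral_diff(2)[OF e(2) Gi, symmetric])
    have d': "\<bar>LINT s:{a..b}|lborel. heat (C b - C s) (G s) x - G s x\<bar> \<le> (2 * ?c\<^sup>2 * (\<Lambda> * (b - a)) * M 2) * (b - a)"
    proof (rule sint_bound[OF set_integral_diff(1)[OF e(2) Gi] _ ab])
      fix s assume s: "s \<in> {a..b}"
      have p: "psd (C b - C s)" and t: "trace (C b - C s) \<le> \<Lambda> * (b - s)"
        using s a b psd_incrD(1,2)[OF C, of s b] by auto
      have "trace (C b - C s) \<le> \<Lambda> * (b - a)"
        using t s L0 mult_left_mono[of "b - s" "b - a" \<Lambda>] by auto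
      then have "2 * ?c\<^sup>2 * trace (C b - C s) * M 2 \<le> 2 * ?c\<^sup>2 * (\<Lambda> * (b - a)) * M 2"
        using M0 by (intro mult_right_mono mult_left_mono) auto
      with heat_first[OF p admissibleD(1)[OF G, of s], of x]
      show "\<bar>heat (C b - C s) (G s) x - G s x\<bar> \<le> 2 * ?c\<^sup>2 * (\<Lambda> * (b - a)) * M 2" by linarith
    qed
    have 2: "\<bar>(LINT s:{a..b}|lborel. heat (C b - C s) (G s) x) - (LINT s:{a..b}|lborel. G s x)\<bar> \<le> 2 * ?c\<^sup>2 * \<Lambda> * M 2 * (b - a)\<^sup>2"
    proof -
      have "(2 * ?c\<^sup>2 * (\<Lambda> * (b - a)) * M 2) * (b - a) = 2 * ?c\<^sup>2 * \<Lambda> * M 2 * (b - a)\<^sup>2"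
        unfolding power2_eq_square[of "b - a"] by (simp only: mult_ac)
      with d' show ?thesis unfolding d by (simp only:)
    qed
    show "\<bar>duhamel C [] G b x - duhamel C [] G a x - trace ((C b - C a) ** hess (duhamel C [] G a) x) - (LINT s:{a..b}|lborel. G s x)\<bar> \<le> K * (b - a)\<^sup>2"
      using 1 2 unfolding e(1) D_def[symmetric] K_def distrib_right by linarith
  qed
qed

text \<open>The source is quantified after K: the constant depends on it only through
  \<open>M\<close>. Hence one constant serves all differentiated sources of a given order.\<close>

lemma duhamel_lip:
  fixes C :: "real \<Rightarrow> real^'n^'n"
  assumes C: "psd_incr T \<Lambda> C"
  obtains K where "0 \<le> K" "\<And>(G::real \<Rightarrow> real^'n \<Rightarrow> real) a b x y. admissible M G \<Longrightarrow> a \<in> {0..T} \<Longrightarrow> b \<in> {0..T} \<Longrightarrow>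
     \<bar>duhamel C [] G b y - duhamel C [] G a x\<bar> \<le> K * (\<bar>b - a\<bar> + norm (y - x))"
proof (cases "0 \<le> T")
  case False
  then show ?thesis by (intro that[of 0]) auto
next
  case T: True
  let ?c = "real CARD('n)"
  have L0: "0 \<le> \<Lambda>" by (rule psd_incrD(3)[OF C])
  define K1 where "K1 = 2 * ?c\<^sup>2 * \<Lambda> * (T * M 2) + M 0"
  define K2 where "K2 = ?c * (T * M 1)"
  have time: "\<bar>duhamel C [] G b x - duhamel C [] G a x\<bar> \<le> K1 * (b - a)" if G: "admissible M G" and a: "0 \<le> a" and ab: "a \<le> b" and b: "b \<le> T" for a b x and G :: "real \<Rightarrow> real^'n \<Rightarrow> real"
  proof -
    have M0: "0 \<le> M k" for k by (rule Cb_le_nonneg[OF admissibleD(1)[OF G]])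
    have aT: "a \<in> {0..T}" using a ab b by auto
    define D where "D = C b - C a"
    have p: "psd D" unfolding D_def by (rule psd_incrD(1)[OF C a ab b])
    have tr: "trace D \<le> \<Lambda> * (b - a)" using psd_incrD(2)[OF C a ab b] by (auto simp: D_def)
    from mult_left_mono[OF tr, of "2 * ?c\<^sup>2 * (T * M 2)"] T M0
    have "2 * ?c\<^sup>2 * trace D * (T * M 2) \<le> 2 * ?c\<^sup>2 * \<Lambda> * (T * M 2) * (b - a)" by (simp add: mult_ac)
    with heat_first[OF p Cb_le_duhamel(1)[OF C G aT, of "[]"], of x]
    have 1: "\<bar>heat D (duhamel C [] G a) x - duhamel C [] G a x\<bar> \<le> 2 * ?c\<^sup>2 * \<Lambda> * (T * M 2) * (b - a)" by linarith
    note e = duhamel_evol[OF C G a ab b, of x]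
    have 2: "\<bar>LINT s:{a..b}|lborel. heat (C b - C s) (G s) x\<bar> \<le> M 0 * (b - a)"
    proof (rule sint_bound[OF e(2) _ ab])
      fix s assume s: "s \<in> {a..b}"
      have "psd (C b - C s)" using s a b psd_incrD(1)[OF C, of s b] by auto
      from Cb_le_bound[OF Cb_le_heat(1)[OF this admissibleD(1)[OF G]]]
      show "\<bar>heat (C b - C s) (G s) x\<bar> \<le> M 0" .
    qed
    show ?thesis using 1 2 unfolding e(1) D_def[symmetric] K1_def distrib_right by linarith
  qed
  show ?thesis
  proof (rule that[of "\<bar>K1\<bar> + \<bar>K2\<bar>"])
    show "0 \<le> \<bar>K1\<bar> + \<bar>K2\<bar>" by simp
    fix a b x y and G :: "real \<Rightarrow> real^'n \<Rightarrow> real" assume G: "admissible M G" and a: "a \<in> {0..T}" and b: "b \<in> {0..T}"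
    have 1: "\<bar>duhamel C [] G b y - duhamel C [] G a y\<bar> \<le> K1 * \<bar>b - a\<bar>"
      using time[OF G, of a b y] time[OF G, of b a y] a b by (cases "a \<le> b") (auto simp: abs_minus_commute)
    have 2: "\<bar>duhamel C [] G a y - duhamel C [] G a x\<bar> \<le> K2 * norm (y - x)"
      using taylor1'[OF Cb_le_duhamel(1)[OF C G a, of "[]"], of y x] by (simp add: K2_def mult_ac)
    have "K1 * \<bar>b - a\<bar> \<le> (\<bar>K1\<bar> + \<bar>K2\<bar>) * \<bar>b - a\<bar>" "K2 * norm (y - x) \<le> (\<bar>K1\<bar> + \<bar>K2\<bar>) * norm (y - x)"
      by (auto intro: mult_right_mono)
    with 1 2 show "\<bar>duhamel C [] G b y - duhamel C [] G a x\<bar> \<le> (\<bar>K1\<bar> + \<bar>K2\<bar>) * (\<bar>b - a\<bar> + norm (y - x))"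
      unfolding distrib_left by linarith
  qed
qed

section \<open>The covariance accumulated along the flow\<close>

definition cov_density :: "real^'n^'n \<Rightarrow> (real \<Rightarrow> real^'n^'n) \<Rightarrow> real \<Rightarrow> real^'n^'n" where
  "cov_density A Q r = mexp A r ** Q r ** transpose (mexp A r)"

text \<open>Half the covariance matrix of the Gaussian noise collected up to time t, in the
  coordinates moving with the flow. The solution formulas involve only its increments.\<close>

definition cov :: "real^'n^'n \<Rightarrow> (real \<Rightarrow> real^'n^'n) \<Rightarrow> real \<Rightarrow> real^'n^'n" where
  "cov A Q t = (\<chi> i j. LINT r:{0..t}|lborel. cov_density A Q r $ i $ j)"

lemma continuous_on_matrix_mult:
  fixes f :: "real \<Rightarrow> real^'n^'n" and g :: "real \<Rightarrow> real^'n^'n"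
  assumes "continuous_on S f" "continuous_on S g"
  shows "continuous_on S (\<lambda>t. f t ** g t)"
  unfolding matrix_matrix_mult_def
  by (intro continuous_on_vec_lambda continuous_on_sum continuous_on_mult continuous_on_component assms)

lemma continuous_on_transpose:
  fixes f :: "real \<Rightarrow> real^'n^'n"
  assumes "continuous_on S f"
  shows "continuous_on S (\<lambda>t. transpose (f t))"
  unfolding transpose_def by (intro continuous_on_vec_lambda continuous_on_component assms)

lemma cov_density_cont: "continuous_on S Q \<Longrightarrow> continuous_on S (cov_density A Q)"
  unfolding cov_density_def[abs_def] by (intro continuous_on_matrix_mult continuous_on_transpose mexp_cont)

lemma cov_density_sint:
  assumes "continuous_on {0..T} Q" "0 \<le> a" "b \<le> T"
  shows "set_integrable lborel {a..b} (\<lambda>r. cov_density A Q r $ i $ j)"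
  by (rule set_integrable_continuous, intro continuous_on_component, rule continuous_on_subset[OF cov_density_cont[OF assms(1)]])
     (use assms in auto)

lemma cov_diff:
  assumes Q: "continuous_on {0..T} Q" and a: "0 \<le> a" "a \<le> b" "b \<le> T"
  shows "(cov A Q b - cov A Q a) $ i $ j = (LINT r:{a..b}|lborel. cov_density A Q r $ i $ j)"
  using lint_combine[OF cov_density_sint[OF Q order_refl a(3)] a(1,2), of A i j] by (simp add: cov_def)

lemma psd_cov_density: "psd (Q r) \<Longrightarrow> psd (cov_density A Q r)"
proof -
  assume p: "psd (Q r)"
  let ?E = "mexp A r"
  have "transpose (cov_density A Q r) = cov_density A Q r"
    using p by (simp add: cov_density_def psd_def matrix_transpose_mul matrix_mul_assoc)
  moreover have "0 \<le> (cov_density A Q r *v \<xi>) \<bullet> \<xi>" for \<xi>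
  proof -
    have "(cov_density A Q r *v \<xi>) \<bullet> \<xi> = (?E *v (Q r *v (transpose ?E *v \<xi>))) \<bullet> \<xi>"
      by (simp only: cov_density_def matrix_vector_mul_assoc matrix_mul_assoc)
    also have "\<dots> = (Q r *v (transpose ?E *v \<xi>)) \<bullet> (transpose ?E *v \<xi>)"
      by (metis dot_lmul_matrix inner_commute transpose_matrix_vector)
    also have "0 \<le> \<dots>" using p by (simp add: psd_def)
    finally show ?thesis .
  qed
  ultimately show ?thesis by (simp add: psd_def)
qed

lemma lint_nonneg:
  fixes f :: "real \<Rightarrow> real"
  assumes "\<And>s. s \<in> A \<Longrightarrow> 0 \<le> f s" shows "0 \<le> (LINT s:A|lborel. f s)"
  unfolding set_lebesgue_integral_def
  by (rule Bochner_Integration.integral_nonneg) (use assms in \<open>auto simp: indicator_def\<close>)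

lemma cov_trace_mult:
  fixes A :: "real^'n^'n"
  assumes Q: "continuous_on {0..T} Q" and a: "0 \<le> a" "a \<le> b" "b \<le> T"
  shows "trace ((cov A Q b - cov A Q a) ** N) = (LINT r:{a..b}|lborel. trace (cov_density A Q r ** N))"
    and "set_integrable lborel {a..b} (\<lambda>r. trace (cov_density A Q r ** N))"
proof -
  note I = cov_density_sint[OF Q a(1,3)]
  have e: "trace (K ** N) = (\<Sum>ij\<in>UNIV. N $ snd ij $ fst ij * K $ fst ij $ snd ij)" for K :: "real^'n^'n"
    unfolding trace_mult UNIV_Times_UNIV[symmetric] sum.cartesian_product by (simp add: case_prod_unfold mult.commute)
  show "trace ((cov A Q b - cov A Q a) ** N) = (LINT r:{a..b}|lborel. trace (cov_density A Q r ** N))"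
    unfolding e cov_diff[OF Q a] by (subst lint_sum(2)) (auto intro: I)
  show "set_integrable lborel {a..b} (\<lambda>r. trace (cov_density A Q r ** N))"
    unfolding e by (rule lint_sum(1)) (auto intro: I)
qed

text \<open>Quadratic forms and traces of an increment are traces against a fixed matrix, hence
  integrals of the corresponding quantities of the density, which are nonnegative and
  bounded.\<close>

lemma cov_psd_incr:
  fixes A :: "real^'n^'n"
  assumes Q: "continuous_on {0..T} Q" and p: "\<And>t. t \<in> {0..T} \<Longrightarrow> psd (Q t)"
  obtains \<Lambda> where "psd_incr T \<Lambda> (cov A Q)"
proof -
  have "continuous_on {0..T} (\<lambda>r. trace (cov_density A Q r))"
    unfolding trace_def by (intro continuous_intros continuous_on_component cov_density_cont Q)
  then have "compact ((\<lambda>r. trace (cov_density A Q r)) ` {0..T})" by (intro compact_continuous_image compact_Icc)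
  then obtain b0 where b0: "\<And>r. r \<in> {0..T} \<Longrightarrow> \<bar>trace (cov_density A Q r)\<bar> \<le> b0"
    by (meson compact_imp_bounded bounded_real imageI)
  define \<Lambda> where "\<Lambda> = max 0 b0"
  have b: "\<bar>trace (cov_density A Q r)\<bar> \<le> \<Lambda>" if "r \<in> {0..T}" for r
    using b0[OF that] by (simp add: \<Lambda>_def)
  have "psd (cov A Q b - cov A Q a) \<and> trace (cov A Q b - cov A Q a) \<le> \<Lambda> * (b - a)"
    if a: "0 \<le> a" "a \<le> b" "b \<le> T" for a b
  proof
    have pr: "psd (cov_density A Q r)" if "r \<in> {a..b}" for r
      by (intro psd_cov_density p) (use that a in auto)
    let ?D = "cov A Q b - cov A Q a"
    show "psd ?D"
      unfolding psd_def
    proof (intro conjI allI)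
      have "?D $ i $ j = ?D $ j $ i" for i j
        unfolding cov_diff[OF Q a] by (rule set_lebesgue_integral_cong) (use psd_sym[OF pr] in auto)
      then show "transpose ?D = ?D" unfolding transpose_def vec_eq_iff by simp
      fix \<xi> :: "real^'n"
      have e: "(K *v \<xi>) \<bullet> \<xi> = trace (K ** (\<chi> i j. \<xi> $ i * \<xi> $ j))" for K :: "real^'n^'n"
        unfolding quadratic_form_sum trace_mult by (simp add: mult_ac)
      show "0 \<le> (?D *v \<xi>) \<bullet> \<xi>"
        unfolding e cov_trace_mult(1)[OF Q a] by (rule lint_nonneg) (use pr in \<open>auto simp: e[symmetric] psd_def\<close>)
    qed
    have "trace ?D = trace (?D ** mat 1)" by simp
    also have "\<dots> = (LINT r:{a..b}|lborel. trace (cov_density A Q r ** mat 1))" by (rule cov_trace_mult(1)[OF Q a])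
    also have "\<dots> \<le> \<Lambda> * (b - a)"
    proof -
      have "\<bar>LINT r:{a..b}|lborel. trace (cov_density A Q r ** mat 1)\<bar> \<le> \<Lambda> * (b - a)"
        by (rule sint_bound[OF cov_trace_mult(2)[OF Q a] _ a(2)]) (use b a in auto)
      then show ?thesis by simp
    qed
    finally show "trace ?D \<le> \<Lambda> * (b - a)" .
  qed
  then have "psd_incr T \<Lambda> (cov A Q)" by (auto simp: psd_incr_def \<Lambda>_def)
  then show ?thesis by (rule that)
qed

text \<open>Increments of quadratic order force a zero derivative. Applied to the solution minus the
  integral of the right-hand side, this gives the integral equation although the source is only
  measurable in time.\<close>

lemma quad_const:
  fixes F :: "real \<Rightarrow> real"
  assumes q: "\<And>a b. 0 \<le> a \<Longrightarrow> a \<le> b \<Longrightarrow> b \<le> T \<Longrightarrow> \<bar>F b - F a\<bar> \<le> K * (b - a)\<^sup>2" and t: "t \<in> {0..T}"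
  shows "F t = F 0"
proof (rule ccontr)
  assume "F t \<noteq> F 0"
  have "(F has_field_derivative 0) (at x within {0..T})" if x: "x \<in> {0..T}" for x
    unfolding has_field_derivative_iff
  proof (rule Lim_null_comparison[where g="\<lambda>y. \<bar>K\<bar> * \<bar>y - x\<bar>"])
    have "norm ((F y - F x) / (y - x) - 0) \<le> \<bar>K\<bar> * \<bar>y - x\<bar>" if y: "y \<in> {0..T}" "y \<noteq> x" for y
    proof -
      have "\<bar>F y - F x\<bar> \<le> K * (y - x)\<^sup>2"
        using q[of x y] q[of y x] x y by (cases "x \<le> y") (auto simp: abs_minus_commute power2_commute)
      also have "\<dots> \<le> \<bar>K\<bar> * \<bar>y - x\<bar> * \<bar>y - x\<bar>"
        by (simp add: power2_eq_square abs_mult[symmetric] mult.assoc)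
      finally show ?thesis using y by (simp add: divide_le_eq)
    qed
    then show "\<forall>\<^sub>F y in at x within {0..T}. norm ((F y - F x) / (y - x)) \<le> \<bar>K\<bar> * \<bar>y - x\<bar>"
      by (auto simp: eventually_at_filter)
    have "((\<lambda>y. \<bar>K\<bar> * \<bar>y - x\<bar>) \<longlongrightarrow> \<bar>K\<bar> * \<bar>x - x\<bar>) (at x within {0..T})"
      by (intro tendsto_intros)
    then show "((\<lambda>y. \<bar>K\<bar> * \<bar>y - x\<bar>) \<longlongrightarrow> 0) (at x within {0..T})" by simp
  qed
  then have "\<exists>c. \<forall>x\<in>{0..T}. F x = c"
    by (intro has_field_derivative_zero_constant) auto
  then show False using \<open>F t \<noteq> F 0\<close> t by force
qed

section \<open>Existence\<close>

lemma partial2_linear: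
  fixes P :: "real^'n^'n"
  assumes g: "Cb_le M g"
  shows "partial i (partial j (\<lambda>z. g (P *v z))) z = (\<Sum>k\<in>UNIV. \<Sum>l\<in>UNIV. P $ k $ i * P $ l $ j * partial k (partial l g) (P *v z))"
proof -
  define h where "h = (\<lambda>z. \<Sum>l\<in>UNIV. P $ l $ j * partial l g z)"
  have h: "Cb_le (\<lambda>m. \<Sum>l\<in>UNIV. \<bar>P $ l $ j\<bar> * M (Suc m)) h"
    unfolding h_def by (rule Cb_le_sum(1)) (auto intro: Cb_le_partial g)
  have h2: "partial k h z = (\<Sum>l\<in>UNIV. P $ l $ j * partial k (partial l g) z)" for k z
    using Cb_le_sum(2)[where I="UNIV::'n set" and M="\<lambda>_ k. M (Suc k)" and f="\<lambda>j. partial j g" and c="\<lambda>l. P $ l $ j" and js="[k]"]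
      Cb_le_partial[OF g] by (simp add: h_def)
  have "partial j (\<lambda>z. g (P *v z)) = (\<lambda>z. h (P *v z))"
    unfolding partial_linear(1)[OF g] h_def ..
  then show ?thesis
    unfolding partial_linear(1)[OF h] by (simp add: partial_linear(1)[OF h] h2 sum_distrib_left mult.assoc)
qed

lemma hess_linear:
  fixes P :: "real^'n^'n"
  assumes g: "Cb_le M g"
  shows "hess (\<lambda>z. g (P *v z)) z = transpose P ** hess g (P *v z) ** P"
proof -
  have "hess (\<lambda>z. g (P *v z)) z $ i $ j = (transpose P ** hess g (P *v z) ** P) $ i $ j" for i j
    unfolding hess_def vec_lambda_beta partial2_linear[OF g]
    by (subst sum.swap) (simp add: matrix_matrix_mult_def transpose_def sum_distrib_right sum_distrib_left mult_ac)
  then show ?thesis by (simp add: vec_eq_iff)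
qed

text \<open>The Hessian of g (P z) is the Hessian of g between the transpose of P and P, and
  cyclicity of the trace moves both factors to Q. With P = exp (t A) this produces
  \<open>cov_density\<close>.\<close>

lemma trace_hess_linear:
  fixes P :: "real^'n^'n"
  assumes g: "Cb_le M g"
  shows "trace (Q ** hess (\<lambda>z. g (P *v z)) z) = trace ((P ** Q ** transpose P) ** hess g (P *v z))"
proof -
  have "trace (Q ** hess (\<lambda>z. g (P *v z)) z) = trace ((Q ** transpose P ** hess g (P *v z)) ** P)"
    unfolding hess_linear[OF g] by (simp only: matrix_mul_assoc)
  also have "\<dots> = trace (P ** (Q ** transpose P ** hess g (P *v z)))" by (rule trace_mul_sym)
  finally show ?thesis by (simp only: matrix_mul_assoc)
qed

lemma grad_linear:
  fixes P :: "real^'n^'n"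
  assumes g: "Cb_le M g"
  shows "y \<bullet> grad (\<lambda>z. g (P *v z)) z = (P *v y) \<bullet> grad g (P *v z)"
proof -
  have "y \<bullet> grad (\<lambda>z. g (P *v z)) z = (\<Sum>i\<in>UNIV. \<Sum>k\<in>UNIV. y $ i * (P $ k $ i * partial k g (P *v z)))"
    by (simp add: inner_vec_def grad_def partial_linear(1)[OF g] sum_distrib_left)
  also have "\<dots> = (\<Sum>k\<in>UNIV. \<Sum>i\<in>UNIV. y $ i * (P $ k $ i * partial k g (P *v z)))" by (rule sum.swap)
  finally show ?thesis
    by (simp add: inner_vec_def grad_def matrix_vector_mult_def sum_distrib_right mult_ac)
qed

lemma norm_le_sum: "norm (x::real^'n) \<le> (\<Sum>i\<in>UNIV. \<bar>x $ i\<bar>)"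
  by (rule norm_le_l1_cart)

lemma mexp_vec_lip:
  obtains X where "0 \<le> X" "\<And>a b. a \<in> {0..T} \<Longrightarrow> b \<in> {0..T} \<Longrightarrow> norm (mexp A b *v z - mexp A a *v (z::real^'n)) \<le> X * \<bar>b - a\<bar>"
    "\<And>s i. s \<in> {0..T} \<Longrightarrow> \<bar>(mexp A s *v (A *v z)) $ i\<bar> \<le> X"
proof -
  have c: "continuous_on {0..T} (\<lambda>s. mexp A s *v (A *v z))"
    unfolding matrix_vector_mult_def
    by (intro continuous_on_vec_lambda continuous_on_sum continuous_on_mult continuous_on_component mexp_cont continuous_on_const)
  have "compact ((\<lambda>s. mexp A s *v (A *v z)) ` {0..T})" by (intro compact_continuous_image compact_Icc c)
  then obtain b where b: "\<And>s. s \<in> {0..T} \<Longrightarrow> norm (mexp A s *v (A *v z)) \<le> b"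
    by (meson compact_imp_bounded bounded_iff imageI)
  define B where "B = max 0 b"
  have B: "\<bar>(mexp A s *v (A *v z)) $ i\<bar> \<le> B" if "s \<in> {0..T}" for s i
    using b[OF that] component_le_norm_cart[of "mexp A s *v (A *v z)" i] by (simp add: B_def)
  have B0: "0 \<le> B" by (simp add: B_def)
  define X where "X = real CARD('n) * B"
  have "1 \<le> real CARD('n)" by (simp add: Suc_leI)
  then have BX: "B \<le> X" using B0 mult_right_mono[of 1 "real CARD('n)" B] by (simp add: X_def)
  show ?thesis
  proof (rule that[of X])
    show "0 \<le> X" using B0 by (simp add: X_def)
    show "\<bar>(mexp A s *v (A *v z)) $ i\<bar> \<le> X" if "s \<in> {0..T}" for s i using B[OF that, of i] BX by simp
    fix a b assume ab: "a \<in> {0..T}" "b \<in> {0..T}"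
    have "\<bar>(mexp A b *v z) $ i - (mexp A a *v z) $ i\<bar> \<le> B * \<bar>b - a\<bar>" for i
    proof -
      have "norm ((mexp A b *v z) $ i - (mexp A a *v z) $ i) \<le> B * norm (b - a)"
        by (rule field_differentiable_bound[where S="{0..T}" and f'="\<lambda>s. (mexp A s *v (A *v z)) $ i"])
          (use ab B in \<open>auto intro: DERIV_subset[OF mexp_vec_deriv]\<close>)
      then show ?thesis by simp
    qed
    then have "(\<Sum>i\<in>UNIV. \<bar>(mexp A b *v z - mexp A a *v z) $ i\<bar>) \<le> (\<Sum>i\<in>(UNIV::'n set). B * \<bar>b - a\<bar>)"
      by (intro sum_mono) simp
    then show "norm (mexp A b *v z - mexp A a *v z) \<le> X * \<bar>b - a\<bar>"
      using norm_le_sum[of "mexp A b *v z - mexp A a *v z"] by (simp add: X_def mult.assoc)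
  qed
qed

lemma lint_FTC:
  fixes F :: "real \<Rightarrow> real"
  assumes "a \<le> b" "\<And>x. (F has_real_derivative f x) (at x)" "continuous_on UNIV f"
  shows "(LINT s:{a..b}|lborel. f s) = F b - F a"
  using integral_FTC_Icc_real[of a b F f] assms
  by (simp add: set_lebesgue_integral_def mult.commute continuous_on_eq_continuous_at)

lemma continuous_on_lip:
  fixes f :: "real \<Rightarrow> real"
  assumes "\<And>a b. a \<in> S \<Longrightarrow> b \<in> S \<Longrightarrow> \<bar>f b - f a\<bar> \<le> K * \<bar>b - a\<bar>"
  shows "continuous_on S f"
proof (rule lipschitz_on_continuous_on[where L="max 0 K"], rule lipschitz_onI)
  fix x y assume xy: "x \<in> S" "y \<in> S"
  have "\<bar>f x - f y\<bar> \<le> K * \<bar>x - y\<bar>" using assms[OF xy(2,1)] .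
  also have "\<dots> \<le> max 0 K * \<bar>x - y\<bar>" by (intro mult_right_mono) auto
  finally show "dist (f x) (f y) \<le> max 0 K * dist x y" by (simp add: dist_real_def)
qed simp

text \<open>Derivatives of a Duhamel integral are Duhamel integrals of differentiated sources, so
  \<open>duhamel_lip\<close> applies to them. The time of the function and the time of the flow are
  separate arguments because \<open>solution_increment\<close> freezes one while the other
  moves.\<close>

lemma duhamel_path_lip:
  fixes G :: "real \<Rightarrow> real^'n \<Rightarrow> real"
  assumes C: "psd_incr T \<Lambda> C" and G: "admissible M G"
  obtains K where "0 \<le> K" "\<And>js a b a' b'. length js \<le> 2 \<Longrightarrow> a \<in> {0..T} \<Longrightarrow> b \<in> {0..T} \<Longrightarrow> a' \<in> {0..T} \<Longrightarrow> b' \<in> {0..T} \<Longrightarrow>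
    \<bar>partials js (duhamel C [] G b) (mexp A b' *v z) - partials js (duhamel C [] G a) (mexp A a' *v z)\<bar> \<le> K * (\<bar>b - a\<bar> + \<bar>b' - a'\<bar>)"
proof -
  obtain X where X: "0 \<le> X" "\<And>a b. a \<in> {0..T} \<Longrightarrow> b \<in> {0..T} \<Longrightarrow> norm (mexp A b *v z - mexp A a *v z) \<le> X * \<bar>b - a\<bar>"
    using mexp_vec_lip[of T A z] by metis
  have "\<exists>K. 0 \<le> K \<and> (\<forall>(G::real \<Rightarrow> real^'n \<Rightarrow> real) a b x y. admissible (\<lambda>m. M (m + k)) G \<longrightarrow> a \<in> {0..T} \<longrightarrow> b \<in> {0..T} \<longrightarrow>
     \<bar>duhamel C [] G b y - duhamel C [] G a x\<bar> \<le> K * (\<bar>b - a\<bar> + norm (y - x)))" for k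
    using duhamel_lip[OF C, of "\<lambda>m. M (m + k)"] by metis
  then obtain K where K: "\<And>k. 0 \<le> K k" "\<And>k (G::real \<Rightarrow> real^'n \<Rightarrow> real) a b x y. admissible (\<lambda>m. M (m + k)) G \<Longrightarrow> a \<in> {0..T} \<Longrightarrow> b \<in> {0..T} \<Longrightarrow>
     \<bar>duhamel C [] G b y - duhamel C [] G a x\<bar> \<le> K k * (\<bar>b - a\<bar> + norm (y - x))" by metis
  define K' where "K' = (\<Sum>k\<le>2. K k) * (1 + X)"
  show ?thesis
  proof (rule that[of K'])
    show "0 \<le> K'" using K(1) X(1) by (simp add: K'_def sum_nonneg)
    fix js :: "'n list" and a b a' b' assume js: "length js \<le> 2" and ab: "a \<in> {0..T}" "b \<in> {0..T}" "a' \<in> {0..T}" "b' \<in> {0..T}"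
    have "\<bar>partials js (duhamel C [] G b) (mexp A b' *v z) - partials js (duhamel C [] G a) (mexp A a' *v z)\<bar>
      \<le> K (length js) * (\<bar>b - a\<bar> + norm (mexp A b' *v z - mexp A a' *v z))"
      unfolding Cb_le_duhamel(2)[OF C G ab(1)] Cb_le_duhamel(2)[OF C G ab(2)] by (rule K(2)[OF admissible_partials[OF G] ab(1,2)])
    also have "\<dots> \<le> K (length js) * ((1 + X) * (\<bar>b - a\<bar> + \<bar>b' - a'\<bar>))"
    proof (rule mult_left_mono[OF _ K(1)])
      have "0 \<le> X * \<bar>b - a\<bar>" using X(1) by simp
      then show "\<bar>b - a\<bar> + norm (mexp A b' *v z - mexp A a' *v z) \<le> (1 + X) * (\<bar>b - a\<bar> + \<bar>b' - a'\<bar>)"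
        using X(2)[OF ab(3,4)] by (simp add: algebra_simps)
    qed
    also have "\<dots> \<le> (\<Sum>k\<le>2. K k) * ((1 + X) * (\<bar>b - a\<bar> + \<bar>b' - a'\<bar>))"
      using js X(1) K(1) by (intro mult_right_mono member_le_sum) auto
    finally show "\<bar>partials js (duhamel C [] G b) (mexp A b' *v z) - partials js (duhamel C [] G a) (mexp A a' *v z)\<bar> \<le> K' * (\<bar>b - a\<bar> + \<bar>b' - a'\<bar>)"
      by (simp add: K'_def mult.assoc)
  qed
qed


lemma duhamel_joint_cont:
  fixes G :: "real \<Rightarrow> real^'n \<Rightarrow> real"
  assumes C: "psd_incr T \<Lambda> C" and G: "admissible M G"
  shows "continuous_on ({0..T} \<times> UNIV) (\<lambda>(t, x). duhamel C [] G t x)"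
proof -
  obtain K where K: "0 \<le> K" "\<And>a b x y. a \<in> {0..T} \<Longrightarrow> b \<in> {0..T} \<Longrightarrow> \<bar>duhamel C [] G b y - duhamel C [] G a x\<bar> \<le> K * (\<bar>b - a\<bar> + norm (y - x))"
    using duhamel_lip[OF C, of M] G by metis
  show ?thesis
  proof (rule lipschitz_on_continuous_on[where L="2 * K"], rule lipschitz_onI)
    fix p q :: "real \<times> (real^'n)" assume pq: "p \<in> {0..T} \<times> UNIV" "q \<in> {0..T} \<times> UNIV"
    obtain b y where p: "p = (b, y)" by (cases p)
    obtain a x where q: "q = (a, x)" by (cases q)
    have "\<bar>b - a\<bar> + norm (y - x) \<le> 2 * dist p q"
      using dist_fst_le[of p q] dist_snd_le[of p q] by (simp add: p q dist_real_def dist_norm)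
    from mult_left_mono[OF this K(1)] K(2)[of a b y x] pq
    show "dist (case p of (t, x) \<Rightarrow> duhamel C [] G t x) (case q of (t, x) \<Rightarrow> duhamel C [] G t x) \<le> 2 * K * dist p q"
      by (simp add: p q dist_real_def mult_ac)
  qed (use K(1) in simp)
qed

lemma flow_joint_cont: "continuous_on S (\<lambda>(t, z). (t, mexp A t *v z))"
proof -
  have "continuous_on S (\<lambda>p. mexp A (fst p))"
    by (rule continuous_on_compose2[OF mexp_cont[of UNIV] continuous_on_fst[OF continuous_on_id]]) auto
  then show ?thesis
    unfolding case_prod_unfold matrix_vector_mult_def
    by (intro continuous_on_Pair continuous_on_fst continuous_on_vec_lambda continuous_on_sum continuous_on_mult
        continuous_on_component continuous_on_snd continuous_on_id) auto
qed

lemma trace_bound: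
  fixes K N :: "real^'n^'n"
  assumes "\<And>i j. \<bar>K $ i $ j\<bar> \<le> q" "\<And>i j. \<bar>N $ i $ j\<bar> \<le> r"
  shows "\<bar>trace (K ** N)\<bar> \<le> (real CARD('n))\<^sup>2 * (q * r)"
proof -
  have q: "0 \<le> q" using assms(1) abs_ge_zero order_trans by blast
  have "\<bar>trace (K ** N)\<bar> \<le> (\<Sum>i\<in>UNIV. \<Sum>j\<in>UNIV. \<bar>K $ i $ j * N $ j $ i\<bar>)"
    unfolding trace_mult by (rule order_trans[OF sum_abs sum_mono[OF sum_abs]])
  also have "\<dots> \<le> (\<Sum>i\<in>(UNIV::'n set). \<Sum>j\<in>(UNIV::'n set). q * r)"
    unfolding abs_mult by (intro sum_mono mult_mono assms q) auto
  finally show ?thesis by (simp add: power2_eq_square mult.assoc)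
qed

lemma floor_approx:
  "real_of_int \<lfloor>s * real (Suc n)\<rfloor> / real (Suc n) \<le> s"
  "s - real_of_int \<lfloor>s * real (Suc n)\<rfloor> / real (Suc n) \<le> 1 / real (Suc n)"
proof -
  have f: "real_of_int \<lfloor>s * real (Suc n)\<rfloor> \<le> s * real (Suc n)" "s * real (Suc n) \<le> real_of_int \<lfloor>s * real (Suc n)\<rfloor> + 1"
    by linarith+
  show "real_of_int \<lfloor>s * real (Suc n)\<rfloor> / real (Suc n) \<le> s" using f(1) by (simp add: divide_le_eq)
  have "s \<le> (real_of_int \<lfloor>s * real (Suc n)\<rfloor> + 1) / real (Suc n)"
    using f(2) by (simp only: pos_le_divide_eq of_nat_0_less_iff zero_less_Suc)
  then show "s - real_of_int \<lfloor>s * real (Suc n)\<rfloor> / real (Suc n) \<le> 1 / real (Suc n)"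
    unfolding add_divide_distrib by linarith
qed

lemma floor_lim: "(\<lambda>n. real_of_int \<lfloor>s * real (Suc n)\<rfloor> / real (Suc n)) \<longlonglongrightarrow> s"
proof (rule LIM_zero_cancel)
  have 1: "\<forall>n. norm (real_of_int \<lfloor>s * real (Suc n)\<rfloor> / real (Suc n) - s) \<le> 1 / real (Suc n)"
  proof
    fix n
    show "norm (real_of_int \<lfloor>s * real (Suc n)\<rfloor> / real (Suc n) - s) \<le> 1 / real (Suc n)"
      using floor_approx[of s n] unfolding real_norm_def by linarith
  qed
  have 2: "(\<lambda>n. 1 / real (Suc n)) \<longlonglongrightarrow> 0" by (rule LIMSEQ_Suc[OF lim_const_over_n])
  show "(\<lambda>n. real_of_int \<lfloor>s * real (Suc n)\<rfloor> / real (Suc n) - s) \<longlonglongrightarrow> 0"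
    by (rule Lim_null_comparison[OF always_eventually[OF 1] 2])
qed

lemma mexp_path_cont: "continuous_on S (\<lambda>s. mexp A s *v z)"
  unfolding matrix_vector_mult_def
  by (intro continuous_on_vec_lambda continuous_on_sum continuous_on_mult continuous_on_component mexp_cont continuous_on_const)

text \<open>With the path frozen at grid times, countably many measurable functions of s remain;
  continuity of \<open>G s\<close> in space then carries measurability to the limit.\<close>

lemma admissible_path_measurable:
  fixes G :: "real \<Rightarrow> real^'n \<Rightarrow> real"
  assumes G: "admissible M G" and x: "continuous_on UNIV x"
  shows "(\<lambda>s. G s (x s)) \<in> borel_measurable borel"
proof (rule borel_measurable_LIMSEQ_real)
  fix n
  show "(\<lambda>s. G s (x (real_of_int \<lfloor>s * real (Suc n)\<rfloor> / real (Suc n)))) \<in> borel_measurable borel"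
    by (rule measurable_compose_countable[where f="\<lambda>i s. G s (x (real_of_int i / real (Suc n)))"])
      (auto intro!: admissibleD(2)[OF G])
next
  fix s
  have "isCont x s" using x by (simp add: continuous_on_eq_continuous_at)
  then have "(\<lambda>n. x (real_of_int \<lfloor>s * real (Suc n)\<rfloor> / real (Suc n))) \<longlonglongrightarrow> x s"
    by (rule isCont_tendsto_compose[OF _ floor_lim])
  moreover have "isCont (G s) (x s)"
    using Cb_le_cont[OF admissibleD(1)[OF G], of UNIV s] by (simp add: continuous_on_eq_continuous_at)
  ultimately show "(\<lambda>n. G s (x (real_of_int \<lfloor>s * real (Suc n)\<rfloor> / real (Suc n)))) \<longlonglongrightarrow> G s (x s)"
    by (rule isCont_tendsto_compose[rotated])
qed

text \<open>The increment along z moved by the flow is split at time b and the old point x a.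
  Passing from time a to b at the fixed point x a is one step of \<open>duhamel_step\<close>; moving
  the point at the fixed time b is Taylor's formula. The integrands frozen in this way are compared
  with the true ones by their Lipschitz bounds, and every error is quadratic in b - a.\<close>

lemma solution_increment:
  fixes A :: "real^'n^'n" and G :: "real \<Rightarrow> real^'n \<Rightarrow> real"
  assumes T: "0 < T" and Q: "continuous_on {0..T} Q" and p: "\<And>t. t \<in> {0..T} \<Longrightarrow> psd (Q t)" and G: "admissible M G"
    and f_def: "f = (\<lambda>s. G s (mexp A s *v z))"
    and l_def: "l = (\<lambda>s. trace (cov_density A Q s ** hess (duhamel (cov A Q) [] G s) (mexp A s *v z)) +
         (mexp A s *v (A *v z)) \<bullet> grad (duhamel (cov A Q) [] G s) (mexp A s *v z))"
  shows "continuous_on {0..T} l"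
    and "\<exists>K. \<forall>a b. 0 \<le> a \<longrightarrow> a \<le> b \<longrightarrow> b \<le> T \<longrightarrow>
      \<bar>duhamel (cov A Q) [] G b (mexp A b *v z) - duhamel (cov A Q) [] G a (mexp A a *v z) - ((LINT s:{a..b}|lborel. f s) + (LINT s:{a..b}|lborel. l s))\<bar> \<le> K * (b - a)\<^sup>2"
proof -
  obtain \<Lambda> where C: "psd_incr T \<Lambda> (cov A Q)" using cov_psd_incr[OF Q p] by blast
  define w where "w = duhamel (cov A Q) [] G"
  define x where "x s = mexp A s *v z" for s
  define v where "v s = mexp A s *v (A *v z)" for s
  let ?c = "real CARD('n)"
  have Cw: "Cb_le (\<lambda>k. T * M k) (w t)" if "t \<in> {0..T}" for t
    unfolding w_def by (rule Cb_le_duhamel(1)[OF C G that])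
  obtain X where X: "0 \<le> X" "\<And>a b. a \<in> {0..T} \<Longrightarrow> b \<in> {0..T} \<Longrightarrow> norm (x b - x a) \<le> X * \<bar>b - a\<bar>"
     "\<And>s i. s \<in> {0..T} \<Longrightarrow> \<bar>v s $ i\<bar> \<le> X"
    unfolding x_def v_def using mexp_vec_lip[of T A z] by metis
  obtain K where K: "0 \<le> K" "\<And>js a b a' b'. length js \<le> 2 \<Longrightarrow> a \<in> {0..T} \<Longrightarrow> b \<in> {0..T} \<Longrightarrow> a' \<in> {0..T} \<Longrightarrow> b' \<in> {0..T} \<Longrightarrow>
    \<bar>partials js (w b) (x b') - partials js (w a) (x a')\<bar> \<le> K * (\<bar>b - a\<bar> + \<bar>b' - a'\<bar>)"
    unfolding w_def x_def using duhamel_path_lip[OF C G, of A z] by metis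
  have K1: "\<bar>partial i (w b) (x b') - partial i (w a) (x a')\<bar> \<le> K * (\<bar>b - a\<bar> + \<bar>b' - a'\<bar>)"
    and K2: "\<bar>partial i (partial j (w b)) (x b') - partial i (partial j (w a)) (x a')\<bar> \<le> K * (\<bar>b - a\<bar> + \<bar>b' - a'\<bar>)"
    if "a \<in> {0..T}" "b \<in> {0..T}" "a' \<in> {0..T}" "b' \<in> {0..T}" for i j a b a' b'
    using K(2)[of "[i]", OF _ that] K(2)[of "[i,j]", OF _ that] by simp_all
  have contv: "continuous_on S (\<lambda>s. v s $ i)" for i S
    unfolding v_def by (rule DERIV_continuous_on[OF DERIV_subset[OF mexp_vec_deriv subset_UNIV]])
  have dbl: "K * (d + d) = 2 * K * d" for d by (simp add: algebra_simps)
  have cont1: "continuous_on {0..T} (\<lambda>s. partial i (w s) (x s))" for i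
    by (rule continuous_on_lip[where K="2 * K"]) (rule K1[where a=a and b=b and a'=a and b'=b for a b, unfolded dbl])
  have cont2: "continuous_on {0..T} (\<lambda>s. partial i (partial j (w s)) (x s))" for i j
    by (rule continuous_on_lip[where K="2 * K"]) (rule K2[where a=a and b=b and a'=a and b'=b for a b, unfolded dbl])
  have contcov: "continuous_on {0..T} (\<lambda>s. cov_density A Q s $ i $ j)" for i j
    by (intro continuous_on_component cov_density_cont Q)
  have c1: "continuous_on {0..T} (\<lambda>s. trace (cov_density A Q s ** hess (w s) (x s)))"
    unfolding trace_mult hess_def vec_lambda_beta by (intro continuous_on_sum continuous_on_mult contcov cont2)
  have c2: "continuous_on {0..T} (\<lambda>s. v s \<bullet> grad (w s) (x s))"
    unfolding inner_vec_def grad_def vec_lambda_beta inner_real_def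
    by (intro continuous_on_sum continuous_on_mult contv cont1)
  have l: "l s = trace (cov_density A Q s ** hess (w s) (x s)) + v s \<bullet> grad (w s) (x s)" for s
    by (simp add: l_def w_def x_def v_def)
  show "continuous_on {0..T} l"
    using continuous_on_add[OF c1 c2] by (simp add: l[abs_def])
  have "\<exists>q. \<forall>s\<in>{0..T}. \<forall>i j. \<bar>cov_density A Q s $ i $ j\<bar> \<le> q"
  proof -
    have "compact (cov_density A Q ` {0..T})" by (intro compact_continuous_image compact_Icc cov_density_cont Q)
    then obtain b where b: "\<And>s. s \<in> {0..T} \<Longrightarrow> norm (cov_density A Q s) \<le> b"
      by (meson compact_imp_bounded bounded_iff imageI)
    have "\<bar>cov_density A Q s $ i $ j\<bar> \<le> b" if "s \<in> {0..T}" for s i j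
      using b[OF that] component_le_norm_cart[of "cov_density A Q s $ i" j] Finite_Cartesian_Product.norm_nth_le[of "cov_density A Q s" i]
      by linarith
    then show ?thesis by blast
  qed
  then obtain q where q: "\<And>s i j. s \<in> {0..T} \<Longrightarrow> \<bar>cov_density A Q s $ i $ j\<bar> \<le> q" by blast
  obtain K0 where K0: "\<And>a b y. 0 \<le> a \<Longrightarrow> a \<le> b \<Longrightarrow> b \<le> T \<Longrightarrow>
     \<bar>w b y - w a y - trace ((cov A Q b - cov A Q a) ** hess (w a) y) - (LINT s:{a..b}|lborel. G s y)\<bar> \<le> K0 * (b - a)\<^sup>2"
    unfolding w_def using duhamel_step[OF C G] by metis
  \<comment> \<open>One term for each of the five errors: the step in time at a fixed point, the
    Hessian term, the drift term, the source along the path, and Taylor's remainder in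
    space.\<close>
  define KK where "KK = K0 + ?c\<^sup>2 * (q * (2 * K)) + ?c * (X * (2 * K)) + ?c * X * M 1 + (?c * X)\<^sup>2 * (T * M 2)"
  have "\<bar>w b (x b) - w a (x a) - ((LINT s:{a..b}|lborel. f s) + (LINT s:{a..b}|lborel. l s))\<bar> \<le> KK * (b - a)\<^sup>2"
    if a: "0 \<le> a" and ab: "a \<le> b" and b: "b \<le> T" for a b
  proof -
    have aT: "a \<in> {0..T}" and bT: "b \<in> {0..T}" and sT: "\<And>s. s \<in> {a..b} \<Longrightarrow> s \<in> {0..T}" using a ab b by auto
    have sub: "{a..b} \<subseteq> {0..T}" using sT by blast
    define r where "r = (b - a)\<^sup>2"
    have r0: "0 \<le> r" by (simp add: r_def)
    have rr: "u * (b - a) * (b - a) = u * r" for u by (simp add: r_def power2_eq_square)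
    have i1: "set_integrable lborel {a..b} (\<lambda>s. trace (cov_density A Q s ** hess (w s) (x s)))"
      by (rule set_integrable_continuous[OF continuous_on_subset[OF c1 sub]])
    have i2: "set_integrable lborel {a..b} (\<lambda>s. v s \<bullet> grad (w s) (x s))"
      by (rule set_integrable_continuous[OF continuous_on_subset[OF c2 sub]])
    have L: "(LINT s:{a..b}|lborel. l s) = (LINT s:{a..b}|lborel. trace (cov_density A Q s ** hess (w s) (x s))) + (LINT s:{a..b}|lborel. v s \<bullet> grad (w s) (x s))"
      unfolding l by (rule set_integral_add(2)[OF i1 i2])
    note t1 = cov_trace_mult[OF Q a ab b, of A "hess (w a) (x a)"]
    have T1: "\<bar>(LINT s:{a..b}|lborel. trace (cov_density A Q s ** hess (w s) (x s))) - trace ((cov A Q b - cov A Q a) ** hess (w a) (x a))\<bar>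
       \<le> ?c\<^sup>2 * (q * (2 * K)) * r"
    proof -
      have "(LINT s:{a..b}|lborel. trace (cov_density A Q s ** hess (w s) (x s))) - trace ((cov A Q b - cov A Q a) ** hess (w a) (x a))
        = (LINT s:{a..b}|lborel. trace (cov_density A Q s ** hess (w s) (x s)) - trace (cov_density A Q s ** hess (w a) (x a)))"
        unfolding t1(1) by (rule set_integral_diff(2)[OF i1 t1(2), symmetric])
      moreover have "\<bar>LINT s:{a..b}|lborel. trace (cov_density A Q s ** hess (w s) (x s)) - trace (cov_density A Q s ** hess (w a) (x a))\<bar>
          \<le> ?c\<^sup>2 * (q * (2 * K)) * (b - a) * (b - a)"
      proof (rule sint_bound[OF set_integral_diff(1)[OF i1 t1(2)] _ ab])
        fix s assume s: "s \<in> {a..b}"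
        have "\<bar>trace (cov_density A Q s ** (hess (w s) (x s) - hess (w a) (x a)))\<bar> \<le> ?c\<^sup>2 * (q * (2 * K * (b - a)))"
        proof (rule trace_bound)
          show "\<bar>cov_density A Q s $ i $ j\<bar> \<le> q" for i j by (rule q[OF sT[OF s]])
          fix i j
          have "K * (\<bar>s - a\<bar> + \<bar>s - a\<bar>) \<le> K * (2 * (b - a))"
            using s by (intro mult_left_mono K(1)) auto
          moreover have "K * (2 * (b - a)) = 2 * K * (b - a)" by simp
          moreover have "(hess (w s) (x s) - hess (w a) (x a)) $ i $ j = partial i (partial j (w s)) (x s) - partial i (partial j (w a)) (x a)"
            by (simp add: hess_def)
          ultimately show "\<bar>(hess (w s) (x s) - hess (w a) (x a)) $ i $ j\<bar> \<le> 2 * K * (b - a)"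
            using K2[OF aT sT[OF s] aT sT[OF s], of i j] by linarith
        qed
        moreover have "trace (cov_density A Q s ** (hess (w s) (x s) - hess (w a) (x a))) =
            trace (cov_density A Q s ** hess (w s) (x s)) - trace (cov_density A Q s ** hess (w a) (x a))"
          by (simp add: trace_mult right_diff_distrib sum_subtractf)
        ultimately show "\<bar>trace (cov_density A Q s ** hess (w s) (x s)) - trace (cov_density A Q s ** hess (w a) (x a))\<bar>
           \<le> ?c\<^sup>2 * (q * (2 * K)) * (b - a)" by (simp add: mult.assoc)
      qed
      ultimately show ?thesis by (simp only: rr)
    qed
    define y where "y = x b - x a"
    have yn: "norm y \<le> X * (b - a)" using X(2)[OF aT bT] ab by (simp add: y_def)
    \<comment> \<open>The point moves when the time is already b, hence the gradient at time b and
      at the old point.\<close>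
    let ?g = "grad (w b) (x a)"
    have i3: "set_integrable lborel {a..b} (\<lambda>s. v s \<bullet> ?g)"
      by (rule set_integrable_continuous) (auto simp: inner_vec_def intro!: continuous_on_sum continuous_on_mult contv continuous_on_const)
    have T2': "(LINT s:{a..b}|lborel. v s \<bullet> ?g) = dd y (w b) (x a)"
    proof -
      have "(LINT s:{a..b}|lborel. v s $ i) = y $ i" for i
        unfolding y_def x_def vector_minus_component v_def
        by (rule lint_FTC[OF ab mexp_vec_deriv]) (use contv[of UNIV i] in \<open>simp add: v_def\<close>)
      moreover have "(LINT s:{a..b}|lborel. v s \<bullet> ?g) = (LINT s:{a..b}|lborel. \<Sum>i\<in>UNIV. ?g $ i * v s $ i)"
        by (simp add: inner_vec_def mult.commute)
      moreover have "\<dots> = (\<Sum>i\<in>UNIV. ?g $ i * (LINT s:{a..b}|lborel. v s $ i))"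
        by (rule lint_sum(2)) (auto intro!: set_integrable_continuous contv)
      ultimately show ?thesis by (simp add: dd_def grad_def mult.commute)
    qed
    have T2: "\<bar>(LINT s:{a..b}|lborel. v s \<bullet> grad (w s) (x s)) - dd y (w b) (x a)\<bar> \<le> ?c * (X * (2 * K)) * r"
    proof -
      have "(LINT s:{a..b}|lborel. v s \<bullet> grad (w s) (x s)) - dd y (w b) (x a)
        = (LINT s:{a..b}|lborel. v s \<bullet> grad (w s) (x s) - v s \<bullet> ?g)"
        unfolding T2'[symmetric] by (rule set_integral_diff(2)[OF i2 i3, symmetric])
      moreover have "\<bar>LINT s:{a..b}|lborel. v s \<bullet> grad (w s) (x s) - v s \<bullet> ?g\<bar> \<le> ?c * (X * (2 * K)) * (b - a) * (b - a)"
      proof (rule sint_bound[OF set_integral_diff(1)[OF i2 i3] _ ab])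
        fix s assume s: "s \<in> {a..b}"
        have "v s \<bullet> grad (w s) (x s) - v s \<bullet> ?g = (\<Sum>i\<in>UNIV. v s $ i * (partial i (w s) (x s) - partial i (w b) (x a)))"
          by (simp add: inner_vec_def grad_def right_diff_distrib sum_subtractf)
        also have "\<bar>\<dots>\<bar> \<le> (\<Sum>i\<in>UNIV. \<bar>v s $ i * (partial i (w s) (x s) - partial i (w b) (x a))\<bar>)" by (rule sum_abs)
        also have "\<dots> \<le> (\<Sum>i\<in>(UNIV::'n set). X * (2 * K * (b - a)))"
          unfolding abs_mult
        proof (intro sum_mono mult_mono X(3) sT[OF s] X(1) abs_ge_zero)
          fix i
          have "K * (\<bar>s - b\<bar> + \<bar>s - a\<bar>) \<le> K * (2 * (b - a))"
            using s by (intro mult_left_mono K(1)) auto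
          moreover have "K * (2 * (b - a)) = 2 * K * (b - a)" by simp
          ultimately show "\<bar>partial i (w s) (x s) - partial i (w b) (x a)\<bar> \<le> 2 * K * (b - a)"
            using K1[OF bT sT[OF s] aT sT[OF s], of i] by linarith
        qed
        finally show "\<bar>v s \<bullet> grad (w s) (x s) - v s \<bullet> ?g\<bar> \<le> ?c * (X * (2 * K)) * (b - a)" by (simp add: mult.assoc)
      qed
      ultimately show ?thesis by (simp only: rr)
    qed
    have T3: "\<bar>w b (x b) - w b (x a) - dd y (w b) (x a)\<bar> \<le> (?c * X)\<^sup>2 * (T * M 2) * r"
    proof -
      have "\<bar>w b (x a + y) - w b (x a) - dd y (w b) (x a)\<bar> \<le> (?c * norm y)\<^sup>2 * (T * M 2)"
        by (rule taylor2[OF Cw[OF bT]])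
      also have "\<dots> \<le> (?c * (X * (b - a)))\<^sup>2 * (T * M 2)"
        using yn T Cb_le_nonneg[OF admissibleD(1)[OF G]] by (intro mult_right_mono power_mono mult_left_mono) auto
      also have "\<dots> = (?c * X)\<^sup>2 * (T * M 2) * r" by (simp add: r_def power_mult_distrib mult_ac)
      finally show ?thesis by (simp add: y_def)
    qed
    note i4 = admissible_sint(1)[OF G, of a b "x a"]
    have i5: "set_integrable lborel {a..b} f"
    proof (rule set_integrable_bounded(1))
      show "f \<in> borel_measurable borel"
        unfolding f_def by (rule admissible_path_measurable[OF G mexp_path_cont])
      show "\<bar>f s\<bar> \<le> M 0" for s unfolding f_def by (rule Cb_le_bound[OF admissibleD(1)[OF G]])
    qed
    have T4: "\<bar>(LINT s:{a..b}|lborel. f s) - (LINT s:{a..b}|lborel. G s (x a))\<bar> \<le> ?c * X * M 1 * r"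
    proof -
      have "(LINT s:{a..b}|lborel. f s) - (LINT s:{a..b}|lborel. G s (x a)) = (LINT s:{a..b}|lborel. f s - G s (x a))"
        by (rule set_integral_diff(2)[OF i5 i4, symmetric])
      moreover have "\<bar>LINT s:{a..b}|lborel. f s - G s (x a)\<bar> \<le> ?c * X * M 1 * (b - a) * (b - a)"
      proof (rule sint_bound[OF set_integral_diff(1)[OF i5 i4] _ ab])
        fix s assume s: "s \<in> {a..b}"
        have "\<bar>G s (x s) - G s (x a)\<bar> \<le> ?c * norm (x s - x a) * M 1" by (rule taylor1'[OF admissibleD(1)[OF G]])
        also have "\<dots> \<le> ?c * (X * (b - a)) * M 1"
        proof (intro mult_right_mono mult_left_mono)
          have "X * (s - a) \<le> X * (b - a)" using s X(1) by (intro mult_left_mono) auto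
          then show "norm (x s - x a) \<le> X * (b - a)" using X(2)[OF aT sT[OF s]] s by simp
        qed (auto intro: Cb_le_nonneg[OF admissibleD(1)[OF G]])
        finally show "\<bar>f s - G s (x a)\<bar> \<le> ?c * X * M 1 * (b - a)" by (simp add: f_def x_def mult_ac)
      qed
      ultimately show ?thesis by (simp only: rr)
    qed
    have T0: "\<bar>w b (x a) - w a (x a) - trace ((cov A Q b - cov A Q a) ** hess (w a) (x a)) - (LINT s:{a..b}|lborel. G s (x a))\<bar> \<le> K0 * r"
      unfolding r_def by (rule K0[OF a ab b])
    show ?thesis
      using T0 T1 T2 T3 T4 unfolding L KK_def r_def[symmetric] distrib_right by linarith
  qed
  then show "\<exists>K. \<forall>a b. 0 \<le> a \<longrightarrow> a \<le> b \<longrightarrow> b \<le> T \<longrightarrow>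
      \<bar>duhamel (cov A Q) [] G b (mexp A b *v z) - duhamel (cov A Q) [] G a (mexp A a *v z) - ((LINT s:{a..b}|lborel. f s) + (LINT s:{a..b}|lborel. l s))\<bar> \<le> K * (b - a)\<^sup>2"
    unfolding w_def x_def by blast
qed


text \<open>The drift arises from the motion of the point, the second-order part from the growth of
  the covariance. \<open>F\<close> is the defect in the integral equation: its increments are of
  quadratic order by \<open>solution_increment\<close>, so it is constant, and it vanishes at
  0.\<close>

lemma solution:
  fixes A :: "real^'n^'n" and G :: "real \<Rightarrow> real^'n \<Rightarrow> real"
  assumes T: "0 < T" and Q: "continuous_on {0..T} Q" and p: "\<And>t. t \<in> {0..T} \<Longrightarrow> psd (Q t)" and G: "admissible M G"
    and u_def: "u = (\<lambda>t z. duhamel (cov A Q) [] G t (mexp A t *v z))"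
    and L_def: "L = (\<lambda>t g z. trace (Q t ** hess g z) + (A *v z) \<bullet> grad g z)"
  shows "is_solution T L (\<lambda>t z. G t (mexp A t *v z)) u"
    and "continuous_on {0..T} (\<lambda>s. L s (u s) z)"
proof -
  obtain \<Lambda> where C: "psd_incr T \<Lambda> (cov A Q)" using cov_psd_incr[OF Q p] by blast
  define w where "w = duhamel (cov A Q) [] G"
  have Cw: "Cb_le (\<lambda>k. T * M k) (w t)" if "t \<in> {0..T}" for t
    unfolding w_def by (rule Cb_le_duhamel(1)[OF C G that])
  have u: "u t = (\<lambda>z. w t (mexp A t *v z))" for t by (simp add: u_def w_def)
  define l where "l z s = trace (cov_density A Q s ** hess (w s) (mexp A s *v z)) + (mexp A s *v (A *v z)) \<bullet> grad (w s) (mexp A s *v z)" for z s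
  have Ll: "L s (u s) z = l z s" if "s \<in> {0..T}" for s z
    unfolding L_def u l_def trace_hess_linear[OF Cw[OF that]] grad_linear[OF Cw[OF that]] cov_density_def ..
  note step = solution_increment[where A=A, OF T Q p G refl, folded w_def]
  have lc: "continuous_on {0..T} (l z)" for z
    unfolding l_def[abs_def] by (rule step(1)[OF _ refl])
  then show "continuous_on {0..T} (\<lambda>s. L s (u s) z)"
    by (rule continuous_on_cong[THEN iffD1, OF refl, rotated]) (use Ll in auto)
  let ?f = "\<lambda>t z. G t (mexp A t *v z)"
  have fi: "set_integrable lborel {a..b} (\<lambda>s. ?f s z)" for a b z
    by (rule set_integrable_bounded(1)[OF admissible_path_measurable[OF G mexp_path_cont]]) (rule Cb_le_bound[OF admissibleD(1)[OF G]])
  show "is_solution T L ?f u"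
    unfolding is_solution_def
  proof (intro conjI ballI allI)
    have "\<bar>u t z\<bar> \<le> T * M 0" if "t \<in> {0..T}" for t z
      unfolding u by (rule Cb_le_bound[OF Cw[OF that]])
    then show "bounded ((\<lambda>(t, z). u t z) ` ({0..T} \<times> UNIV))"
      unfolding bounded_real by force
    have "continuous_on ({0..T} \<times> UNIV) ((\<lambda>(t, x). w t x) \<circ> (\<lambda>(t, z). (t, mexp A t *v z)))"
      by (rule continuous_on_compose[OF flow_joint_cont continuous_on_subset[OF duhamel_joint_cont[OF C G, folded w_def]]]) auto
    then show "continuous_on ({0..T} \<times> UNIV) (\<lambda>(t, z). u t z)"
      by (simp add: u o_def case_prod_unfold)
    fix t assume t: "t \<in> {0..T}"
    obtain q where "\<And>i j. \<bar>mexp A t $ i $ j\<bar> \<le> q" using mexp_entry_bound[of T A] t by force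
    then show "C_k 2 (u t)" unfolding u by (rule Cb_le_C_k[OF Cb_le_linear[OF _ Cw[OF t]]])
    fix z
    have li: "set_integrable lborel {0..b} (l z)" if "b \<in> {0..T}" for b
      by (rule set_integrable_continuous[OF continuous_on_subset[OF lc]]) (use that in auto)
    have e: "s \<in> {0..t} \<Longrightarrow> ?f s z + L s (u s) z = ?f s z + l z s" for s using Ll t by auto
    show "set_integrable lborel {0..t} (\<lambda>s. ?f s z + L s (u s) z)"
      by (rule set_integrable_cong[THEN iffD2, OF refl refl e]) (use set_integral_add(1)[OF fi li[OF t]] in auto)
    have e2: "(LINT s:{0..t}|lborel. ?f s z + L s (u s) z) = (LINT s:{0..t}|lborel. ?f s z) + (LINT s:{0..t}|lborel. l z s)"
    proof -
      have "(LINT s:{0..t}|lborel. ?f s z + L s (u s) z) = (LINT s:{0..t}|lborel. ?f s z + l z s)"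
        by (rule set_lebesgue_integral_cong) (use e in auto)
      then show ?thesis using set_integral_add(2)[OF fi li[OF t]] by simp
    qed
    define F where "F b = w b (mexp A b *v z) - ((LINT s:{0..b}|lborel. ?f s z) + (LINT s:{0..b}|lborel. l z s))" for b
    obtain K where K: "\<And>a b. 0 \<le> a \<Longrightarrow> a \<le> b \<Longrightarrow> b \<le> T \<Longrightarrow>
      \<bar>w b (mexp A b *v z) - w a (mexp A a *v z) - ((LINT s:{a..b}|lborel. ?f s z) + (LINT s:{a..b}|lborel. l z s))\<bar> \<le> K * (b - a)\<^sup>2"
      using step(2)[where z=z, OF _ refl] unfolding l_def[abs_def] by blast
    have "F t = F 0"
    proof (rule quad_const[OF _ t])
      fix a b :: real assume ab: "0 \<le> a" "a \<le> b" "b \<le> T"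
      then have bT: "b \<in> {0..T}" by auto
      have "F b - F a = w b (mexp A b *v z) - w a (mexp A a *v z) - ((LINT s:{a..b}|lborel. ?f s z) + (LINT s:{a..b}|lborel. l z s))"
        unfolding F_def lint_combine[OF fi ab(1,2)] lint_combine[OF li[OF bT] ab(1,2)] by simp
      then show "\<bar>F b - F a\<bar> \<le> K * (b - a)\<^sup>2" using K[OF ab] by simp
    qed
    moreover have "F 0 = 0"
    proof -
      have z: "(LINT s:{0..0}|lborel. h s) = 0" for h :: "real \<Rightarrow> real"
      proof -
        have "indicator {0..0::real} s *\<^sub>R h s = indicator {0..0} s *\<^sub>R h 0" for s by (auto simp: indicator_def)
        note e = this
        show ?thesis unfolding set_lebesgue_integral_def e by simp
      qed
      show ?thesis unfolding F_def w_def duhamel_def z by simp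
    qed
    ultimately have "F t = 0" by (simp only:)
    then show "u t z = (LINT s:{0..t}|lborel. ?f s z + L s (u s) z)"
      unfolding e2 F_def u[of t] by (simp only: right_minus_eq)
  qed
qed

section \<open>Uniqueness\<close>

definition hess_form :: "(real^'n \<Rightarrow> real) \<Rightarrow> real^'n \<Rightarrow> real^'n \<Rightarrow> real" where
  "hess_form g z h = (\<Sum>i\<in>UNIV. \<Sum>j\<in>UNIV. h $ i * h $ j * partial i (partial j g) z)"

definition D2 :: "(real^'n \<Rightarrow> real) \<Rightarrow> real^'n \<Rightarrow> real^'n \<Rightarrow> real" where
  "D2 g z h = g (z + h) + g (z - h) - 2 * g z"

lemma C2D:
  assumes "C_k 2 g"
  shows "(g has_derivative (\<lambda>h. \<Sum>i\<in>UNIV. h $ i * partial i g z)) (at z)"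
    and "(partial j g has_derivative (\<lambda>h. \<Sum>i\<in>UNIV. h $ i * partial i (partial j g) z)) (at z)"
    and "continuous_on S (partial i (partial j g))" and "continuous_on S (partial j g)"
proof -
  have "C_k (Suc (Suc 0)) g" using assms by (simp only: numeral_2_eq_2)
  then have d: "\<And>z. g differentiable (at z)" "\<And>z j. partial j g differentiable (at z)"
    "\<And>i j. continuous_on UNIV (partial i (partial j g))" by auto
  show "(g has_derivative (\<lambda>h. \<Sum>i\<in>UNIV. h $ i * partial i g z)) (at z)"
    "(partial j g has_derivative (\<lambda>h. \<Sum>i\<in>UNIV. h $ i * partial i (partial j g) z)) (at z)"
    by (intro has_derivative_partials d)+
  then show "continuous_on S (partial j g)"
    by (meson d(2) continuous_at_imp_continuous_on differentiable_imp_continuous_within)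
  show "continuous_on S (partial i (partial j g))" using continuous_on_subset[OF d(3)] by blast
qed

lemma C2_line:
  assumes "C_k 2 g"
  shows "((\<lambda>s. g (z + s *\<^sub>R h)) has_real_derivative dd h g (z + s *\<^sub>R h)) (at s)"
    and "((\<lambda>s. dd h g (z + s *\<^sub>R h)) has_real_derivative hess_form g (z + s *\<^sub>R h) h) (at s)"
proof -
  have l: "((\<lambda>s. f (z + s *\<^sub>R h)) has_real_derivative (\<Sum>i\<in>UNIV. h $ i * f' i)) (at s)"
    if "(f has_derivative (\<lambda>h. \<Sum>i\<in>UNIV. h $ i * f' i)) (at (z + s *\<^sub>R h))" for f :: "real^'a \<Rightarrow> real" and f'
  proof -
    have "((\<lambda>s. f (z + s *\<^sub>R h)) has_derivative (\<lambda>t. \<Sum>i\<in>UNIV. (t *\<^sub>R h) $ i * f' i)) (at s)"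
      by (rule has_derivative_compose[where f="\<lambda>s. z + s *\<^sub>R h" and f'="\<lambda>t. t *\<^sub>R h", OF _ that])
        (auto intro!: derivative_eq_intros)
    then show ?thesis
      unfolding has_field_derivative_def
      by (rule has_derivative_eq_rhs) (simp add: sum_distrib_right sum_distrib_left mult_ac fun_eq_iff)
  qed
  show "((\<lambda>s. g (z + s *\<^sub>R h)) has_real_derivative dd h g (z + s *\<^sub>R h)) (at s)"
    unfolding dd_def by (rule l[OF C2D(1)[OF assms]])
  have "((\<lambda>s. \<Sum>j\<in>UNIV. h $ j * partial j g (z + s *\<^sub>R h)) has_real_derivative
     (\<Sum>j\<in>UNIV. h $ j * (\<Sum>i\<in>UNIV. h $ i * partial i (partial j g) (z + s *\<^sub>R h)))) (at s)"
    by (intro DERIV_sum DERIV_cmult l C2D(2)[OF assms])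
  moreover have "(\<Sum>j\<in>UNIV. h $ j * (\<Sum>i\<in>UNIV. h $ i * partial i (partial j g) (z + s *\<^sub>R h))) = hess_form g (z + s *\<^sub>R h) h"
    unfolding hess_form_def by (subst sum.swap) (simp add: sum_distrib_left mult_ac)
  ultimately show "((\<lambda>s. dd h g (z + s *\<^sub>R h)) has_real_derivative hess_form g (z + s *\<^sub>R h) h) (at s)"
    by (simp add: dd_def)
qed

lemma taylor_exact:
  assumes g: "C_k 2 g"
  shows "\<exists>\<theta>. 0 < \<theta> \<and> \<theta> < 1 \<and> g (z + h) = g z + dd h g z + hess_form g (z + \<theta> *\<^sub>R h) h / 2"
proof -
  define diff where "diff m s = (if m = 0 then g (z + s *\<^sub>R h) else if m = 1 then dd h g (z + s *\<^sub>R h) else hess_form g (z + s *\<^sub>R h) h)" for m :: nat and s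
  have "\<exists>t>0. t < 1 \<and> diff 0 1 = (\<Sum>m<2. diff m 0 / fact m * 1 ^ m) + diff 2 t / fact 2 * 1 ^ 2"
  proof (rule Maclaurin)
    show "\<forall>m t. m < 2 \<and> 0 \<le> t \<and> t \<le> 1 \<longrightarrow> (diff m has_real_derivative diff (Suc m) t) (at t)"
    proof (intro allI impI)
      fix m :: nat and t :: real assume "m < 2 \<and> 0 \<le> t \<and> t \<le> 1"
      then have "m = 0 \<or> m = 1" by auto
      then show "(diff m has_real_derivative diff (Suc m) t) (at t)"
        using C2_line(1)[OF g, where z=z and h=h and s=t] C2_line(2)[OF g, where z=z and h=h and s=t] by (auto simp: diff_def[abs_def])
    qed
  qed auto
  then show ?thesis by (auto simp: diff_def eval_nat_numeral)
qed

text \<open>Taylor's formula for the even function s |-> g (z + s h) + g (z - s h), whose derivative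
  vanishes at 0; therefore the same \<theta> occurs in both Hessian forms.\<close>

lemma D2_taylor:
  assumes g: "C_k 2 g"
  shows "\<exists>\<theta>. 0 < \<theta> \<and> \<theta> < 1 \<and> D2 g z h = (hess_form g (z + \<theta> *\<^sub>R h) h + hess_form g (z + (- \<theta>) *\<^sub>R h) h) / 2"
proof -
  define diff where "diff m s = (if m = 0 then g (z + s *\<^sub>R h) + g (z + (- s) *\<^sub>R h) else if m = 1 then dd h g (z + s *\<^sub>R h) - dd h g (z + (- s) *\<^sub>R h)
     else hess_form g (z + s *\<^sub>R h) h + hess_form g (z + (- s) *\<^sub>R h) h)" for m :: nat and s
  have "\<exists>t>0. t < 1 \<and> diff 0 1 = (\<Sum>m<2. diff m 0 / fact m * 1 ^ m) + diff 2 t / fact 2 * 1 ^ 2"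
  proof (rule Maclaurin)
    show "\<forall>m t. m < 2 \<and> 0 \<le> t \<and> t \<le> 1 \<longrightarrow> (diff m has_real_derivative diff (Suc m) t) (at t)"
    proof (intro allI impI)
      fix m :: nat and t :: real assume "m < 2 \<and> 0 \<le> t \<and> t \<le> 1"
      then have m: "m = 0 \<or> m = 1" by auto
      have n: "((\<lambda>s. f (- s)) has_real_derivative (- f')) (at t)" if "(f has_real_derivative f') (at (- t))" for f :: "real \<Rightarrow> real" and f'
        by (rule DERIV_mirror[THEN iffD1, OF that])
      have 0: "((\<lambda>s. g (z + s *\<^sub>R h) + g (z + (- s) *\<^sub>R h)) has_real_derivative (dd h g (z + t *\<^sub>R h) + - dd h g (z + (- t) *\<^sub>R h))) (at t)"
        by (rule DERIV_add[OF C2_line(1)[OF g] n[OF C2_line(1)[OF g]]])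
      have 1: "((\<lambda>s. dd h g (z + s *\<^sub>R h) - dd h g (z + (- s) *\<^sub>R h)) has_real_derivative (hess_form g (z + t *\<^sub>R h) h - - hess_form g (z + (- t) *\<^sub>R h) h)) (at t)"
        by (rule DERIV_diff[OF C2_line(2)[OF g] n[OF C2_line(2)[OF g]]])
      show "(diff m has_real_derivative diff (Suc m) t) (at t)"
        using m 0 1 by (auto simp: diff_def[abs_def])
    qed
  qed auto
  then obtain t where t: "0 < t" "t < 1" and d: "diff 0 1 = (\<Sum>m<2. diff m 0 / fact m * 1 ^ m) + diff 2 t / fact 2 * 1 ^ 2"
    by blast
  have "diff 0 1 = diff 0 0 + diff 1 0 + diff 2 t / 2"
    using d by (simp add: numeral_2_eq_2)
  moreover have "diff 0 1 = g (z + h) + g (z - h)" "diff 0 0 = 2 * g z" "diff 1 0 = 0"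
    "diff 2 t = hess_form g (z + t *\<^sub>R h) h + hess_form g (z + (- t) *\<^sub>R h) h"
    by (simp_all add: diff_def)
  ultimately have "D2 g z h = (hess_form g (z + t *\<^sub>R h) h + hess_form g (z + (- t) *\<^sub>R h) h) / 2"
    by (simp add: D2_def)
  with t show ?thesis by blast
qed

lemma hess_form_scale: "hess_form g z (c *\<^sub>R h) = c\<^sup>2 * hess_form g z h"
  by (simp add: hess_form_def sum_distrib_left power2_eq_square mult_ac)

lemma dd_scale: "dd (c *\<^sub>R h) g z = c * dd h g z"
  by (simp add: dd_def sum_distrib_left mult_ac)

lemma hess_form_diff_bound:
  "\<bar>hess_form g y h - hess_form g z h\<bar> \<le> (\<Sum>i\<in>UNIV. \<Sum>j\<in>UNIV. \<bar>partial i (partial j g) y - partial i (partial j g) z\<bar>) * (norm h)\<^sup>2"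
proof -
  have "\<bar>hess_form g y h - hess_form g z h\<bar> = \<bar>\<Sum>i\<in>UNIV. \<Sum>j\<in>UNIV. h $ i * h $ j * (partial i (partial j g) y - partial i (partial j g) z)\<bar>"
    by (simp add: hess_form_def sum_subtractf[symmetric] algebra_simps)
  also have "\<dots> \<le> (\<Sum>i\<in>UNIV. \<Sum>j\<in>UNIV. \<bar>h $ i * h $ j * (partial i (partial j g) y - partial i (partial j g) z)\<bar>)"
    by (rule order_trans[OF sum_abs sum_mono[OF sum_abs]])
  also have "\<dots> \<le> (\<Sum>i\<in>UNIV. \<Sum>j\<in>UNIV. \<bar>partial i (partial j g) y - partial i (partial j g) z\<bar> * (norm h)\<^sup>2)"
  proof (intro sum_mono)
    fix i j
    have "\<bar>h $ i\<bar> * \<bar>h $ j\<bar> \<le> norm h * norm h"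
      by (intro mult_mono component_le_norm_cart) auto
    from mult_right_mono[OF this, of "\<bar>partial i (partial j g) y - partial i (partial j g) z\<bar>"]
    show "\<bar>h $ i * h $ j * (partial i (partial j g) y - partial i (partial j g) z)\<bar> \<le> \<bar>partial i (partial j g) y - partial i (partial j g) z\<bar> * (norm h)\<^sup>2"
      by (simp add: abs_mult power2_eq_square mult_ac)
  qed
  finally show ?thesis by (simp add: sum_distrib_right)
qed

lemma hess_form_bound: "\<bar>hess_form g z h\<bar> \<le> (\<Sum>i\<in>UNIV. \<Sum>j\<in>UNIV. \<bar>partial i (partial j g) z\<bar>) * (norm h)\<^sup>2"
proof -
  have "\<bar>hess_form g z h\<bar> \<le> (\<Sum>i\<in>UNIV. \<Sum>j\<in>UNIV. \<bar>h $ i * h $ j * partial i (partial j g) z\<bar>)"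
    unfolding hess_form_def by (rule order_trans[OF sum_abs sum_mono[OF sum_abs]])
  also have "\<dots> \<le> (\<Sum>i\<in>UNIV. \<Sum>j\<in>UNIV. \<bar>partial i (partial j g) z\<bar> * (norm h)\<^sup>2)"
  proof (intro sum_mono)
    fix i j
    have "\<bar>h $ i\<bar> * \<bar>h $ j\<bar> \<le> norm h * norm h"
      by (intro mult_mono component_le_norm_cart) auto
    from mult_right_mono[OF this, of "\<bar>partial i (partial j g) z\<bar>"]
    show "\<bar>h $ i * h $ j * partial i (partial j g) z\<bar> \<le> \<bar>partial i (partial j g) z\<bar> * (norm h)\<^sup>2"
      by (simp add: abs_mult power2_eq_square mult_ac)
  qed
  finally show ?thesis by (simp add: sum_distrib_right)
qed

text \<open>
  A condition on a time slice that involves no derivative, and so is closed under pointwise limits, but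
  bounds the first and second derivatives. Every \<open>C\<^sup>2\<close> function satisfies it for some m.
\<close>

definition D2_control :: "real \<Rightarrow> real \<Rightarrow> real \<Rightarrow> (real^'n \<Rightarrow> real) \<Rightarrow> bool" where
  "D2_control R \<eta> m g \<longleftrightarrow> (\<forall>z h. norm z \<le> R \<longrightarrow> norm h \<le> 1 \<longrightarrow>
     \<bar>g (z + h) - g z\<bar> \<le> m * norm h \<and> \<bar>D2 g z h\<bar> \<le> m * (norm h)\<^sup>2 \<and>
     (m * norm h \<le> 1 \<longrightarrow> (\<forall>k\<ge>1::nat. (real k)\<^sup>2 * D2 g z ((1 / real k) *\<^sub>R h) \<le> D2 g z h + \<eta> * (norm h)\<^sup>2)))"

text \<open>The points z + h with |h| \<le> 1 lie in the compact ball of radius R + 1, on which the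
  derivatives are bounded and the second ones uniformly continuous. The number m plays two roles: it
  bounds the derivatives, and m |h| \<le> 1 restricts h to a scale at which the Hessian form varies
  by at most \<eta> / 2 times |h|^2.\<close>

lemma D2_control_ex:
  fixes g :: "real^'n \<Rightarrow> real"
  assumes g: "C_k 2 g" and \<eta>: "0 < \<eta>"
  shows "\<exists>m::nat. D2_control R \<eta> (real (Suc m)) g"
proof -
  let ?S = "cball 0 (R + 1) :: (real^'n) set"
  have c2: "continuous_on S (partial i (partial j g))" for i j S by (rule C2D(3)[OF g])
  have "compact ((\<lambda>z. \<Sum>i\<in>UNIV. \<Sum>j\<in>UNIV. \<bar>partial i (partial j g) z\<bar>) ` ?S)"
    by (intro compact_continuous_image continuous_on_sum continuous_on_rabs c2 compact_cball)
  then obtain B where B0: "\<And>z. z \<in> ?S \<Longrightarrow> \<bar>\<Sum>i\<in>UNIV. \<Sum>j\<in>UNIV. \<bar>partial i (partial j g) z\<bar>\<bar> \<le> B"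
    by (meson compact_imp_bounded bounded_real imageI)
  have B: "\<bar>hess_form g z h\<bar> \<le> B * (norm h)\<^sup>2" if "z \<in> ?S" for z h
    using hess_form_bound[of g z h] abs_le_D1[OF B0[OF that]] mult_right_mono[of _ B "(norm h)\<^sup>2"] by (meson order_trans zero_le_power2)
  have "compact ((\<lambda>z. \<Sum>i\<in>UNIV. \<bar>partial i g z\<bar>) ` ?S)"
    by (intro compact_continuous_image continuous_on_sum continuous_on_rabs C2D(4)[OF g] compact_cball)
  then obtain B' where B'0: "\<And>z. z \<in> ?S \<Longrightarrow> \<bar>\<Sum>i\<in>UNIV. \<bar>partial i g z\<bar>\<bar> \<le> B'"
    by (meson compact_imp_bounded bounded_real imageI)
  have B': "\<bar>dd h g z\<bar> \<le> B' * norm h" if "z \<in> ?S" for z h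
  proof -
    have "\<bar>dd h g z\<bar> \<le> (\<Sum>i\<in>UNIV. \<bar>h $ i * partial i g z\<bar>)" unfolding dd_def by (rule sum_abs)
    also have "\<dots> \<le> (\<Sum>i\<in>UNIV. \<bar>partial i g z\<bar> * norm h)"
      by (intro sum_mono, subst mult.commute) (simp add: abs_mult mult_left_mono component_le_norm_cart)
    also have "\<dots> = (\<Sum>i\<in>UNIV. \<bar>partial i g z\<bar>) * norm h" by (simp only: sum_distrib_right)
    also have "\<dots> \<le> B' * norm h" by (rule mult_right_mono[OF abs_le_D1[OF B'0[OF that]] norm_ge_zero])
    finally show ?thesis .
  qed
  \<comment> \<open>The tolerance is shared among all entries of the Hessian, so that the form as a
    whole varies by at most \<eta> / 2.\<close>
  have "\<exists>d>0. \<forall>y\<in>?S. \<forall>z\<in>?S. dist z y < d \<longrightarrow> \<bar>partial i (partial j g) z - partial i (partial j g) y\<bar> < \<eta> / (2 * (real CARD('n))\<^sup>2)" for i j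
  proof -
    have "uniformly_continuous_on ?S (partial i (partial j g))"
      by (rule compact_uniformly_continuous[OF c2 compact_cball])
    then show ?thesis unfolding uniformly_continuous_on_def dist_real_def
      using \<eta> by (metis divide_pos_pos mult_pos_pos of_nat_0_less_iff zero_less_card_finite zero_less_numeral zero_less_power)
  qed
  then obtain d where d: "\<And>i j. 0 < d i j" "\<And>i j y z. y \<in> ?S \<Longrightarrow> z \<in> ?S \<Longrightarrow> dist z y < d i j \<Longrightarrow>
     \<bar>partial i (partial j g) z - partial i (partial j g) y\<bar> < \<eta> / (2 * (real CARD('n))\<^sup>2)" by metis
  define dm where "dm = Min (range (\<lambda>p. d (fst p) (snd p)))"
  have dm: "0 < dm" "dm \<le> d i j" for i j
  proof -
    show "0 < dm" unfolding dm_def by (subst Min_gr_iff) (auto simp: d(1))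
    show "dm \<le> d i j" unfolding dm_def by (rule Min_le) (auto intro: image_eqI[of _ _ "(i, j)"])
  qed
  have osc: "\<bar>hess_form g y h - hess_form g z h\<bar> \<le> \<eta> / 2 * (norm h)\<^sup>2" if "y \<in> ?S" "z \<in> ?S" "dist y z < dm" for y z h
  proof -
    have "(\<Sum>i\<in>UNIV. \<Sum>j\<in>UNIV. \<bar>partial i (partial j g) y - partial i (partial j g) z\<bar>) \<le> (\<Sum>i\<in>(UNIV::'n set). \<Sum>j\<in>(UNIV::'n set). \<eta> / (2 * (real CARD('n))\<^sup>2))"
      by (intro sum_mono less_imp_le d(2)[OF that(2,1)] order_less_le_trans[OF that(3) dm(2)])
    also have "\<dots> = \<eta> / 2" by (simp add: power2_eq_square)
    finally have "(\<Sum>i\<in>UNIV. \<Sum>j\<in>UNIV. \<bar>partial i (partial j g) y - partial i (partial j g) z\<bar>) \<le> \<eta> / 2" .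
    from mult_right_mono[OF this zero_le_power2[of "norm h"]] hess_form_diff_bound[of g y h z] show ?thesis by linarith
  qed
  \<comment> \<open>The lower bound \<open>2 / dm\<close> makes \<open>m * norm h \<le> 1\<close>
    imply \<open>norm h \<le> dm / 2\<close>.\<close>
  obtain m :: nat where m: "max (max B B') (2 / dm) \<le> real m" using real_arch_simple by blast
  let ?m = "real (Suc m)"
  have mm: "B \<le> ?m" "B' \<le> ?m" "2 / dm \<le> ?m" using m by auto
  have inS: "z + \<theta> *\<^sub>R h \<in> ?S" if "norm z \<le> R" "norm h \<le> 1" "\<bar>\<theta>\<bar> \<le> 1" for z h :: "real^'n" and \<theta>
  proof -
    have "norm (z + \<theta> *\<^sub>R h) \<le> norm z + \<bar>\<theta>\<bar> * norm h" by (metis norm_scaleR norm_triangle_ineq)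
    also have "\<dots> \<le> R + 1" using that mult_le_one[of "\<bar>\<theta>\<bar>" "norm h"] by simp
    finally show ?thesis by simp
  qed
  have "D2_control R \<eta> ?m g"
    unfolding D2_control_def
  proof (intro allI impI conjI)
    fix z h :: "real^'n" assume z: "norm z \<le> R" and h: "norm h \<le> 1"
    have zS: "z \<in> ?S" using z by simp
    show "\<bar>g (z + h) - g z\<bar> \<le> ?m * norm h"
    proof -
      have "\<exists>t>0. t < 1 \<and> g (z + 1 *\<^sub>R h) - g (z + 0 *\<^sub>R h) = (1 - 0) * dd h g (z + t *\<^sub>R h)"
        by (rule MVT2) (use C2_line(1)[OF g] in auto)
      then obtain t where t: "0 < t" "t < 1" "g (z + h) - g z = dd h g (z + t *\<^sub>R h)" by auto
      have "\<bar>dd h g (z + t *\<^sub>R h)\<bar> \<le> B' * norm h" by (rule B'[OF inS[OF z h]]) (use t in auto)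
      also have "\<dots> \<le> ?m * norm h" by (rule mult_right_mono[OF mm(2)]) simp
      finally show ?thesis using t(3) by simp
    qed
    show "\<bar>D2 g z h\<bar> \<le> ?m * (norm h)\<^sup>2"
    proof -
      obtain t where t: "0 < t" "t < 1" "D2 g z h = (hess_form g (z + t *\<^sub>R h) h + hess_form g (z + (- t) *\<^sub>R h) h) / 2"
        using D2_taylor[OF g] by blast
      have "\<bar>hess_form g (z + t *\<^sub>R h) h\<bar> \<le> B * (norm h)\<^sup>2" "\<bar>hess_form g (z + (- t) *\<^sub>R h) h\<bar> \<le> B * (norm h)\<^sup>2"
        using t by (auto intro!: B inS[OF z h] simp del: scaleR_minus_left)
      then have "\<bar>D2 g z h\<bar> \<le> B * (norm h)\<^sup>2" unfolding t(3) add_divide_distrib by linarith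
      also have "\<dots> \<le> ?m * (norm h)\<^sup>2" by (rule mult_right_mono[OF mm(1)]) simp
      finally show ?thesis .
    qed
    fix k :: nat assume mh: "?m * norm h \<le> 1" and k: "1 \<le> k"
    have close: "\<bar>D2 g z h' - hess_form g z h'\<bar> \<le> \<eta> / 2 * (norm h')\<^sup>2" if h': "norm h' \<le> norm h" for h'
    proof -
      obtain t where t: "0 < t" "t < 1" "D2 g z h' = (hess_form g (z + t *\<^sub>R h') h' + hess_form g (z + (- t) *\<^sub>R h') h') / 2"
        using D2_taylor[OF g] by blast
      have h'1: "norm h' \<le> 1" using h' h by simp
      have "2 / dm * norm h \<le> 1" using mult_right_mono[OF mm(3) norm_ge_zero[of h]] mh by linarith
      then have "norm h \<le> dm / 2" using dm(1) by (simp add: field_simps)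
      then have hd: "norm h' < dm" using h' dm(1) by linarith
      have "\<bar>hess_form g (z + s *\<^sub>R h') h' - hess_form g z h'\<bar> \<le> \<eta> / 2 * (norm h')\<^sup>2" if "\<bar>s\<bar> \<le> 1" for s
      proof (rule osc[OF inS[OF z h'1 that] zS])
        have "\<bar>s\<bar> * norm h' \<le> 1 * norm h'" by (rule mult_right_mono[OF that]) simp
        then show "dist (z + s *\<^sub>R h') z < dm" using hd by (simp add: dist_norm)
      qed
      from half_diff_bound[OF this[of t] this[of "- t"]] t(1,2) show ?thesis
        unfolding t(3) by simp
    qed
    let ?h = "(1 / real k) *\<^sub>R h"
    have "norm h * 1 \<le> norm h * real k" using k by (intro mult_left_mono) auto
    then have nk: "norm ?h \<le> norm h" using k by (simp add: divide_le_eq)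
    have k2: "(real k)\<^sup>2 * (norm ?h)\<^sup>2 = (norm h)\<^sup>2" "(real k)\<^sup>2 * hess_form g z ?h = hess_form g z h"
      using k by (simp_all add: hess_form_scale power_divide)
    have "D2 g z ?h \<le> hess_form g z ?h + \<eta> / 2 * (norm ?h)\<^sup>2" using abs_le_D1[OF close[OF nk]] by linarith
    from mult_left_mono[OF this zero_le_power2[of "real k"]]
    have "(real k)\<^sup>2 * D2 g z ?h \<le> (real k)\<^sup>2 * hess_form g z ?h + \<eta> / 2 * ((real k)\<^sup>2 * (norm ?h)\<^sup>2)"
      by (simp only: distrib_left mult_ac)
    also have "\<dots> = hess_form g z h + \<eta> / 2 * (norm h)\<^sup>2" unfolding k2 ..
    also have "\<dots> \<le> D2 g z h + \<eta> * (norm h)\<^sup>2" using abs_le_D2[OF close[of h]] by linarith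
    finally show "(real k)\<^sup>2 * D2 g z ?h \<le> D2 g z h + \<eta> * (norm h)\<^sup>2" .
  qed
  then show ?thesis by blast
qed

text \<open>The squared factor restores homogeneity: by \<open>D2_taylor\<close> the scaled
  difference is the Hessian form of h itself, averaged over two points that converge to z.\<close>

lemma D2_lim:
  assumes g: "C_k 2 g"
  shows "(\<lambda>k. (real (Suc k))\<^sup>2 * D2 g z ((1 / real (Suc k)) *\<^sub>R h)) \<longlonglongrightarrow> hess_form g z h"
proof -
  have "\<exists>\<theta>. 0 < \<theta> \<and> \<theta> < 1 \<and> D2 g z ((1 / real (Suc k)) *\<^sub>R h) =
    (hess_form g (z + \<theta> *\<^sub>R ((1 / real (Suc k)) *\<^sub>R h)) ((1 / real (Suc k)) *\<^sub>R h) + hess_form g (z + (- \<theta>) *\<^sub>R ((1 / real (Suc k)) *\<^sub>R h)) ((1 / real (Suc k)) *\<^sub>R h)) / 2" for k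
    by (rule D2_taylor[OF g])
  then obtain \<theta> where \<theta>: "\<And>k. 0 < \<theta> k" "\<And>k. \<theta> k < 1" "\<And>k. D2 g z ((1 / real (Suc k)) *\<^sub>R h) =
    (hess_form g (z + \<theta> k *\<^sub>R ((1 / real (Suc k)) *\<^sub>R h)) ((1 / real (Suc k)) *\<^sub>R h) + hess_form g (z + (- \<theta> k) *\<^sub>R ((1 / real (Suc k)) *\<^sub>R h)) ((1 / real (Suc k)) *\<^sub>R h)) / 2"
    by metis
  have e: "(real (Suc k))\<^sup>2 * D2 g z ((1 / real (Suc k)) *\<^sub>R h) =
     (hess_form g (z + (\<theta> k / real (Suc k)) *\<^sub>R h) h + hess_form g (z + (- \<theta> k / real (Suc k)) *\<^sub>R h) h) / 2" for k
  proof -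
    have q: "(real (Suc k))\<^sup>2 * (1 / real (Suc k))\<^sup>2 = 1"
      by (simp add: power_divide del: of_nat_Suc)
    have r: "r * ((q * a + q * b) / 2) = (r * q) * ((a + b) / 2)" for r q a b :: real
      by (simp add: algebra_simps)
    show ?thesis unfolding \<theta>(3) hess_form_scale scaleR_scaleR r q by simp
  qed
  have l1: "(\<lambda>k. \<theta> k / real (Suc k)) \<longlonglongrightarrow> 0"
  proof (rule Lim_null_comparison[OF always_eventually LIMSEQ_Suc[OF lim_const_over_n[of 1]]], intro allI)
    fix k show "norm (\<theta> k / real (Suc k)) \<le> 1 / real (Suc k)"
      using \<theta>(1,2)[of k] by (simp add: divide_right_mono less_imp_le)
  qed
  have l2: "(\<lambda>k. - \<theta> k / real (Suc k)) \<longlonglongrightarrow> 0" using tendsto_minus[OF l1] by simp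
  have c: "continuous_on UNIV (\<lambda>y. hess_form g y h)"
    unfolding hess_form_def by (intro continuous_on_sum continuous_on_mult continuous_on_const C2D(3)[OF g])
  have lim: "(\<lambda>k. hess_form g (z + t k *\<^sub>R h) h) \<longlonglongrightarrow> hess_form g z h" if "t \<longlonglongrightarrow> 0" for t
  proof -
    have "(\<lambda>k. z + t k *\<^sub>R h) \<longlonglongrightarrow> z + 0 *\<^sub>R h" by (intro tendsto_intros that)
    then have "(\<lambda>k. z + t k *\<^sub>R h) \<longlonglongrightarrow> z" by simp
    moreover have "isCont (\<lambda>y. hess_form g y h) z" using c by (simp add: continuous_on_eq_continuous_at)
    ultimately show ?thesis by (rule isCont_tendsto_compose[rotated])
  qed
  have "(\<lambda>k. (hess_form g (z + (\<theta> k / real (Suc k)) *\<^sub>R h) h + hess_form g (z + (- \<theta> k / real (Suc k)) *\<^sub>R h) h) / 2) \<longlonglongrightarrow> (hess_form g z h + hess_form g z h) / 2"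
    by (rule tendsto_divide[OF tendsto_add[OF lim[OF l1] lim[OF l2]] tendsto_const]) simp
  then show ?thesis unfolding e by simp
qed

text \<open>Derivative bounds are recovered by shrinking the step to h/k. The last clause of
  \<open>D2_control\<close> compares every h/k with h, so its limit bounds the Hessian form by a
  second difference with the fixed step h, which can be read off from values of g at a visible
  distance.\<close>

lemma D2_control_hess:
  fixes g :: "real^'n \<Rightarrow> real"
  assumes g: "C_k 2 g" and E: "D2_control R \<eta> m g" and z: "norm z \<le> R"
  shows "\<bar>dd h g z\<bar> \<le> m * norm h" and "\<bar>hess_form g z h\<bar> \<le> m * (norm h)\<^sup>2"
    and "norm h \<le> 1 \<Longrightarrow> m * norm h \<le> 1 \<Longrightarrow> hess_form g z h \<le> D2 g z h + \<eta> * (norm h)\<^sup>2"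
proof -
  obtain K :: nat where K: "norm h \<le> real K" using real_arch_simple by blast
  have small: "norm ((1 / real (Suc k)) *\<^sub>R h) \<le> 1" if "K \<le> k" for k
    using K that by (simp add: divide_le_eq)
  show "\<bar>hess_form g z h\<bar> \<le> m * (norm h)\<^sup>2"
  proof (rule LIMSEQ_le_const2[OF tendsto_rabs[OF D2_lim[OF g]]], intro exI[of _ K] allI impI)
    fix k assume "K \<le> k"
    from small[OF this] have "\<bar>D2 g z ((1 / real (Suc k)) *\<^sub>R h)\<bar> \<le> m * (norm ((1 / real (Suc k)) *\<^sub>R h))\<^sup>2"
      using E z unfolding D2_control_def by blast
    from mult_left_mono[OF this zero_le_power2[of "real (Suc k)"]]
    show "\<bar>(real (Suc k))\<^sup>2 * D2 g z ((1 / real (Suc k)) *\<^sub>R h)\<bar> \<le> m * (norm h)\<^sup>2"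
      by (simp add: abs_mult power_divide mult_ac del: of_nat_Suc)
  qed
  show "hess_form g z h \<le> D2 g z h + \<eta> * (norm h)\<^sup>2" if "norm h \<le> 1" "m * norm h \<le> 1"
  proof (rule LIMSEQ_le_const2[OF D2_lim[OF g]], intro exI[of _ 0] allI impI)
    fix k :: nat
    have "1 \<le> Suc k" by simp
    then show "(real (Suc k))\<^sup>2 * D2 g z ((1 / real (Suc k)) *\<^sub>R h) \<le> D2 g z h + \<eta> * (norm h)\<^sup>2"
      using E z that unfolding D2_control_def by blast
  qed
  have "(\<lambda>k. (g (z + (1 / real (Suc k)) *\<^sub>R h) - g z) / (1 / real (Suc k))) \<longlonglongrightarrow> dd h g z"
  proof -
    have "((\<lambda>t. (g (z + t *\<^sub>R h) - g z) / t) \<longlongrightarrow> dd h g z) (at 0)"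
      using C2_line(1)[OF g, of z h 0] by (simp add: has_field_derivative_iff)
    moreover have "filterlim (\<lambda>k. 1 / real (Suc k)) (at 0) sequentially"
      unfolding filterlim_at using LIMSEQ_Suc[OF lim_const_over_n[of 1]] by (auto intro: always_eventually)
    ultimately show ?thesis by (rule filterlim_compose)
  qed
  then show "\<bar>dd h g z\<bar> \<le> m * norm h"
  proof (rule LIMSEQ_le_const2[OF tendsto_rabs], intro exI[of _ K] allI impI)
    fix k assume "K \<le> k"
    from small[OF this] have "\<bar>g (z + (1 / real (Suc k)) *\<^sub>R h) - g z\<bar> \<le> m * norm ((1 / real (Suc k)) *\<^sub>R h)"
      using E z unfolding D2_control_def by blast
    then have "real (Suc k) * \<bar>g (z + (1 / real (Suc k)) *\<^sub>R h) - g z\<bar> \<le> real (Suc k) * (m * norm ((1 / real (Suc k)) *\<^sub>R h))"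
      by (rule mult_left_mono) simp
    also have "\<dots> = m * norm h" by (simp del: of_nat_Suc)
    finally show "\<bar>(g (z + (1 / real (Suc k)) *\<^sub>R h) - g z) / (1 / real (Suc k))\<bar> \<le> m * norm h"
      by (simp add: abs_mult mult.commute del: of_nat_Suc)
  qed
qed

text \<open>2 C is a sum of rank-one matrices, and against each of them the trace is the Hessian
  form of the corresponding vector.\<close>

lemma trace_hess_form:
  assumes p: "psd C" and b: "\<And>a. hess_form g z a \<le> b * (norm a)\<^sup>2"
  shows "trace (C ** hess g z) \<le> b * trace C"
proof -
  have s: "trace ((\<chi> i j. a $ i * a $ j) ** hess g z) = hess_form g z a" for a
    unfolding trace_mult hess_form_def hess_def by (subst sum.swap) (simp add: mult_ac)
  have "trace (gram as ** hess g z) \<le> b * trace (gram as)" for as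
  proof (induction as)
    case Nil
    then show ?case by (simp add: trace_mult trace_def)
  next
    case (Cons a as)
    have "trace (gram (a # as) ** hess g z) = hess_form g z a + trace (gram as ** hess g z)"
      unfolding s[symmetric] gram_simps trace_mult by (simp add: algebra_simps sum.distrib)
    then show ?case using Cons b[of a] unfolding trace_gram_Cons distrib_left by linarith
  qed
  from this[of "factor C"] have "trace (2 *\<^sub>R C ** hess g z) \<le> b * trace (2 *\<^sub>R C)"
    by (simp only: gram_factor[OF p])
  moreover have "trace (2 *\<^sub>R C ** hess g z) = 2 * trace (C ** hess g z)"
    by (simp add: trace_mult sum_distrib_left mult.assoc)
  ultimately show ?thesis unfolding trace_scale by simp
qed

section \<open>Integrals over open sets of times\<close>

lemma lint_Ioo:
  fixes f :: "real \<Rightarrow> real"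
  assumes "set_integrable lborel {a..b} f"
  shows "(LINT s:{a<..<b}|lborel. f s) = (LINT s:{a..b}|lborel. f s)"
proof -
  have "set_integrable lborel {a<..<b} f" by (rule set_integrable_subset[OF assms]) auto
  then show ?thesis using assms
    by (simp add: set_borel_integral_eq_integral integral_open_interval_real)
qed

text \<open>The components of an open subset of an interval are countably many disjoint open
  intervals with endpoints outside the set; the bounds are added over finite unions and passed to
  the limit. The lemma serves an integrand without pointwise bound, whose integral is controlled
  only over whole gaps of a closed set.\<close>

lemma lint_components:
  fixes f :: "real \<Rightarrow> real"
  assumes U: "open U" "U \<subseteq> {p..q}" and f: "set_integrable lborel U f"
    and c: "\<And>a b. a < b \<Longrightarrow> {a<..<b} \<subseteq> U \<Longrightarrow> a \<notin> U \<Longrightarrow> b \<notin> U \<Longrightarrow> (LINT s:{a<..<b}|lborel. f s) \<le> C * (b - a)"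
    and C: "0 \<le> C"
  shows "(LINT s:U|lborel. f s) \<le> C * measure lborel U"
proof -
  define \<C> where "\<C> = components U"
  have disj: "X \<inter> Y = {}" if "X \<in> \<C>" "Y \<in> \<C>" "X \<noteq> Y" for X Y
    using that pairwise_disjoint_components[of U] by (auto simp: \<C>_def pairwise_def disjnt_def)
  have opn: "open X" if "X \<in> \<C>" for X
    using that U(1) open_components by (auto simp: \<C>_def)
  have cnt: "countable \<C>"
    by (rule countable_disjoint_open_subsets) (use opn disj in \<open>auto simp: pairwise_def disjnt_def\<close>)
  have comp: "(LINT s:X|lborel. f s) \<le> C * measure lborel X" if X: "X \<in> \<C>" for X
  proof -
    have ne: "X \<noteq> {}" and con: "connected X" and sub: "X \<subseteq> U"
      using in_components_nonempty[OF X[unfolded \<C>_def]] in_components_connected[OF X[unfolded \<C>_def]]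
        in_components_subset[OF X[unfolded \<C>_def]] by blast+
    have bd: "bdd_below X" "bdd_above X" using sub U(2) by (meson bdd_below_Icc bdd_below_mono order_trans, meson bdd_above_Icc bdd_above_mono order_trans)
    define a where "a = Inf X"
    define b where "b = Sup X"
    have iv: "x \<in> X" if "y \<in> X" "z \<in> X" "y \<le> x" "x \<le> z" for x y z
      using con that unfolding connected_iff_interval by blast
    have anX: "a \<notin> X"
    proof
      assume "a \<in> X"
      then obtain e where "0 < e" "ball a e \<subseteq> X" using opn[OF X] open_contains_ball by blast
      then have "a - e / 2 \<in> X" by (auto simp: subset_iff dist_real_def)
      then have "a \<le> a - e / 2" unfolding a_def by (intro cInf_lower bd)
      then show False using \<open>0 < e\<close> by simp
    qed
    have bnX: "b \<notin> X"
    proof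
      assume "b \<in> X"
      then obtain e where "0 < e" "ball b e \<subseteq> X" using opn[OF X] open_contains_ball by blast
      then have "b + e / 2 \<in> X" by (auto simp: subset_iff dist_real_def)
      then have "b + e / 2 \<le> b" unfolding b_def by (intro cSup_upper bd)
      then show False using \<open>0 < e\<close> by simp
    qed
    have Xeq: "X = {a<..<b}"
    proof (rule subset_antisym)
      show "X \<subseteq> {a<..<b}"
      proof
        fix x assume x: "x \<in> X"
        then have "a \<le> x" "x \<le> b" unfolding a_def b_def using bd by (auto intro: cInf_lower cSup_upper)
        then show "x \<in> {a<..<b}" using x anX bnX by (metis greaterThanLessThan_iff order_le_less)
      qed
      show "{a<..<b} \<subseteq> X"
      proof
        fix x assume x: "x \<in> {a<..<b}"
        obtain y where y: "y \<in> X" "y < x" using cInf_lessD[OF ne, of x] x by (auto simp: a_def)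
        obtain z where z: "z \<in> X" "x < z" using less_cSupD[OF ne, of x] x by (auto simp: b_def)
        show "x \<in> X" using iv[OF y(1) z(1)] y z by simp
      qed
    qed
    have ab: "a < b" using ne Xeq by auto
    \<comment> \<open>By maximality a component cannot be enlarged by an endpoint lying in
      \<open>U\<close>.\<close>
    have out: "x \<notin> U" if x: "x = a \<or> x = b" for x
    proof
      assume xU: "x \<in> U"
      have "connected (insert x X)"
      proof -
        have "insert x X \<subseteq> closure X"
          unfolding Xeq closure_greaterThanLessThan[OF ab] using x ab by auto
        then show ?thesis by (rule connected_intermediate_closure[OF con subset_insertI])
      qed
      then have "insert x X \<subseteq> X"
        using X xU sub components_maximal[of X U "insert x X"] ne by (auto simp: \<C>_def)
      then show False using x anX bnX by auto
    qed
    have "(LINT s:X|lborel. f s) \<le> C * (b - a)"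
      unfolding Xeq by (rule c[OF ab]) (use sub Xeq out in auto)
    then show ?thesis unfolding Xeq using ab by simp
  qed
  show ?thesis
  proof (cases "\<C> = {}")
    case True
    then have "U = {}" by (simp add: \<C>_def)
    then show ?thesis by (simp add: set_lebesgue_integral_def)
  next
    case False
    define X where "X n = from_nat_into \<C> n" for n
    have XC: "X n \<in> \<C>" for n using from_nat_into[OF False] by (simp add: X_def)
    have XU: "(\<Union>n. X n) = U"
      using range_from_nat_into[OF False cnt] Union_components[of U] by (simp add: X_def[abs_def] \<C>_def)
    define B where "B n = (\<Union>k<n. X k)" for n
    have "open (B n)" for n
      unfolding B_def by (intro open_UN ballI opn XC)
    then have bor: "B n \<in> sets lborel" for n by simp
    have BU: "B n \<subseteq> U" for n using XU by (auto simp: B_def)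
    have fin: "emeasure lborel U < \<infinity>"
      by (rule order_le_less_trans[OF emeasure_mono[OF U(2)]]) (auto simp: emeasure_lborel_Icc_eq)
    have finS: "S \<subseteq> U \<Longrightarrow> S \<in> sets lborel \<Longrightarrow> S \<in> fmeasurable lborel" for S
      unfolding fmeasurable_def using emeasure_mono[of S U lborel] fin U(1) by (auto intro: order_le_less_trans)
    have step: "(LINT s:B n|lborel. f s) \<le> C * measure lborel (B n)" for n
    proof (induction n)
      case 0
      then show ?case by (simp add: B_def set_lebesgue_integral_def)
    next
      case (Suc n)
      have Bs: "B (Suc n) = B n \<union> X n" by (auto simp: B_def less_Suc_eq)
      \<comment> \<open>The enumeration repeats members when there are finitely many components, so
        the n-th one may already be covered.\<close>
      show ?case
      proof (cases "X n \<subseteq> B n")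
        case True
        then show ?thesis using Suc Bs by (simp add: Un_absorb2)
      next
        case False
        have d: "B n \<inter> X n = {}"
        proof -
          have "X k \<inter> X n = {}" if "k < n" for k
          proof (rule disj[OF XC XC])
            show "X k \<noteq> X n" using False that by (auto simp: B_def)
          qed
          then show ?thesis by (auto simp: B_def)
        qed
        have Xb: "X n \<in> sets lborel" by (auto intro!: borel_open opn XC)
        have XnU: "X n \<subseteq> U" using XU by auto
        have "(LINT s:B (Suc n)|lborel. f s) = (LINT s:B n|lborel. f s) + (LINT s:X n|lborel. f s)"
          unfolding Bs by (rule set_integral_Un[OF d]; rule set_integrable_subset[OF f]) (use bor BU Xb XnU in auto)
        also have "\<dots> \<le> C * measure lborel (B n) + C * measure lborel (X n)" using Suc comp[OF XC] by (intro add_mono)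
        also have "\<dots> = C * measure lborel (B (Suc n))"
        proof -
          have "measure lborel (B n \<union> X n) = measure lborel (B n) + measure lborel (X n)"
            by (rule measure_Union) (use finS[OF BU[of n] bor[of n]] finS[OF XnU Xb] d in \<open>auto simp: fmeasurable_def\<close>)
          then show ?thesis unfolding Bs by (simp add: distrib_left)
        qed
        finally show ?thesis .
      qed
    qed
    have UB: "(\<Union>n. B n) = U" using XU by (force simp: B_def)
    have "incseq B" unfolding incseq_def B_def by (intro allI impI UN_mono) auto
    then have "(\<lambda>n. LINT s:B n|lborel. f s) \<longlonglongrightarrow> (LINT s:(\<Union>n. B n)|lborel. f s)"
      using bor f UB by (intro set_integral_cont_up) (simp_all only:)
    then have lim: "(\<lambda>n. LINT s:B n|lborel. f s) \<longlonglongrightarrow> (LINT s:U|lborel. f s)" unfolding UB .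
    show ?thesis
    proof (rule LIMSEQ_le_const2[OF lim], intro exI[of _ 0] allI impI)
      fix n
      have "measure lborel (B n) \<le> measure lborel U"
        by (rule measure_mono_fmeasurable[OF BU bor finS]) (use U(1) in auto)
      from mult_left_mono[OF this C] step[of n]
      show "(LINT s:B n|lborel. f s) \<le> C * measure lborel U" by linarith
    qed
  qed
qed

text \<open>A paraboloid in space that rises linearly in time. The factor exp (\<nu> \<tau>) lets
  its time derivative dominate the drift, which applied to |z|^2 is again of quadratic growth; \<nu>
  = 0 gives the local paraboloids of \<open>growth_in_gap\<close>.\<close>

definition barrier :: "real \<Rightarrow> real \<Rightarrow> real^'n \<Rightarrow> real \<Rightarrow> real \<Rightarrow> real \<Rightarrow> real^'n \<Rightarrow> real" where
  "barrier \<alpha> c q \<mu> \<nu> \<tau> z = \<alpha> + c * \<tau> + q \<bullet> z + \<mu> * exp (\<nu> * \<tau>) * (z \<bullet> z)"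

lemma barrier_shift: "barrier (\<alpha> + e) c q \<mu> \<nu> \<tau> z = barrier \<alpha> c q \<mu> \<nu> \<tau> z + e"
  by (simp add: barrier_def)

lemma barrier_time: "((\<lambda>\<tau>. barrier \<alpha> c q \<mu> \<nu> \<tau> z) has_real_derivative (c + \<mu> * \<nu> * exp (\<nu> * \<tau>) * (z \<bullet> z))) (at \<tau>)"
  unfolding barrier_def by (auto intro!: derivative_eq_intros)

lemma barrier_add: "barrier \<alpha> c q \<mu> \<nu> \<tau> (z + h) = barrier \<alpha> c q \<mu> \<nu> \<tau> z + (q + (2 * \<mu> * exp (\<nu> * \<tau>)) *\<^sub>R z) \<bullet> h + \<mu> * exp (\<nu> * \<tau>) * (norm h)\<^sup>2"
  by (simp add: barrier_def inner_add_left inner_add_right inner_commute power2_norm_eq_inner algebra_simps)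

lemma barrier_cont: "continuous_on S (\<lambda>(\<tau>, z). barrier \<alpha> c q \<mu> \<nu> \<tau> z)"
  unfolding barrier_def case_prod_unfold by (intro continuous_intros)

section \<open>Comparison of the difference of two solutions with strict paraboloids\<close>

locale null_solution =
  fixes T :: real and A :: "real^'n^'n" and Q :: "real \<Rightarrow> real^'n^'n" and v :: "real \<Rightarrow> real^'n \<Rightarrow> real" and V :: real
  assumes T: "0 < T"
    and Q_cont: "continuous_on {0..T} Q" and Q_psd: "\<And>t. t \<in> {0..T} \<Longrightarrow> psd (Q t)"
    and v_bound: "\<And>t z. t \<in> {0..T} \<Longrightarrow> \<bar>v t z\<bar> \<le> V"
    and v_cont: "continuous_on ({0..T} \<times> UNIV) (\<lambda>(t, z). v t z)"
    and v_C2: "\<And>t. t \<in> {0..T} \<Longrightarrow> C_k 2 (v t)"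
    and v_int: "\<And>t z. t \<in> {0..T} \<Longrightarrow> set_integrable lborel {0..t} (\<lambda>s. trace (Q s ** hess (v s) z) + (A *v z) \<bullet> grad (v s) z)"
    and v_eq: "\<And>t z. t \<in> {0..T} \<Longrightarrow> v t z = (LINT s:{0..t}|lborel. trace (Q s ** hess (v s) z) + (A *v z) \<bullet> grad (v s) z)"
begin

definition Lv :: "real \<Rightarrow> real^'n \<Rightarrow> real" where
  "Lv s z = trace (Q s ** hess (v s) z) + (A *v z) \<bullet> grad (v s) z"

lemma Lv_int: "0 \<le> a \<Longrightarrow> b \<le> T \<Longrightarrow> set_integrable lborel {a..b} (\<lambda>s. Lv s z)"
  unfolding Lv_def by (rule set_integrable_subset[OF v_int[of T]]) (use T in auto)

lemma Lv_eq:
  assumes "0 \<le> a" "a \<le> b" "b \<le> T"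
  shows "v b z - v a z = (LINT s:{a..b}|lborel. Lv s z)"
  using v_eq[of b z] v_eq[of a z] lint_combine[OF Lv_int[of 0 b z] assms(1,2)] assms by (simp add: Lv_def)

text \<open>
  The time derivative of the barrier minus an upper bound for the operator applied to it.
\<close>

definition slack :: "real \<Rightarrow> real^'n \<Rightarrow> real \<Rightarrow> real \<Rightarrow> real \<Rightarrow> real^'n \<Rightarrow> real" where
  "slack c q \<mu> \<nu> \<tau> z = c + \<mu> * \<nu> * exp (\<nu> * \<tau>) * (z \<bullet> z) -
     (2 * \<mu> * exp (\<nu> * \<tau>) * trace (Q \<tau>) + (A *v z) \<bullet> (q + (2 * \<mu> * exp (\<nu> * \<tau>)) *\<^sub>R z))"

text \<open>Parabolic comparison, from the bottom and the lateral boundary of a cylinder to its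
  interior, for all balls in \<open>cball 0 R\<close> and all barriers that are supersolutions with
  margin \<kappa>. The margin is fixed in advance so that it can be divided among errors;
  quantifying over all balls and barriers makes the property chain along adjacent time
  intervals.\<close>

definition comparison :: "real \<Rightarrow> real \<Rightarrow> real \<Rightarrow> real \<Rightarrow> bool" where
  "comparison \<kappa> R s t \<longleftrightarrow> (\<forall>z0 \<rho> \<alpha> c q \<mu> \<nu>. 0 < \<rho> \<longrightarrow> cball z0 \<rho> \<subseteq> cball 0 R \<longrightarrow>
     (\<forall>\<tau>\<in>{s..t}. \<forall>z\<in>cball z0 \<rho>. \<kappa> \<le> slack c q \<mu> \<nu> \<tau> z) \<longrightarrow>
     (\<forall>z\<in>cball z0 \<rho>. v s z \<le> barrier \<alpha> c q \<mu> \<nu> s z) \<longrightarrow>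
     (\<forall>\<tau>\<in>{s..t}. \<forall>z\<in>sphere z0 \<rho>. v \<tau> z \<le> barrier \<alpha> c q \<mu> \<nu> \<tau> z) \<longrightarrow>
     (\<forall>\<tau>\<in>{s..t}. \<forall>z\<in>cball z0 \<rho>. v \<tau> z \<le> barrier \<alpha> c q \<mu> \<nu> \<tau> z))"

lemma comparisonD:
  assumes "comparison \<kappa> R s t" "0 < \<rho>" "cball z0 \<rho> \<subseteq> cball 0 R"
    "\<And>\<tau> z. \<tau> \<in> {s..t} \<Longrightarrow> z \<in> cball z0 \<rho> \<Longrightarrow> \<kappa> \<le> slack c q \<mu> \<nu> \<tau> z"
    "\<And>z. z \<in> cball z0 \<rho> \<Longrightarrow> v s z \<le> barrier \<alpha> c q \<mu> \<nu> s z"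
    "\<And>\<tau> z. \<tau> \<in> {s..t} \<Longrightarrow> z \<in> sphere z0 \<rho> \<Longrightarrow> v \<tau> z \<le> barrier \<alpha> c q \<mu> \<nu> \<tau> z"
    "\<tau> \<in> {s..t}" "z \<in> cball z0 \<rho>"
  shows "v \<tau> z \<le> barrier \<alpha> c q \<mu> \<nu> \<tau> z"
  using assms unfolding comparison_def by blast

lemma comparison_trans:
  assumes sr: "comparison \<kappa> R s r" and rt: "comparison \<kappa> R r t" and o: "s \<le> r" "r \<le> t"
  shows "comparison \<kappa> R s t"
  unfolding comparison_def
proof (intro allI impI ballI)
  fix z0 \<rho> \<alpha> c q \<mu> \<nu> \<tau> z
  assume a: "0 < \<rho>" "cball z0 \<rho> \<subseteq> cball 0 R"
     "\<forall>\<tau>\<in>{s..t}. \<forall>z\<in>cball z0 \<rho>. \<kappa> \<le> slack c q \<mu> \<nu> \<tau> z"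
     "\<forall>z\<in>cball z0 \<rho>. v s z \<le> barrier \<alpha> c q \<mu> \<nu> s z"
     "\<forall>\<tau>\<in>{s..t}. \<forall>z\<in>sphere z0 \<rho>. v \<tau> z \<le> barrier \<alpha> c q \<mu> \<nu> \<tau> z"
    and \<tau>: "\<tau> \<in> {s..t}" and z: "z \<in> cball z0 \<rho>"
  have 1: "v \<tau> z \<le> barrier \<alpha> c q \<mu> \<nu> \<tau> z" if "\<tau> \<in> {s..r}" "z \<in> cball z0 \<rho>" for \<tau> z
    by (rule comparisonD[OF sr a(1,2) _ _ _ that]) (use a(3-) o in auto)
  show "v \<tau> z \<le> barrier \<alpha> c q \<mu> \<nu> \<tau> z"
  proof (cases "\<tau> \<le> r")
    case True
    then show ?thesis using 1 \<tau> z by auto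
  next
    case False
    show ?thesis
      by (rule comparisonD[OF rt a(1,2) _ _ _ _ z]) (use a(3-) o False \<tau> 1 in auto)
  qed
qed

lemma uniform_modulus:
  assumes "0 < e"
  obtains d where "0 < d" "\<And>\<tau> \<tau>' z z'. \<tau> \<in> {0..T} \<Longrightarrow> \<tau>' \<in> {0..T} \<Longrightarrow> z \<in> cball 0 R \<Longrightarrow> z' \<in> cball 0 R \<Longrightarrow>
     \<bar>\<tau> - \<tau>'\<bar> < d \<Longrightarrow> dist z z' < d \<Longrightarrow> \<bar>(v \<tau> z - barrier \<alpha> c q \<mu> \<nu> \<tau> z) - (v \<tau>' z' - barrier \<alpha> c q \<mu> \<nu> \<tau>' z')\<bar> < e"
proof -
  let ?S = "{0..T} \<times> cball 0 R"
  let ?f = "\<lambda>p. (case p of (t, z) \<Rightarrow> v t z) - (case p of (t, z) \<Rightarrow> barrier \<alpha> c q \<mu> \<nu> t z)"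
  have "continuous_on ?S ?f"
    by (intro continuous_on_diff barrier_cont continuous_on_subset[OF v_cont]) auto
  then have "uniformly_continuous_on ?S ?f"
    by (rule compact_uniformly_continuous) (intro compact_Times compact_Icc compact_cball)
  then obtain d where d: "0 < d" "\<And>p p'. p \<in> ?S \<Longrightarrow> p' \<in> ?S \<Longrightarrow> dist p' p < d \<Longrightarrow> dist (?f p') (?f p) < e"
    using assms unfolding uniformly_continuous_on_def by metis
  show ?thesis
  proof (rule that[of "d / 2"])
    show "0 < d / 2" using d by simp
    fix \<tau> \<tau>' and z z' :: "real^'n" assume a: "\<tau> \<in> {0..T}" "\<tau>' \<in> {0..T}" "z \<in> cball 0 R" "z' \<in> cball 0 R"
      "\<bar>\<tau> - \<tau>'\<bar> < d / 2" "dist z z' < d / 2"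
    have "dist (\<tau>, z) (\<tau>', z') \<le> dist \<tau> \<tau>' + dist z z'"
      unfolding dist_Pair_Pair by (rule sqrt_sum_squares_le_sum) auto
    then have "dist (\<tau>, z) (\<tau>', z') < d" using a(5,6) by (simp add: dist_real_def)
    from d(2)[OF _ _ this] a(1-4)
    show "\<bar>(v \<tau> z - barrier \<alpha> c q \<mu> \<nu> \<tau> z) - (v \<tau>' z' - barrier \<alpha> c q \<mu> \<nu> \<tau>' z')\<bar> < e"
      by (simp add: dist_real_def)
  qed
qed

text \<open>Adding e to the barrier leaves the slack unchanged, since \<open>\<alpha>\<close> does
  not occur in it, and by uniform continuity the raised barrier dominates v shortly after a. Letting
  e tend to 0 settles the interior times, and continuity in time settles b.\<close>

lemma comparison_closure:
  assumes ab: "0 \<le> a" "a < b" "b \<le> T"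
    and in_: "\<And>a' b'. a < a' \<Longrightarrow> a' \<le> b' \<Longrightarrow> b' < b \<Longrightarrow> comparison \<kappa> R a' b'"
  shows "comparison \<kappa> R a b"
  unfolding comparison_def
proof (intro allI impI ballI)
  fix z0 \<rho> \<alpha> c q \<mu> \<nu> \<tau> z
  assume h: "0 < \<rho>" "cball z0 \<rho> \<subseteq> cball 0 R"
     "\<forall>\<tau>\<in>{a..b}. \<forall>z\<in>cball z0 \<rho>. \<kappa> \<le> slack c q \<mu> \<nu> \<tau> z"
     "\<forall>z\<in>cball z0 \<rho>. v a z \<le> barrier \<alpha> c q \<mu> \<nu> a z"
     "\<forall>\<tau>\<in>{a..b}. \<forall>z\<in>sphere z0 \<rho>. v \<tau> z \<le> barrier \<alpha> c q \<mu> \<nu> \<tau> z"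
    and \<tau>: "\<tau> \<in> {a..b}" and z: "z \<in> cball z0 \<rho>"
  have inner: "v \<tau> z \<le> barrier \<alpha> c q \<mu> \<nu> \<tau> z + e" if e: "0 < e" and \<tau>: "a < \<tau>" "\<tau> < b" and z: "z \<in> cball z0 \<rho>" for e \<tau> z
  proof -
    obtain d where d: "0 < d" "\<And>\<tau> \<tau>' z z'. \<tau> \<in> {0..T} \<Longrightarrow> \<tau>' \<in> {0..T} \<Longrightarrow> z \<in> cball 0 R \<Longrightarrow> z' \<in> cball 0 R \<Longrightarrow>
       \<bar>\<tau> - \<tau>'\<bar> < d \<Longrightarrow> dist z z' < d \<Longrightarrow> \<bar>(v \<tau> z - barrier \<alpha> c q \<mu> \<nu> \<tau> z) - (v \<tau>' z' - barrier \<alpha> c q \<mu> \<nu> \<tau>' z')\<bar> < e"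
      using uniform_modulus[OF e, of R \<alpha> c q \<mu> \<nu>] by metis
    define a' where "a' = min \<tau> (a + d / 2)"
    have a': "a < a'" "a' \<le> \<tau>" "\<bar>a' - a\<bar> < d" using d(1) \<tau> by (auto simp: a'_def)
    have init: "v a' y \<le> barrier (\<alpha> + e) c q \<mu> \<nu> a' y" if y: "y \<in> cball z0 \<rho>" for y
      using d(2)[of a' a y y] a' \<tau> ab y h(2) h(4) d(1) unfolding barrier_shift by force
    have "v \<tau> z \<le> barrier (\<alpha> + e) c q \<mu> \<nu> \<tau> z"
    proof (rule comparisonD[OF in_[OF a'(1,2) \<tau>(2)] h(1,2) _ init _ _ z])
      fix \<tau>' y assume t: "\<tau>' \<in> {a'..\<tau>}"
      then have t2: "\<tau>' \<in> {a..b}" using a' \<tau> by auto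
      show "\<kappa> \<le> slack c q \<mu> \<nu> \<tau>' y" if "y \<in> cball z0 \<rho>" using h(3) t2 that by blast
      show "v \<tau>' y \<le> barrier (\<alpha> + e) c q \<mu> \<nu> \<tau>' y" if "y \<in> sphere z0 \<rho>" using h(5) t2 that e unfolding barrier_shift by force
    qed (use a' in auto)
    then show ?thesis unfolding barrier_shift .
  qed
  consider "\<tau> = a" | "a < \<tau>" "\<tau> < b" | "\<tau> = b" using \<tau> by fastforce
  then show "v \<tau> z \<le> barrier \<alpha> c q \<mu> \<nu> \<tau> z"
  proof cases
    case 1
    then show ?thesis using h(4) z by blast
  next
    case 2
    then show ?thesis using inner[OF _ 2 z] field_le_epsilon by blast
  next
    case 3
    show ?thesis
    proof (rule field_le_epsilon)
      fix e :: real assume e: "0 < e"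
      then have e2: "0 < e / 2" by simp
      obtain d where d: "0 < d" "\<And>\<tau> \<tau>' z z'. \<tau> \<in> {0..T} \<Longrightarrow> \<tau>' \<in> {0..T} \<Longrightarrow> z \<in> cball 0 R \<Longrightarrow> z' \<in> cball 0 R \<Longrightarrow>
       \<bar>\<tau> - \<tau>'\<bar> < d \<Longrightarrow> dist z z' < d \<Longrightarrow> \<bar>(v \<tau> z - barrier \<alpha> c q \<mu> \<nu> \<tau> z) - (v \<tau>' z' - barrier \<alpha> c q \<mu> \<nu> \<tau>' z')\<bar> < e / 2"
        using uniform_modulus[OF e2, of R \<alpha> c q \<mu> \<nu>] by metis
      define b' where "b' = max ((a + b) / 2) (b - d / 2)"
      have "b - d / 2 \<le> b'" by (simp add: b'_def)
      moreover have b'1: "a < b'" "b' < b" using d(1) ab by (auto simp: b'_def less_max_iff_disj)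
      ultimately have b': "a < b'" "b' < b" "\<bar>b - b'\<bar> < d" using d(1) by auto
      have "v b' z \<le> barrier \<alpha> c q \<mu> \<nu> b' z + e / 2" by (rule inner[OF e2 b'(1,2) z])
      moreover have "\<bar>(v b z - barrier \<alpha> c q \<mu> \<nu> b z) - (v b' z - barrier \<alpha> c q \<mu> \<nu> b' z)\<bar> < e / 2"
        by (rule d(2)) (use ab b' z h(2) d(1) in auto)
      ultimately show "v \<tau> z \<le> barrier \<alpha> c q \<mu> \<nu> \<tau> z + e" unfolding 3 by linarith
    qed
  qed
qed

text \<open>Control of second differences at time a places \<open>v a\<close> below a paraboloid
  that is tangent at z1 and has quadratic coefficient m / 2. A barrier with coefficient m has
  \<open>m / 2 * \<rho>1\<^sup>2\<close> to spare on the sphere, which covers the oscillation of v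
  during the gap, and the rate \<open>Cc\<close> makes it a strict supersolution. Comparison over
  the gap then bounds the growth at the centre.\<close>

lemma growth_in_gap:
  assumes ab: "0 \<le> a" "a < b" "b \<le> T" and P: "comparison \<kappa> R a b" and \<kappa>: "0 < \<kappa>"
    and E: "D2_control R \<eta> m (v a)" and m: "1 \<le> m"
    and ball: "0 < \<rho>1" "cball z1 \<rho>1 \<subseteq> cball 0 R"
    and osc: "\<And>\<tau> z. \<tau> \<in> {a..b} \<Longrightarrow> z \<in> cball z1 \<rho>1 \<Longrightarrow> \<bar>v \<tau> z - v a z\<bar> \<le> m / 2 * \<rho>1\<^sup>2"
    and Cc: "\<And>\<tau> z. \<tau> \<in> {0..T} \<Longrightarrow> z \<in> cball 0 R \<Longrightarrow> 2 * m * trace (Q \<tau>) + norm (A *v z) * (m + 2 * m * \<rho>1) + \<kappa> \<le> Cc"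
  shows "v b z1 - v a z1 \<le> Cc * (b - a)"
proof -
  have aT: "a \<in> {0..T}" using ab by auto
  note C2 = v_C2[OF aT]
  have z1: "z1 \<in> cball 0 R" using ball by (meson centre_in_cball less_imp_le subsetD)
  define g where "g = grad (v a) z1"
  have ddg: "dd h (v a) z1 = g \<bullet> h" for h
    by (simp add: dd_def g_def grad_inner)
  have gm: "norm g \<le> m"
  proof (cases "g = 0")
    case False
    have "norm g * norm g \<le> m * norm g"
      using D2_control_hess(1)[OF C2 E, of z1 g] z1 unfolding ddg by (simp add: dot_square_norm power2_eq_square)
    then show ?thesis using False by simp
  qed (use m in simp)
  \<comment> \<open>The choice of \<open>q\<close> and \<open>\<alpha>\<close> recentres the barrier
    at z1, with gradient g and value \<open>v a z1\<close> there at time a.\<close>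
  define q where "q = g - (2 * m) *\<^sub>R z1"
  define \<alpha> where "\<alpha> = v a z1 - g \<bullet> z1 + m * (z1 \<bullet> z1) - Cc * a"
  have barrier: "barrier \<alpha> Cc q m 0 \<tau> z = v a z1 + g \<bullet> (z - z1) + m * (norm (z - z1))\<^sup>2 + Cc * (\<tau> - a)" for \<tau> z
    by (simp add: barrier_def \<alpha>_def q_def power2_norm_eq_inner inner_diff_left inner_diff_right inner_commute algebra_simps)
  have Cc0: "0 \<le> Cc"
  proof -
    have "0 \<le> norm (A *v z1) * (m + 2 * m * \<rho>1)" using m ball by simp
    then show ?thesis using Cc[OF aT z1] trace_psd_nonneg[OF Q_psd[OF aT]] m \<kappa> mult_nonneg_nonneg[of "2 * m" "trace (Q a)"] by linarith
  qed
  have para: "v a z \<le> v a z1 + g \<bullet> (z - z1) + m / 2 * (norm (z - z1))\<^sup>2" if z: "z \<in> cball z1 \<rho>1" for z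
  proof -
    obtain \<theta> where \<theta>: "0 < \<theta>" "\<theta> < 1" "v a (z1 + (z - z1)) = v a z1 + dd (z - z1) (v a) z1 + hess_form (v a) (z1 + \<theta> *\<^sub>R (z - z1)) (z - z1) / 2"
      using taylor_exact[OF C2] by blast
    have "z1 + \<theta> *\<^sub>R (z - z1) \<in> cball z1 \<rho>1"
    proof -
      have "\<theta> * norm (z - z1) \<le> 1 * norm (z - z1)" using \<theta> by (intro mult_right_mono) auto
      then show ?thesis using z \<theta>(1) by (simp add: dist_norm norm_minus_commute)
    qed
    then have "norm (z1 + \<theta> *\<^sub>R (z - z1)) \<le> R" using ball(2) by auto
    from D2_control_hess(2)[OF C2 E this, of "z - z1"] \<theta>(3) show ?thesis unfolding ddg by simp
  qed
  have "v b z1 \<le> barrier \<alpha> Cc q m 0 b z1"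
  proof (rule comparisonD[OF P ball])
    fix \<tau> z assume \<tau>: "\<tau> \<in> {a..b}" and z: "z \<in> cball z1 \<rho>1"
    have zR: "z \<in> cball 0 R" using z ball by blast
    have e: "q + (2 * m * exp (0 * \<tau>)) *\<^sub>R z = g + (2 * m) *\<^sub>R (z - z1)"
      by (simp add: q_def algebra_simps)
    have "(A *v z) \<bullet> (g + (2 * m) *\<^sub>R (z - z1)) \<le> norm (A *v z) * norm (g + (2 * m) *\<^sub>R (z - z1))"
      by (rule norm_cauchy_schwarz)
    also have "\<dots> \<le> norm (A *v z) * (m + 2 * m * \<rho>1)"
    proof (rule mult_left_mono)
      have "norm (g + (2 * m) *\<^sub>R (z - z1)) \<le> norm g + 2 * m * norm (z - z1)"
        using norm_triangle_ineq[of g "(2 * m) *\<^sub>R (z - z1)"] m by simp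
      also have "\<dots> \<le> m + 2 * m * \<rho>1" using gm z m
        by (intro add_mono mult_left_mono) (auto simp: dist_norm norm_minus_commute)
      finally show "norm (g + (2 * m) *\<^sub>R (z - z1)) \<le> m + 2 * m * \<rho>1" .
    qed simp
    finally show "\<kappa> \<le> slack Cc q m 0 \<tau> z"
      using Cc[of \<tau> z] \<tau> ab zR unfolding slack_def e by simp
  next
    fix z assume z: "z \<in> cball z1 \<rho>1"
    have "m / 2 * (norm (z - z1))\<^sup>2 \<le> m * (norm (z - z1))\<^sup>2" using m by (intro mult_right_mono) auto
    with para[OF z] show "v a z \<le> barrier \<alpha> Cc q m 0 a z" unfolding barrier by simp
  next
    fix \<tau> z assume \<tau>: "\<tau> \<in> {a..b}" and z: "z \<in> sphere z1 \<rho>1"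
    then have n: "norm (z - z1) = \<rho>1" and zc: "z \<in> cball z1 \<rho>1" by (auto simp: dist_norm norm_minus_commute)
    have "0 \<le> Cc * (\<tau> - a)" using Cc0 \<tau> by simp
    with para[OF zc] osc[OF \<tau> zc] show "v \<tau> z \<le> barrier \<alpha> Cc q m 0 \<tau> z" unfolding barrier n by linarith
  qed (use ab ball in auto)
  then show ?thesis unfolding barrier by simp
qed

end

context null_solution begin

text \<open>If comparison fails, the maximum \<open>M\<close> over the ball of v minus the barrier
  rises from at most 0 to a positive value; the rise is contradicted on a time interval where
  \<open>M\<close> is positive and its maximizers stay inside. At times in G the equation at a
  nearby maximizer gives no growth. Over a gap of G comparison shows that \<open>M\<close> does not
  grow, whereas at a fixed point the growth is only bounded by a multiple of the length of the gap.
  Both are combined so that the weaker estimate is used only on a set of times of small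
  measure.\<close>

lemma comparison_on_portion:
  assumes \<kappa>: "0 < \<kappa>" and R: "0 < R" and G: "closed G" and st: "0 \<le> s0" "s0 \<le> t0" "t0 \<le> T"
    and E: "\<And>r. r \<in> G \<Longrightarrow> s0 \<le> r \<Longrightarrow> r \<le> t0 \<Longrightarrow> D2_control R \<eta> m (v r)" and m: "1 \<le> m" and \<eta>0: "0 \<le> \<eta>"
    and \<Lambda>: "\<And>r. r \<in> {0..T} \<Longrightarrow> trace (Q r) \<le> \<Lambda>" "0 \<le> \<Lambda>" and \<eta>: "\<eta> * \<Lambda> \<le> \<kappa> / 4"
    and gaps: "\<And>a b. s0 \<le> a \<Longrightarrow> a \<le> b \<Longrightarrow> b \<le> t0 \<Longrightarrow> {a..b} \<inter> G = {} \<Longrightarrow> comparison \<kappa> R a b"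
  shows "comparison \<kappa> R s0 t0"
  unfolding comparison_def
proof (intro allI impI ballI)
  fix z0 \<rho> \<alpha> c q \<mu> \<nu> \<tau>' z'
  assume \<rho>: "0 < \<rho>" and DR: "cball z0 \<rho> \<subseteq> cball 0 R"
     and sl: "\<forall>\<tau>\<in>{s0..t0}. \<forall>z\<in>cball z0 \<rho>. \<kappa> \<le> slack c q \<mu> \<nu> \<tau> z"
     and init: "\<forall>z\<in>cball z0 \<rho>. v s0 z \<le> barrier \<alpha> c q \<mu> \<nu> s0 z"
     and lat: "\<forall>\<tau>\<in>{s0..t0}. \<forall>z\<in>sphere z0 \<rho>. v \<tau> z \<le> barrier \<alpha> c q \<mu> \<nu> \<tau> z"
     and \<tau>': "\<tau>' \<in> {s0..t0}" and z': "z' \<in> cball z0 \<rho>"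
  define D where "D = cball z0 \<rho>"
  define \<phi> where "\<phi> \<tau> z = barrier \<alpha> c q \<mu> \<nu> \<tau> z" for \<tau> z
  define w where "w \<tau> z = v \<tau> z - \<phi> \<tau> z" for \<tau> z
  \<comment> \<open>Endpoints of a gap may lie in G; \<open>comparison_closure\<close> includes
    them.\<close>
  have gapP: "comparison \<kappa> R a b" if "s0 \<le> a" "a < b" "b \<le> t0" "{a<..<b} \<inter> G = {}" for a b
  proof (rule comparison_closure)
    fix a' b' assume "a < a'" "a' \<le> b'" "b' < b"
    moreover from this have "{a'..b'} \<subseteq> {a<..<b}" by auto
    ultimately show "comparison \<kappa> R a' b'" using gaps[of a' b'] that by fastforce
  qed (use that st in auto)
  show "v \<tau>' z' \<le> barrier \<alpha> c q \<mu> \<nu> \<tau>' z'"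
  proof (rule ccontr)
    assume neg: "\<not> v \<tau>' z' \<le> barrier \<alpha> c q \<mu> \<nu> \<tau>' z'"
    have DR': "D \<subseteq> cball 0 R" using DR by (simp add: D_def)
    have wu: "\<exists>d>0. \<forall>\<tau>\<in>{0..T}. \<forall>\<tau>'\<in>{0..T}. \<forall>z\<in>D. \<forall>z'\<in>D. \<bar>\<tau> - \<tau>'\<bar> < d \<longrightarrow> dist z z' < d \<longrightarrow> \<bar>w \<tau> z - w \<tau>' z'\<bar> < e"
      if "0 < e" for e
    proof -
      note e = that
      obtain d where d: "0 < d" "\<And>\<tau> \<tau>' z z'. \<tau> \<in> {0..T} \<Longrightarrow> \<tau>' \<in> {0..T} \<Longrightarrow> z \<in> cball 0 R \<Longrightarrow> z' \<in> cball 0 R \<Longrightarrow>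
         \<bar>\<tau> - \<tau>'\<bar> < d \<Longrightarrow> dist z z' < d \<Longrightarrow> \<bar>(v \<tau> z - barrier \<alpha> c q \<mu> \<nu> \<tau> z) - (v \<tau>' z' - barrier \<alpha> c q \<mu> \<nu> \<tau>' z')\<bar> < e"
        using uniform_modulus[OF e, of R \<alpha> c q \<mu> \<nu>] by metis
      show ?thesis
        unfolding w_def \<phi>_def
        by (intro exI[of _ d] conjI ballI impI d(1)) (rule d(2)[OF _ _ subsetD[OF DR'] subsetD[OF DR']])
    qed
    have sT: "\<tau> \<in> {0..T}" if "s0 \<le> \<tau>" "\<tau> \<le> t0" for \<tau> using that st by auto
    have "\<exists>z\<in>D. \<forall>y\<in>D. w \<tau> y \<le> w \<tau> z" if "\<tau> \<in> {0..T}" for \<tau>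
    proof (rule continuous_attains_sup)
      show "compact D" "D \<noteq> {}" using \<rho> by (auto simp: D_def)
      have "continuous_on D ((\<lambda>(t, z). v t z) \<circ> Pair \<tau>)"
        by (rule continuous_on_compose[OF _ continuous_on_subset[OF v_cont]]) (use that in \<open>auto intro!: continuous_intros\<close>)
      moreover have "continuous_on D (\<phi> \<tau>)" unfolding \<phi>_def barrier_def by (intro continuous_intros)
      ultimately show "continuous_on D (w \<tau>)" unfolding w_def[abs_def] by (intro continuous_on_diff) (auto simp: o_def)
    qed
    then obtain zm where zm: "\<And>\<tau>. \<tau> \<in> {0..T} \<Longrightarrow> zm \<tau> \<in> D" "\<And>\<tau> y. \<tau> \<in> {0..T} \<Longrightarrow> y \<in> D \<Longrightarrow> w \<tau> y \<le> w \<tau> (zm \<tau>)"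
      by metis
    define M where "M \<tau> = w \<tau> (zm \<tau>)" for \<tau>
    have Mle: "w \<tau> y \<le> M \<tau>" if "\<tau> \<in> {0..T}" "y \<in> D" for \<tau> y using zm(2)[OF that] by (simp add: M_def)
    have Mu: "\<exists>d>0. \<forall>\<tau>\<in>{0..T}. \<forall>\<tau>'\<in>{0..T}. \<bar>\<tau> - \<tau>'\<bar> < d \<longrightarrow> \<bar>M \<tau> - M \<tau>'\<bar> < e" if e: "0 < e" for e
    proof -
      obtain d where d: "0 < d" "\<forall>\<tau>\<in>{0..T}. \<forall>\<tau>'\<in>{0..T}. \<forall>z\<in>D. \<forall>z'\<in>D. \<bar>\<tau> - \<tau>'\<bar> < d \<longrightarrow> dist z z' < d \<longrightarrow> \<bar>w \<tau> z - w \<tau>' z'\<bar> < e"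
        using wu[OF e] by blast
      have "M \<tau> - M \<tau>' < e" if t: "\<tau> \<in> {0..T}" "\<tau>' \<in> {0..T}" "\<bar>\<tau> - \<tau>'\<bar> < d" for \<tau> \<tau>'
      proof -
        have "\<bar>w \<tau> (zm \<tau>) - w \<tau>' (zm \<tau>)\<bar> < e" using d t zm(1) by (metis dist_self)
        then show ?thesis using Mle[OF t(2) zm(1)[OF t(1)]] by (simp add: M_def abs_less_iff)
      qed
      then show ?thesis using d(1) by (intro exI[of _ d]) (auto simp: abs_less_iff)
    qed
    have Mcont: "continuous_on {0..T} M"
      unfolding continuous_on_iff dist_real_def using Mu by (metis abs_minus_commute)
    \<comment> \<open>the last time before the exit at which M is at most half its final value\<close>
    have t1: "s0 \<le> \<tau>'" "\<tau>' \<le> t0" using \<tau>' by auto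
    have Mt1: "0 < M \<tau>'" using Mle[OF sT[OF t1], of z'] z' neg by (simp add: w_def \<phi>_def D_def)
    define c0 where "c0 = M \<tau>' / 2"
    have c0: "0 < c0" "c0 < M \<tau>'" using Mt1 by (auto simp: c0_def)
    have Ms0: "M s0 \<le> 0" using init zm(1)[OF sT[OF order_refl st(2)]] by (simp add: M_def w_def \<phi>_def D_def)
    define S where "S = {s \<in> {s0..\<tau>'}. M s \<le> c0}"
    have "compact S"
    proof -
      have sub: "{s0..\<tau>'} \<subseteq> {0..T}" using st t1 by auto
      have "closed ({s0..\<tau>'} \<inter> M -` {..c0})"
        by (rule continuous_closed_preimage[OF continuous_on_subset[OF Mcont sub]]) auto
      moreover have "{s0..\<tau>'} \<inter> M -` {..c0} = S" by (auto simp: S_def)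
      ultimately have "closed S" by simp
      moreover have "bounded S" by (rule bounded_subset[OF bounded_closed_interval[of s0 \<tau>']]) (auto simp: S_def)
      ultimately show ?thesis by (simp add: compact_eq_bounded_closed)
    qed
    moreover have "s0 \<in> S" using Ms0 c0 t1 by (auto simp: S_def)
    ultimately obtain s1 where s1: "s1 \<in> S" "\<And>s. s \<in> S \<Longrightarrow> s \<le> s1"
      using compact_attains_sup[of S] by blast
    have s1': "s0 \<le> s1" "M s1 \<le> c0" "s1 < \<tau>'" using s1(1) c0 by (auto simp: S_def less_le)
    have Mbig: "c0 < M \<tau>" if "s1 < \<tau>" "\<tau> \<le> \<tau>'" for \<tau>
      using s1(2)[of \<tau>] that s1'(1) by (force simp: S_def)
    have s1T: "\<tau> \<in> {0..T}" if "s1 \<le> \<tau>" "\<tau> \<le> \<tau>'" for \<tau> using that s1' t1 sT by auto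
    \<comment> \<open>\<open>M\<close> is positive at s1 too, which matters when s1 is the left end
      of a gap: only a nonnegative shift of the barrier keeps the condition on the sphere.\<close>
    have Ms1: "c0 \<le> M s1"
    proof (rule ccontr)
      assume "\<not> c0 \<le> M s1"
      then have "0 < c0 - M s1" by simp
      from Mu[OF this] obtain d where d: "0 < d" "\<forall>\<tau>\<in>{0..T}. \<forall>\<tau>'\<in>{0..T}. \<bar>\<tau> - \<tau>'\<bar> < d \<longrightarrow> \<bar>M \<tau> - M \<tau>'\<bar> < c0 - M s1" by blast
      define y where "y = min \<tau>' (s1 + d / 2)"
      have y: "s1 < y" "y \<le> \<tau>'" "\<bar>y - s1\<bar> < d" using d(1) s1'(3) by (auto simp: y_def)
      have "\<bar>M y - M s1\<bar> < c0 - M s1" using d(2) y s1T[of y] s1T[of s1] by auto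
      then show False using Mbig[OF y(1,2)] by linarith
    qed
    \<comment> \<open>maximizers stay away from the sphere\<close>
    obtain d1 where d1: "0 < d1" "\<forall>\<tau>\<in>{0..T}. \<forall>\<tau>'\<in>{0..T}. \<forall>z\<in>D. \<forall>z'\<in>D. \<bar>\<tau> - \<tau>'\<bar> < d1 \<longrightarrow> dist z z' < d1 \<longrightarrow> \<bar>w \<tau> z - w \<tau>' z'\<bar> < c0"
      using wu[OF c0(1)] by blast
    \<comment> \<open>Within \<open>d1\<close> the function w changes by less than
      \<open>c0\<close>. The bound 1 keeps steps admissible for \<open>D2_control\<close>; the bound
      \<open>\<rho> / 2\<close> keeps a maximizer near the sphere away from the centre, so that it
      can be projected radially.\<close>
    define \<rho>1 where "\<rho>1 = min 1 (min (d1 / 2) (\<rho> / 2))"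
    have \<rho>1: "0 < \<rho>1" "\<rho>1 \<le> 1" "\<rho>1 < d1" "\<rho>1 < \<rho>" using d1(1) \<rho> by (auto simp: \<rho>1_def min_less_iff_disj)
    have inD: "cball (zm p) \<rho>1 \<subseteq> D" if p: "s1 < p" "p \<le> \<tau>'" for p
    proof -
      have pT: "p \<in> {0..T}" using s1T[of p] p by simp
      have ps: "p \<in> {s0..t0}" using p s1' t1 by auto
      let ?z = "zm p"
      define r where "r = dist z0 ?z"
      have r: "r \<le> \<rho>" using zm(1)[OF pT] by (simp add: D_def r_def)
      have "r + \<rho>1 \<le> \<rho>"
      proof (rule ccontr)
        assume "\<not> r + \<rho>1 \<le> \<rho>"
        then have r0: "\<rho> - \<rho>1 < r" "0 < r" using \<rho>1 by auto
        define y where "y = z0 + (\<rho> / r) *\<^sub>R (?z - z0)"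
        have "norm (y - z0) = \<rho>" using r0 \<rho> by (simp add: y_def r_def dist_norm norm_minus_commute)
        then have y: "y \<in> sphere z0 \<rho>" by (simp add: dist_norm norm_minus_commute)
        have "y - ?z = (\<rho> / r - 1) *\<^sub>R (?z - z0)" by (simp add: y_def algebra_simps)
        then have "dist ?z y = \<bar>\<rho> / r - 1\<bar> * r" by (metis dist_commute dist_norm norm_scaleR r_def)
        also have "\<dots> = \<rho> - r" using r0 r by (simp add: abs_if field_simps)
        finally have dy: "dist ?z y < d1" using r0 \<rho>1 by linarith
        have yD: "y \<in> D" using y by (auto simp: D_def)
        have "\<bar>w p ?z - w p y\<bar> < c0" using d1 dy pT zm(1)[OF pT] yD by auto
        moreover have "w p y \<le> 0" using lat ps y by (auto simp: w_def \<phi>_def)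
        ultimately show False using Mbig[OF p] by (simp add: M_def)
      qed
      then show ?thesis unfolding D_def r_def
        by (auto simp: subset_iff) (metis add_mono_thms_linordered_semiring(1) dist_triangle le_trans order_trans order_refl)
    qed
    have "compact ((\<lambda>z. norm (A *v z)) ` cball 0 R)"
      by (intro compact_continuous_image continuous_intros compact_cball matrix_vector_mult_linear_continuous_on)
    then obtain aa where aa: "\<And>z. z \<in> cball 0 R \<Longrightarrow> \<bar>norm (A *v z)\<bar> \<le> aa"
      by (meson compact_imp_bounded bounded_real imageI)
    define a1 where "a1 = max 1 aa"
    have a1: "norm (A *v z) \<le> a1" if "z \<in> cball 0 R" for z using aa[OF that] by (simp add: a1_def)
    have a11: "1 \<le> a1" by (simp add: a1_def)
    have "compact ((\<lambda>r. \<mu> * exp (\<nu> * r)) ` {0..T})"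
      by (intro compact_continuous_image continuous_intros compact_Icc)
    then obtain mm where mm: "\<And>r. r \<in> {0..T} \<Longrightarrow> \<bar>\<mu> * exp (\<nu> * r)\<bar> \<le> mm"
      by (meson compact_imp_bounded bounded_real imageI)
    have mm0: "0 \<le> mm" using mm[of 0] T by auto
    \<comment> \<open>The step for second differences: within \<open>\<rho>1\<close> of a maximizer,
      and small enough for the last clause of \<open>D2_control\<close>.\<close>
    define h1 where "h1 = min \<rho>1 (1 / m)"
    have h1: "0 < h1" "h1 \<le> \<rho>1" "h1 \<le> 1" "m * h1 \<le> 1"
    proof -
      show "0 < h1" "h1 \<le> \<rho>1" "h1 \<le> 1" using \<rho>1 m by (auto simp: h1_def min_le_iff_disj)
      have "m * h1 \<le> m * (1 / m)" using m by (intro mult_left_mono) (auto simp: h1_def)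
      then show "m * h1 \<le> 1" using m by simp
    qed
    \<comment> \<open>The margin \<kappa> is spent in four quarters: on \<eta> times the trace of Q,
      on the error 4 \<omega> / h1^2 of the second differences, on 2 \<omega> / \<epsilon> in the
      difference quotient along the drift, and on \<open>KK * \<epsilon>\<close>, the second-order
      part of that quotient with step \<epsilon>. Hence \<omega> is chosen after h1 and
      \<epsilon>.\<close>
    define KK where "KK = (m / 2 + mm + 1) * a1\<^sup>2"
    have KK: "0 < KK" using m mm0 a11 by (auto simp: KK_def intro!: mult_pos_pos)
    define \<epsilon> where "\<epsilon> = min (h1 / a1) (\<kappa> / (4 * KK))"
    have \<epsilon>: "0 < \<epsilon>" "\<epsilon> * a1 \<le> h1" "KK * \<epsilon> \<le> \<kappa> / 4"
    proof -
      show "0 < \<epsilon>" using h1 a11 KK \<kappa> by (auto simp: \<epsilon>_def)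
      have "\<epsilon> * a1 \<le> (h1 / a1) * a1" using a11 by (intro mult_right_mono) (auto simp: \<epsilon>_def)
      then show "\<epsilon> * a1 \<le> h1" using a11 by simp
      have "KK * \<epsilon> \<le> KK * (\<kappa> / (4 * KK))" using KK by (intro mult_left_mono) (auto simp: \<epsilon>_def)
      then show "KK * \<epsilon> \<le> \<kappa> / 4" using KK by simp
    qed
    define \<omega> where "\<omega> = min (\<kappa> * h1\<^sup>2 / (16 * (\<Lambda> + 1))) (\<kappa> * \<epsilon> / 8)"
    have \<omega>: "0 < \<omega>" "4 * \<omega> / h1\<^sup>2 * \<Lambda> \<le> \<kappa> / 4" "2 * \<omega> / \<epsilon> \<le> \<kappa> / 4"
    proof -
      show w0: "0 < \<omega>" using h1 \<epsilon> \<kappa> \<Lambda> by (auto simp: \<omega>_def)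
      have "\<omega> * (16 * (\<Lambda> + 1)) \<le> (\<kappa> * h1\<^sup>2 / (16 * (\<Lambda> + 1))) * (16 * (\<Lambda> + 1))"
        using \<Lambda> by (intro mult_right_mono) (auto simp: \<omega>_def)
      also have "\<dots> = \<kappa> * h1\<^sup>2" using \<Lambda> by simp
      finally have "\<omega> * 16 * \<Lambda> \<le> \<kappa> * h1\<^sup>2" using w0 by (simp add: algebra_simps)
      then show "4 * \<omega> / h1\<^sup>2 * \<Lambda> \<le> \<kappa> / 4" using h1(1) by (simp add: field_simps)
      have "\<omega> \<le> \<kappa> * \<epsilon> / 8" unfolding \<omega>_def by (rule min.cobounded2)
      then show "2 * \<omega> / \<epsilon> \<le> \<kappa> / 4" using \<epsilon>(1) by (simp add: field_simps)
    qed
    obtain d2 where d2: "0 < d2" "\<forall>\<tau>\<in>{0..T}. \<forall>\<tau>'\<in>{0..T}. \<forall>z\<in>D. \<forall>z'\<in>D. \<bar>\<tau> - \<tau>'\<bar> < d2 \<longrightarrow> dist z z' < d2 \<longrightarrow> \<bar>w \<tau> z - w \<tau>' z'\<bar> < \<omega>"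
      using wu[OF \<omega>(1)] by blast
    have pos3: "0 < m / 2 * \<rho>1\<^sup>2" using m \<rho>1 by simp
    \<comment> \<open>The barrier with all coefficients 0 vanishes, so this is a modulus of
      continuity of v itself.\<close>
    obtain d3 where d3: "0 < d3" "\<And>\<tau> \<tau>' z z'. \<tau> \<in> {0..T} \<Longrightarrow> \<tau>' \<in> {0..T} \<Longrightarrow> z \<in> cball 0 R \<Longrightarrow> z' \<in> cball 0 R \<Longrightarrow>
       \<bar>\<tau> - \<tau>'\<bar> < d3 \<Longrightarrow> dist z z' < d3 \<Longrightarrow> \<bar>(v \<tau> z - barrier 0 0 0 0 0 \<tau> z) - (v \<tau>' z' - barrier 0 0 0 0 0 \<tau>' z')\<bar> < m / 2 * \<rho>1\<^sup>2"
      using uniform_modulus[OF pos3, of R 0 0 0 0 0] by metis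
    define \<delta>0 where "\<delta>0 = min d2 d3"
    have \<delta>0: "0 < \<delta>0" using d2 d3 by (simp add: \<delta>0_def)
    define \<phi>t where "\<phi>t r z = c + \<mu> * \<nu> * exp (\<nu> * r) * (z \<bullet> z)" for r and z :: "real^'n"
    have \<phi>t: "((\<lambda>r. \<phi> r z) has_real_derivative \<phi>t r z) (at r)" for r z
      unfolding \<phi>_def \<phi>t_def by (rule barrier_time)
    have \<phi>tc: "continuous_on X (\<lambda>r. \<phi>t r z)" for X z unfolding \<phi>t_def by (intro continuous_intros)
    have \<phi>int: "\<phi> b z - \<phi> a z = (LINT r:{a..b}|lborel. \<phi>t r z)" if "a \<le> b" for a b z
      by (rule lint_FTC[OF that \<phi>t \<phi>tc, symmetric])
    have "\<exists>F. \<forall>r\<in>{0..T}. \<forall>z\<in>D. \<bar>\<phi>t r z\<bar> \<le> F"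
    proof -
      have "compact ((\<lambda>p. \<phi>t (fst p) (snd p)) ` ({0..T} \<times> D))"
        unfolding \<phi>t_def D_def by (intro compact_continuous_image continuous_intros compact_Times compact_Icc compact_cball)
      then obtain F where "\<And>p. p \<in> {0..T} \<times> D \<Longrightarrow> \<bar>\<phi>t (fst p) (snd p)\<bar> \<le> F"
        by (meson compact_imp_bounded bounded_real imageI)
      then show ?thesis by (intro exI[of _ F]) force
    qed
    then obtain F where F: "\<And>r z. r \<in> {0..T} \<Longrightarrow> z \<in> D \<Longrightarrow> \<bar>\<phi>t r z\<bar> \<le> F" by blast
    have F0: "0 \<le> F" using F[of 0 z0] T \<rho> by (force simp: D_def)
    define Cc where "Cc = 2 * m * \<Lambda> + a1 * (m + 2 * m * \<rho>1) + \<kappa>"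
    have Cc0: "0 \<le> Cc" using m \<Lambda> a11 \<rho>1 \<kappa> by (simp add: Cc_def)
    \<comment> \<open>\<open>Cc\<close> bounds the growth of v and \<open>F\<close> the change of
      the barrier, so C bounds the rate at which w grows at a fixed point across a gap.\<close>
    define C where "C = Cc + F"
    have C0: "0 \<le> C" using Cc0 F0 by (simp add: C_def)
    let ?f = "\<lambda>z r. Lv r z - \<phi>t r z"
    have fint: "set_integrable lborel {a..b} (?f z)" if "0 \<le> a" "b \<le> T" for a b z
      by (rule set_integral_diff(1)[OF Lv_int[OF that] set_integrable_continuous[OF \<phi>tc]])
    have winc: "w b z - w a z = (LINT r:{a..b}|lborel. ?f z r)" if "0 \<le> a" "a \<le> b" "b \<le> T" for a b z
    proof -
      have sc: "set_integrable lborel {a..b} (\<lambda>r. \<phi>t r z)" by (rule set_integrable_continuous[OF \<phi>tc])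
      show ?thesis
        unfolding set_integral_diff(2)[OF Lv_int[OF that(1,3)] sc] \<phi>int[OF that(2), symmetric] Lv_eq[OF that, symmetric]
        by (simp add: w_def)
    qed
    \<comment> \<open>Near a maximizer the second differences of v at step h are at most those of the barrier, so
       the equation gives a nonpositive increment at the times where they control the Hessian.\<close>
    have good: "?f (zm p) r \<le> 0" if r: "r \<in> G" "s1 \<le> r" "r \<le> \<tau>'" and p: "s1 < p" "p \<le> \<tau>'" "\<bar>r - p\<bar> < \<delta>0" for p r
    proof -
      let ?z = "zm p"
      have rT: "r \<in> {0..T}" and pT: "p \<in> {0..T}" using s1T r p by auto
      have rs: "r \<in> {s0..t0}" using r s1' t1 by auto
      note C2 = v_C2[OF rT]
      have Er: "D2_control R \<eta> m (v r)" using E r rs by auto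
      have zD: "?z \<in> D" by (rule zm(1)[OF pT])
      have zR: "norm ?z \<le> R" using zD DR' by auto
      let ?e = "\<mu> * exp (\<nu> * r)"
      let ?g = "q + (2 * \<mu> * exp (\<nu> * r)) *\<^sub>R ?z"
      have close: "w r y \<le> w p y + \<omega>" "w p y \<le> w r y + \<omega>" if "y \<in> D" for y
        using d2(2) rT pT that p(3) d2(1) by (force simp: \<delta>0_def abs_less_iff)+
      \<comment> \<open>\<open>zm p\<close> maximizes w at time p, not at r; changing the time at
        both points costs 2 \<omega>.\<close>
      have up: "w r (?z + h) \<le> w r ?z + 2 * \<omega>" if h: "norm h \<le> h1" for h
      proof -
        have yD: "?z + h \<in> D" using inD[OF p(1,2)] h h1(2) by (auto simp: subset_iff dist_norm)
        show ?thesis using close(1)[OF yD] close(2)[OF zD] Mle[OF pT yD] by (simp add: M_def)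
      qed
      have phi: "\<phi> r (?z + h) = \<phi> r ?z + ?g \<bullet> h + ?e * (norm h)\<^sup>2" for h
        unfolding \<phi>_def by (rule barrier_add)
      have hfs: "hess_form (v r) ?z h \<le> (4 * \<omega> + \<eta> * (norm h)\<^sup>2) + 2 * ?e * (norm h)\<^sup>2" if h: "norm h = h1" for h
      proof -
        have "m * norm h \<le> 1" using h h1 by simp
        then have "hess_form (v r) ?z h \<le> D2 (v r) ?z h + \<eta> * (norm h)\<^sup>2" using D2_control_hess(3)[OF C2 Er zR, of h] h h1 by simp
        moreover have "D2 (v r) ?z h = w r (?z + h) + w r (?z + - h) - 2 * w r ?z + 2 * ?e * (norm h)\<^sup>2"
          using phi[of h] phi[of "- h"] by (simp add: D2_def w_def)
        moreover have "w r (?z + h) \<le> w r ?z + 2 * \<omega>" "w r (?z + - h) \<le> w r ?z + 2 * \<omega>"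
          using h by (auto intro!: up simp del: add_uminus_conv_diff)
        ultimately show ?thesis by linarith
      qed
      have hfa: "hess_form (v r) ?z a \<le> (4 * \<omega> / h1\<^sup>2 + \<eta> + 2 * ?e) * (norm a)\<^sup>2" for a
      proof (cases "a = 0")
        case True
        then show ?thesis by (simp add: hess_form_def)
      next
        case False
        define h where "h = (h1 / norm a) *\<^sub>R a"
        have nh: "norm h = h1" using False h1 by (simp add: h_def)
        have ah: "a = (norm a / h1) *\<^sub>R h" using False h1 by (simp add: h_def)
        have "hess_form (v r) ?z a = (norm a / h1)\<^sup>2 * hess_form (v r) ?z h" by (subst ah) (rule hess_form_scale)
        also have "\<dots> \<le> (norm a / h1)\<^sup>2 * ((4 * \<omega> + \<eta> * h1\<^sup>2) + 2 * ?e * h1\<^sup>2)"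
          using hfs[OF nh] unfolding nh by (intro mult_left_mono) auto
        also have "\<dots> = (4 * \<omega> / h1\<^sup>2 + \<eta> + 2 * ?e) * (norm a)\<^sup>2"
          using h1(1) by (simp add: power_divide field_simps)
        finally show ?thesis .
      qed
      have pr: "psd (Q r)" by (rule Q_psd[OF rT])
      have tr: "trace (Q r ** hess (v r) ?z) \<le> \<kappa> / 2 + 2 * ?e * trace (Q r)"
      proof -
        have "trace (Q r ** hess (v r) ?z) \<le> (4 * \<omega> / h1\<^sup>2 + \<eta> + 2 * ?e) * trace (Q r)"
          by (rule trace_hess_form[OF pr hfa])
        moreover have "4 * \<omega> / h1\<^sup>2 * trace (Q r) \<le> 4 * \<omega> / h1\<^sup>2 * \<Lambda>"
          using \<Lambda>(1)[OF rT] \<omega>(1) by (intro mult_left_mono) auto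
        moreover have "\<eta> * trace (Q r) \<le> \<eta> * \<Lambda>" using \<Lambda>(1)[OF rT] \<eta>0 by (intro mult_left_mono)
        ultimately show ?thesis using \<omega>(2) \<eta> unfolding distrib_right by linarith
      qed
      \<comment> \<open>At time r the point need not be critical for w. The one-sided bound
        \<open>up\<close> for the step \<epsilon> A z replaces the first-order condition.\<close>
      have dr: "(A *v ?z) \<bullet> grad (v r) ?z \<le> (A *v ?z) \<bullet> ?g + \<kappa> / 2"
      proof -
        define h where "h = \<epsilon> *\<^sub>R (A *v ?z)"
        have az: "norm (A *v ?z) \<le> a1" using a1[of ?z] zR by simp
        have nh: "norm h \<le> \<epsilon> * a1" using az \<epsilon>(1) by (simp add: h_def mult_left_mono)
        have nh1: "norm h \<le> h1" using nh \<epsilon>(2) by simp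
        obtain \<theta> where \<theta>: "0 < \<theta>" "\<theta> < 1" "v r (?z + h) = v r ?z + dd h (v r) ?z + hess_form (v r) (?z + \<theta> *\<^sub>R h) h / 2"
          using taylor_exact[OF C2] by blast
        have "norm (\<theta> *\<^sub>R h) \<le> 1 * norm h" unfolding norm_scaleR using \<theta> by (intro mult_right_mono) auto
        then have "?z + \<theta> *\<^sub>R h \<in> D" using inD[OF p(1,2)] nh1 h1(2) by (auto simp: subset_iff dist_norm)
        then have "norm (?z + \<theta> *\<^sub>R h) \<le> R" using DR' by auto
        from D2_control_hess(2)[OF C2 Er this, of h]
        have "- (m * (norm h)\<^sup>2) \<le> hess_form (v r) (?z + \<theta> *\<^sub>R h) h" by (simp add: abs_le_iff)
        then have 1: "dd h (v r) ?z \<le> v r (?z + h) - v r ?z + m / 2 * (norm h)\<^sup>2" using \<theta>(3) by linarith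
        have 2: "v r (?z + h) - v r ?z \<le> 2 * \<omega> + ?g \<bullet> h + ?e * (norm h)\<^sup>2"
          using up[OF nh1] phi[of h] by (simp add: w_def)
        have "?e * (norm h)\<^sup>2 \<le> mm * (norm h)\<^sup>2" using mm[OF rT] by (intro mult_right_mono) auto
        then have "dd h (v r) ?z \<le> ?g \<bullet> h + 2 * \<omega> + (m / 2 + mm) * (norm h)\<^sup>2" using 1 2 unfolding distrib_right by linarith
        also have "(m / 2 + mm) * (norm h)\<^sup>2 \<le> (m / 2 + mm + 1) * (\<epsilon> * a1)\<^sup>2"
          using nh m mm0 by (intro mult_mono power_mono) auto
        also have "(m / 2 + mm + 1) * (\<epsilon> * a1)\<^sup>2 = \<epsilon> * (KK * \<epsilon>)" by (simp add: KK_def power2_eq_square mult_ac)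
        finally have "\<epsilon> * dd (A *v ?z) (v r) ?z \<le> \<epsilon> * (?g \<bullet> (A *v ?z)) + 2 * \<omega> + \<epsilon> * (KK * \<epsilon>)"
          by (simp add: h_def dd_scale)
        also have "2 * \<omega> = \<epsilon> * (2 * \<omega> / \<epsilon>)" using \<epsilon>(1) by simp
        finally have "\<epsilon> * dd (A *v ?z) (v r) ?z \<le> \<epsilon> * (?g \<bullet> (A *v ?z) + 2 * \<omega> / \<epsilon> + KK * \<epsilon>)"
          by (simp only: distrib_left)
        then have "dd (A *v ?z) (v r) ?z \<le> ?g \<bullet> (A *v ?z) + 2 * \<omega> / \<epsilon> + KK * \<epsilon>"
          using \<epsilon>(1) by (simp only: mult_le_cancel_left_pos)
        moreover have "dd (A *v ?z) (v r) ?z = (A *v ?z) \<bullet> grad (v r) ?z"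
          by (simp add: dd_def inner_vec_def grad_def)
        ultimately show ?thesis using \<omega>(3) \<epsilon>(3) by (simp add: inner_commute)
      qed
      have "\<kappa> \<le> slack c q \<mu> \<nu> r ?z" using sl rs zD by (simp add: D_def)
      then have "\<kappa> \<le> \<phi>t r ?z - (2 * ?e * trace (Q r) + (A *v ?z) \<bullet> ?g)"
        by (simp add: slack_def \<phi>t_def mult.assoc)
      then show ?thesis using tr dr unfolding Lv_def by linarith
    qed
    \<comment> \<open>The barrier raised by \<open>M a\<close> dominates v at time a by definition
      of the maximum, and on the sphere because \<open>M a\<close> is nonnegative.\<close>
    have gapM: "M b \<le> M a" if ab: "s1 \<le> a" "a < b" "b \<le> \<tau>'" "{a<..<b} \<inter> G = {}" for a b
    proof -
      have aT: "a \<in> {0..T}" and bT: "b \<in> {0..T}" using s1T ab by auto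
      have Ma: "0 \<le> M a" using Mbig[of a] Ms1 c0 ab by (cases "a = s1") auto
      have "v b (zm b) \<le> barrier (\<alpha> + M a) c q \<mu> \<nu> b (zm b)"
      proof (rule comparisonD[OF gapP[of a b] \<rho> DR])
        show "zm b \<in> cball z0 \<rho>" using zm(1)[OF bT] by (simp add: D_def)
        show "\<kappa> \<le> slack c q \<mu> \<nu> \<tau> z" if "\<tau> \<in> {a..b}" "z \<in> cball z0 \<rho>" for \<tau> z
          using sl that ab s1' t1 by auto
        show "v a z \<le> barrier (\<alpha> + M a) c q \<mu> \<nu> a z" if "z \<in> cball z0 \<rho>" for z
          using Mle[OF aT, of z] that unfolding barrier_shift by (simp add: w_def \<phi>_def D_def)
        show "v \<tau> z \<le> barrier (\<alpha> + M a) c q \<mu> \<nu> \<tau> z" if "\<tau> \<in> {a..b}" "z \<in> sphere z0 \<rho>" for \<tau> z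
        proof -
          have "v \<tau> z \<le> barrier \<alpha> c q \<mu> \<nu> \<tau> z" using lat that ab s1' t1 by auto
          then show ?thesis using Ma unfolding barrier_shift by linarith
        qed
      qed (use ab s1' t1 in auto)
      then show ?thesis unfolding barrier_shift by (simp add: M_def w_def \<phi>_def)
    qed
    have Gb: "G \<in> sets lborel" using G by auto
    \<comment> \<open>The maximizer at the later time p is followed back to a0 at the same point, so
      a single point of space is involved. The integral over times in G is nonpositive; over the
      gaps it is bounded by \<open>growth_in_gap\<close>, since the left end of each gap lies in G,
      where second differences are controlled.\<close>
    have claimA: "M p - M a0 \<le> C * measure lborel ({a0..p} - G)"
      if pq: "a0 \<in> G" "p \<in> G" "s1 \<le> a0" "a0 < p" "p \<le> \<tau>'" "p - a0 < \<delta>0" for a0 p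
    proof -
      let ?z = "zm p"
      have aT: "a0 \<in> {0..T}" and pT: "p \<in> {0..T}" using s1T pq by auto
      have p1: "s1 < p" using pq by simp
      have zD: "?z \<in> D" by (rule zm(1)[OF pT])
      define U where "U = {a0..p} - G"
      have Ueq: "U = {a0<..<p} - G" 
      proof (rule set_eqI)
        fix y
        have "y \<notin> G \<Longrightarrow> y \<noteq> a0 \<and> y \<noteq> p" using pq(1,2) by blast
        then show "y \<in> U \<longleftrightarrow> y \<in> {a0<..<p} - G" by (auto simp: U_def order_le_less)
      qed
      have Uo: "open U" unfolding Ueq using G by (intro open_Diff) auto
      have Us: "U \<subseteq> {a0..p}" by (auto simp: U_def)
      have fi: "set_integrable lborel {a0..p} (?f ?z)" by (rule fint) (use aT pT in auto)
      have fU: "set_integrable lborel U (?f ?z)" by (rule set_integrable_subset[OF fi]) (use Uo Us in auto)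
      have fG: "set_integrable lborel ({a0..p} \<inter> G) (?f ?z)" by (rule set_integrable_subset[OF fi]) (use Gb in auto)
      have "M p - M a0 \<le> w p ?z - w a0 ?z" using Mle[OF aT zD] by (simp add: M_def)
      also have "\<dots> = (LINT r:{a0..p}|lborel. ?f ?z r)" by (rule winc) (use aT pT pq in auto)
      also have "{a0..p} = U \<union> ({a0..p} \<inter> G)" by (auto simp: U_def)
      also have "(LINT r:U \<union> ({a0..p} \<inter> G)|lborel. ?f ?z r) = (LINT r:U|lborel. ?f ?z r) + (LINT r:({a0..p} \<inter> G)|lborel. ?f ?z r)"
        by (rule set_integral_Un[OF _ fU fG]) (auto simp: U_def)
      also have "(LINT r:({a0..p} \<inter> G)|lborel. ?f ?z r) \<le> 0"
      proof -
        have "0 \<le> (LINT r:({a0..p} \<inter> G)|lborel. - ?f ?z r)"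
          by (rule lint_nonneg) (use good[of _ p] pq p1 in auto)
        then show ?thesis using set_integral_uminus[OF fG] by simp
      qed
      also have "(LINT r:U|lborel. ?f ?z r) \<le> C * measure lborel U"
      proof (rule lint_components[OF Uo Us fU _ C0])
        fix a b assume ab: "a < b" "{a<..<b} \<subseteq> U" "a \<notin> U" "b \<notin> U"
        have clo: "{a..b} \<subseteq> {a0..p}"
        proof -
          have "closure {a<..<b} \<subseteq> {a0..p}" by (rule closure_minimal) (use ab Us in auto)
          then show ?thesis using ab by simp
        qed
        then have abp: "a0 \<le> a" "b \<le> p" using ab by auto
        have aG: "a \<in> G" using clo ab by (auto simp: U_def)
        have abT: "0 \<le> a" "b \<le> T" "a \<in> {0..T}" using abp aT pT ab by auto
        have "w b ?z - w a ?z \<le> C * (b - a)"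
        proof -
          have dG: "{a<..<b} \<inter> G = {}" using ab by (auto simp: U_def)
          have bD: "cball ?z \<rho>1 \<subseteq> cball 0 R" using inD[OF p1 pq(5)] DR' by blast
          have "v b ?z - v a ?z \<le> Cc * (b - a)"
          proof (rule growth_in_gap[OF abT(1) ab(1) abT(2) gapP \<kappa> _ m \<rho>1(1) bD])
            show "D2_control R \<eta> m (v a)" using E[OF aG] abp pq s1' t1 ab by auto
            show "\<bar>v \<tau> z - v a z\<bar> \<le> m / 2 * \<rho>1\<^sup>2" if "\<tau> \<in> {a..b}" "z \<in> cball ?z \<rho>1" for \<tau> z
            proof -
              have "\<bar>\<tau> - a\<bar> < d3" using that abp pq by (simp add: \<delta>0_def)
              then show ?thesis using d3(2)[of \<tau> a z z] d3(1) that abT ab(1) bD by (force simp: barrier_def)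
            qed
            show "2 * m * trace (Q \<tau>) + norm (A *v z) * (m + 2 * m * \<rho>1) + \<kappa> \<le> Cc" if "\<tau> \<in> {0..T}" "z \<in> cball 0 R" for \<tau> z
              unfolding Cc_def using a1[OF that(2)] \<Lambda>(1)[OF that(1)] m \<rho>1(1)
              by (intro add_mono mult_left_mono mult_right_mono) auto
          qed (use abp pq s1' t1 ab dG in auto)
          moreover have "\<bar>\<phi> b ?z - \<phi> a ?z\<bar> \<le> F * (b - a)"
            unfolding \<phi>int[OF less_imp_le[OF ab(1)]]
            by (rule sint_bound[OF set_integrable_continuous[OF \<phi>tc]]) (use F zD abT ab(1) in auto)
          ultimately show ?thesis unfolding w_def C_def distrib_right by linarith
        qed
        moreover have "(LINT s:{a<..<b}|lborel. ?f ?z s) = w b ?z - w a ?z"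
          unfolding lint_Ioo[OF fint[OF abT(1,2)]] by (rule winc[symmetric]) (use abT ab in auto)
        ultimately show "(LINT s:{a<..<b}|lborel. ?f ?z s) \<le> C * (b - a)" by simp
      qed
      finally show ?thesis unfolding U_def by simp
    qed
    \<comment> \<open>M grows at most at a constant rate times the measure of the complement of G and does not grow in
       gaps. Hence it does not grow once finitely many gaps exhaust that measure up to epsilon.\<close>
    have "M \<tau>' \<le> M s1"
    proof (rule field_le_epsilon)
      fix e :: real assume e: "0 < e"
      define U where "U = {s1<..<\<tau>'} - G"
      have Uo: "open U" unfolding U_def using G by (intro open_Diff) auto
      have "0 < e / (C + 1)" using e C0 by simp
      \<comment> \<open>Inner regularity: K takes up most of the complement of G, and the growth
        rate C is charged only on the rest \<open>X\<close>. The summand 1 in C + 1 avoids division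
        by zero.\<close>
      then obtain K where K: "closed K" "K \<subseteq> U" "emeasure lebesgue (U - K) < ennreal (e / (C + 1))"
        using sets_lebesgue_inner_closed[of U "e / (C + 1)"] Uo by (metis borel_open sets_completionI_sets sets_lborel)
      define X where "X = U - K"
      have Xo: "open X" unfolding X_def using Uo K(1) by (rule open_Diff)
      have Xb: "X \<in> sets lborel" using Xo by simp
      have mX: "measure lborel X \<le> e / (C + 1)"
      proof -
        have "emeasure lborel X < ennreal (e / (C + 1))" using K(3) Xb by (simp add: X_def emeasure_completion)
        then show ?thesis unfolding measure_def using \<open>0 < e / (C + 1)\<close> by (metis enn2real_ennreal enn2real_mono ennreal_less_top less_imp_le)
      qed
      have fin: "Y \<in> fmeasurable lborel" if "Y \<in> sets lborel" "Y \<subseteq> {s1..\<tau>'}" for Y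
        using that emeasure_mono[OF that(2), of lborel] unfolding fmeasurable_def
        by (auto simp: emeasure_lborel_Icc_eq intro: order_le_less_trans)
      have XI: "X \<subseteq> {s1..\<tau>'}" by (auto simp: X_def U_def)
      \<comment> \<open>The right-hand side is additive over adjacent intervals, so Bolzano's
        local-to-global principle reduces the bound to short intervals around each time.\<close>
      define P where "P a b \<longleftrightarrow> (s1 \<le> a \<longrightarrow> b \<le> \<tau>' \<longrightarrow> M b - M a \<le> C * measure lborel ({a<..b} \<inter> X))" for a b
      have "P s1 \<tau>'"
      proof (rule Bolzano[of s1 \<tau>' P])
        show "s1 \<le> \<tau>'" using s1' by simp
      next
        fix a b c assume trans: "P a b" "P b c" "a \<le> b" "b \<le> c"
        show "P a c" unfolding P_def
        proof (intro impI)
          assume ac: "s1 \<le> a" "c \<le> \<tau>'"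
          have "M b - M a \<le> C * measure lborel ({a<..b} \<inter> X)" "M c - M b \<le> C * measure lborel ({b<..c} \<inter> X)"
            using trans ac unfolding P_def by auto
          moreover have "measure lborel ({a<..c} \<inter> X) = measure lborel ({a<..b} \<inter> X) + measure lborel ({b<..c} \<inter> X)"
          proof -
            have e: "{a<..c} \<inter> X = ({a<..b} \<inter> X) \<union> ({b<..c} \<inter> X)" using trans(3,4) by auto
            have f1: "{a<..b} \<inter> X \<in> fmeasurable lborel" "{b<..c} \<inter> X \<in> fmeasurable lborel"
              by (rule fin; use Xb XI in auto)+
            show ?thesis unfolding e
              by (rule measure_Union) (use f1 in \<open>auto simp: fmeasurable_def\<close>)
          qed
          ultimately show "M c - M a \<le> C * measure lborel ({a<..c} \<inter> X)" by (simp add: distrib_left)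
        qed
      next
        fix x
        show "\<exists>d>0. \<forall>a b. a \<le> x \<and> x \<le> b \<and> b - a < d \<longrightarrow> P a b"
        proof (cases "x \<in> G")
          case False
          then obtain d where d: "0 < d" "ball x d \<inter> G = {}"
            using G open_contains_ball[of "- G"] by (metis ComplI Compl_disjoint2 closed_def disjoint_eq_subset_Compl inf_commute)
          show ?thesis
          proof (intro exI[of _ d] conjI allI impI d(1))
            fix a b assume ab: "a \<le> x \<and> x \<le> b \<and> b - a < d"
            show "P a b" unfolding P_def
            proof (intro impI)
              assume i: "s1 \<le> a" "b \<le> \<tau>'"
              have "{a<..<b} \<subseteq> ball x d" using ab by (auto simp: dist_real_def)
              then have "{a<..<b} \<inter> G = {}" using d(2) by blast
              then have "M b \<le> M a" using gapM[of a b] i ab by (cases "a = b") auto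
              moreover have "0 \<le> C * measure lborel ({a<..b} \<inter> X)" using C0 by simp
              ultimately show "M b - M a \<le> C * measure lborel ({a<..b} \<inter> X)" by linarith
            qed
          qed
        next
          case True
          then have "x \<notin> K" using K(2) by (auto simp: U_def)
          then obtain d where d: "0 < d" "ball x d \<inter> K = {}"
            using K(1) open_contains_ball[of "- K"] by (metis ComplI Compl_disjoint2 closed_def disjoint_eq_subset_Compl inf_commute)
          show ?thesis
          proof (intro exI[of _ "min d \<delta>0"] conjI allI impI)
            show "0 < min d \<delta>0" using d \<delta>0 by simp
            fix a b assume ab: "a \<le> x \<and> x \<le> b \<and> b - a < min d \<delta>0"
            show "P a b" unfolding P_def
            proof (intro impI)
              assume i: "s1 \<le> a" "b \<le> \<tau>'"
              have cmpct: "compact ({a..b} \<inter> G)" using G by (intro compact_Int_closed compact_Icc)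
              have ne: "{a..b} \<inter> G \<noteq> {}" using True ab by auto
              \<comment> \<open>Between the first and the last time of G in [a,b]
                \<open>claimA\<close> applies, and since [a,b] avoids K its error is charged to X.
                The two outer pieces are gaps, where M does not grow.\<close>
              obtain p where p: "p \<in> {a..b} \<inter> G" "\<And>y. y \<in> {a..b} \<inter> G \<Longrightarrow> p \<le> y"
                using compact_attains_inf[OF cmpct ne] by blast
              obtain r where r: "r \<in> {a..b} \<inter> G" "\<And>y. y \<in> {a..b} \<inter> G \<Longrightarrow> y \<le> r"
                using compact_attains_sup[OF cmpct ne] by blast
              have pr: "p \<le> r" using p r by auto
              have 1: "M p \<le> M a"
              proof (cases "a = p")
                case False
                have "{a<..<p} \<inter> G = {}"
                proof (rule equals0I)
                  fix y assume y: "y \<in> {a<..<p} \<inter> G"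
                  then have "y \<in> {a..b} \<inter> G" using p(1) by auto
                  from p(2)[OF this] show False using y by auto
                qed
                then show ?thesis using gapM[of a p] False p(1) i by auto
              qed simp
              have 2: "M b \<le> M r"
              proof (cases "r = b")
                case False
                have "{r<..<b} \<inter> G = {}"
                proof (rule equals0I)
                  fix y assume y: "y \<in> {r<..<b} \<inter> G"
                  then have "y \<in> {a..b} \<inter> G" using r(1) by auto
                  from r(2)[OF this] show False using y by auto
                qed
                then show ?thesis using gapM[of r b] False r(1) i by auto
              qed simp
              have 3: "M r - M p \<le> C * measure lborel ({a<..b} \<inter> X)"
              proof (cases "p = r")
                case True
                then show ?thesis using C0 by simp
              next
                case False
                have "p < r" using pr False by simp
                then have "M r - M p \<le> C * measure lborel ({p..r} - G)"
                  by (intro claimA) (use p(1) r(1) i ab in auto)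
                also have "\<dots> \<le> C * measure lborel ({a<..b} \<inter> X)"
                proof (rule mult_left_mono[OF measure_mono_fmeasurable C0])
                  show "{p..r} - G \<subseteq> {a<..b} \<inter> X"
                  proof
                    fix y assume y: "y \<in> {p..r} - G"
                    then have "y \<noteq> p" "y \<noteq> r" using p(1) r(1) by blast+
                    then have y2: "p < y" "y < r" using y by auto
                    have "dist x y < d" using y2 p(1) r(1) ab by (auto simp: dist_real_def)
                    then have "y \<notin> K" using d(2) by (auto simp: disjoint_iff)
                    then show "y \<in> {a<..b} \<inter> X" using y y2 p(1) r(1) i by (auto simp: X_def U_def)
                  qed
                  show "{p..r} - G \<in> sets lborel" using Gb by auto
                  show "{a<..b} \<inter> X \<in> fmeasurable lborel" by (rule fin) (use Xb XI in auto)
                qed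
                finally show ?thesis .
              qed
              show "M b - M a \<le> C * measure lborel ({a<..b} \<inter> X)" using 1 2 3 by linarith
            qed
          qed
        qed
      qed
      then have "M \<tau>' - M s1 \<le> C * measure lborel ({s1<..\<tau>'} \<inter> X)" by (simp add: P_def)
      also have "\<dots> \<le> C * measure lborel X"
        using fin[OF Xb XI] Xb by (intro mult_left_mono[OF measure_mono_fmeasurable C0]) auto
      also have "\<dots> \<le> C * (e / (C + 1))" by (rule mult_left_mono[OF mX C0])
      also have "\<dots> \<le> e" using e C0 by (simp add: field_simps)
      finally show "M \<tau>' \<le> M s1 + e" by simp
    qed
    then show False using s1'(2) c0 by simp
  qed
qed

end

section \<open>Comparison at all times and uniqueness\<close>

lemma lint_point:
  fixes h :: "real \<Rightarrow> real"
  shows "(LINT s:{0..0}|lborel. h s) = 0"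
proof -
  have e: "indicator {0..0::real} s *\<^sub>R h s = indicator {0..0} s *\<^sub>R h 0" for s by (auto simp: indicator_def)
  show ?thesis unfolding set_lebesgue_integral_def e by simp
qed

context null_solution begin

lemma v_lim:
  assumes "\<And>n. x n \<in> {0..T}" "x \<longlonglongrightarrow> l" "l \<in> {0..T}"
  shows "(\<lambda>n. v (x n) y) \<longlonglongrightarrow> v l y"
proof -
  have "continuous_on {0..T} ((\<lambda>(t, z). v t z) \<circ> (\<lambda>t. (t, y)))"
    by (rule continuous_on_compose[OF _ continuous_on_subset[OF v_cont]]) (auto intro!: continuous_intros)
  then have "continuous_on {0..T} (\<lambda>t. v t y)" by (simp add: o_def)
  then show ?thesis using assms unfolding continuous_on_sequentially o_def by blast
qed

lemma D2_control_closed: "closed {t \<in> {0..T}. D2_control R \<eta> m (v t)}"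
  unfolding closed_sequential_limits
proof (intro allI impI, elim conjE)
  fix x l assume x: "\<forall>n. x n \<in> {t \<in> {0..T}. D2_control R \<eta> m (v t)}" and l: "x \<longlonglongrightarrow> l"
  have lT: "l \<in> {0..T}" using closed_sequentially[OF closed_atLeastAtMost, of x 0 T l] x l by auto
  have E: "D2_control R \<eta> m (v (x n))" for n using x by auto
  have lim: "(\<lambda>n. v (x n) y) \<longlonglongrightarrow> v l y" for y by (rule v_lim[OF _ l lT]) (use x in auto)
  have limD: "(\<lambda>n. D2 (v (x n)) z h) \<longlonglongrightarrow> D2 (v l) z h" for z h
    unfolding D2_def by (intro tendsto_diff tendsto_add tendsto_mult lim tendsto_const)
  have "D2_control R \<eta> m (v l)"
    unfolding D2_control_def
  proof (intro allI impI conjI)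
    fix z h :: "real^'n" assume z: "norm z \<le> R" and h: "norm h \<le> 1"
    show "\<bar>v l (z + h) - v l z\<bar> \<le> m * norm h"
      by (rule LIMSEQ_le_const2[OF tendsto_rabs[OF tendsto_diff[OF lim lim]]])
        (use E z h in \<open>auto simp: D2_control_def\<close>)
    show "\<bar>D2 (v l) z h\<bar> \<le> m * (norm h)\<^sup>2"
      by (rule LIMSEQ_le_const2[OF tendsto_rabs[OF limD]])
        (use E z h in \<open>auto simp: D2_control_def\<close>)
    fix k :: nat assume "m * norm h \<le> 1" "1 \<le> k"
    then show "(real k)\<^sup>2 * D2 (v l) z ((1 / real k) *\<^sub>R h) \<le> D2 (v l) z h + \<eta> * (norm h)\<^sup>2"
      by (intro LIMSEQ_le[OF tendsto_mult[OF tendsto_const limD] tendsto_add[OF limD tendsto_const]])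
        (use E z h in \<open>auto simp: D2_control_def\<close>)
  qed
  then show "l \<in> {t \<in> {0..T}. D2_control R \<eta> m (v t)}" using lT by simp
qed

lemma trace_Q_bound: obtains \<Lambda> where "0 \<le> \<Lambda>" "\<And>r. r \<in> {0..T} \<Longrightarrow> trace (Q r) \<le> \<Lambda>"
proof -
  have "continuous_on {0..T} (\<lambda>r. trace (Q r))"
    unfolding trace_def by (intro continuous_on_sum continuous_on_component Q_cont)
  then have "compact ((\<lambda>r. trace (Q r)) ` {0..T})" by (intro compact_continuous_image compact_Icc)
  then obtain b where b: "\<And>r. r \<in> {0..T} \<Longrightarrow> \<bar>trace (Q r)\<bar> \<le> b"
    by (meson compact_imp_bounded bounded_real imageI)
  show ?thesis
  proof (rule that[of "\<bar>b\<bar>"])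
    show "trace (Q r) \<le> \<bar>b\<bar>" if "r \<in> {0..T}" for r using b[OF that] by linarith
  qed simp
qed

text \<open>
  The times without a neighbourhood on which comparison holds form a closed set G. By Baire's theorem
  \<^const>\<open>D2_control\<close> holds with one constant on a relatively open part of G, and there comparison holds.
\<close>

lemma comparison_all:
  assumes \<kappa>: "0 < \<kappa>" and R: "0 < R"
  shows "comparison \<kappa> R 0 T"
proof -
  obtain \<Lambda> where \<Lambda>: "0 \<le> \<Lambda>" "\<And>r. r \<in> {0..T} \<Longrightarrow> trace (Q r) \<le> \<Lambda>" using trace_Q_bound by blast
  \<comment> \<open>This spends one quarter of \<kappa> on \<open>\<eta> * \<Lambda>\<close>; the
    summand 1 keeps \<eta> well defined when \<Lambda> = 0.\<close>
  define \<eta> where "\<eta> = \<kappa> / (4 * (\<Lambda> + 1))"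
  have \<eta>: "0 < \<eta>" using \<kappa> \<Lambda> by (simp add: \<eta>_def)
  have \<eta>\<Lambda>: "\<eta> * \<Lambda> \<le> \<kappa> / 4"
  proof -
    have "\<eta> * \<Lambda> \<le> \<eta> * (\<Lambda> + 1)" using \<eta> by simp
    also have "\<dots> = \<kappa> / 4" using \<Lambda> by (simp add: \<eta>_def field_simps)
    finally show ?thesis .
  qed
  define good where "good t \<longleftrightarrow> (\<exists>\<delta>>0. \<forall>s t'. t - \<delta> < s \<longrightarrow> s \<le> t' \<longrightarrow> t' < t + \<delta> \<longrightarrow> 0 \<le> s \<longrightarrow> t' \<le> T \<longrightarrow> comparison \<kappa> R s t')" for t
  define G where "G = {t \<in> {0..T}. \<not> good t}"
  have "open {t. good t}"
    unfolding open_contains_ball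
  proof
    fix t assume "t \<in> {t. good t}"
    then obtain \<delta> where d: "0 < \<delta>" "\<And>s t'. t - \<delta> < s \<Longrightarrow> s \<le> t' \<Longrightarrow> t' < t + \<delta> \<Longrightarrow> 0 \<le> s \<Longrightarrow> t' \<le> T \<Longrightarrow> comparison \<kappa> R s t'"
      unfolding good_def by blast
    have "good y" if "y \<in> ball t (\<delta> / 2)" for y
      unfolding good_def
    proof (intro exI[of _ "\<delta> / 2"] conjI allI impI)
      fix s t' assume "y - \<delta> / 2 < s" "s \<le> t'" "t' < y + \<delta> / 2" "0 \<le> s" "t' \<le> T"
      moreover have "\<bar>t - y\<bar> < \<delta> / 2" using that by (simp add: dist_real_def)
      ultimately show "comparison \<kappa> R s t'" by (intro d(2)) linarith+
    qed (use d in simp)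
    then show "\<exists>e>0. ball t e \<subseteq> {t. good t}" using d(1) by (intro exI[of _ "\<delta> / 2"]) auto
  qed
  then have "closed ({0..T} \<inter> - {t. good t})" by (intro closed_Int) auto
  moreover have "{0..T} \<inter> - {t. good t} = G" by (auto simp: G_def)
  ultimately have Gc: "closed G" by simp
  have gaps: "comparison \<kappa> R a b" if ab: "0 \<le> a" "a \<le> b" "b \<le> T" "{a..b} \<inter> G = {}" for a b
  proof -
    define P where "P x y \<longleftrightarrow> (a \<le> x \<longrightarrow> y \<le> b \<longrightarrow> x \<le> y \<longrightarrow> comparison \<kappa> R x y)" for x y
    have "P a b"
    proof (rule Bolzano[of a b P])
      show "a \<le> b" by (rule ab(2))
      fix x y z assume "P x y" "P y z" "x \<le> y" "y \<le> z"
      then show "P x z" unfolding P_def using comparison_trans[of \<kappa> R x y z] by auto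
    next
      fix x assume x: "a \<le> x" "x \<le> b"
      then have "x \<in> {0..T}" "x \<notin> G" using ab by auto
      then have "good x" by (simp add: G_def)
      then obtain \<delta> where d: "0 < \<delta>" "\<And>s t'. x - \<delta> < s \<Longrightarrow> s \<le> t' \<Longrightarrow> t' < x + \<delta> \<Longrightarrow> 0 \<le> s \<Longrightarrow> t' \<le> T \<Longrightarrow> comparison \<kappa> R s t'"
        unfolding good_def by blast
      show "\<exists>d>0. \<forall>u w. u \<le> x \<and> x \<le> w \<and> w - u < d \<longrightarrow> P u w"
        unfolding P_def using ab x by (intro exI[of _ \<delta>] conjI allI impI d) auto
    qed
    then show ?thesis using ab(2) by (simp add: P_def)
  qed
  have "G = {}"
  proof (rule ccontr)
    assume ne: "G \<noteq> {}"
    define E where "E n = {t \<in> {0..T}. D2_control R \<eta> (real (Suc n)) (v t)}" for n :: nat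
    have Ec: "closed (E n)" for n unfolding E_def by (rule D2_control_closed)
    have cover: "\<exists>n. t \<in> E n" if "t \<in> G" for t
      using D2_control_ex[OF v_C2 \<eta>, of t R] that by (auto simp: E_def G_def)
    have "\<exists>n. \<not> G \<subseteq> closure (G - E n)"
    proof (rule ccontr)
      assume "\<not> (\<exists>n. \<not> G \<subseteq> closure (G - E n))"
      then have dense: "G \<subseteq> closure (G - E n)" for n by blast
      \<comment> \<open>If every \<open>G - E n\<close> were dense in G, these relatively open sets
        would have a dense intersection; but it is empty because the sets \<open>E n\<close> cover
        G.\<close>
      have "G \<subseteq> closure (\<Inter>(range (\<lambda>n. G - E n)))"
      proof (rule Baire[OF Gc])
        fix U assume "U \<in> range (\<lambda>n. G - E n)"
        then obtain n where U: "U = G \<inter> - E n" by auto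
        have "openin (top_of_set G) U" unfolding U using Ec by (intro openin_open_Int) auto
        moreover have "G \<subseteq> closure U" using dense[of n] by (simp add: U Diff_eq)
        ultimately show "openin (top_of_set G) U \<and> G \<subseteq> closure U" by simp
      qed simp
      moreover have "\<Inter>(range (\<lambda>n. G - E n)) = {}" using cover by blast
      ultimately have "G \<subseteq> closure {}" by (simp only:)
      then show False using ne by simp
    qed
    then obtain n t0 where t0: "t0 \<in> G" "t0 \<notin> closure (G - E n)" by blast
    then obtain \<delta> where d: "0 < \<delta>" "ball t0 \<delta> \<subseteq> - closure (G - E n)"
      using open_contains_ball[of "- closure (G - E n)"] by auto
    have sub: "r \<in> E n" if "r \<in> G" "\<bar>r - t0\<bar> < \<delta>" for r
    proof (rule ccontr)
      assume "r \<notin> E n"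
      then have "r \<in> G - E n" using that by simp
      then have "r \<in> closure (G - E n)" by (rule closure_subset[THEN subsetD])
      moreover have "r \<in> ball t0 \<delta>" using that(2) by (simp add: dist_real_def abs_minus_commute)
      ultimately show False using d(2) by blast
    qed
    have "good t0"
      unfolding good_def
    proof (intro exI[of _ \<delta>] conjI allI impI d(1))
      fix s t' assume st: "t0 - \<delta> < s" "s \<le> t'" "t' < t0 + \<delta>" "0 \<le> s" "t' \<le> T"
      show "comparison \<kappa> R s t'"
      proof (rule comparison_on_portion[OF \<kappa> R Gc st(4,2,5), where \<eta>=\<eta> and m="real (Suc n)" and \<Lambda>=\<Lambda>])
        show "D2_control R \<eta> (real (Suc n)) (v r)" if "r \<in> G" "s \<le> r" "r \<le> t'" for r
          using sub[of r] that st by (auto simp: E_def abs_less_iff)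
        show "comparison \<kappa> R a b" if "s \<le> a" "a \<le> b" "b \<le> t'" "{a..b} \<inter> G = {}" for a b
          by (rule gaps) (use that st in auto)
      qed (use \<eta> \<eta>\<Lambda> \<Lambda> in auto)
    qed
    then show False using t0(1) by (simp add: G_def)
  qed
  then show ?thesis by (intro gaps) (use T in auto)
qed

lemma null_solution_initial: "v 0 z = 0"
proof -
  have "0 \<in> {0..T}" using T by simp
  from v_eq[OF this, of z] show ?thesis by (simp only: lint_point)
qed

text \<open>The barrier is \<epsilon> times a function growing like |z|^2, so on a sphere of large
  radius R it exceeds the bound V of v. The exponent \<nu> = 2 a, with a a bound for the operator
  norm of A, lets the time derivative absorb the drift, and c makes the slack at least \<epsilon>.
  At a fixed point the barrier tends to 0 with \<epsilon>.\<close>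

lemma null_solution_nonpos:
  assumes t: "t \<in> {0..T}"
  shows "v t z \<le> 0"
proof -
  obtain \<Lambda> where \<Lambda>: "0 \<le> \<Lambda>" "\<And>r. r \<in> {0..T} \<Longrightarrow> trace (Q r) \<le> \<Lambda>" using trace_Q_bound by blast
  obtain a where a: "0 < a" "\<And>z. norm (A *v z) \<le> norm z * a"
    using bounded_linear.pos_bounded[OF matrix_vector_mul_bounded_linear[of A]] by blast
  define \<nu> where "\<nu> = 2 * a"
  have \<nu>: "0 < \<nu>" using a by (simp add: \<nu>_def)
  have V0: "0 \<le> V" using v_bound[OF t, of z] by linarith
  define K where "K = (1 + 2 * exp (\<nu> * T) * \<Lambda>) * T + exp (\<nu> * T) * (z \<bullet> z)"
  have K0: "0 \<le> K" using \<Lambda> T by (simp add: K_def)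
  have main: "v t z \<le> \<epsilon> * K" if \<epsilon>: "0 < \<epsilon>" for \<epsilon>
  proof -
    define R where "R = 1 + norm z + V / \<epsilon>"
    have R: "1 \<le> R" "norm z \<le> R" "V / \<epsilon> \<le> R" using V0 \<epsilon> by (auto simp: R_def)
    have VR: "V \<le> \<epsilon> * R\<^sup>2"
    proof -
      have "V \<le> \<epsilon> * R" using R(3) \<epsilon> by (simp add: field_simps)
      also have "\<dots> \<le> \<epsilon> * R\<^sup>2" using R(1) \<epsilon> self_le_power[of R 2] by (intro mult_left_mono) auto
      finally show ?thesis .
    qed
    define c where "c = \<epsilon> * (1 + 2 * exp (\<nu> * T) * \<Lambda>)"
    have c0: "0 \<le> c" using \<epsilon> \<Lambda> by (simp add: c_def)
    have "v t z \<le> barrier 0 c 0 \<epsilon> \<nu> t z"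
    proof (rule comparisonD[OF comparison_all[OF \<epsilon>, of R], of R 0])
      fix \<tau> and y :: "real^'n" assume \<tau>: "\<tau> \<in> {0..T}"
      let ?e = "exp (\<nu> * \<tau>)"
      have 1: "?e * trace (Q \<tau>) \<le> exp (\<nu> * T) * \<Lambda>"
        using \<Lambda> \<tau> \<nu> trace_psd_nonneg[OF Q_psd[OF \<tau>]] by (intro mult_mono) auto
      have "(A *v y) \<bullet> y \<le> norm (A *v y) * norm y" by (rule norm_cauchy_schwarz)
      also have "\<dots> \<le> (norm y * a) * norm y" by (intro mult_right_mono a) auto
      also have "\<dots> = a * (y \<bullet> y)" by (simp add: dot_square_norm power2_eq_square)
      finally have 2: "(2 * \<epsilon> * ?e) * ((A *v y) \<bullet> y) \<le> (2 * \<epsilon> * ?e) * (a * (y \<bullet> y))"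
        using \<epsilon> by (intro mult_left_mono) auto
      have "2 * \<epsilon> * ?e * trace (Q \<tau>) = 2 * \<epsilon> * (?e * trace (Q \<tau>))" by simp
      also have "\<dots> \<le> 2 * \<epsilon> * (exp (\<nu> * T) * \<Lambda>)" using \<epsilon> by (intro mult_left_mono 1) auto
      finally show "\<epsilon> \<le> slack c 0 \<epsilon> \<nu> \<tau> y"
        using 2 by (simp add: slack_def c_def \<nu>_def algebra_simps)
    next
      show "v 0 y \<le> barrier 0 c 0 \<epsilon> \<nu> 0 y" for y :: "real^'n" using \<epsilon> by (simp add: null_solution_initial barrier_def)
      fix \<tau> and y :: "real^'n" assume \<tau>: "\<tau> \<in> {0..T}" and y: "y \<in> sphere 0 R"
      have yy: "y \<bullet> y = R\<^sup>2" using y by (simp add: dot_square_norm)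
      have "v \<tau> y \<le> \<epsilon> * R\<^sup>2" using v_bound[OF \<tau>, of y] VR by linarith
      also have "\<dots> \<le> \<epsilon> * exp (\<nu> * \<tau>) * R\<^sup>2"
        using \<epsilon> \<nu> \<tau> by (intro mult_right_mono) auto
      also have "\<dots> \<le> barrier 0 c 0 \<epsilon> \<nu> \<tau> y" using c0 \<tau> by (simp add: barrier_def yy)
      finally show "v \<tau> y \<le> barrier 0 c 0 \<epsilon> \<nu> \<tau> y" .
    qed (use R t in auto)
    also have "\<dots> \<le> \<epsilon> * K"
    proof -
      have "c * t \<le> c * T" using c0 t by (intro mult_left_mono) auto
      moreover have "\<epsilon> * exp (\<nu> * t) * (z \<bullet> z) \<le> \<epsilon> * exp (\<nu> * T) * (z \<bullet> z)"
        using \<epsilon> \<nu> t by (intro mult_right_mono mult_left_mono) auto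
      moreover have "c * T + \<epsilon> * exp (\<nu> * T) * (z \<bullet> z) = \<epsilon> * K" by (simp add: K_def c_def distrib_left mult.assoc)
      ultimately show ?thesis by (simp add: barrier_def)
    qed
    finally show ?thesis .
  qed
  show ?thesis
  proof (rule field_le_epsilon)
    fix e :: real assume e: "0 < e"
    have "v t z \<le> e / (K + 1) * K" by (rule main) (use e K0 in simp)
    also have "\<dots> \<le> e" using e K0 by (simp add: field_simps)
    finally show "v t z \<le> 0 + e" by simp
  qed
qed

end

lemma C2_diff:
  assumes f: "C_k 2 f" and g: "C_k 2 g"
  shows "C_k 2 (\<lambda>z. f z - g z)"
    and "partial i (\<lambda>z. f z - g z) z = partial i f z - partial i g z"
    and "partial i (partial j (\<lambda>z. f z - g z)) z = partial i (partial j f) z - partial i (partial j g) z"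
proof -
  have d: "((\<lambda>z. F z - G z) has_derivative (\<lambda>h. \<Sum>i\<in>UNIV. h $ i * (F' i - G' i))) (at z)"
    if "(F has_derivative (\<lambda>h. \<Sum>i\<in>UNIV. h $ i * F' i)) (at z)" "(G has_derivative (\<lambda>h. \<Sum>i\<in>UNIV. h $ i * G' i)) (at z)"
    for F G :: "real^'a \<Rightarrow> real" and F' G' z
    using has_derivative_diff[OF that] by (simp add: sum_subtractf right_diff_distrib)
  have p1: "partial i (\<lambda>z. f z - g z) = (\<lambda>z. partial i f z - partial i g z)" for i
    by (rule ext) (rule partial_of_sum[OF d[OF C2D(1)[OF f] C2D(1)[OF g]]])
  have p2: "partial i (partial j (\<lambda>z. f z - g z)) = (\<lambda>z. partial i (partial j f) z - partial i (partial j g) z)" for i j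
    unfolding p1 by (rule ext) (rule partial_of_sum[OF d[OF C2D(2)[OF f] C2D(2)[OF g]]])
  show "partial i (\<lambda>z. f z - g z) z = partial i f z - partial i g z" by (simp add: p1)
  show "partial i (partial j (\<lambda>z. f z - g z)) z = partial i (partial j f) z - partial i (partial j g) z" by (simp add: p2)
  show "C_k 2 (\<lambda>z. f z - g z)"
    unfolding numeral_2_eq_2 C_k.simps p2
  proof (intro conjI allI)
    show "(\<lambda>z. f z - g z) differentiable at z" for z
      using d[OF C2D(1)[OF f] C2D(1)[OF g]] by (auto simp: differentiable_def)
    show "partial i (\<lambda>z. f z - g z) differentiable at z" for i z
      unfolding p1 using d[OF C2D(2)[OF f] C2D(2)[OF g]] by (auto simp: differentiable_def)
    show "continuous_on UNIV (\<lambda>z. partial i (partial j f) z - partial i (partial j g) z)" for i j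
      by (intro continuous_on_diff C2D(3) f g)
  qed
qed

lemma solution_le:
  fixes A :: "real^'n^'n"
  assumes T: "0 < T" and Q: "continuous_on {0..T} Q" and p: "\<And>t. t \<in> {0..T} \<Longrightarrow> psd (Q t)"
    and L: "L = (\<lambda>t g z. trace (Q t ** hess g z) + (A *v z) \<bullet> grad g z)"
    and u: "is_solution T L f u" and v: "is_solution T L f v" and t: "t \<in> {0..T}"
  shows "u t z \<le> v t z"
proof -
  have uC: "C_k 2 (u s)" and vC: "C_k 2 (v s)" if "s \<in> {0..T}" for s
    using u v that by (auto simp: is_solution_def)
  obtain U where U: "\<And>s z. s \<in> {0..T} \<Longrightarrow> \<bar>u s z\<bar> \<le> U"
    using u unfolding is_solution_def bounded_real by fastforce
  obtain V where V: "\<And>s z. s \<in> {0..T} \<Longrightarrow> \<bar>v s z\<bar> \<le> V"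
    using v unfolding is_solution_def bounded_real by fastforce
  have Ld: "trace (Q s ** hess (\<lambda>z. u s z - v s z) z) + (A *v z) \<bullet> grad (\<lambda>z. u s z - v s z) z
     = (f s z + L s (u s) z) - (f s z + L s (v s) z)" if "s \<in> {0..T}" for s z
  proof -
    have "hess (\<lambda>z. u s z - v s z) z = hess (u s) z - hess (v s) z"
      by (simp add: hess_def vec_eq_iff C2_diff(3)[OF uC[OF that] vC[OF that]])
    moreover have "grad (\<lambda>z. u s z - v s z) z = grad (u s) z - grad (v s) z"
      by (simp add: grad_def vec_eq_iff C2_diff(2)[OF uC[OF that] vC[OF that]])
    moreover have "trace (Q s ** (M - N)) = trace (Q s ** M) - trace (Q s ** N)" for M N :: "real^'n^'n"
      by (simp add: trace_mult right_diff_distrib sum_subtractf)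
    ultimately show ?thesis by (simp add: L inner_diff_right)
  qed
  have int: "set_integrable lborel {0..s} (\<lambda>r. f r z + L r (u r) z)" "u s z = (LINT r:{0..s}|lborel. f r z + L r (u r) z)"
    "set_integrable lborel {0..s} (\<lambda>r. f r z + L r (v r) z)" "v s z = (LINT r:{0..s}|lborel. f r z + L r (v r) z)"
    if "s \<in> {0..T}" for s z
    using u v that by (auto simp: is_solution_def)
  interpret null_solution T A Q "\<lambda>s z. u s z - v s z" "U + V"
  proof
    show "\<bar>u s z - v s z\<bar> \<le> U + V" if "s \<in> {0..T}" for s z
      using U[OF that, of z] V[OF that, of z] by linarith
    have "continuous_on ({0..T} \<times> UNIV) (\<lambda>p. (case p of (t, z) \<Rightarrow> u t z) - (case p of (t, z) \<Rightarrow> v t z))"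
      using u v by (intro continuous_on_diff) (auto simp: is_solution_def)
    then show "continuous_on ({0..T} \<times> UNIV) (\<lambda>(t, z). u t z - v t z)" by (simp add: case_prod_unfold)
    show "C_k 2 (\<lambda>z. u s z - v s z)" if "s \<in> {0..T}" for s by (rule C2_diff(1)[OF uC[OF that] vC[OF that]])
    fix s z assume s: "s \<in> {0..T}"
    have e: "r \<in> {0..s} \<Longrightarrow> trace (Q r ** hess (\<lambda>z. u r z - v r z) z) + (A *v z) \<bullet> grad (\<lambda>z. u r z - v r z) z
       = (f r z + L r (u r) z) - (f r z + L r (v r) z)" for r
      using s by (intro Ld) auto
    show "set_integrable lborel {0..s} (\<lambda>r. trace (Q r ** hess (\<lambda>z. u r z - v r z) z) + (A *v z) \<bullet> grad (\<lambda>z. u r z - v r z) z)"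
      by (rule set_integrable_cong[THEN iffD2, OF refl refl e]) (assumption, rule set_integral_diff(1)[OF int(1)[OF s] int(3)[OF s]])
    have "(LINT r:{0..s}|lborel. trace (Q r ** hess (\<lambda>z. u r z - v r z) z) + (A *v z) \<bullet> grad (\<lambda>z. u r z - v r z) z)
       = (LINT r:{0..s}|lborel. (f r z + L r (u r) z) - (f r z + L r (v r) z))"
      by (rule set_lebesgue_integral_cong) (use e in auto)
    also have "\<dots> = u s z - v s z"
      unfolding set_integral_diff(2)[OF int(1)[OF s] int(3)[OF s]] using int(2)[OF s, of z] int(4)[OF s, of z] by simp
    finally show "u s z - v s z = (LINT r:{0..s}|lborel. trace (Q r ** hess (\<lambda>z. u r z - v r z) z) + (A *v z) \<bullet> grad (\<lambda>z. u r z - v r z) z)" ..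
  qed (use T Q p in auto)
  show ?thesis using null_solution_nonpos[OF t, of z] by simp
qed

lemma solution_unique:
  fixes A :: "real^'n^'n"
  assumes "0 < T" "continuous_on {0..T} Q" "\<And>t. t \<in> {0..T} \<Longrightarrow> psd (Q t)"
    "L = (\<lambda>t g z. trace (Q t ** hess g z) + (A *v z) \<bullet> grad g z)"
    "is_solution T L f u" "is_solution T L f v" "t \<in> {0..T}"
  shows "u t z = v t z"
  using solution_le[OF assms(1-4), of f u v t z] solution_le[OF assms(1-4), of f v u t z] assms(5-7) by (simp add: order_antisym)

section \<open>The estimate with finitely many jumps\<close>

definition Lp_int :: "real \<Rightarrow> real \<Rightarrow> (real \<Rightarrow> real^'n \<Rightarrow> real) \<Rightarrow> ennreal" where
  "Lp_int p T g = (\<integral>\<^sup>+w\<in>{0<..<T} \<times> UNIV. ennreal (\<bar>g (fst w) (snd w)\<bar> powr p) \<partial>lborel)"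

lemma Lp_norm_Lp_int: "Lp_norm p T g = (if Lp_int p T g = \<infinity> then \<infinity> else ennreal (enn2real (Lp_int p T g) powr (1 / p)))"
  by (simp add: Lp_norm_def Lp_int_def Let_def)

text \<open>Integrals of p-th powers are the form to which convexity, Tonelli and Fatou apply.
  Either side may be infinite, whence the case distinctions.\<close>

lemma Lp_le_iff:
  assumes p: "0 < p" and C: "0 < C"
  shows "Lp_norm p T g \<le> ennreal C * Lp_norm p T h \<longleftrightarrow> Lp_int p T g \<le> ennreal (C powr p) * Lp_int p T h"
proof (cases "Lp_int p T h = \<infinity>")
  case True
  then show ?thesis using C by (simp add: Lp_norm_Lp_int ennreal_mult_top)
next
  case False
  then obtain b where b: "0 \<le> b" "Lp_int p T h = ennreal b" by (cases "Lp_int p T h") auto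
  have rhs: "ennreal C * Lp_norm p T h = ennreal (C * b powr (1 / p))" "ennreal (C powr p) * Lp_int p T h = ennreal (C powr p * b)"
    using b C by (simp_all add: Lp_norm_Lp_int ennreal_mult)
  show ?thesis
  proof (cases "Lp_int p T g = \<infinity>")
    case True
    then show ?thesis unfolding rhs by (simp add: Lp_norm_Lp_int top_unique)
  next
    case False
    then obtain a where a: "0 \<le> a" "Lp_int p T g = ennreal a" by (cases "Lp_int p T g") auto
    have "a powr (1 / p) \<le> C * b powr (1 / p) \<longleftrightarrow> a \<le> C powr p * b"
    proof -
      have e: "C * b powr (1 / p) = (C powr p * b) powr (1 / p)"
        using C b p by (simp add: powr_mult powr_powr)
      show ?thesis
      proof
        assume "a powr (1 / p) \<le> C * b powr (1 / p)"
        then have "(a powr (1 / p)) powr p \<le> ((C powr p * b) powr (1 / p)) powr p"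
          unfolding e using p by (intro powr_mono2[of p "a powr (1 / p)"]) auto
        then show "a \<le> C powr p * b" using p a b C by (simp add: powr_powr)
      next
        assume "a \<le> C powr p * b"
        then show "a powr (1 / p) \<le> C * b powr (1 / p)" unfolding e using p a by (intro powr_mono2) auto
      qed
    qed
    then show ?thesis unfolding rhs using a b C by (simp add: Lp_norm_Lp_int)
  qed
qed

lemma half_powr: 
  assumes "1 \<le> p"
  shows "((\<bar>x\<bar> + \<bar>y\<bar>) / 2) powr p \<le> (\<bar>x\<bar> powr p + \<bar>y\<bar> powr p) / (2::real)"
proof -
  have h: "(\<bar>u\<bar> / 2) powr p \<le> \<bar>u\<bar> powr p / 2" for u :: real
  proof -
    have "(1/2 :: real) powr p \<le> (1/2) powr 1" by (rule powr_mono') (use assms in auto)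
    then have "\<bar>u\<bar> powr p * (1/2) powr p \<le> \<bar>u\<bar> powr p * (1/2)" by (intro mult_left_mono) auto
    then show ?thesis by (simp add: powr_mult[symmetric])
  qed
  \<comment> \<open>Convexity is applied on the open half-line; when an entry vanishes,
    \<open>h\<close> takes its place.\<close>
  show ?thesis
  proof (cases "x = 0 \<or> y = 0")
    case True
    then show ?thesis using h[of x] h[of y] assms by auto
  next
    case False
    have "convex_on {0<..} (\<lambda>x::real. x powr p)" using assms by (rule powr_convex)
    from convex_onD[OF this, of "1/2" "\<bar>x\<bar>" "\<bar>y\<bar>"] False show ?thesis
      by (simp add: field_simps)
  qed
qed

section \<open>Measurability, shifts and half-sums on the strip\<close>

definition strip_measurable :: "real \<Rightarrow> (real \<Rightarrow> real^'n \<Rightarrow> real) \<Rightarrow> bool" where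
  "strip_measurable T g \<longleftrightarrow> (\<lambda>w. indicator ({0..T} \<times> UNIV) w * g (fst w) (snd w)) \<in> borel_measurable borel"

lemma Lp_int_alt: "Lp_int p T g = (\<integral>\<^sup>+w. ennreal (\<bar>indicator ({0<..<T} \<times> UNIV) w * g (fst w) (snd w)\<bar> powr p) \<partial>lborel)"
  unfolding Lp_int_def by (rule nn_integral_cong) (auto simp: indicator_def)

lemma strip_measurable_open: "strip_measurable T g \<Longrightarrow> (\<lambda>w. indicator ({0<..<T} \<times> UNIV) w * g (fst w) (snd w)) \<in> borel_measurable borel"
proof -
  assume g: "strip_measurable T g"
  have m: "(\<lambda>w. indicator ({0<..<T} \<times> UNIV) w * (indicator ({0..T} \<times> UNIV) w * g (fst w) (snd w))) \<in> borel_measurable borel"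
    by (rule borel_measurable_times[OF borel_measurable_indicator g[unfolded strip_measurable_def]])
      (intro borel_open open_Times open_greaterThanLessThan open_UNIV)
  have "indicator ({0<..<T} \<times> UNIV) w * (indicator ({0..T} \<times> UNIV) w * g (fst w) (snd w)) = indicator ({0<..<T} \<times> UNIV) w * g (fst w) (snd w)" for w
    by (auto simp: indicator_def)
  with m show ?thesis by simp
qed

lemma shift_measurable:
  fixes c :: "real \<Rightarrow> real^'n"
  assumes "c \<in> borel_measurable borel"
  shows "(\<lambda>w::real \<times> (real^'n). (fst w, snd w + c (fst w))) \<in> borel_measurable borel"
proof -
  have f: "fst \<in> borel_measurable (borel :: (real \<times> (real^'n)) measure)"
    and s: "snd \<in> borel_measurable (borel :: (real \<times> (real^'n)) measure)"
    by (auto intro!: borel_measurable_continuous_onI continuous_intros)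
  show ?thesis
    by (intro borel_measurable_Pair borel_measurable_add f s measurable_compose[OF f assms])
qed

lemma strip_measurable_shift:
  assumes c: "c \<in> borel_measurable borel" and g: "strip_measurable T g"
  shows "strip_measurable T (\<lambda>t z. g t (z + c t))"
proof -
  have "(\<lambda>w. (\<lambda>w. indicator ({0..T} \<times> UNIV) w * g (fst w) (snd w)) (fst w, snd w + c (fst w))) \<in> borel_measurable borel"
    by (rule measurable_compose[OF shift_measurable[OF c] g[unfolded strip_measurable_def]])
  then show ?thesis unfolding strip_measurable_def by (simp add: indicator_def mem_Times_iff)
qed

text \<open>Tonelli and translation invariance of Lebesgue measure on each time slice; the shift may
  depend on time in any measurable way.\<close>

lemma Lp_int_shift:
  assumes c: "c \<in> borel_measurable borel" and g: "strip_measurable T g"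
  shows "Lp_int p T (\<lambda>t z. g t (z + c t)) = Lp_int p T (g :: real \<Rightarrow> real^'n \<Rightarrow> real)"
proof -
  define F :: "real \<times> (real^'n) \<Rightarrow> ennreal" where "F w = ennreal (\<bar>indicator ({0<..<T} \<times> UNIV) w * g (fst w) (snd w)\<bar> powr p)" for w
  have F: "F \<in> borel_measurable borel"
    unfolding F_def using strip_measurable_open[OF g] by measurable
  have Fs: "(\<lambda>w. F (fst w, snd w + c (fst w))) \<in> borel_measurable borel"
    by (rule measurable_compose[OF shift_measurable[OF c] F])
  have pr: "(\<integral>\<^sup>+w. K w \<partial>lborel) = (\<integral>\<^sup>+t. \<integral>\<^sup>+z. K (t, z) \<partial>lborel \<partial>lborel)" if "K \<in> borel_measurable borel" for K :: "real \<times> (real^'n) \<Rightarrow> ennreal"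
  proof -
    have "K \<in> borel_measurable (lborel \<Otimes>\<^sub>M lborel)" using that by (simp add: lborel_prod)
    from lborel.nn_integral_fst[OF this] show ?thesis by (simp add: lborel_prod)
  qed
  have tr: "(\<integral>\<^sup>+z. h (z + d) \<partial>lborel) = (\<integral>\<^sup>+z. h z \<partial>lborel)" if "h \<in> borel_measurable borel" for h :: "real^'n \<Rightarrow> ennreal" and d
  proof -
    have "(\<integral>\<^sup>+z. h z \<partial>lborel) = (\<integral>\<^sup>+z. h z \<partial>(distr lborel borel ((+) d)))" by (simp add: lborel_distr_plus)
    also have "\<dots> = (\<integral>\<^sup>+z. h (d + z) \<partial>lborel)" by (rule nn_integral_distr) (use that in auto)
    finally show ?thesis by (simp add: add.commute)
  qed
  have Ft: "(\<lambda>z. F (t, z)) \<in> borel_measurable borel" for t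
    by (rule measurable_compose[OF _ F]) (intro borel_measurable_continuous_onI continuous_intros)
  have "Lp_int p T (\<lambda>t z. g t (z + c t)) = (\<integral>\<^sup>+w. F (fst w, snd w + c (fst w)) \<partial>lborel)"
    unfolding Lp_int_alt F_def by (rule nn_integral_cong) (auto simp: indicator_def)
  also have "\<dots> = (\<integral>\<^sup>+t. \<integral>\<^sup>+z. F (t, z + c t) \<partial>lborel \<partial>lborel)" unfolding pr[OF Fs] by simp
  also have "\<dots> = (\<integral>\<^sup>+t. \<integral>\<^sup>+z. F (t, z) \<partial>lborel \<partial>lborel)"
    using tr[OF Ft] by simp
  also have "\<dots> = Lp_int p T g" unfolding pr[OF F, symmetric] by (simp only: Lp_int_alt F_def[abs_def])
  finally show ?thesis .
qed

text \<open>By convexity of the p-th power the half-sum contributes at most half of each integral,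
  and two halves of K make K, also when K is infinite. The factor 1 obtained here is what preserves
  the constant under a jump.\<close>

lemma Lp_int_half:
  assumes p: "1 \<le> p" and g: "strip_measurable T g" and h: "strip_measurable T h"
    and k: "\<And>t z. t \<in> {0<..<T} \<Longrightarrow> \<bar>k t z\<bar> \<le> (\<bar>g t z\<bar> + \<bar>h t z\<bar>) / 2"
    and gb: "Lp_int p T g \<le> K" and hb: "Lp_int p T h \<le> K"
  shows "Lp_int p T k \<le> K"
proof -
  let ?F = "\<lambda>g w. ennreal (\<bar>indicator ({0<..<T} \<times> UNIV) w * g (fst w) (snd w)\<bar> powr p)"
  have m: "?F g \<in> borel_measurable lborel" "?F h \<in> borel_measurable lborel"
    using strip_measurable_open[OF g] strip_measurable_open[OF h] by measurable
  have "Lp_int p T k \<le> (\<integral>\<^sup>+w. ennreal (1/2) * (?F g w + ?F h w) \<partial>lborel)"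
    unfolding Lp_int_alt
  proof (rule nn_integral_mono)
    fix w :: "real \<times> (real^'a)"
    show "?F k w \<le> ennreal (1/2) * (?F g w + ?F h w)"
    proof (cases "w \<in> {0<..<T} \<times> UNIV")
      case True
      then have "\<bar>k (fst w) (snd w)\<bar> powr p \<le> ((\<bar>g (fst w) (snd w)\<bar> + \<bar>h (fst w) (snd w)\<bar>) / 2) powr p"
        using k p by (intro powr_mono2) auto
      also note half_powr[OF p]
      finally have "\<bar>k (fst w) (snd w)\<bar> powr p \<le> 1/2 * (\<bar>g (fst w) (snd w)\<bar> powr p + \<bar>h (fst w) (snd w)\<bar> powr p)" by simp
      then have "ennreal (\<bar>k (fst w) (snd w)\<bar> powr p) \<le> ennreal (1/2 * (\<bar>g (fst w) (snd w)\<bar> powr p + \<bar>h (fst w) (snd w)\<bar> powr p))"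
        by (rule ennreal_leI)
      also have "\<dots> = ennreal (1/2) * (ennreal (\<bar>g (fst w) (snd w)\<bar> powr p) + ennreal (\<bar>h (fst w) (snd w)\<bar> powr p))"
        by (subst ennreal_mult) auto
      finally show ?thesis using True by simp
    qed simp
  qed
  also have "\<dots> = ennreal (1/2) * (Lp_int p T g + Lp_int p T h)"
    unfolding Lp_int_alt using m by (subst nn_integral_cmult) (auto intro!: borel_measurable_add simp: nn_integral_add)
  also have "\<dots> \<le> ennreal (1/2) * (K + K)" by (intro mult_left_mono add_mono gb hb) auto
  also have "\<dots> = K"
  proof -
    have "ennreal (1/2) * (K + K) = ennreal (1/2) * (2 * K)" by (simp add: mult_2)
    also have "\<dots> = (ennreal (1/2) * ennreal 2) * K" by (simp add: mult.assoc)
    also have "ennreal (1/2) * ennreal 2 = 1" by (subst ennreal_mult[symmetric]) auto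
    finally show ?thesis by simp
  qed
  finally show ?thesis .
qed

text \<open>
  Conditioning on the sign of the jump a at time \<open>\<tau>\<close> shifts the source by -a from then on.
\<close>

definition late_shift :: "real \<Rightarrow> real^'n \<Rightarrow> (real \<Rightarrow> real^'n \<Rightarrow> real) \<Rightarrow> real \<Rightarrow> real^'n \<Rightarrow> real" where
  "late_shift \<tau> a G s x = G s (x + (if \<tau> \<le> s then - a else 0))"

lemma admissible_late_shift: assumes "admissible M G" shows "admissible M (late_shift \<tau> a G)"
  unfolding admissible_def
proof (intro conjI allI)
  show "Cb_le M (late_shift \<tau> a G s)" for s
    unfolding late_shift_def[abs_def] by (rule Cb_le_translate(1)[OF admissibleD(1)[OF assms]])
  have "(\<lambda>s. if \<tau> \<le> s then G s (x + - a) else G s (x + 0)) \<in> borel_measurable borel" for x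
    by (intro measurable_If admissibleD(2)[OF assms]) auto
  moreover have "(\<lambda>s. late_shift \<tau> a G s x) = (\<lambda>s. if \<tau> \<le> s then G s (x + - a) else G s (x + 0))" for x
    by (auto simp: late_shift_def)
  ultimately show "(\<lambda>s. late_shift \<tau> a G s x) \<in> borel_measurable borel" for x by simp
qed

lemma partials_late_shift: assumes "admissible M G" shows "partials js (late_shift \<tau> a G s) = late_shift \<tau> a (\<lambda>s. partials js (G s)) s"
  unfolding late_shift_def[abs_def] by (rule Cb_le_translate(2)[OF admissibleD(1)[OF assms]])

text \<open>For s < \<tau> \<le> t the evaluation point carries the jump; for \<tau> \<le> s the
  shifts of point and source cancel. The jump is thus felt exactly by sources before \<tau> at times
  from \<tau> on. Its two signs give the half-sum, with one jump fewer in the list.\<close>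

lemma duhamel_Cons:
  fixes G :: "real \<Rightarrow> real^'n \<Rightarrow> real"
  assumes C: "psd_incr T \<Lambda> C" and G: "admissible M G" and t: "t \<in> {0..T}"
  shows "duhamel C ((\<tau>, a) # L) G t x =
    (duhamel C L (late_shift \<tau> a G) t (x + (if \<tau> \<le> t then a else 0)) + duhamel C L (late_shift \<tau> (- a) G) t (x + (if \<tau> \<le> t then - a else 0))) / 2"
proof -
  let ?I = "\<lambda>G x s. avg (jumps_in L s t) (heat (C t - C s) (G s)) x"
  have int: "set_integrable lborel {0..t} (?I G x)" if G: "admissible M G" for G x
  proof -
    have "set_integrable lborel {0..t} (\<lambda>s. (if s \<in> {0..t} then avg (jumps_in L s t) (heat (C t - C s) (G s)) else (\<lambda>_. 0)) x)"
      by (rule admissible_sint(1)[OF admissible_propag[OF C G t order_refl]])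
    then show ?thesis by (rule set_integrable_cong[THEN iffD1, rotated -1]) auto
  qed
  let ?x1 = "x + (if \<tau> \<le> t then a else 0)" and ?x2 = "x + (if \<tau> \<le> t then - a else 0)"
  have sh: "?I (late_shift \<tau> b G) y s = avg (jumps_in L s t) (heat (C t - C s) (G s)) (y + (if \<tau> \<le> s then - b else 0))" for b y s
  proof -
    have "heat (C t - C s) (late_shift \<tau> b G s) = (\<lambda>y. heat (C t - C s) (G s) (y + (if \<tau> \<le> s then - b else 0)))"
      unfolding late_shift_def[abs_def] by (rule ext) (rule heat_translate)
    then show ?thesis by (simp only: avg_translate)
  qed
  have "duhamel C ((\<tau>, a) # L) G t x = (LINT s:{0..t}|lborel. (?I (late_shift \<tau> a G) ?x1 s + ?I (late_shift \<tau> (- a) G) ?x2 s) / 2)"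
    unfolding duhamel_def
  proof (rule set_lebesgue_integral_cong)
    show "\<forall>s. s \<in> {0..t} \<longrightarrow> avg (jumps_in ((\<tau>, a) # L) s t) (heat (C t - C s) (G s)) x = (?I (late_shift \<tau> a G) ?x1 s + ?I (late_shift \<tau> (- a) G) ?x2 s) / 2"
      unfolding sh by (auto simp: jumps_in_def)
  qed simp
  also have "\<dots> = ((LINT s:{0..t}|lborel. ?I (late_shift \<tau> a G) ?x1 s) + (LINT s:{0..t}|lborel. ?I (late_shift \<tau> (- a) G) ?x2 s)) / 2"
    using set_integral_add(2)[OF int[OF admissible_late_shift[OF G]] int[OF admissible_late_shift[OF G]]] by simp
  finally show ?thesis by (simp add: duhamel_def)
qed

text \<open>Without jumps the solution is jointly continuous; jumps destroy continuity in time, but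
  the recursion \<open>duhamel_Cons\<close> consists of measurable shifts.\<close>

lemma duhamel_strip_measurable:
  fixes G :: "real \<Rightarrow> real^'n \<Rightarrow> real"
  assumes C: "psd_incr T \<Lambda> C" and G: "admissible M G"
  shows "strip_measurable T (duhamel C L G)"
  using G
proof (induction L arbitrary: G)
  case Nil
  have "(\<lambda>w. indicator ({0..T} \<times> UNIV) w *\<^sub>R (case w of (t, x) \<Rightarrow> duhamel C [] G t x)) \<in> borel_measurable borel"
    by (rule borel_measurable_continuous_on_indicator[OF _ duhamel_joint_cont[OF C Nil]]) (auto intro!: borel_closed closed_Times)
  then show ?case by (simp add: strip_measurable_def case_prod_unfold)
next
  case (Cons l L)
  obtain \<tau> a where l: "l = (\<tau>, a)" by (cases l)
  have c: "(\<lambda>t. if \<tau> \<le> t then b else 0) \<in> borel_measurable borel" for b :: "real^'n"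
    by (intro measurable_If) auto
  note 1 = strip_measurable_shift[OF c Cons.IH[OF admissible_late_shift[OF Cons.prems]], unfolded strip_measurable_def]
  have "(\<lambda>w. (indicator ({0..T} \<times> UNIV) w * duhamel C L (late_shift \<tau> a G) (fst w) (snd w + (if \<tau> \<le> fst w then a else 0)) +
     indicator ({0..T} \<times> UNIV) w * duhamel C L (late_shift \<tau> (- a) G) (fst w) (snd w + (if \<tau> \<le> fst w then - a else 0))) / 2) \<in> borel_measurable borel"
    by (intro borel_measurable_divide borel_measurable_add 1 borel_measurable_const)
  also have "(\<lambda>w. (indicator ({0..T} \<times> UNIV) w * duhamel C L (late_shift \<tau> a G) (fst w) (snd w + (if \<tau> \<le> fst w then a else 0)) +
     indicator ({0..T} \<times> UNIV) w * duhamel C L (late_shift \<tau> (- a) G) (fst w) (snd w + (if \<tau> \<le> fst w then - a else 0))) / 2)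
     = (\<lambda>w. indicator ({0..T} \<times> UNIV) w * duhamel C (l # L) G (fst w) (snd w))"
    unfolding l using duhamel_Cons[OF C Cons.prems] by (auto simp: indicator_def fun_eq_iff mem_Times_iff)
  finally show ?case by (simp add: strip_measurable_def)
qed

lemma strip_measurable_flow:
  assumes "strip_measurable T g" shows "strip_measurable T (\<lambda>t z. g t (mexp A t *v z))"
proof -
  have "(\<lambda>w. (fst w, mexp A (fst w) *v snd w)) \<in> borel_measurable borel"
    using flow_joint_cont[of UNIV A] by (intro borel_measurable_continuous_onI) (simp add: case_prod_unfold)
  from measurable_compose[OF this assms[unfolded strip_measurable_def]]
  show ?thesis unfolding strip_measurable_def by (simp add: indicator_def mem_Times_iff)
qed

text \<open>The (i, j) entry of the Hessian in the original coordinates, by the chain rule and with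
  the derivatives placed on the source. In this form the jump recursion, measurability and limits of
  \<open>duhamel\<close> apply directly.\<close>

definition hess_entry :: "real^'n^'n \<Rightarrow> (real \<Rightarrow> real^'n^'n) \<Rightarrow> (real \<times> (real^'n)) list \<Rightarrow> (real \<Rightarrow> real^'n \<Rightarrow> real) \<Rightarrow> 'n \<Rightarrow> 'n \<Rightarrow> real \<Rightarrow> real^'n \<Rightarrow> real" where
  "hess_entry A C L G i j t z = (\<Sum>k\<in>UNIV. \<Sum>l\<in>UNIV. mexp A t $ k $ i * mexp A t $ l $ j * duhamel C L (\<lambda>s. partial k (partial l (G s))) t (mexp A t *v z))"

lemma partial2_duhamel:
  fixes G :: "real \<Rightarrow> real^'n \<Rightarrow> real"
  assumes C: "psd_incr T \<Lambda> C" and G: "admissible M G" and t: "t \<in> {0..T}"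
  shows "partial i (partial j (\<lambda>z. duhamel C L G t (mexp A t *v z))) z = hess_entry A C L G i j t z"
  unfolding partial2_linear[OF Cb_le_duhamel(1)[OF C G t]] hess_entry_def
  using Cb_le_duhamel(2)[OF C G t, of "[_,_]" L] by simp

lemma admissible_partial2: "admissible M G \<Longrightarrow> admissible (\<lambda>k. M (k + 2)) (\<lambda>s. partial k (partial l (G s)))"
  using admissible_partials[of M G "[k,l]"] by (simp add: numeral_2_eq_2)

lemma strip_measurable_const_mult:
  assumes c: "continuous_on UNIV c" and g: "strip_measurable T g" shows "strip_measurable T (\<lambda>t z. c t * g t z)"
proof -
  have "(\<lambda>w. c (fst w) * (indicator ({0..T} \<times> UNIV) w * g (fst w) (snd w))) \<in> borel_measurable borel"
    by (intro borel_measurable_times g[unfolded strip_measurable_def] borel_measurable_continuous_onI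
        continuous_on_compose2[OF c continuous_on_fst[OF continuous_on_id]]) auto
  then show ?thesis unfolding strip_measurable_def by (simp add: mult.left_commute)
qed

lemma strip_measurable_sum: assumes "\<And>i. i \<in> I \<Longrightarrow> strip_measurable T (g i)" shows "strip_measurable T (\<lambda>t z. \<Sum>i\<in>I. g i t z)"
  using assms unfolding strip_measurable_def sum_distrib_left by (intro borel_measurable_sum)

lemma hess_entry_strip_measurable:
  fixes G :: "real \<Rightarrow> real^'n \<Rightarrow> real"
  assumes C: "psd_incr T \<Lambda> C" and G: "admissible M G"
  shows "strip_measurable T (hess_entry A C L G i j)"
  unfolding hess_entry_def[abs_def]
  by (intro strip_measurable_sum strip_measurable_const_mult continuous_on_mult continuous_on_component mexp_cont strip_measurable_flow duhamel_strip_measurable[OF C admissible_partial2[OF G]])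

text \<open>A shift by a in the moving coordinates is a shift by exp (- t A) a in the original ones.
  It depends on time but not on the point, as \<open>Lp_int_shift\<close> requires.\<close>

lemma hess_entry_Cons:
  fixes G :: "real \<Rightarrow> real^'n \<Rightarrow> real"
  assumes C: "psd_incr T \<Lambda> C" and G: "admissible M G" and t: "t \<in> {0..T}"
  shows "hess_entry A C ((\<tau>, a) # L) G i j t z =
    (hess_entry A C L (late_shift \<tau> a G) i j t (z + (if \<tau> \<le> t then mexp A (- t) *v a else 0)) +
     hess_entry A C L (late_shift \<tau> (- a) G) i j t (z + (if \<tau> \<le> t then mexp A (- t) *v (- a) else 0))) / 2"
proof -
  have f: "mexp A t *v (z + (if \<tau> \<le> t then mexp A (- t) *v b else 0)) = mexp A t *v z + (if \<tau> \<le> t then b else 0)" for b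
    by (simp add: matrix_vector_right_distrib mexp_vec_inverse)
  have sh: "(\<lambda>s. partial k (partial l (late_shift \<tau> b G s))) = late_shift \<tau> b (\<lambda>s. partial k (partial l (G s)))" for k l b
    using partials_late_shift[OF G, of "[k,l]" \<tau> b] by auto
  show ?thesis
    unfolding hess_entry_def f sh duhamel_Cons[OF C admissible_partial2[OF G] t]
    by (simp add: sum.distrib[symmetric] sum_divide_distrib algebra_simps add_divide_distrib)
qed

section \<open>Matrix norms of the padded Hessian\<close>

lemma sum_delta2: "(\<Sum>a\<in>UNIV. \<Sum>b\<in>UNIV. f a b * (if i = a \<and> j = b then 1 else 0)) = (f i j :: real)"
  for i j :: "'b::finite"
proof -
  have "(\<Sum>b\<in>UNIV. f a b * (if i = a \<and> j = b then 1 else 0)) = (\<Sum>b\<in>UNIV. if j = b then (if i = a then f a b else 0) else 0)" for a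
    by (rule sum.cong) auto
  then show ?thesis by simp
qed

text \<open>It presents the padded matrix as a finite combination of fixed matrices, so that
  measurability of the entries suffices.\<close>

lemma pad_sum: "pad e (M :: real^'d^'d) = (\<Sum>a\<in>UNIV. \<Sum>b\<in>UNIV. M $ a $ b *\<^sub>R pad e (\<chi> i j. if i = a \<and> j = b then 1 else 0))"
proof -
  have "(\<Sum>a\<in>UNIV. \<Sum>b\<in>UNIV. M $ a $ b * (if i = a \<and> j = b then 1 else 0)) = M $ i $ j" for i j :: 'd
    by (rule sum_delta2)
  then have "pad e M $ i $ j = (\<Sum>a\<in>UNIV. \<Sum>b\<in>UNIV. M $ a $ b *\<^sub>R pad e (\<chi> i j. if i = a \<and> j = b then 1 else 0)) $ i $ j" for i j
    by (cases "i \<in> range e \<and> j \<in> range e") (simp_all add: pad_def, auto intro!: sum.neutral)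
  then show ?thesis by (simp add: vec_eq_iff)
qed

text \<open>Nonnegativity comes from the triangle inequality for M and - M. Expansion in matrix
  units bounds the norm by a multiple of the Euclidean one, whence it is Lipschitz; continuity is
  what measurability and limits use.\<close>

lemma mnorm_facts:
  assumes n: "matrix_norm nrm"
  shows "nrm 0 = 0" "0 \<le> nrm M" "nrm (c *\<^sub>R M) = \<bar>c\<bar> * nrm M" "nrm (M + N) \<le> nrm M + nrm N"
    and "continuous_on UNIV nrm"
proof -
  show z: "nrm 0 = 0" and s: "\<And>c M. nrm (c *\<^sub>R M) = \<bar>c\<bar> * nrm M" and t: "\<And>M N. nrm (M + N) \<le> nrm M + nrm N"
    using n by (auto simp: matrix_norm_def)
  have neg: "nrm (- M) = nrm M" for M using s[of "-1" M] by simp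
  show nn: "0 \<le> nrm M" for M using t[of M "- M"] z neg[of M] by simp
  let ?E = "\<lambda>i j. (\<chi> k l. if k = i \<and> l = j then 1 else 0) :: real^'a^'a"
  define K where "K = (\<Sum>i\<in>UNIV. \<Sum>j\<in>UNIV. nrm (?E i j))"
  have sum_le: "nrm (\<Sum>i\<in>I. f i) \<le> (\<Sum>i\<in>I. nrm (f i))" if "finite I" for I and f :: "'b \<Rightarrow> real^'a^'a"
    using that by (induction rule: finite_induct) (auto simp: z intro: order_trans[OF t])
  have b: "nrm M \<le> K * norm M" for M
  proof -
    have "M = (\<Sum>i\<in>UNIV. \<Sum>j\<in>UNIV. M $ i $ j *\<^sub>R ?E i j)"
    proof -
      have "(\<Sum>i\<in>UNIV. \<Sum>j\<in>UNIV. M $ i $ j * (if k = i \<and> l = j then 1 else 0)) = M $ k $ l" for k l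
        by (rule sum_delta2)
      then show ?thesis by (simp add: vec_eq_iff)
    qed
    then have "nrm M = nrm (\<Sum>i\<in>UNIV. \<Sum>j\<in>UNIV. M $ i $ j *\<^sub>R ?E i j)" by metis
    also have "\<dots> \<le> (\<Sum>i\<in>UNIV. \<Sum>j\<in>UNIV. nrm (M $ i $ j *\<^sub>R ?E i j))"
      by (rule order_trans[OF sum_le sum_mono[OF sum_le]]) auto
    also have "\<dots> \<le> (\<Sum>i\<in>UNIV. \<Sum>j\<in>UNIV. norm M * nrm (?E i j))"
    proof (intro sum_mono)
      fix i j
      have "\<bar>M $ i $ j\<bar> \<le> norm M"
        using component_le_norm_cart[of "M $ i" j] Finite_Cartesian_Product.norm_nth_le[of M i] by linarith
      then show "nrm (M $ i $ j *\<^sub>R ?E i j) \<le> norm M * nrm (?E i j)" unfolding s by (rule mult_right_mono[OF _ nn])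
    qed
    finally show ?thesis by (simp add: K_def sum_distrib_left mult.commute)
  qed
  have K0: "0 \<le> K" unfolding K_def by (intro sum_nonneg nn)
  show "continuous_on UNIV nrm"
  proof (rule lipschitz_on_continuous_on[where L=K], rule lipschitz_onI[OF _ K0])
    fix M N
    have "nrm M \<le> nrm (M - N) + nrm N" "nrm N \<le> nrm (N - M) + nrm M" using t[of "M - N" N] t[of "N - M" M] by auto
    moreover have "nrm (N - M) = nrm (M - N)" using neg[of "M - N"] by simp
    ultimately show "dist (nrm M) (nrm N) \<le> K * dist M N"
      using b[of "M - N"] by (simp add: dist_real_def dist_norm abs_le_iff)
  qed
qed

definition hess_x_norm :: "(real^'n^'n \<Rightarrow> real) \<Rightarrow> ('d::finite \<Rightarrow> 'n) \<Rightarrow> real^'n^'n \<Rightarrow> (real \<Rightarrow> real^'n^'n) \<Rightarrow> (real \<times> (real^'n)) list \<Rightarrow> (real \<Rightarrow> real^'n \<Rightarrow> real) \<Rightarrow> real \<Rightarrow> real^'n \<Rightarrow> real" where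
  "hess_x_norm nrm e A C L G t z = nrm (pad e (\<chi> a b. hess_entry A C L G (e a) (e b) t z))"

lemma nrm_hess_x:
  fixes G :: "real \<Rightarrow> real^'n \<Rightarrow> real"
  assumes C: "psd_incr T \<Lambda> C" and G: "admissible M G" and t: "t \<in> {0..T}"
  shows "nrm (pad e (hess_x e (\<lambda>z. duhamel C L G t (mexp A t *v z)) z)) = hess_x_norm nrm e A C L G t z"
  unfolding hess_x_def hess_x_norm_def partial2_duhamel[OF C G t] ..

lemma strip_measurable_mnorm:
  assumes n: "matrix_norm nrm" and f: "\<And>a b. strip_measurable T (f a b)"
  shows "strip_measurable T (\<lambda>t z. nrm (pad e (\<chi> a b. f a b t z)))"
proof -
  let ?i = "\<lambda>w. indicator ({0..T} \<times> UNIV) w :: real"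
  let ?P = "\<lambda>w. \<Sum>a\<in>UNIV. \<Sum>b\<in>UNIV. (?i w * f a b (fst w) (snd w)) *\<^sub>R pad e (\<chi> i j. if i = a \<and> j = b then 1 else 0)"
  have "?P \<in> borel_measurable borel"
    by (intro borel_measurable_sum borel_measurable_scaleR f[unfolded strip_measurable_def] borel_measurable_const)
  then have "(\<lambda>w. nrm (?P w)) \<in> borel_measurable borel"
    by (rule measurable_compose[OF _ borel_measurable_continuous_onI[OF mnorm_facts(5)[OF n]]])
  moreover have "nrm (?P w) = ?i w * nrm (pad e (\<chi> a b. f a b (fst w) (snd w)))" for w
    unfolding pad_sum[of e "\<chi> a b. f a b (fst w) (snd w)"] using mnorm_facts(1)[OF n] by (auto simp: indicator_def)
  ultimately show ?thesis by (simp add: strip_measurable_def)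
qed

lemma hess_x_norm_strip_measurable:
  fixes G :: "real \<Rightarrow> real^'n \<Rightarrow> real"
  assumes n: "matrix_norm nrm" and C: "psd_incr T \<Lambda> C" and G: "admissible M G"
  shows "strip_measurable T (hess_x_norm nrm e A C L G)"
  unfolding hess_x_norm_def[abs_def] by (rule strip_measurable_mnorm[OF n hess_entry_strip_measurable[OF C G]])

lemma hess_x_norm_Cons:
  fixes G :: "real \<Rightarrow> real^'n \<Rightarrow> real"
  assumes n: "matrix_norm nrm" and C: "psd_incr T \<Lambda> C" and G: "admissible M G" and t: "t \<in> {0..T}"
  shows "\<bar>hess_x_norm nrm e A C ((\<tau>, a) # L) G t z\<bar> \<le>
    (\<bar>hess_x_norm nrm e A C L (late_shift \<tau> a G) t (z + (if \<tau> \<le> t then mexp A (- t) *v a else 0))\<bar> +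
     \<bar>hess_x_norm nrm e A C L (late_shift \<tau> (- a) G) t (z + (if \<tau> \<le> t then mexp A (- t) *v (- a) else 0))\<bar>) / 2"
proof -
  let ?X = "\<chi> i j. hess_entry A C L (late_shift \<tau> a G) (e i) (e j) t (z + (if \<tau> \<le> t then mexp A (- t) *v a else 0))"
  let ?Y = "\<chi> i j. hess_entry A C L (late_shift \<tau> (- a) G) (e i) (e j) t (z + (if \<tau> \<le> t then mexp A (- t) *v (- a) else 0))"
  have "pad e (\<chi> i j. hess_entry A C ((\<tau>, a) # L) G (e i) (e j) t z) = (1/2) *\<^sub>R (pad e ?X + pad e ?Y)"
    unfolding hess_entry_Cons[OF C G t] by (simp add: pad_def vec_eq_iff)
  then have "hess_x_norm nrm e A C ((\<tau>, a) # L) G t z = 1/2 * nrm (pad e ?X + pad e ?Y)"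
    unfolding hess_x_norm_def by (simp add: mnorm_facts(3)[OF n])
  also have "\<dots> \<le> 1/2 * (nrm (pad e ?X) + nrm (pad e ?Y))" by (intro mult_left_mono mnorm_facts(4)[OF n]) auto
  finally show ?thesis using mnorm_facts(2)[OF n] by (simp add: hess_x_norm_def)
qed

lemma Lp_int_cong: "(\<And>t z. t \<in> {0<..<T} \<Longrightarrow> g t z = h t z) \<Longrightarrow> Lp_int p T g = Lp_int p T h"
  unfolding Lp_int_def by (rule nn_integral_cong) (auto simp: indicator_def)

lemma mexp_norm_bound:
  obtains B where "0 \<le> B" "\<And>t z. t \<in> {-T..T} \<Longrightarrow> norm (mexp A t *v (z::real^'n)) \<le> B * norm z"
proof -
  obtain q where q: "0 \<le> q" "\<And>t i j. t \<in> {-T..T} \<Longrightarrow> \<bar>mexp A t $ i $ j\<bar> \<le> q"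
    using mexp_entry_bound[of T A] by blast
  show ?thesis
  proof (rule that[of "real CARD('n) * (real CARD('n) * q)"])
    show "0 \<le> real CARD('n) * (real CARD('n) * q)" using q(1) by simp
    fix t and z :: "real^'n" assume t: "t \<in> {-T..T}"
    have "\<bar>(mexp A t *v z) $ i\<bar> \<le> real CARD('n) * q * norm z" for i
    proof -
      have "\<bar>(mexp A t *v z) $ i\<bar> \<le> (\<Sum>j\<in>UNIV. \<bar>mexp A t $ i $ j\<bar> * \<bar>z $ j\<bar>)"
        unfolding matrix_vector_mult_def vec_lambda_beta abs_mult[symmetric] by (rule sum_abs)
      also have "\<dots> \<le> (\<Sum>j\<in>(UNIV::'n set). q * norm z)"
        by (intro sum_mono mult_mono q t component_le_norm_cart) auto
      finally show ?thesis by (simp add: mult.assoc)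
    qed
    then have "(\<Sum>i\<in>UNIV. \<bar>(mexp A t *v z) $ i\<bar>) \<le> (\<Sum>i\<in>(UNIV::'n set). real CARD('n) * q * norm z)"
      by (intro sum_mono)
    then show "norm (mexp A t *v z) \<le> real CARD('n) * (real CARD('n) * q) * norm z"
      using norm_le_sum[of "mexp A t *v z"] by (simp add: mult.assoc)
  qed
qed

text \<open>
  In contrast to \<^const>\<open>admissible\<close>, this is stable under \<^const>\<open>late_shift\<close> and gives members of \<^const>\<open>Bb_C0inf\<close>
  after the change of coordinates: joint continuity keeps piecewise continuity along the moving points.
\<close>

definition pw_admissible :: "real \<Rightarrow> (nat \<Rightarrow> real) \<Rightarrow> (real \<Rightarrow> real^'n \<Rightarrow> real) \<Rightarrow> bool" where
  "pw_admissible T M G \<longleftrightarrow> admissible M G \<and> strip_measurable T G \<and> (\<exists>R. \<forall>s x. R < norm x \<longrightarrow> G s x = 0) \<and>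
     (\<exists>F. finite F \<and> continuous_on (({0..T} - F) \<times> UNIV) (\<lambda>(t, x). G t x))"

lemma pw_admissible_late_shift:
  fixes G :: "real \<Rightarrow> real^'n \<Rightarrow> real"
  assumes G: "pw_admissible T M G" shows "pw_admissible T M (late_shift \<tau> a G)"
proof -
  from G obtain R F where R: "\<And>s x. R < norm x \<Longrightarrow> G s x = 0"
    and F: "finite F" "continuous_on (({0..T} - F) \<times> UNIV) (\<lambda>(t, x). G t x)"
    and admissible: "admissible M G" and strip_measurable: "strip_measurable T G" unfolding pw_admissible_def by blast
  have sh: "late_shift \<tau> a G = (\<lambda>t x. G t (x + (if \<tau> \<le> t then - a else 0)))" by (auto simp: late_shift_def fun_eq_iff)
  have c: "(\<lambda>t. if \<tau> \<le> t then - a else 0) \<in> borel_measurable borel"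
    by (intro measurable_If) auto
  have "strip_measurable T (late_shift \<tau> a G)" unfolding sh by (rule strip_measurable_shift[OF c strip_measurable])
  moreover have "\<forall>s x. R + norm a < norm x \<longrightarrow> late_shift \<tau> a G s x = 0"
  proof (intro allI impI)
    fix s and x :: "real^'n" assume x: "R + norm a < norm x"
    have "norm x \<le> norm (x + (if \<tau> \<le> s then - a else 0)) + norm a"
      using norm_triangle_ineq4[of "x - a" "- a"] by auto
    then have "R < norm (x + (if \<tau> \<le> s then - a else 0))" using x by linarith
    then show "late_shift \<tau> a G s x = 0" unfolding sh by (rule R)
  qed
  \<comment> \<open>The jump time joins the exceptional times; away from it the shift is locally
    constant.\<close>
  moreover have "continuous_on (({0..T} - insert \<tau> F) \<times> UNIV) (\<lambda>(t, x). late_shift \<tau> a G t x)"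
  proof -
    have "continuous_on ({..<\<tau>} \<union> {\<tau><..}) (\<lambda>t. if \<tau> \<le> t then - a else 0)"
    proof (rule continuous_on_open_Un)
      show "continuous_on {..<\<tau>} (\<lambda>t. if \<tau> \<le> t then - a else 0)"
        by (rule continuous_on_eq[OF continuous_on_const[of _ 0]]) auto
      show "continuous_on {\<tau><..} (\<lambda>t. if \<tau> \<le> t then - a else 0)"
        by (rule continuous_on_eq[OF continuous_on_const[of _ "- a"]]) auto
    qed auto
    then have cc: "continuous_on (({0..T} - insert \<tau> F) \<times> UNIV) (\<lambda>p. (fst p, snd p + (if \<tau> \<le> fst p then - a else 0)))"
      by (intro continuous_on_Pair continuous_on_fst continuous_on_snd continuous_on_add continuous_on_id
          continuous_on_compose2[OF _ continuous_on_fst[OF continuous_on_id]]) auto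
    have "continuous_on (({0..T} - insert \<tau> F) \<times> UNIV) (\<lambda>p. (\<lambda>(t, x). G t x) (fst p, snd p + (if \<tau> \<le> fst p then - a else 0)))"
      by (rule continuous_on_compose2[OF F(2) cc]) auto
    then show ?thesis unfolding sh by (simp add: case_prod_unfold)
  qed
  ultimately show ?thesis using admissible_late_shift[OF admissible] F(1) unfolding pw_admissible_def by blast
qed

text \<open>The inverse flow is bounded uniformly over [0,T], which puts the supports into one ball.
  Joint continuity off the finite set F yields continuity in time along each moving point.\<close>

lemma pw_admissible_Bb:
  fixes G :: "real \<Rightarrow> real^'n \<Rightarrow> real"
  assumes T: "0 < T" and G: "pw_admissible T M G"
  shows "(\<lambda>t z. G t (mexp A t *v z)) \<in> Bb_C0inf T"
proof -
  from G obtain R F where R: "\<And>s x. R < norm x \<Longrightarrow> G s x = 0"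
    and F: "finite F" "continuous_on (({0..T} - F) \<times> UNIV) (\<lambda>(t, x). G t x)"
    and admissible: "admissible M G" and strip_measurable: "strip_measurable T G" unfolding pw_admissible_def by blast
  let ?f = "\<lambda>t z. G t (mexp A t *v z)"
  obtain q where q: "0 \<le> q" "\<And>t i j. t \<in> {-T..T} \<Longrightarrow> \<bar>mexp A t $ i $ j\<bar> \<le> q"
    using mexp_entry_bound[of T A] by blast
  define M' where "M' k = (real CARD('n) * q)^k * M k" for k
  have Cf: "Cb_le M' (?f t)" if "t \<in> {0..T}" for t
    unfolding M'_def[abs_def] by (rule Cb_le_linear[OF q(2) admissibleD(1)[OF admissible]]) (use that in auto)
  obtain B where B: "0 \<le> B" "\<And>t z. t \<in> {-T..T} \<Longrightarrow> norm (mexp A t *v (z::real^'n)) \<le> B * norm z"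
    using mexp_norm_bound[of T A] by blast
  define R' where "R' = B * \<bar>R\<bar> + 1"
  have sup: "supp (?f t) \<subseteq> cball 0 (B * \<bar>R\<bar>)" if t: "t \<in> {0..T}" for t
    unfolding supp_def
  proof (rule closure_minimal)
    show "{z. ?f t z \<noteq> 0} \<subseteq> cball 0 (B * \<bar>R\<bar>)"
    proof
      fix z assume "z \<in> {z. ?f t z \<noteq> 0}"
      then have "norm (mexp A t *v z) \<le> \<bar>R\<bar>" using R[of "mexp A t *v z" t] by force
      have "norm z = norm (mexp A (- t) *v (mexp A t *v z))" by (simp add: mexp_vec_inverse)
      also have "\<dots> \<le> B * norm (mexp A t *v z)" by (rule B(2)) (use t in auto)
      also have "\<dots> \<le> B * \<bar>R\<bar>" by (rule mult_left_mono) fact+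
      finally show "z \<in> cball 0 (B * \<bar>R\<bar>)" by simp
    qed
  qed simp
  show ?thesis
    unfolding Bb_C0inf_def mem_Collect_eq
  proof (intro conjI ballI allI)
    have "(\<lambda>w. indicator ({0..T} \<times> UNIV) w *\<^sub>R (case w of (t, z) \<Rightarrow> ?f t z)) \<in> borel_measurable borel"
      using strip_measurable_flow[OF strip_measurable, of A] by (simp add: strip_measurable_def case_prod_unfold)
    then show "(\<lambda>(t, z). ?f t z) \<in> borel_measurable (restrict_space borel ({0..T} \<times> UNIV))"
      by (subst borel_measurable_restrict_space_iff) (auto intro!: borel_closed closed_Times)
    show "bounded ((\<lambda>(t, z). ?f t z) ` ({0..T} \<times> UNIV))"
      unfolding bounded_real using Cb_le_bound[OF admissibleD(1)[OF admissible]] by fastforce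
    show "\<exists>R. \<forall>t\<in>{0..T}. supp (?f t) \<subseteq> ball 0 R"
      using sup by (intro exI[of _ R']) (force simp: R'_def)
    show "C_k n (?f t)" if "t \<in> {0..T}" for n t by (rule Cb_le_C_k[OF Cf[OF that]])
    show "compact (supp (?f t))" if "t \<in> {0..T}" for t
      using sup[OF that] bounded_subset[OF bounded_cball] by (auto simp: compact_eq_bounded_closed supp_def)
    show "(SUP t\<in>{0..T}. Cn_norm n (?f t)) < \<infinity>" for n
    proof -
      have "Cn_norm n (?f t) \<le> ennreal (\<Sum>k\<le>n. M' k)" if t: "t \<in> {0..T}" for t
        unfolding Cn_norm_def
      proof (intro SUP_least ennreal_leI)
        fix js :: "'n list" and z assume "js \<in> {js. length js \<le> n}"
        then have "M' (length js) \<le> (\<Sum>k\<le>n. M' k)"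
          by (intro member_le_sum) (auto intro: Cb_le_nonneg[OF Cf[OF t]])
        then show "\<bar>partials js (?f t) z\<bar> \<le> (\<Sum>k\<le>n. M' k)" using Cb_leD(2)[OF Cf[OF t], of js z] by linarith
      qed
      then have "(SUP t\<in>{0..T}. Cn_norm n (?f t)) \<le> ennreal (\<Sum>k\<le>n. M' k)" by (rule SUP_least)
      then show ?thesis by (rule order_le_less_trans) simp
    qed
    show "piecewise_cont T (\<lambda>t. ?f t z)" for z
      unfolding piecewise_cont_def
    proof (intro exI[of _ F] conjI ballI F(1))
      fix t assume t: "t \<in> {0..T} - F"
      have "continuous_on ({0..T} - F) (\<lambda>t. (\<lambda>(t, x). G t x) (t, mexp A t *v z))"
        by (rule continuous_on_compose2[OF F(2)]) (auto intro!: continuous_on_Pair continuous_on_id mexp_path_cont)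
      then have "continuous (at t within {0..T} - F) (\<lambda>t. ?f t z)"
        using t by (simp add: continuous_on_eq_continuous_within)
      moreover have "at t within {0..T} - F = at t within {0..T}"
        by (rule at_within_nhd[of _ "- F"]) (use t F(1) finite_imp_closed in auto)
      ultimately show "continuous (at t within {0..T}) (\<lambda>t. ?f t z)" by simp
    qed
  qed
qed

lemma psd_const_cov:
  assumes "psd B"
  obtains \<Lambda> where "psd_incr T \<Lambda> (cov A (\<lambda>_. B))"
  by (rule cov_psd_incr[of T "\<lambda>_. B" A]) (use assms in auto)

text \<open>Without jumps this is the assumed estimate for the unperturbed problem. A further jump
  gives a half-sum of two translates of estimates with one jump fewer and late-shifted sources. Both
  the Hessian and the source side are translated by shifts depending only on time, so neither
  integral changes, and \<open>Lp_int_half\<close> returns the same bound.\<close>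

lemma jump_bound:
  fixes G :: "real \<Rightarrow> real^'n \<Rightarrow> real" and e :: "'d::finite \<Rightarrow> 'n"
  assumes T: "0 < T" and B: "psd B" and n: "matrix_norm nrm" and p: "1 < p" and Cp: "0 < Cp"
    and base: "\<And>g u. g \<in> Bb_C0inf T \<Longrightarrow> is_solution T (\<lambda>t. L_ou B A) g u \<Longrightarrow>
       Lp_mnorm_x nrm e p T (\<lambda>t. hess_x e (u t)) \<le> ennreal Cp * Lp_norm p T g"
    and G: "pw_admissible T M G"
  shows "Lp_int p T (hess_x_norm nrm e A (cov A (\<lambda>_. B)) L G) \<le> ennreal (Cp powr p) * Lp_int p T (\<lambda>t z. G t (mexp A t *v z))"
  using G
proof (induction L arbitrary: G)
  case Nil
  obtain \<Lambda> where C: "psd_incr T \<Lambda> (cov A (\<lambda>_. B))" using psd_const_cov[OF B] by blast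
  have admissible: "admissible M G" using Nil by (simp add: pw_admissible_def)
  have "is_solution T (\<lambda>t g z. trace (B ** hess g z) + (A *v z) \<bullet> grad g z) (\<lambda>t z. G t (mexp A t *v z))
      (\<lambda>t z. duhamel (cov A (\<lambda>_. B)) [] G t (mexp A t *v z))"
    by (rule solution(1)[OF T _ _ admissible refl refl]) (use B in auto)
  then have "is_solution T (\<lambda>t. L_ou B A) (\<lambda>t z. G t (mexp A t *v z)) (\<lambda>t z. duhamel (cov A (\<lambda>_. B)) [] G t (mexp A t *v z))"
    by (simp add: L_ou_def[abs_def])
  from base[OF pw_admissible_Bb[OF T Nil] this]
  have "Lp_int p T (\<lambda>t z. nrm (pad e (hess_x e (\<lambda>z. duhamel (cov A (\<lambda>_. B)) [] G t (mexp A t *v z)) z)))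
     \<le> ennreal (Cp powr p) * Lp_int p T (\<lambda>t z. G t (mexp A t *v z))"
    unfolding Lp_mnorm_x_def by (rule iffD1[OF Lp_le_iff[OF less_trans[OF zero_less_one p] Cp]])
  moreover have "Lp_int p T (\<lambda>t z. nrm (pad e (hess_x e (\<lambda>z. duhamel (cov A (\<lambda>_. B)) [] G t (mexp A t *v z)) z))) = Lp_int p T (hess_x_norm nrm e A (cov A (\<lambda>_. B)) [] G)"
    by (rule Lp_int_cong, rule nrm_hess_x[OF C admissible]) auto
  ultimately show ?case by simp
next
  case (Cons l L)
  obtain \<tau> a where l: "l = (\<tau>, a)" by (cases l)
  obtain \<Lambda> where C: "psd_incr T \<Lambda> (cov A (\<lambda>_. B))" using psd_const_cov[OF B] by blast
  have admissible: "admissible M G" and jmG: "strip_measurable T G" using Cons.prems by (auto simp: pw_admissible_def)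
  let ?c = "\<lambda>b t. if \<tau> \<le> t then mexp A (- t) *v b else 0"
  have c: "?c b \<in> borel_measurable borel" for b
  proof (intro measurable_If borel_measurable_const)
    have "continuous_on UNIV (\<lambda>t. mexp A (- t) *v b)"
      by (rule continuous_on_compose2[OF mexp_path_cont[of UNIV] continuous_on_minus[OF continuous_on_id]]) auto
    then show "(\<lambda>t. mexp A (- t) *v b) \<in> borel_measurable borel" by (rule borel_measurable_continuous_onI)
  qed auto
  let ?N = "\<lambda>b t z. hess_x_norm nrm e A (cov A (\<lambda>_. B)) L (late_shift \<tau> b G) t (z + ?c b t)"
  let ?K = "ennreal (Cp powr p) * Lp_int p T (\<lambda>t z. G t (mexp A t *v z))"
  note jN = hess_x_norm_strip_measurable[OF n C admissible_late_shift[OF admissible]]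
  have bnd: "Lp_int p T (?N b) \<le> ?K" for b
  proof -
    have "Lp_int p T (?N b) = Lp_int p T (hess_x_norm nrm e A (cov A (\<lambda>_. B)) L (late_shift \<tau> b G))"
      by (rule Lp_int_shift[OF c jN])
    also have "\<dots> \<le> ennreal (Cp powr p) * Lp_int p T (\<lambda>t z. late_shift \<tau> b G t (mexp A t *v z))"
      by (rule Cons.IH[OF pw_admissible_late_shift[OF Cons.prems]])
    also have "Lp_int p T (\<lambda>t z. late_shift \<tau> b G t (mexp A t *v z)) = Lp_int p T (\<lambda>t z. G t (mexp A t *v (z + ?c (- b) t)))"
      by (rule Lp_int_cong) (simp add: late_shift_def matrix_vector_right_distrib mexp_vec_inverse)
    also have "\<dots> = Lp_int p T (\<lambda>t z. G t (mexp A t *v z))"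
      by (rule Lp_int_shift[OF c strip_measurable_flow[OF jmG]])
    finally show ?thesis .
  qed
  show ?case
    unfolding l
  proof (rule Lp_int_half[OF less_imp_le[OF p] strip_measurable_shift[OF c jN] strip_measurable_shift[OF c jN] _ bnd[of a] bnd[of "- a"]])
    fix t z assume "t \<in> {0<..<T}"
    then have t: "t \<in> {0..T}" by auto
    show "\<bar>hess_x_norm nrm e A (cov A (\<lambda>_. B)) ((\<tau>, a) # L) G t z\<bar> \<le> (\<bar>?N a t z\<bar> + \<bar>?N (- a) t z\<bar>) / 2"
      by (rule hess_x_norm_Cons[OF n C admissible t])
  qed
qed

section \<open>Jumps on a time grid\<close>

definition grid_jumps :: "(real \<Rightarrow> real^'n^'n) \<Rightarrow> nat \<Rightarrow> nat \<Rightarrow> (real \<times> (real^'n)) list" where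
  "grid_jumps C m N = concat (map (\<lambda>k. map (Pair (real (Suc k) / real m)) (factor (C (real (Suc k) / real m) - C (real k / real m)))) [0..<N])"

lemma jumps_in_concat:
  "jumps_in (concat (map (\<lambda>k. map (Pair (\<tau> k)) (F k)) ks)) s t = concat (map F (filter (\<lambda>k. s < \<tau> k \<and> \<tau> k \<le> t) ks))"
proof (induction ks)
  case (Cons k ks)
  have "jumps_in (xs @ ys) s t = jumps_in xs s t @ jumps_in ys s t" for xs ys :: "(real \<times> (real^'a)) list" by (simp add: jumps_in_def)
  moreover have "jumps_in (map (Pair (\<tau> k)) (F k)) s t = (if s < \<tau> k \<and> \<tau> k \<le> t then F k else [])"
    by (simp add: jumps_in_def filter_map o_def)
  ultimately show ?case using Cons by simp
qed (simp add: jumps_in_def)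

lemma filter_upt_range:
  assumes "j \<le> N" shows "filter (\<lambda>k. i \<le> k \<and> k < j) [0..<N] = [i..<j]"
proof (rule sorted_distinct_set_unique)
  show "set (filter (\<lambda>k. i \<le> k \<and> k < j) [0..<N]) = set [i..<j]" using assms by auto
qed (auto intro: sorted_wrt_filter)

text \<open>The covariance of cell k is released at its right end (k+1)/m. This time lies in (s,t]
  exactly when floor (s m) \<le> k < floor (t m), so the jumps seen represent the covariance between
  the grid points below s and below t.\<close>

lemma jumps_in_grid:
  assumes m: "0 < m" and s: "0 \<le> s" and t: "0 \<le> t" and N: "nat \<lfloor>t * real m\<rfloor> \<le> N"
  shows "jumps_in (grid_jumps C m N) s t = concat (map (\<lambda>k. factor (C (real (Suc k) / real m) - C (real k / real m))) [nat \<lfloor>s * real m\<rfloor>..<nat \<lfloor>t * real m\<rfloor>])"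
proof -
  have "(s < real (Suc k) / real m \<and> real (Suc k) / real m \<le> t) \<longleftrightarrow> (nat \<lfloor>s * real m\<rfloor> \<le> k \<and> k < nat \<lfloor>t * real m\<rfloor>)" for k
  proof -
    have "s < real (Suc k) / real m \<longleftrightarrow> s * real m < real (Suc k)" using m by (simp add: less_divide_eq)
    also have "\<dots> \<longleftrightarrow> \<lfloor>s * real m\<rfloor> < int (Suc k)" by (simp add: floor_less_iff)
    also have "\<dots> \<longleftrightarrow> nat \<lfloor>s * real m\<rfloor> \<le> k" by linarith
    finally have 1: "s < real (Suc k) / real m \<longleftrightarrow> nat \<lfloor>s * real m\<rfloor> \<le> k" .
    have "real (Suc k) / real m \<le> t \<longleftrightarrow> real (Suc k) \<le> t * real m" using m by (simp add: divide_le_eq)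
    also have "\<dots> \<longleftrightarrow> int (Suc k) \<le> \<lfloor>t * real m\<rfloor>" by (simp add: le_floor_iff)
    also have "\<dots> \<longleftrightarrow> k < nat \<lfloor>t * real m\<rfloor>" by linarith
    finally show ?thesis using 1 by blast
  qed
  then show ?thesis
    unfolding grid_jumps_def jumps_in_concat by (simp only: filter_upt_range[OF N])
qed

text \<open>The cells are exchanged one at a time. A cell carries covariance of trace at most
  \<Lambda> / m, and replacing its jumps by the heat operator costs the square of this.\<close>

lemma grid_error:
  fixes \<phi> :: "real^'n \<Rightarrow> real"
  assumes C: "psd_incr T \<Lambda> C" and m: "0 < m" and \<phi>: "Cb_le M \<phi>" and ij: "i \<le> j" and jT: "real j / real m \<le> T"
  shows "\<bar>avg (concat (map (\<lambda>k. factor (C (real (Suc k) / real m) - C (real k / real m))) [i..<j])) \<phi> x - heat (C (real j / real m) - C (real i / real m)) \<phi> x\<bar>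
     \<le> real (j - i) * (8 * (real CARD('n))^4 * (\<Lambda> / real m)\<^sup>2 * M 4)"
  using ij jT \<phi>
proof (induction j arbitrary: \<phi> rule: dec_induct)
  case base
  then show ?case using heat_zero[OF base.prems(2)] by simp
next
  case (step j)
  let ?C = "\<lambda>k. C (real k / real m)"
  let ?D = "?C (Suc j) - ?C j"
  let ?P = "concat (map (\<lambda>k. factor (?C (Suc k) - ?C k)) [i..<j])"
  let ?K = "8 * (real CARD('n))^4 * (\<Lambda> / real m)\<^sup>2 * M 4"
  have jT: "real j / real m \<le> T" using step.prems(1) m by (simp add: divide_le_eq)
  have o: "0 \<le> real j / real m" "real j / real m \<le> real (Suc j) / real m" by (auto intro: divide_right_mono)
  have o2: "0 \<le> real i / real m" "real i / real m \<le> real j / real m" using step.hyps by (auto intro: divide_right_mono)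
  have pD: "psd ?D" by (rule psd_incrD(1)[OF C o step.prems(1)])
  have pE: "psd (?C j - ?C i)" by (rule psd_incrD(1)[OF C o2 jT])
  have tD: "trace ?D \<le> \<Lambda> / real m" using psd_incrD(2)[OF C o step.prems(1)] by (simp add: add_divide_distrib)
  have M0: "0 \<le> M 4" by (rule Cb_le_nonneg[OF step.prems(2)])
  have "\<bar>avg (factor ?D) \<phi> y - heat ?D \<phi> y\<bar> \<le> ?K" for y
  proof -
    have "\<bar>avg (factor ?D) \<phi> y - heat ?D \<phi> y\<bar> \<le> 8 * (real CARD('n))^4 * (trace ?D)\<^sup>2 * M 4"
      by (rule heat_avg_diff[OF pD step.prems(2) gram_factor[OF pD]])
    also have "\<dots> \<le> ?K" using tD trace_psd_nonneg[OF pD] M0 by (intro mult_right_mono mult_left_mono power_mono) auto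
    finally show ?thesis .
  qed
  then have 1: "\<bar>avg ?P (avg (factor ?D) \<phi>) x - avg ?P (heat ?D \<phi>) x\<bar> \<le> ?K" by (rule avg_diff_bound)
  have 2: "\<bar>avg ?P (heat ?D \<phi>) x - heat (?C j - ?C i) (heat ?D \<phi>) x\<bar> \<le> real (j - i) * ?K"
    by (rule step.IH[OF jT Cb_le_heat(1)[OF pD step.prems(2)]])
  have 3: "heat (?C j - ?C i) (heat ?D \<phi>) = heat (?C (Suc j) - ?C i) \<phi>"
    using heat_add[OF pE pD step.prems(2)] by (simp add: algebra_simps)
  have 4: "avg (concat (map (\<lambda>k. factor (?C (Suc k) - ?C k)) [i..<Suc j])) \<phi> x = avg ?P (avg (factor ?D) \<phi>) x"
    using step.hyps by (simp add: avg_append)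
  have 5: "real (Suc j - i) * ?K = real (j - i) * ?K + ?K"
    using step.hyps by (simp add: Suc_diff_le distrib_right)
  show ?case using 1 2 unfolding 3 4 5 by linarith
qed

text \<open>At most T m cells occur, each with an error of order 1/m^2. Moving s and t to the grid
  points below them changes the trace by at most \<Lambda> / m in each case, which gives the terms
  with \<open>M 2\<close>.\<close>

lemma jumps_error:
  fixes \<phi> :: "real^'n \<Rightarrow> real"
  assumes C: "psd_incr T \<Lambda> C" and \<phi>: "Cb_le M \<phi>" and m: "0 < m" and st: "0 \<le> s" "s \<le> t" "t \<le> T" and N: "nat \<lfloor>T * real m\<rfloor> \<le> N"
  shows "\<bar>avg (jumps_in (grid_jumps C m N) s t) \<phi> x - heat (C t - C s) \<phi> x\<bar>
    \<le> (8 * (real CARD('n))^4 * \<Lambda>\<^sup>2 * T * M 4 + 4 * (real CARD('n))\<^sup>2 * \<Lambda> * M 2) / real m"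
proof -
  define i where "i = nat \<lfloor>s * real m\<rfloor>"
  define j where "j = nat \<lfloor>t * real m\<rfloor>"
  let ?C = "\<lambda>k::nat. C (real k / real m)"
  let ?c = "real CARD('n)"
  have L0: "0 \<le> \<Lambda>" by (rule psd_incrD(3)[OF C])
  have M0: "0 \<le> M k" for k by (rule Cb_le_nonneg[OF \<phi>])
  have fl: "real (nat \<lfloor>u * real m\<rfloor>) / real m \<le> u" "u - real (nat \<lfloor>u * real m\<rfloor>) / real m \<le> 1 / real m" if "0 \<le> u" for u
  proof -
    have "0 \<le> \<lfloor>u * real m\<rfloor>" using that by simp
    then have e: "real (nat \<lfloor>u * real m\<rfloor>) = real_of_int \<lfloor>u * real m\<rfloor>" by simp
    have "real m = real (Suc (m - 1))" using m by simp
    then show "real (nat \<lfloor>u * real m\<rfloor>) / real m \<le> u" "u - real (nat \<lfloor>u * real m\<rfloor>) / real m \<le> 1 / real m"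
      unfolding e using floor_approx[of u "m - 1"] by metis+
  qed
  have is1: "real i / real m \<le> s" "s - real i / real m \<le> 1 / real m" unfolding i_def using fl[OF st(1)] by auto
  have t0: "0 \<le> t" using st by simp
  have jt: "real j / real m \<le> t" "t - real j / real m \<le> 1 / real m" unfolding j_def using fl[OF t0] by auto
  have ij: "i \<le> j" unfolding i_def j_def using st by (intro nat_mono floor_mono mult_right_mono) auto
  have jT: "real j / real m \<le> T" using jt st by simp
  have jN: "nat \<lfloor>t * real m\<rfloor> \<le> N" using N st by (meson floor_mono mult_right_mono nat_mono of_nat_0_le_iff order_trans)
  have i0: "0 \<le> real i / real m" "0 \<le> real j / real m" by auto
  have ijm: "real i / real m \<le> real j / real m" using ij by (intro divide_right_mono) auto
  have 1: "\<bar>avg (jumps_in (grid_jumps C m N) s t) \<phi> x - heat (?C j - ?C i) \<phi> x\<bar> \<le> real (j - i) * (8 * ?c^4 * (\<Lambda> / real m)\<^sup>2 * M 4)"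
    unfolding jumps_in_grid[OF m st(1) t0 jN] i_def[symmetric] j_def[symmetric] by (rule grid_error[OF C m \<phi> ij jT])
  have "real (j - i) \<le> T * real m" using jT m by (simp add: divide_le_eq)
  then have "real (j - i) * (8 * ?c^4 * (\<Lambda> / real m)\<^sup>2 * M 4) \<le> (T * real m) * (8 * ?c^4 * (\<Lambda> / real m)\<^sup>2 * M 4)"
    using M0 by (intro mult_right_mono) auto
  also have "\<dots> = 8 * ?c^4 * \<Lambda>\<^sup>2 * T * M 4 / real m" using m by (simp add: power2_eq_square)
  finally have 1: "\<bar>avg (jumps_in (grid_jumps C m N) s t) \<phi> x - heat (?C j - ?C i) \<phi> x\<bar> \<le> 8 * ?c^4 * \<Lambda>\<^sup>2 * T * M 4 / real m"
    using 1 by linarith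
  have tr: "2 * ?c\<^sup>2 * trace (C b - C a) * M 2 \<le> 2 * ?c\<^sup>2 * \<Lambda> * M 2 / real m"
    if "0 \<le> a" "a \<le> b" "b \<le> T" "b - a \<le> 1 / real m" for a b
  proof -
    have "trace (C b - C a) \<le> \<Lambda> * (1 / real m)"
      using psd_incrD(2)[OF C that(1-3)] mult_left_mono[OF that(4) L0] by linarith
    from mult_left_mono[OF this, of "2 * ?c\<^sup>2 * M 2"] show ?thesis using M0 by (simp add: mult_ac)
  qed
  \<comment> \<open>The increment from the grid point below s up to t dominates both increments to
    be compared and serves as the intermediate one.\<close>
  have e1: "(C t - ?C i) - (?C j - ?C i) = C t - ?C j" and e2: "(C t - ?C i) - (C t - C s) = C s - ?C i" by auto
  have 2: "\<bar>heat (C t - ?C i) \<phi> x - heat (?C j - ?C i) \<phi> x\<bar> \<le> 2 * ?c\<^sup>2 * \<Lambda> * M 2 / real m"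
    using heat_mono_diff[OF psd_incrD(1)[OF C i0(1) ijm jT], of "C t - ?C i", OF _ \<phi>, of x] psd_incrD(1)[OF C i0(2) jt(1) st(3)] tr[OF i0(2) jt(1) st(3) jt(2)]
    unfolding e1 by linarith
  have sT: "s \<le> T" using st by simp
  have 3: "\<bar>heat (C t - ?C i) \<phi> x - heat (C t - C s) \<phi> x\<bar> \<le> 2 * ?c\<^sup>2 * \<Lambda> * M 2 / real m"
    using heat_mono_diff[OF psd_incrD(1)[OF C st], of "C t - ?C i", OF _ \<phi>, of x] psd_incrD(1)[OF C i0(1) is1(1) sT] tr[OF i0(1) is1(1) sT is1(2)]
    unfolding e2 by linarith
  have "(8 * ?c^4 * \<Lambda>\<^sup>2 * T * M 4 + 4 * ?c\<^sup>2 * \<Lambda> * M 2) / real m = 8 * ?c^4 * \<Lambda>\<^sup>2 * T * M 4 / real m + 2 * (2 * ?c\<^sup>2 * \<Lambda> * M 2 / real m)"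
    by (simp add: add_divide_distrib)
  then show ?thesis using 1 2 3 by linarith
qed

section \<open>Discretization in time and passage to the limit\<close>

lemma C_k_partials: "C_k (n + length js) f \<Longrightarrow> C_k n (partials js f)"
proof (induction js arbitrary: n)
  case (Cons i js)
  have "C_k (Suc n) (partials js f)" using Cons.IH[of "Suc n"] Cons.prems by simp
  then show ?case by simp
qed simp

lemma Bb_Cb_le:
  fixes f :: "real \<Rightarrow> real^'n \<Rightarrow> real"
  assumes f: "f \<in> Bb_C0inf T"
  obtains M where "\<And>t. t \<in> {0..T} \<Longrightarrow> Cb_le M (f t)"
proof -
  define M where "M n = enn2real (SUP t\<in>{0..T}. Cn_norm n (f t))" for n
  show ?thesis
  proof (rule that[of M])
    fix t assume t: "t \<in> {0..T}"
    show "Cb_le M (f t)"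
      unfolding Cb_le_def
    proof (intro allI conjI)
      fix js :: "'n list" and z
      have "C_k (Suc 0 + length js) (f t)" using f t by (auto simp: Bb_C0inf_def simp del: C_k.simps)
      from C_k_partials[OF this] show "partials js (f t) differentiable at z" by simp
      have fin: "(SUP t\<in>{0..T}. Cn_norm (length js) (f t)) < \<infinity>" using f by (simp add: Bb_C0inf_def)
      have "ennreal \<bar>partials js (f t) z\<bar> \<le> Cn_norm (length js) (f t)"
        unfolding Cn_norm_def by (rule SUP_upper2[of js], simp, rule SUP_upper) simp
      also have "\<dots> \<le> (SUP t\<in>{0..T}. Cn_norm (length js) (f t))" by (rule SUP_upper[OF t])
      also have "\<dots> = ennreal (M (length js))" unfolding M_def using fin by simp
      finally show "\<bar>partials js (f t) z\<bar> \<le> M (length js)" by (simp add: M_def)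
    qed
  qed
qed

lemma Bb_strip_measurable:
  assumes f: "f \<in> Bb_C0inf T" shows "strip_measurable T f"
proof -
  have "(\<lambda>(t, z). f t z) \<in> borel_measurable (restrict_space borel ({0..T} \<times> UNIV))"
    using f by (simp add: Bb_C0inf_def)
  then have "(\<lambda>w. indicator ({0..T} \<times> UNIV) w *\<^sub>R (case w of (t, z) \<Rightarrow> f t z)) \<in> borel_measurable borel"
    by (subst (asm) borel_measurable_restrict_space_iff) (auto intro!: borel_closed closed_Times)
  then show ?thesis by (simp add: strip_measurable_def case_prod_unfold)
qed

lemma Bb_support:
  assumes f: "f \<in> Bb_C0inf T"
  obtains R where "0 \<le> R" "\<And>t z. t \<in> {0..T} \<Longrightarrow> R < norm z \<Longrightarrow> f t z = 0"
proof -
  obtain R where R: "\<And>t. t \<in> {0..T} \<Longrightarrow> supp (f t) \<subseteq> ball 0 R"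
    using f unfolding Bb_C0inf_def by blast
  show ?thesis
  proof (rule that[of "max 0 R"])
    fix t and z :: "real^'a" assume t: "t \<in> {0..T}" and z: "max 0 R < norm z"
    show "f t z = 0"
    proof (rule ccontr)
      assume "f t z \<noteq> 0"
      then have "z \<in> supp (f t)" unfolding supp_def by (intro subsetD[OF closure_subset]) simp
      with R[OF t] z show False by auto
    qed
  qed simp
qed

text \<open>Each point has finitely many exceptional times. Over a countable dense set of points
  their union is countable, and the Lipschitz bound in space, uniform in time, transfers continuity
  to all other points. The exceptional set thus becomes null and independent of the point.\<close>

lemma Bb_cont:
  fixes f :: "real \<Rightarrow> real^'n \<Rightarrow> real"
  assumes f: "f \<in> Bb_C0inf T"
  obtains N where "countable N" "\<And>t z. t \<in> {0..T} \<Longrightarrow> t \<notin> N \<Longrightarrow> continuous (at t within {0..T}) (\<lambda>s. f s z)"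
proof -
  obtain M where M: "\<And>t. t \<in> {0..T} \<Longrightarrow> Cb_le M (f t)" using Bb_Cb_le[OF f] by blast
  obtain D :: "(real^'n) set" where D: "countable D" "\<And>X. open X \<Longrightarrow> X \<noteq> {} \<Longrightarrow> \<exists>d\<in>D. d \<in> X"
    using countable_dense_exists by blast
  have "\<forall>z. \<exists>F. finite F \<and> (\<forall>t\<in>{0..T} - F. continuous (at t within {0..T}) (\<lambda>s. f s z))"
    using f by (simp add: Bb_C0inf_def piecewise_cont_def)
  then obtain F where F: "\<And>z. finite (F z)" "\<And>z t. t \<in> {0..T} - F z \<Longrightarrow> continuous (at t within {0..T}) (\<lambda>s. f s z)"
    by metis
  show ?thesis
  proof (rule that[of "\<Union>d\<in>D. F d"])
    show "countable (\<Union>d\<in>D. F d)" by (rule countable_UN[OF D(1)]) (rule countable_finite[OF F(1)])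
    fix t z assume t: "t \<in> {0..T}" and tN: "t \<notin> (\<Union>d\<in>D. F d)"
    show "continuous (at t within {0..T}) (\<lambda>s. f s z)"
      unfolding continuous_within
    proof (rule tendstoI)
      fix \<epsilon> :: real assume \<epsilon>: "0 < \<epsilon>"
      define K where "K = real CARD('n) * M 1"
      have K0: "0 \<le> K" unfolding K_def using Cb_le_nonneg[OF M[OF t]] by simp
      define r where "r = \<epsilon> / 3 / (K + 1)"
      have n: "K + 1 \<noteq> 0" using K0 by linarith
      have r: "0 < r" using \<epsilon> K0 by (simp add: r_def)
      have Kr: "K * r \<le> \<epsilon> / 3"
      proof -
        have "K * r \<le> (K + 1) * r" using r by (simp add: distrib_right)
        also have "\<dots> = \<epsilon> / 3" unfolding r_def by (subst times_divide_eq_right) (rule nonzero_mult_div_cancel_left[OF n])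
        finally show ?thesis .
      qed
      obtain d where d: "d \<in> D" "d \<in> ball z r" using D(2)[of "ball z r"] r by auto
      have close: "\<bar>f s z - f s d\<bar> \<le> \<epsilon> / 3" if "s \<in> {0..T}" for s
      proof -
        have "\<bar>f s z - f s d\<bar> \<le> real CARD('n) * norm (z - d) * M 1" by (rule taylor1'[OF M[OF that]])
        also have "\<dots> = K * norm (z - d)" by (simp add: K_def)
        also have "\<dots> \<le> K * r" using d(2) K0 by (intro mult_left_mono) (auto simp: dist_norm)
        finally show ?thesis using Kr by linarith
      qed
      have "((\<lambda>s. f s d) \<longlongrightarrow> f t d) (at t within {0..T})"
        using F(2)[of t d] t tN d(1) by (auto simp: continuous_within)
      moreover have "0 < \<epsilon> / 3" using \<epsilon> by simp
      ultimately have "\<forall>\<^sub>F s in at t within {0..T}. dist (f s d) (f t d) < \<epsilon> / 3" by (rule tendstoD)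
      moreover have "\<forall>\<^sub>F s in at t within {0..T}. s \<in> {0..T}" by (simp add: eventually_at_filter)
      ultimately show "\<forall>\<^sub>F s in at t within {0..T}. dist (f s z) (f t z) < \<epsilon>"
      proof eventually_elim
        case (elim s)
        then show ?case using close[of s] close[OF t] unfolding dist_real_def by linarith
      qed
    qed
  qed
qed

text \<open>The largest multiple of 1/(n+1) not above s; rounding down keeps it in [0,T].\<close>

definition grid :: "nat \<Rightarrow> real \<Rightarrow> real" where
  "grid n s = real_of_int \<lfloor>s * real (Suc n)\<rfloor> / real (Suc n)"

lemma grid_range: "s \<in> {0..T} \<Longrightarrow> grid n s \<in> {0..T}"
  using floor_approx(1)[of s n] unfolding grid_def by (auto intro: order_trans divide_nonneg_nonneg)

lemma grid_lim:
  assumes "continuous (at t within {0..T}) (\<lambda>s. f s z)" "t \<in> {0..T}"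
  shows "(\<lambda>n. f (grid n t) z) \<longlonglongrightarrow> f t z"
  using continuous_within_tendsto_compose'[OF assms(1) grid_range[OF assms(2)], of "\<lambda>n. n"] floor_lim[of t]
  by (simp add: grid_def)

lemma grid_strip_measurable:
  fixes f :: "real \<Rightarrow> real^'n \<Rightarrow> real"
  assumes M: "\<And>t. t \<in> {0..T} \<Longrightarrow> Cb_le M (f t)"
  shows "strip_measurable T (\<lambda>s. f (grid n s))"
proof -
  define h where "h i w = (if real_of_int i / real (Suc n) \<in> {0..T} then f (real_of_int i / real (Suc n)) (snd w) else 0)" 
    for i and w :: "real \<times> (real^'n)"
  have fs: "fst \<in> borel_measurable (borel :: (real \<times> (real^'n)) measure)"
    by (auto intro!: borel_measurable_continuous_onI continuous_intros)
  have "(\<lambda>w. h \<lfloor>fst w * real (Suc n)\<rfloor> w) \<in> borel_measurable borel"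
  proof (rule measurable_compose_countable[where f=h])
    fix i
    show "h i \<in> borel_measurable borel"
    proof (cases "real_of_int i / real (Suc n) \<in> {0..T}")
      case True
      have "continuous_on UNIV (\<lambda>w::real \<times> (real^'n). f (real_of_int i / real (Suc n)) (snd w))"
        by (rule continuous_on_compose2[OF Cb_le_cont[OF M[OF True], of UNIV] continuous_on_snd[OF continuous_on_id]]) auto
      then show ?thesis unfolding h_def[abs_def] using True by (simp add: borel_measurable_continuous_onI)
    next
      case False
      then have "h i = (\<lambda>_. 0)" unfolding h_def[abs_def] by (simp only: if_False)
      then show ?thesis by simp
    qed
    show "(\<lambda>w::real \<times> (real^'n). \<lfloor>fst w * real (Suc n)\<rfloor>) \<in> measurable borel (count_space UNIV)"
      by (rule measurable_compose[OF borel_measurable_times[OF fs borel_measurable_const] measurable_real_floor])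
  qed
  then have "(\<lambda>w. indicator ({0..T} \<times> UNIV) w * h \<lfloor>fst w * real (Suc n)\<rfloor> w) \<in> borel_measurable borel"
    by (intro borel_measurable_times borel_measurable_indicator borel_closed closed_Times) auto
  also have "(\<lambda>w. indicator ({0..T} \<times> UNIV) w * h \<lfloor>fst w * real (Suc n)\<rfloor> w) = (\<lambda>w. indicator ({0..T} \<times> UNIV) w * f (grid n (fst w)) (snd w))"
  proof
    fix w :: "real \<times> (real^'n)"
    show "indicator ({0..T} \<times> UNIV) w * h \<lfloor>fst w * real (Suc n)\<rfloor> w = indicator ({0..T} \<times> UNIV) w * f (grid n (fst w)) (snd w)"
    proof (cases "fst w \<in> {0..T}")
      case True
      then have "h \<lfloor>fst w * real (Suc n)\<rfloor> w = f (grid n (fst w)) (snd w)"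
        unfolding h_def using grid_range[OF True, of n] by (simp only: grid_def if_True)
      then show ?thesis by simp
    qed (simp add: indicator_def mem_Times_iff)
  qed
  finally show ?thesis by (simp add: strip_measurable_def)
qed

text \<open>The source in the coordinates moving with the flow; the extension by zero provides
  bounds at all real times.\<close>

definition pull_back :: "real^'n^'n \<Rightarrow> real \<Rightarrow> (real \<Rightarrow> real^'n \<Rightarrow> real) \<Rightarrow> real \<Rightarrow> real^'n \<Rightarrow> real" where
  "pull_back A T g s x = (if s \<in> {0..T} then g s (mexp A (- s) *v x) else 0)"

lemma pull_back_flow: "t \<in> {0..T} \<Longrightarrow> pull_back A T g t (mexp A t *v z) = g t z"
  by (simp add: pull_back_def mexp_vec_inverse)

lemma inv_flow_cont: "continuous_on S (\<lambda>w. (fst w, mexp A (- fst w) *v snd w))"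
proof -
  have "continuous_on S (\<lambda>w. (\<lambda>(t, z). (t, mexp A t *v z)) (- fst w, snd w))"
    by (rule continuous_on_compose2[OF flow_joint_cont[of UNIV]]) (auto intro!: continuous_intros)
  then have "continuous_on S (\<lambda>w. mexp A (- fst w) *v snd w)"
    using continuous_on_snd by fastforce
  then show ?thesis by (intro continuous_on_Pair continuous_on_fst continuous_on_id)
qed

lemma pull_back_strip_measurable:
  assumes "strip_measurable T g" shows "strip_measurable T (pull_back A T g)"
proof -
  have "(\<lambda>w. (fst w, mexp A (- fst w) *v snd w)) \<in> borel_measurable borel"
    by (rule borel_measurable_continuous_onI[OF inv_flow_cont])
  from measurable_compose[OF this assms[unfolded strip_measurable_def]]
  have "(\<lambda>w. indicator ({0..T} \<times> UNIV) w * g (fst w) (mexp A (- fst w) *v snd w)) \<in> borel_measurable borel"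
    by (simp add: indicator_def mem_Times_iff)
  also have "(\<lambda>w. indicator ({0..T} \<times> UNIV) w * g (fst w) (mexp A (- fst w) *v snd w)) = (\<lambda>w. indicator ({0..T} \<times> UNIV) w * pull_back A T g (fst w) (snd w))"
    by (auto simp: indicator_def pull_back_def fun_eq_iff)
  finally show ?thesis by (simp add: strip_measurable_def)
qed

lemma pull_back_admissible:
  fixes g :: "real \<Rightarrow> real^'n \<Rightarrow> real"
  assumes T: "0 < T" and g: "strip_measurable T g" and M: "\<And>t. t \<in> {0..T} \<Longrightarrow> Cb_le M (g t)"
    and q: "0 \<le> q" "\<And>t i j. t \<in> {-T..T} \<Longrightarrow> \<bar>mexp A t $ i $ j\<bar> \<le> q"
  shows "admissible (\<lambda>k. (real CARD('n) * q)^k * M k) (pull_back A T g)"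
  unfolding admissible_def
proof (intro conjI allI)
  fix s
  show "Cb_le (\<lambda>k. (real CARD('n) * q)^k * M k) (pull_back A T g s)"
  proof (cases "s \<in> {0..T}")
    case True
    then have e: "pull_back A T g s = (\<lambda>x. g s (mexp A (- s) *v x))" by (auto simp: pull_back_def)
    show ?thesis unfolding e by (rule Cb_le_linear[OF q(2) M[OF True]]) (use True in auto)
  next
    case False
    then have e: "pull_back A T g s = (\<lambda>x. 0)" by (auto simp: pull_back_def)
    have "0 \<in> {0..T}" using T by simp
    from Cb_le_nonneg[OF M[OF this]] show ?thesis
      unfolding e using q(1) by (intro Cb_le_I[where P="\<lambda>_ _. 0"]) auto
  qed
next
  fix x :: "real^'n"
  have "(\<lambda>s. (s, x)) \<in> borel_measurable borel"
    by (intro borel_measurable_continuous_onI continuous_intros)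
  from measurable_compose[OF this pull_back_strip_measurable[OF g, of A, unfolded strip_measurable_def]]
  have "(\<lambda>s. indicator ({0..T} \<times> UNIV) (s, x) * pull_back A T g s x) \<in> borel_measurable borel" by simp
  also have "(\<lambda>s. indicator ({0..T} \<times> UNIV) (s, x) * pull_back A T g s x) = (\<lambda>s. pull_back A T g s x)"
    by (auto simp: pull_back_def indicator_def)
  finally show "(\<lambda>s. pull_back A T g s x) \<in> borel_measurable borel" .
qed

lemma pw_admissible_pull_grid:
  fixes f :: "real \<Rightarrow> real^'n \<Rightarrow> real"
  assumes T: "0 < T" and f: "f \<in> Bb_C0inf T" and M: "\<And>t. t \<in> {0..T} \<Longrightarrow> Cb_le M (f t)"
    and q: "0 \<le> q" "\<And>t i j. t \<in> {-T..T} \<Longrightarrow> \<bar>mexp A t $ i $ j\<bar> \<le> q"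
  shows "pw_admissible T (\<lambda>k. (real CARD('n) * q)^k * M k) (pull_back A T (\<lambda>s. f (grid n s)))"
  unfolding pw_admissible_def
proof (intro conjI)
  let ?g = "\<lambda>s. f (grid n s)"
  let ?m = "real (Suc n)"
  have j: "strip_measurable T ?g" by (rule grid_strip_measurable) (rule M)
  show "admissible (\<lambda>k. (real CARD('n) * q)^k * M k) (pull_back A T ?g)"
    by (rule pull_back_admissible[OF T j M[OF grid_range] q])
  show "strip_measurable T (pull_back A T ?g)" by (rule pull_back_strip_measurable[OF j])
  obtain R where R: "0 \<le> R" "\<And>t z. t \<in> {0..T} \<Longrightarrow> R < norm z \<Longrightarrow> f t z = 0" using Bb_support[OF f] by blast
  obtain b where b: "0 \<le> b" "\<And>t z. t \<in> {-T..T} \<Longrightarrow> norm (mexp A t *v (z::real^'n)) \<le> b * norm z"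
    using mexp_norm_bound[of T A] by blast
  have "pull_back A T ?g s x = 0" if x: "b * R < norm x" for s x
  proof (cases "s \<in> {0..T}")
    case s: True
    have "norm x = norm (mexp A s *v (mexp A (- s) *v x))" by (simp add: mexp_vec_inverse)
    also have "\<dots> \<le> b * norm (mexp A (- s) *v x)" by (rule b(2)) (use s in auto)
    finally have "b * R < b * norm (mexp A (- s) *v x)" using x by linarith
    then have "R < norm (mexp A (- s) *v x)" using b(1) by (metis mult_left_mono not_le)
    then show ?thesis using s R(2)[OF grid_range[OF s]] by (simp add: pull_back_def)
  qed (simp add: pull_back_def del: atLeastAtMost_iff)
  then show "\<exists>R. \<forall>s x. R < norm x \<longrightarrow> pull_back A T ?g s x = 0" by blast
  define F where "F = (\<lambda>k. real k / ?m) ` {..nat \<lfloor>T * ?m\<rfloor>}"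
  have "continuous_on (({0..T} - F) \<times> UNIV) (\<lambda>(t, x). pull_back A T ?g t x)"
    unfolding continuous_on_eq_continuous_within
  proof
    fix w :: "real \<times> (real^'n)" assume w: "w \<in> ({0..T} - F) \<times> UNIV"
    let ?S = "({0..T} - F) \<times> (UNIV :: (real^'n) set)"
    define i where "i = \<lfloor>fst w * ?m\<rfloor>"
    have i0: "0 \<le> i" using w by (auto simp: i_def mem_Times_iff)
    have iT: "real_of_int i / ?m \<in> {0..T}" using grid_range[of "fst w" T n] w by (auto simp: grid_def i_def mem_Times_iff)
    have ne: "real_of_int i \<noteq> fst w * ?m"
    proof
      assume e: "real_of_int i = fst w * ?m"
      have "nat i \<le> nat \<lfloor>T * ?m\<rfloor>" using w unfolding i_def by (intro nat_mono floor_mono mult_right_mono) (auto simp: mem_Times_iff)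
      moreover have "fst w = real (nat i) / ?m" using e i0 by (simp add: field_simps)
      ultimately have "fst w \<in> F" unfolding F_def by blast
      with w show False by (auto simp: mem_Times_iff)
    qed
    have "real_of_int i \<le> fst w * ?m" "fst w * ?m < real_of_int i + 1" unfolding i_def by linarith+
    with ne have wi: "real_of_int i < fst w * ?m" "fst w * ?m < real_of_int i + 1" by auto
    define U where "U = {v :: real \<times> (real^'n). real_of_int i < fst v * ?m} \<inter> {v. fst v * ?m < real_of_int i + 1}"
    have "open U" unfolding U_def by (intro open_Int open_Collect_less continuous_intros)
    moreover have "w \<in> U" using wi by (simp add: U_def)
    ultimately obtain d where d: "0 < d" "ball w d \<subseteq> U" by (meson open_contains_ball)
    have "continuous_on ?S (\<lambda>w. f (real_of_int i / ?m) (snd (fst w, mexp A (- fst w) *v snd w)))"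
      by (rule continuous_on_compose2[OF Cb_le_cont[OF M[OF iT], of UNIV] continuous_on_snd[OF inv_flow_cont]]) auto
    then have "continuous (at w within ?S) (\<lambda>w. f (real_of_int i / ?m) (snd (fst w, mexp A (- fst w) *v snd w)))"
      using w unfolding continuous_on_eq_continuous_within by blast
    then have c: "continuous (at w within ?S) (\<lambda>w. f (real_of_int i / ?m) (mexp A (- fst w) *v snd w))" by (simp only: snd_conv)
    show "continuous (at w within ?S) (\<lambda>(t, x). pull_back A T ?g t x)"
    proof (rule continuous_transform_within[OF c d(1) w])
      fix v assume v: "v \<in> ?S" "dist v w < d"
      then have "v \<in> U" using d(2) by (auto simp: dist_commute)
      then have "\<lfloor>fst v * ?m\<rfloor> = i" unfolding U_def by (intro floor_unique) auto
      then have "grid n (fst v) = real_of_int i / ?m" by (simp add: grid_def)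
      then show "f (real_of_int i / ?m) (mexp A (- fst v) *v snd v) = (case v of (t, x) \<Rightarrow> pull_back A T ?g t x)"
        using v(1) by (auto simp: pull_back_def case_prod_unfold mem_Times_iff)
    qed
  qed
  then show "\<exists>F. finite F \<and> continuous_on (({0..T} - F) \<times> UNIV) (\<lambda>(t, x). pull_back A T ?g t x)"
    by (intro exI[of _ F]) (simp add: F_def)
qed

text \<open>A difference quotient with a fixed small step approximates each derivative up to K h,
  with K from the common bounds; for that step convergence of the values suffices.\<close>

lemma partial_converge:
  fixes g :: "real^'n \<Rightarrow> real"
  assumes gs: "\<And>n. Cb_le M (gs n)" and g: "Cb_le M g" and lim: "\<And>y. (\<lambda>n. gs n y) \<longlonglongrightarrow> g y"
  shows "(\<lambda>n. partial i (gs n) x) \<longlonglongrightarrow> partial i g x"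
proof (rule LIMSEQ_I)
  fix r :: real assume r: "0 < r"
  define K where "K = (real CARD('n))\<^sup>2 * M 2"
  have K0: "0 \<le> K" unfolding K_def using Cb_le_nonneg[OF g] by simp
  define h where "h = r / 4 / (K + 1)"
  have n: "K + 1 \<noteq> 0" using K0 by linarith
  have h: "0 < h" using r K0 by (simp add: h_def)
  have Kh: "K * h < r / 3"
  proof -
    have "K * h \<le> (K + 1) * h" using h by (simp add: distrib_right)
    also have "\<dots> = r / 4" unfolding h_def by (subst times_divide_eq_right) (rule nonzero_mult_div_cancel_left[OF n])
    finally show ?thesis using r by simp
  qed
  have q: "\<bar>(k (x + h *\<^sub>R axis i 1) - k x) / h - partial i k x\<bar> \<le> K * h" if k: "Cb_le M k" for k
  proof -
    have d: "dd (h *\<^sub>R axis i 1) k x = h * partial i k x"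
      using sum_axis(1)[of i "\<lambda>j. partial j k x"] by (simp add: dd_def sum_distrib_left[symmetric] mult.assoc)
    have "\<bar>k (x + h *\<^sub>R axis i 1) - k x - h * partial i k x\<bar> \<le> (K * h) * h"
      using taylor2[OF k, of x "h *\<^sub>R axis i 1"] h unfolding d by (simp add: K_def power2_eq_square mult_ac)
    moreover have "(k (x + h *\<^sub>R axis i 1) - k x) / h - partial i k x = (k (x + h *\<^sub>R axis i 1) - k x - h * partial i k x) / h"
      using h by (simp add: diff_divide_distrib)
    ultimately show ?thesis using h by (simp add: abs_divide divide_le_eq)
  qed
  have "(\<lambda>n. (gs n (x + h *\<^sub>R axis i 1) - gs n x) / h) \<longlonglongrightarrow> (g (x + h *\<^sub>R axis i 1) - g x) / h"
    using h by (intro tendsto_divide tendsto_diff lim tendsto_const) auto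
  from LIMSEQ_D[OF this, of "r / 3"] r
  obtain N where N: "\<And>n. N \<le> n \<Longrightarrow> \<bar>(gs n (x + h *\<^sub>R axis i 1) - gs n x) / h - (g (x + h *\<^sub>R axis i 1) - g x) / h\<bar> < r / 3"
    by auto
  have "norm (partial i (gs n) x - partial i g x) < r" if n: "N \<le> n" for n
    using N[OF n] q[OF gs, of n] q[OF g] Kh unfolding real_norm_def by linarith
  then show "\<exists>N. \<forall>n\<ge>N. norm (partial i (gs n) x - partial i g x) < r" by blast
qed

text \<open>At a fixed time s the jumps are replaced by the heat operator of the increment of C2, at
  rate 1/(n+1) with a constant depending only on \<open>M\<close>. By \<open>heat_add\<close> it
  combines with that of C1 to the operator for C, and \<open>heat_pointwise\<close> handles the
  sources. The bound \<open>M 0\<close> dominates the time integral.\<close>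

lemma duhamel_converge:
  fixes G :: "real \<Rightarrow> real^'n \<Rightarrow> real"
  assumes C1: "psd_incr T \<Lambda>1 C1" and C2: "psd_incr T \<Lambda>2 C2" and C: "psd_incr T \<Lambda> C"
    and split: "\<And>a b. 0 \<le> a \<Longrightarrow> a \<le> b \<Longrightarrow> b \<le> T \<Longrightarrow> C b - C a = (C2 b - C2 a) + (C1 b - C1 a)"
    and Gn: "\<And>n. admissible M (Gn n)" and G: "admissible M G" and N: "countable N"
    and lim: "\<And>s x. s \<in> {0..T} \<Longrightarrow> s \<notin> N \<Longrightarrow> (\<lambda>n. Gn n s x) \<longlonglongrightarrow> G s x"
    and t: "t \<in> {0..T}"
  shows "(\<lambda>n. duhamel C1 (grid_jumps C2 (Suc n) (nat \<lfloor>T * real (Suc n)\<rfloor>)) (Gn n) t x) \<longlonglongrightarrow> duhamel C [] G t x"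
proof -
  let ?L = "\<lambda>n. grid_jumps C2 (Suc n) (nat \<lfloor>T * real (Suc n)\<rfloor>)"
  let ?P = "\<lambda>n s. (if s \<in> {0..t} then avg (jumps_in (?L n) s t) (heat (C1 t - C1 s) (Gn n s)) else (\<lambda>_. 0)) x"
  let ?Q = "\<lambda>s. (if s \<in> {0..t} then avg (jumps_in [] s t) (heat (C t - C s) (G s)) else (\<lambda>_. 0)) x"
  note aP = admissible_propag[OF C1 Gn t order_refl]
  note aQ = admissible_propag[OF C G t order_refl]
  have mP: "?P n \<in> borel_measurable borel" for n using admissibleD(2)[OF aP[of "?L n" n], of x] .
  have mQ: "?Q \<in> borel_measurable borel" using admissibleD(2)[OF aQ[of "[]"], of x] .
  define K where "K = 8 * (real CARD('n))^4 * \<Lambda>2\<^sup>2 * T * M 4 + 4 * (real CARD('n))\<^sup>2 * \<Lambda>2 * M 2"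
  have ptw: "(\<lambda>n. ?P n s) \<longlonglongrightarrow> ?Q s" if s: "s \<in> {0..t}" "s \<notin> N" for s
  proof -
    have st: "0 \<le> s" "s \<le> t" "t \<le> T" using s t by auto
    note p1 = psd_incrD(1)[OF C1 st] and p2 = psd_incrD(1)[OF C2 st] and p = psd_incrD(1)[OF C st]
    note c = Cb_le_heat(1)[OF p1 admissibleD(1)[OF Gn]]
    have e: "heat (C t - C s) g = heat (C2 t - C2 s) (heat (C1 t - C1 s) g)" if "Cb_le M g" for g
      unfolding split[OF st] by (rule heat_add[OF p2 p1 that])
    have "(\<lambda>n. heat (C t - C s) (Gn n s) x) \<longlonglongrightarrow> heat (C t - C s) (G s) x"
      by (rule heat_pointwise[OF p admissibleD(1)[OF Gn] admissibleD(1)[OF G] lim]) (use s st in auto)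
    then have 1: "(\<lambda>n. heat (C2 t - C2 s) (heat (C1 t - C1 s) (Gn n s)) x) \<longlonglongrightarrow> heat (C t - C s) (G s) x"
      using e[OF admissibleD(1)[OF Gn]] by simp
    have b: "\<bar>avg (jumps_in (?L n) s t) (heat (C1 t - C1 s) (Gn n s)) x - heat (C2 t - C2 s) (heat (C1 t - C1 s) (Gn n s)) x\<bar> \<le> K / real (Suc n)" for n
      unfolding K_def by (rule jumps_error[OF C2 c _ st order_refl]) simp
    have "(\<lambda>n. K / real (Suc n)) \<longlonglongrightarrow> 0" by (rule LIMSEQ_Suc[OF lim_const_over_n])
    then have "(\<lambda>n. avg (jumps_in (?L n) s t) (heat (C1 t - C1 s) (Gn n s)) x - heat (C2 t - C2 s) (heat (C1 t - C1 s) (Gn n s)) x) \<longlonglongrightarrow> 0"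
      by (rule Lim_null_comparison[rotated]) (use b in auto)
    from tendsto_add[OF this 1]
    have "(\<lambda>n. avg (jumps_in (?L n) s t) (heat (C1 t - C1 s) (Gn n s)) x) \<longlonglongrightarrow> heat (C t - C s) (G s) x" by simp
    moreover have "avg (jumps_in [] s t) (heat (C t - C s) (G s)) x = heat (C t - C s) (G s) x" by (simp add: jumps_in_def)
    ultimately show ?thesis using s(1) by simp
  qed
  show ?thesis
    unfolding duhamel_eq set_lebesgue_integral_def
  proof (rule integral_dominated_convergence[where w="\<lambda>s. indicator {0..t} s *\<^sub>R M 0"])
    show "(\<lambda>s. indicator {0..t} s *\<^sub>R ?Q s) \<in> borel_measurable lborel"
      using mQ by (intro borel_measurable_scaleR) auto
    show "(\<lambda>s. indicator {0..t} s *\<^sub>R ?P n s) \<in> borel_measurable lborel" for n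
      using mP[of n] by (intro borel_measurable_scaleR) auto
    show "integrable lborel (\<lambda>s. indicator {0..t} s *\<^sub>R M 0)"
      using integrable_real_indicator[of "{0..t}" lborel] by (simp add: emeasure_lborel_Icc_eq)
    have "AE s in lborel. s \<notin> N" using countable_imp_null_set_lborel[OF N] by (rule AE_not_in)
    then show "AE s in lborel. (\<lambda>n. indicator {0..t} s *\<^sub>R ?P n s) \<longlonglongrightarrow> indicator {0..t} s *\<^sub>R ?Q s"
    proof eventually_elim
      case (elim s)
      show ?case
      proof (cases "s \<in> {0..t}")
        case True
        show ?thesis by (intro tendsto_scaleR tendsto_const ptw[OF True elim])
      qed (simp add: indicator_def del: atLeastAtMost_iff)
    qed
    show "AE s in lborel. norm (indicator {0..t} s *\<^sub>R ?P n s) \<le> indicator {0..t} s *\<^sub>R M 0" for n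
    proof (rule AE_I2)
      fix s
      have "\<bar>?P n s\<bar> \<le> M 0" by (rule Cb_le_bound[OF admissibleD(1)[OF aP]])
      then show "norm (indicator {0..t} s *\<^sub>R ?P n s) \<le> indicator {0..t} s *\<^sub>R M 0"
        by (auto simp: indicator_def)
    qed
  qed
qed

lemma cov_add:
  fixes A :: "real^'n^'n"
  assumes Q: "continuous_on {0..T} Q" and R: "continuous_on {0..T} R" and a: "0 \<le> a" "a \<le> b" "b \<le> T"
  shows "cov A (\<lambda>t. Q t + R t) b - cov A (\<lambda>t. Q t + R t) a = (cov A R b - cov A R a) + (cov A Q b - cov A Q a)"
proof -
  have d: "cov_density A (\<lambda>t. Q t + R t) r $ i $ j = cov_density A R r $ i $ j + cov_density A Q r $ i $ j" for r i j
    by (simp add: cov_density_def matrix_matrix_mult_def sum.distrib distrib_left distrib_right)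
  have "(cov A (\<lambda>t. Q t + R t) b - cov A (\<lambda>t. Q t + R t) a) $ i $ j = (cov A R b - cov A R a) $ i $ j + (cov A Q b - cov A Q a) $ i $ j" for i j
    unfolding cov_diff[OF Q a] cov_diff[OF R a] cov_diff[OF continuous_on_add[OF Q R] a] d
    by (rule set_integral_add(2)[OF cov_density_sint[OF R a(1,3)] cov_density_sint[OF Q a(1,3)]])
  then show ?thesis by (simp add: vec_eq_iff)
qed

text \<open>\<open>partial_converge\<close>, used twice, gives convergence of the differentiated
  sources, so every Hessian entry is a case of \<open>duhamel_converge\<close>.\<close>

lemma hess_x_norm_converge:
  fixes G :: "real \<Rightarrow> real^'n \<Rightarrow> real" and e :: "'d::finite \<Rightarrow> 'n"
  assumes n: "matrix_norm nrm"
    and C1: "psd_incr T \<Lambda>1 C1" and C2: "psd_incr T \<Lambda>2 C2" and C: "psd_incr T \<Lambda> C"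
    and split: "\<And>a b. 0 \<le> a \<Longrightarrow> a \<le> b \<Longrightarrow> b \<le> T \<Longrightarrow> C b - C a = (C2 b - C2 a) + (C1 b - C1 a)"
    and Gn: "\<And>n. admissible M (Gn n)" and G: "admissible M G" and N: "countable N"
    and lim: "\<And>s x. s \<in> {0..T} \<Longrightarrow> s \<notin> N \<Longrightarrow> (\<lambda>n. Gn n s x) \<longlonglongrightarrow> G s x"
    and t: "t \<in> {0..T}"
  shows "(\<lambda>n. hess_x_norm nrm e A C1 (grid_jumps C2 (Suc n) (nat \<lfloor>T * real (Suc n)\<rfloor>)) (Gn n) t z) \<longlonglongrightarrow> hess_x_norm nrm e A C [] G t z"
proof -
  let ?L = "\<lambda>n. grid_jumps C2 (Suc n) (nat \<lfloor>T * real (Suc n)\<rfloor>)"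
  have p1: "(\<lambda>n. partial l (Gn n s) x) \<longlonglongrightarrow> partial l (G s) x" if "s \<in> {0..T}" "s \<notin> N" for l s x
    by (rule partial_converge[OF admissibleD(1)[OF Gn] admissibleD(1)[OF G] lim[OF that]])
  have p2: "(\<lambda>n. partial k (partial l (Gn n s)) x) \<longlonglongrightarrow> partial k (partial l (G s)) x" if "s \<in> {0..T}" "s \<notin> N" for k l s x
    by (rule partial_converge[OF Cb_le_partial[OF admissibleD(1)[OF Gn]] Cb_le_partial[OF admissibleD(1)[OF G]] p1[OF that]])
  have "(\<lambda>n. duhamel C1 (?L n) (\<lambda>s. partial k (partial l (Gn n s))) t y) \<longlonglongrightarrow> duhamel C [] (\<lambda>s. partial k (partial l (G s))) t y" for k l y
    by (rule duhamel_converge[OF C1 C2 C split admissible_partial2[OF Gn] admissible_partial2[OF G] N p2 t])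
  then have hess_entry: "(\<lambda>n. hess_entry A C1 (?L n) (Gn n) i j t z) \<longlonglongrightarrow> hess_entry A C [] G i j t z" for i j
    unfolding hess_entry_def by (intro tendsto_sum tendsto_mult tendsto_const)
  have "(\<lambda>n. pad e (\<chi> a b. hess_entry A C1 (?L n) (Gn n) (e a) (e b) t z)) \<longlonglongrightarrow> pad e (\<chi> a b. hess_entry A C [] G (e a) (e b) t z)"
  proof (intro vec_tendstoI)
    fix i j
    show "(\<lambda>n. pad e (\<chi> a b. hess_entry A C1 (?L n) (Gn n) (e a) (e b) t z) $ i $ j) \<longlonglongrightarrow> pad e (\<chi> a b. hess_entry A C [] G (e a) (e b) t z) $ i $ j"
      using hess_entry by (cases "i \<in> range e \<and> j \<in> range e") (simp_all add: pad_def del: de_Morgan_conj)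
  qed
  moreover have "isCont nrm (pad e (\<chi> a b. hess_entry A C [] G (e a) (e b) t z))"
    using mnorm_facts(5)[OF n] by (simp add: continuous_on_eq_continuous_at)
  ultimately show ?thesis unfolding hess_x_norm_def by (rule isCont_tendsto_compose[rotated])
qed

lemma AE_fst_notin_countable:
  assumes "countable N" shows "AE w in lborel. fst (w :: real \<times> (real^'n)) \<notin> N"
proof (rule AE_I')
  have N: "N \<in> null_sets lborel" by (rule countable_imp_null_set_lborel[OF assms])
  then have Ns: "N \<in> sets lborel" by auto
  have "emeasure (lborel \<Otimes>\<^sub>M lborel) (N \<times> (UNIV :: (real^'n) set)) = emeasure lborel N * emeasure lborel (UNIV :: (real^'n) set)"
    by (rule lborel.emeasure_pair_measure_Times[OF Ns]) simp
  also have "\<dots> = 0" using N by (simp add: null_sets_def)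
  finally have "emeasure lborel (N \<times> (UNIV :: (real^'n) set)) = 0" by (simp add: lborel_prod)
  moreover have "N \<times> (UNIV :: (real^'n) set) \<in> sets lborel"
  proof -
    have "N \<times> (UNIV :: (real^'n) set) \<in> sets (lborel \<Otimes>\<^sub>M lborel)" by (rule pair_measureI[OF Ns]) simp
    then show ?thesis unfolding lborel_prod .
  qed
  ultimately show "N \<times> (UNIV :: (real^'n) set) \<in> null_sets lborel" by (simp add: null_sets_def)
  show "{w \<in> space lborel. \<not> fst w \<notin> N} \<subseteq> N \<times> (UNIV :: (real^'n) set)" by auto
qed

lemma Lp_int_grid_lim:
  fixes f :: "real \<Rightarrow> real^'n \<Rightarrow> real"
  assumes f: "f \<in> Bb_C0inf T" and T: "0 < T" and p: "0 < p"
  shows "(\<lambda>n. Lp_int p T (\<lambda>s. f (grid n s))) \<longlonglongrightarrow> Lp_int p T f"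
proof -
  obtain M where M: "\<And>t. t \<in> {0..T} \<Longrightarrow> Cb_le M (f t)" using Bb_Cb_le[OF f] by blast
  obtain N where N: "countable N" "\<And>t z. t \<in> {0..T} \<Longrightarrow> t \<notin> N \<Longrightarrow> continuous (at t within {0..T}) (\<lambda>s. f s z)"
    using Bb_cont[OF f] by blast
  obtain R where R: "0 \<le> R" "\<And>t z. t \<in> {0..T} \<Longrightarrow> R < norm z \<Longrightarrow> f t z = 0" using Bb_support[OF f] by blast
  let ?F = "\<lambda>g w. ennreal (\<bar>indicator ({0<..<T} \<times> UNIV) w * g (fst w) (snd w)\<bar> powr p)"
  let ?w = "\<lambda>w :: real \<times> (real^'n). ennreal (M 0 powr p) * indicator ({0..T} \<times> cball 0 R) w"
  have jg: "strip_measurable T (\<lambda>s. f (grid n s))" for n by (rule grid_strip_measurable) (rule M)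
  have mF: "?F g \<in> borel_measurable lborel" if "strip_measurable T g" for g :: "real \<Rightarrow> real^'n \<Rightarrow> real"
    using strip_measurable_open[OF that] by measurable
  have z: "(0::real) powr p = 0" by simp
  show ?thesis
    unfolding Lp_int_alt
  proof (rule nn_integral_dominated_convergence[where w="?w"])
    show "?F (\<lambda>s. f (grid n s)) \<in> borel_measurable lborel" for n by (rule mF[OF jg])
    show "?F f \<in> borel_measurable lborel" by (rule mF[OF Bb_strip_measurable[OF f]])
    have cl: "{0..T} \<times> cball (0::real^'n) R \<in> sets borel" by (intro borel_closed closed_Times) auto
    then show "?w \<in> borel_measurable lborel" by simp
    have "emeasure lborel ({0..T} \<times> cball (0::real^'n) R) < \<infinity>"
      by (intro emeasure_bounded_finite bounded_Times) auto
    then show "(\<integral>\<^sup>+w. ?w w \<partial>lborel) < \<infinity>"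
      using cl by (simp add: nn_integral_cmult_indicator ennreal_mult_less_top)
    show "AE w in lborel. ?F (\<lambda>s. f (grid n s)) w \<le> ?w w" for n
    proof (rule AE_I2)
      fix w :: "real \<times> (real^'n)"
      show "?F (\<lambda>s. f (grid n s)) w \<le> ?w w"
      proof (cases "fst w \<in> {0<..<T}")
        case True
        then have g: "grid n (fst w) \<in> {0..T}" by (intro grid_range) auto
        show ?thesis
        proof (cases "norm (snd w) \<le> R")
          case True
          have "\<bar>f (grid n (fst w)) (snd w)\<bar> powr p \<le> M 0 powr p"
            by (rule powr_mono2) (use p Cb_le_bound[OF M[OF g]] in auto)
          then show ?thesis using \<open>fst w \<in> {0<..<T}\<close> True by (simp add: indicator_def mem_Times_iff ennreal_leI)
        next
          case False
          then have "f (grid n (fst w)) (snd w) = 0" using R(2)[OF g] by simp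
          then show ?thesis by simp
        qed
      qed (simp add: indicator_def mem_Times_iff del: greaterThanLessThan_iff)
    qed
    show "AE w in lborel. (\<lambda>n. ?F (\<lambda>s. f (grid n s)) w) \<longlonglongrightarrow> ?F f w"
      using AE_fst_notin_countable[OF N(1)]
    proof eventually_elim
      case (elim w)
      show ?case
      proof (cases "fst w \<in> {0<..<T}")
        case True
        then have t: "fst w \<in> {0..T}" by auto
        have "(\<lambda>n. f (grid n (fst w)) (snd w)) \<longlonglongrightarrow> f (fst w) (snd w)" by (rule grid_lim[OF N(2)[OF t elim] t])
        then have "(\<lambda>n. ennreal (\<bar>f (grid n (fst w)) (snd w)\<bar> powr p)) \<longlonglongrightarrow> ennreal (\<bar>f (fst w) (snd w)\<bar> powr p)"
          by (intro tendsto_ennrealI tendsto_powr' tendsto_rabs tendsto_const) (use p in auto)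
        then show ?thesis using True by (simp add: indicator_def mem_Times_iff)
      qed (simp add: indicator_def mem_Times_iff del: greaterThanLessThan_iff)
    qed
  qed
qed

text \<open>The same n refines the jumps for S and the grid on which f is frozen. For the Hessians
  pointwise convergence at every time of [0,T] is available, which Fatou turns into a bound; on the
  source side the integrals converge, so the lower limits combine with the constant intact.\<close>

lemma perturbed_bound:
  fixes f :: "real \<Rightarrow> real^'n \<Rightarrow> real" and e :: "'d::finite \<Rightarrow> 'n"
  assumes T: "0 < T" and B: "psd B" and S: "continuous_on {0..T} S" "\<And>t. t \<in> {0..T} \<Longrightarrow> psd (S t)"
    and n: "matrix_norm nrm" and p: "1 < p" and Cp: "0 < Cp"
    and base: "\<And>g u. g \<in> Bb_C0inf T \<Longrightarrow> is_solution T (\<lambda>t. L_ou B A) g u \<Longrightarrow>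
       Lp_mnorm_x nrm e p T (\<lambda>t. hess_x e (u t)) \<le> ennreal Cp * Lp_norm p T g"
    and f: "f \<in> Bb_C0inf T"
  shows "Lp_int p T (hess_x_norm nrm e A (cov A (\<lambda>t. B + S t)) [] (pull_back A T f)) \<le> ennreal (Cp powr p) * Lp_int p T f"
proof -
  obtain M where M: "\<And>t. t \<in> {0..T} \<Longrightarrow> Cb_le M (f t)" using Bb_Cb_le[OF f] by blast
  obtain N where N: "countable N" "\<And>t z. t \<in> {0..T} \<Longrightarrow> t \<notin> N \<Longrightarrow> continuous (at t within {0..T}) (\<lambda>s. f s z)"
    using Bb_cont[OF f] by blast
  obtain q where q: "0 \<le> q" "\<And>t i j. t \<in> {-T..T} \<Longrightarrow> \<bar>mexp A t $ i $ j\<bar> \<le> q"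
    using mexp_entry_bound[of T A] by blast
  define M' where "M' k = (real CARD('n) * q)^k * M k" for k
  have Bc: "continuous_on {0..T} (\<lambda>_. B)" by simp
  obtain \<Lambda>1 where C1: "psd_incr T \<Lambda>1 (cov A (\<lambda>_. B))" using psd_const_cov[OF B] by blast
  obtain \<Lambda>2 where C2: "psd_incr T \<Lambda>2 (cov A S)" using cov_psd_incr[OF S] by blast
  obtain \<Lambda> where C: "psd_incr T \<Lambda> (cov A (\<lambda>t. B + S t))"
    using cov_psd_incr[OF continuous_on_add[OF Bc S(1)] psd_add[OF B S(2)]] by blast
  let ?G = "pull_back A T f" and ?Gn = "\<lambda>n. pull_back A T (\<lambda>s. f (grid n s))"
  let ?L = "\<lambda>n. grid_jumps (cov A S) (Suc n) (nat \<lfloor>T * real (Suc n)\<rfloor>)"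
  let ?N = "\<lambda>n. hess_x_norm nrm e A (cov A (\<lambda>_. B)) (?L n) (?Gn n)"
  let ?N' = "hess_x_norm nrm e A (cov A (\<lambda>t. B + S t)) [] ?G"
  let ?F = "\<lambda>g w. ennreal (\<bar>indicator ({0<..<T} \<times> UNIV) w * g (fst w) (snd w)\<bar> powr p)"
  have nG: "pw_admissible T M' (?Gn n)" for n unfolding M'_def[abs_def] by (rule pw_admissible_pull_grid[OF T f M q])
  then have Gn: "admissible M' (?Gn n)" for n by (simp add: pw_admissible_def)
  have G: "admissible M' ?G" unfolding M'_def[abs_def] by (rule pull_back_admissible[OF T Bb_strip_measurable[OF f] M q])
  have lim: "(\<lambda>n. ?Gn n s x) \<longlonglongrightarrow> ?G s x" if "s \<in> {0..T}" "s \<notin> N" for s x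
    unfolding pull_back_def using grid_lim[OF N(2)[OF that] that(1)] that(1) by simp
  have NEl: "(\<lambda>n. ?N n t z) \<longlonglongrightarrow> ?N' t z" if "t \<in> {0..T}" for t z
    by (rule hess_x_norm_converge[OF n C1 C2 C cov_add[OF Bc S(1)] Gn G N(1) lim that])
  have mF: "?F (?N n) \<in> borel_measurable lborel" for n
    using strip_measurable_open[OF hess_x_norm_strip_measurable[OF n C1 Gn]] by measurable
  have p0: "0 < p" using p by simp
  have "Lp_int p T ?N' = (\<integral>\<^sup>+w. liminf (\<lambda>n. ?F (?N n) w) \<partial>lborel)"
    unfolding Lp_int_alt
  proof (rule nn_integral_cong)
    fix w :: "real \<times> (real^'n)"
    have "(\<lambda>n. ?F (?N n) w) \<longlonglongrightarrow> ?F ?N' w"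
    proof (cases "fst w \<in> {0<..<T}")
      case True
      then have t: "fst w \<in> {0..T}" by auto
      show ?thesis
        by (intro tendsto_ennrealI tendsto_powr' tendsto_rabs tendsto_mult tendsto_const NEl[OF t]) (use p0 in auto)
    qed (simp add: indicator_def mem_Times_iff del: greaterThanLessThan_iff)
    then show "?F ?N' w = liminf (\<lambda>n. ?F (?N n) w)" by (rule lim_imp_Liminf[OF trivial_limit_sequentially, symmetric])
  qed
  also have "\<dots> \<le> liminf (\<lambda>n. Lp_int p T (?N n))"
    unfolding Lp_int_alt by (rule nn_integral_liminf[OF mF])
  also have "\<dots> \<le> liminf (\<lambda>n. ennreal (Cp powr p) * Lp_int p T (\<lambda>s. f (grid n s)))"
  proof (rule Liminf_mono, rule always_eventually, rule allI)
    fix n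
    have "Lp_int p T (?N n) \<le> ennreal (Cp powr p) * Lp_int p T (\<lambda>t z. ?Gn n t (mexp A t *v z))"
      by (rule jump_bound[OF T B \<open>matrix_norm nrm\<close> p Cp base nG])
    also have "Lp_int p T (\<lambda>t z. ?Gn n t (mexp A t *v z)) = Lp_int p T (\<lambda>s. f (grid n s))"
      by (rule Lp_int_cong) (simp add: pull_back_flow)
    finally show "Lp_int p T (?N n) \<le> ennreal (Cp powr p) * Lp_int p T (\<lambda>s. f (grid n s))" .
  qed
  also have "\<dots> = ennreal (Cp powr p) * Lp_int p T f"
  proof (rule lim_imp_Liminf)
    show "(\<lambda>n. ennreal (Cp powr p) * Lp_int p T (\<lambda>s. f (grid n s))) \<longlonglongrightarrow> ennreal (Cp powr p) * Lp_int p T f"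
      by (intro ennreal_tendsto_cmult Lp_int_grid_lim[OF f T p0]) simp
  qed simp
  finally show ?thesis .
qed

section \<open>Padded matrices, the time derivative and the final estimate\<close>

lemma sum_pad:
  fixes e :: "'d::finite \<Rightarrow> 'n::finite"
  assumes "inj e"
  shows "(\<Sum>i\<in>UNIV. if i \<in> range e then F (inv e i) i else 0) = (\<Sum>a\<in>UNIV. F a (e a) :: real)"
proof -
  have "(\<Sum>i\<in>UNIV. if i \<in> range e then F (inv e i) i else 0) = (\<Sum>i\<in>range e. F (inv e i) i)"
    by (subst sum.inter_restrict[symmetric]) auto
  also have "\<dots> = (\<Sum>a\<in>UNIV. F (inv e (e a)) (e a))" by (rule sum.reindex[OF assms, unfolded o_def])
  finally show ?thesis using assms by simp
qed

lemma psd_pad: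
  fixes e :: "'d::finite \<Rightarrow> 'n::finite"
  assumes e: "inj e" and sym: "transpose B = B" and pos: "\<And>\<xi>. 0 \<le> (B *v \<xi>) \<bullet> \<xi>"
  shows "psd (pad e B)"
  unfolding psd_def
proof (intro conjI allI)
  have s: "B $ a $ b = B $ b $ a" for a b using sym by (metis transpose_def vec_lambda_beta)
  have "pad e B $ i $ j = pad e B $ j $ i" for i j unfolding pad_def vec_lambda_beta using s by auto
  then show "transpose (pad e B) = pad e B" by (simp add: transpose_def vec_eq_iff)
  fix \<xi> :: "real^'n"
  let ?\<eta> = "\<chi> a. \<xi> $ e a"
  have "(pad e B *v \<xi>) \<bullet> \<xi> = (\<Sum>i\<in>UNIV. if i \<in> range e then
      (\<Sum>j\<in>UNIV. if j \<in> range e then B $ inv e i $ inv e j * \<xi> $ j * \<xi> $ i else 0) else 0)"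
    unfolding quadratic_form_sum pad_def by (intro sum.cong refl) (auto intro!: sum.cong)
  also have "\<dots> = (\<Sum>i\<in>UNIV. if i \<in> range e then (\<Sum>b\<in>UNIV. B $ inv e i $ b * \<xi> $ e b * \<xi> $ i) else 0)"
    by (subst sum_pad[OF e, of "\<lambda>b j. B $ inv e _ $ b * \<xi> $ j * \<xi> $ _"]) (rule refl)
  also have "\<dots> = (\<Sum>a\<in>UNIV. \<Sum>b\<in>UNIV. B $ a $ b * \<xi> $ e b * \<xi> $ e a)"
    by (rule sum_pad[OF e, of "\<lambda>a i. \<Sum>b\<in>UNIV. B $ a $ b * \<xi> $ e b * \<xi> $ i"])
  also have "\<dots> = (B *v ?\<eta>) \<bullet> ?\<eta>" by (simp add: quadratic_form_sum)
  finally show "0 \<le> (pad e B *v \<xi>) \<bullet> \<xi>" using pos by simp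
qed

text \<open>\<open>pad e (mat 1)\<close> is the orthogonal projection onto the x-coordinates;
  multiplication by it on both sides cuts out the xx-block.\<close>

lemma pad_hess_x:
  fixes e :: "'d::finite \<Rightarrow> 'n::finite"
  assumes e: "inj e"
  shows "pad e (hess_x e g z) = pad e (mat 1) ** hess g z ** pad e (mat 1)"
proof -
  have P: "pad e (mat 1) $ i $ j = (if i = j then (if i \<in> range e then 1 else 0) else (0::real))" for i j
    using e by (auto simp: pad_def mat_def)
  have s1: "(\<Sum>l\<in>UNIV. pad e (mat 1) $ i $ l * X l) = (if i \<in> range e then X i else 0)" for i and X :: "'n \<Rightarrow> real"
    unfolding P by (subst sum.remove[of _ i]) (auto intro!: sum.neutral)
  have s2: "(\<Sum>k\<in>UNIV. X k * pad e (mat 1) $ k $ j) = (if j \<in> range e then X j else 0)" for j and X :: "'n \<Rightarrow> real"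
    unfolding P by (subst sum.remove[of _ j]) (auto intro!: sum.neutral)
  have "pad e (hess_x e g z) $ i $ j = (pad e (mat 1) ** hess g z ** pad e (mat 1)) $ i $ j" for i j
  proof -
    have "(pad e (mat 1) ** hess g z ** pad e (mat 1)) $ i $ j = (if j \<in> range e then if i \<in> range e then hess g z $ i $ j else 0 else 0)"
      unfolding matrix_matrix_mult_def vec_lambda_beta s1 s2 ..
    also have "\<dots> = pad e (hess_x e g z) $ i $ j"
      unfolding pad_def hess_x_def hess_def vec_lambda_beta by (auto simp: f_inv_into_f)
    finally show ?thesis ..
  qed
  then show ?thesis by (simp add: vec_eq_iff)
qed

lemma is_solution_cong:
  assumes fg: "\<And>s z. s \<in> {0..T} \<Longrightarrow> f s z = g s z" and u: "is_solution T L f u"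
  shows "is_solution T L g u"
  unfolding is_solution_def
proof (intro conjI ballI allI)
  fix t z assume t: "t \<in> {0..T}"
  have e: "f s z + L s (u s) z = g s z + L s (u s) z" if "s \<in> {0..t}" for s using fg[of s z] that t by simp
  have "set_integrable lborel {0..t} (\<lambda>s. f s z + L s (u s) z)" using u t by (simp add: is_solution_def)
  moreover have "set_integrable lborel {0..t} (\<lambda>s. f s z + L s (u s) z) = set_integrable lborel {0..t} (\<lambda>s. g s z + L s (u s) z)"
    by (rule set_integrable_cong) (use e in auto)
  ultimately show "set_integrable lborel {0..t} (\<lambda>s. g s z + L s (u s) z)" by simp
  have "u t z = (LINT s:{0..t}|lborel. f s z + L s (u s) z)" using u t by (simp add: is_solution_def)
  also have "\<dots> = (LINT s:{0..t}|lborel. g s z + L s (u s) z)"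
    by (rule set_lebesgue_integral_cong) (use e in auto)
  finally show "u t z = (LINT s:{0..t}|lborel. g s z + L s (u s) z)" .
qed (use u in \<open>auto simp: is_solution_def\<close>)

text \<open>Where the source is continuous in time so is the whole integrand, and the fundamental
  theorem differentiates its integral at that time.\<close>

lemma dt_solution:
  assumes u: "is_solution T L f u" and t: "t \<in> {0<..<T}"
    and f: "continuous (at t within {0..T}) (\<lambda>s. f s z)" and L: "continuous_on {0..T} (\<lambda>s. L s (u s) z)"
  shows "dt u t z = f t z + L t (u t) z"
proof -
  let ?h = "\<lambda>s. f s z + L s (u s) z"
  have t': "t \<in> {0..T}" using t by auto
  have int: "set_integrable lborel {0..s} ?h" "u s z = (LINT s:{0..s}|lborel. ?h s)" if "s \<in> {0..T}" for s
    using u that by (simp_all add: is_solution_def)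
  have I: "?h integrable_on {0..T}"
    by (rule set_borel_integral_eq_integral(1)[OF int(1)]) (use t in auto)
  have e: "u s z = integral {0..s} ?h" if "s \<in> {0..T}" for s
    using int(2)[OF that] set_borel_integral_eq_integral(2)[OF int(1)[OF that]] by simp
  have c: "continuous (at t within {0..T}) ?h"
    by (rule continuous_add[OF f]) (use L t' in \<open>simp add: continuous_on_eq_continuous_within\<close>)
  have "((\<lambda>s. integral {0..s} ?h) has_vector_derivative ?h t) (at t within {0..T})"
    using integral_has_vector_derivative_continuous_at[OF I, of t "{}"] t' c by simp
  moreover have "at t within {0..T} = at t" by (rule at_within_interior) (use t in auto)
  ultimately have d: "((\<lambda>s. integral {0..s} ?h) has_field_derivative ?h t) (at t)"
    by (simp add: has_real_derivative_iff_has_vector_derivative)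
  have ev: "\<forall>\<^sub>F s in nhds t. integral {0..s} ?h = u s z"
  proof -
    have "\<forall>\<^sub>F s in nhds t. s \<in> {0<..<T}" by (rule eventually_nhds_in_open) (use t in auto)
    then show ?thesis by eventually_elim (use e in auto)
  qed
  have "((\<lambda>s. u s z) has_field_derivative ?h t) (at t)"
    by (rule iffD1[OF DERIV_cong_ev[OF refl ev refl] d])
  then show ?thesis unfolding dt_def by (rule DERIV_imp_deriv)
qed

lemma L_ouS_eq: "L_ouS B A S = (\<lambda>t g z. trace ((B + S t) ** hess g z) + (A *v z) \<bullet> grad g z)"
  by (intro ext) (simp add: L_ouS_def L_ou_def trace_mult sum.distrib distrib_right)

theorem theorem1p1:
  fixes T \<nu> p Cp :: real
    and e :: "'d::finite \<Rightarrow> 'n::finite"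
    and B0 :: "real^'d^'d"
    and A B BI :: "real^'n^'n"
    and nrm :: "real^'n^'n \<Rightarrow> real"
    and S :: "real \<Rightarrow> real^'n^'n"
    and f :: "real \<Rightarrow> real^'n \<Rightarrow> real"
  assumes "T > 0"
    and "inj e"
    and "\<nu> > 0"
    and "transpose B0 = B0"
    and "\<And>\<xi>. \<nu> * (norm \<xi>)\<^sup>2 \<le> (B0 *v \<xi>) \<bullet> \<xi> \<and> (B0 *v \<xi>) \<bullet> \<xi> \<le> inverse \<nu> * (norm \<xi>)\<^sup>2"
    and B_def: "B = pad e B0"
    and BI_def: "BI = pad e (mat 1)"
    and "kalman A B"
    and "matrix_norm nrm"
    and "1 < p"
    and "Cp > 0"
    and Cp_bound: "\<And>g u. g \<in> Bb_C0inf T \<Longrightarrow> is_solution T (\<lambda>t. L_ou B A) g u \<Longrightarrow>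
           Lp_mnorm_x nrm e p T (\<lambda>t. hess_x e (u t)) \<le> ennreal Cp * Lp_norm p T g"
    and "continuous_on {0..T} S"
    and "\<And>t. t \<in> {0..T} \<Longrightarrow> transpose (S t) = S t \<and> (\<forall>\<xi>. 0 \<le> (S t *v \<xi>) \<bullet> \<xi>)"
    and "f \<in> Bb_C0inf T"
  shows "\<exists>uS. is_solution T (L_ouS B A S) f uS
           \<and> (\<forall>v. is_solution T (L_ouS B A S) f v \<longrightarrow> (\<forall>t\<in>{0..T}. \<forall>z. v t z = uS t z))
           \<and> Lp_mnorm_x nrm e p T (\<lambda>t. hess_x e (uS t))
               = Lp_mnorm nrm p T (\<lambda>t z. BI ** hess (uS t) z ** BI)
           \<and> Lp_mnorm nrm p T (\<lambda>t z. BI ** hess (uS t) z ** BI)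
               \<le> ennreal Cp * Lp_norm p T (\<lambda>t z. dt uS t z - L_ouS B A S t (uS t) z)
           \<and> ennreal Cp * Lp_norm p T (\<lambda>t z. dt uS t z - L_ouS B A S t (uS t) z)
               = ennreal Cp * Lp_norm p T f"
proof -
  have T: "0 < T" and e: "inj e" and n: "matrix_norm nrm" and p: "1 < p" and Cp: "0 < Cp" and f: "f \<in> Bb_C0inf T"
    and S: "continuous_on {0..T} S"
    by (fact assms(1) assms(2) assms(9) assms(10) assms(11) assms(15) assms(13))+
  have B: "psd B" unfolding B_def
  proof (rule psd_pad[OF e assms(4)])
    fix \<xi> :: "real^'d"
    have "0 \<le> \<nu> * (norm \<xi>)\<^sup>2" using assms(3) by simp
    then show "0 \<le> (B0 *v \<xi>) \<bullet> \<xi>" using assms(5)[of \<xi>] by linarith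
  qed
  have Sp: "psd (S t)" if "t \<in> {0..T}" for t unfolding psd_def by (rule assms(14)[OF that])
  define Q where "Q = (\<lambda>t. B + S t)"
  have Q: "continuous_on {0..T} Q" unfolding Q_def by (intro continuous_on_add continuous_on_const S)
  have Qp: "psd (Q t)" if "t \<in> {0..T}" for t unfolding Q_def by (rule psd_add[OF B Sp[OF that]])
  have L: "L_ouS B A S = (\<lambda>t g z. trace (Q t ** hess g z) + (A *v z) \<bullet> grad g z)"
    unfolding Q_def by (rule L_ouS_eq)
  obtain M where M: "\<And>t. t \<in> {0..T} \<Longrightarrow> Cb_le M (f t)" using Bb_Cb_le[OF f] by blast
  obtain q where q: "0 \<le> q" "\<And>t i j. t \<in> {-T..T} \<Longrightarrow> \<bar>mexp A t $ i $ j\<bar> \<le> q"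
    using mexp_entry_bound[of T A] by blast
  note G = pull_back_admissible[OF T Bb_strip_measurable[OF f] M q]
  define uS where "uS = (\<lambda>t z. duhamel (cov A Q) [] (pull_back A T f) t (mexp A t *v z))"
  have sol0: "is_solution T (L_ouS B A S) (\<lambda>t z. pull_back A T f t (mexp A t *v z)) uS"
    and Lc: "continuous_on {0..T} (\<lambda>s. L_ouS B A S s (uS s) z)" for z
    using solution[OF T Q Qp G uS_def L] by auto
  have sol: "is_solution T (L_ouS B A S) f uS"
    by (rule is_solution_cong[OF _ sol0]) (rule pull_back_flow)
  have uniq: "v t z = uS t z" if "is_solution T (L_ouS B A S) f v" "t \<in> {0..T}" for v t z
    by (rule solution_unique[OF T Q Qp L that(1) sol that(2)])
  have hx: "Lp_mnorm_x nrm e p T (\<lambda>t. hess_x e (uS t)) = Lp_mnorm nrm p T (\<lambda>t z. BI ** hess (uS t) z ** BI)"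
    unfolding Lp_mnorm_x_def Lp_mnorm_def BI_def pad_hess_x[OF e] ..
  obtain N where N: "countable N" "\<And>t z. t \<in> {0..T} \<Longrightarrow> t \<notin> N \<Longrightarrow> continuous (at t within {0..T}) (\<lambda>s. f s z)"
    using Bb_cont[OF f] by blast
  \<comment> \<open>Off a countable set of times, common to all points, the time derivative exists
    and the equation holds pointwise. In the strip the exceptional set is null, so the arbitrary
    values of \<open>deriv\<close> there do not affect the integral.\<close>
  have "Lp_int p T (\<lambda>t z. dt uS t z - L_ouS B A S t (uS t) z) = Lp_int p T f"
    unfolding Lp_int_def
  proof (rule nn_integral_cong_AE)
    show "AE w in lborel. ennreal (\<bar>dt uS (fst w) (snd w) - L_ouS B A S (fst w) (uS (fst w)) (snd w)\<bar> powr p) * indicator ({0<..<T} \<times> UNIV) w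
       = ennreal (\<bar>f (fst w) (snd w)\<bar> powr p) * indicator ({0<..<T} \<times> (UNIV :: (real^'n) set)) w"
      using AE_fst_notin_countable[OF N(1)]
    proof eventually_elim
      case (elim w)
      show ?case
      proof (cases "fst w \<in> {0<..<T}")
        case True
        then have t: "fst w \<in> {0..T}" by auto
        show ?thesis by (simp add: dt_solution[OF sol True N(2)[OF t elim] Lc])
      qed (simp add: indicator_def mem_Times_iff del: greaterThanLessThan_iff)
    qed
  qed
  then have lhs: "Lp_norm p T (\<lambda>t z. dt uS t z - L_ouS B A S t (uS t) z) = Lp_norm p T f"
    by (simp add: Lp_norm_Lp_int)
  obtain \<Lambda> where C: "psd_incr T \<Lambda> (cov A Q)" using cov_psd_incr[OF Q Qp] by blast
  have "Lp_int p T (\<lambda>t z. nrm (pad e (hess_x e (uS t) z))) = Lp_int p T (hess_x_norm nrm e A (cov A Q) [] (pull_back A T f))"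
    unfolding uS_def by (rule Lp_int_cong, rule nrm_hess_x[OF C G]) auto
  also have "\<dots> \<le> ennreal (Cp powr p) * Lp_int p T f"
    unfolding Q_def by (rule perturbed_bound[OF T B S Sp n p Cp Cp_bound f])
  finally have "Lp_mnorm_x nrm e p T (\<lambda>t. hess_x e (uS t)) \<le> ennreal Cp * Lp_norm p T f"
    unfolding Lp_mnorm_x_def by (rule iffD2[OF Lp_le_iff[OF less_trans[OF zero_less_one p] Cp]])
  then have bound: "Lp_mnorm nrm p T (\<lambda>t z. BI ** hess (uS t) z ** BI) \<le> ennreal Cp * Lp_norm p T (\<lambda>t z. dt uS t z - L_ouS B A S t (uS t) z)"
    unfolding hx lhs .
  show ?thesis
    by (intro exI[of _ uS] conjI allI impI ballI sol uniq hx bound) (simp_all only: lhs)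
qed

end
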